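(* Assume the setting and notation of the context, and let $\delta\in(0,1]$. Suppose: (i) $\sup_{s\in\mathcal X}G(s,s)=:\gamma^2<\infty$ (a.s. with respect to any probability measure on $\mathcal X$); (ii) $\sup_{m\in\mathcal P}K(m,m)=:\kappa^2<\infty$ ($\rho_\mu$-a.s.); (iii) for some $\alpha\in(0,1]$, $L>0$: $\|K_{m_1}-K_{m_2}\|_{\mathcal H_K}\le L\|m_1-m_2\|_{\mathcal H_G}^{\alpha}$ for all $m_1,m_2\in\mathcal P$; (iv) $f_\rho=L_K^r h_\rho$ with $h_\rho\in L^2(\mathcal P,\rho_\mu)$, $\|h_\rho\|_{L^2}\le R<\infty$, where $0<r\le\frac12$; (v) for some $\nu\in(0,1]$, $c_\nu<\infty$: $\mathcal N(\lambda)\le c_\nu\lambda^{-\nu}$, and $2r+\nu>1$; (vi) with $\lambda=(\eta_nT_n)^{-1}$, $n\ge \frac{32\kappa^2\log(4/\delta)}{\lambda}\log\big(e\,\mathcal N(\lambda)(1+\frac{\lambda}{\|L_K\|})\big)$, and $\eta_n<\frac1{4\kappa^2}$. Let $\eta_0<\frac1{4\kappa^2}$ and choose the second-stage sample size $$N=N_n\ge \log^{2/\alpha}(n)\Big(\frac{R^2}{M^2}n\Big)^{\frac{2+\nu}{\alpha(2r+\nu)}}.$$ Then, for any $n$ sufficiently large, with probability at least $1-\delta$ with respect to the data $D$, $$\mathbb E_{\hat D|D}\big[\|S_K\bar{\hat h}_{T_n}-f_\rho\|_{L^2}\big]\le C\log(6/\delta)\,R\Big(\frac{M^2}{R^2n}\Big)^{\frac{r}{2r+\nu}},$$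 where $C<\infty$ is a constant not depending on $n$ or $N$, for tail-averaged mini-batch SGD with batch size $b_n$, step size $\eta_n$ and $T_n$ iterations given by each of the following choices: 1. (multi-pass SGD) $b_n=\sqrt n$, $\eta_n=\eta_0$, $T_n=\big(\frac{R^2n}{M^2}\big)^{\frac1{2r+\nu}}$; 2. (batch GD) $b_n=n$, $\eta_n=\eta_0$, $T_n=\big(\frac{R^2n}{M^2}\big)^{\frac1{2r+\nu}}$.
   Context: Setting. $\mathcal X$ is a compact topological space, $\mathcal M^+(\mathcal X)$ the Borel probability measures on $\mathcal X$ (weak topology), $\mathcal Y\subseteq[-M,M]$ with $M>0$. $G$ is a Mercer kernel on $\mathcal X$ (symmetric, continuous, positive semidefinite) with reproducing kernel Hilbert space (RKHS) $\mathcal H_G$; the mean embedding of $x\in\mathcal M^+(\mathcal X)$ is $\mu_x=\int_{\mathcal X}G(s,\cdot)\,dx(s)\in\mathcal H_G$; $\mathcal P:=\{\mu_x:x\in\mathcal M^+(\mathcal X)\}\subset\mathcal H_G$. $K$ is a reproducing kernel on $\mathcal P$ with RKHS $\mathcal H_K$; $K_m:=K(m,\cdot)$. $\rho$ is a probability measure on $\mathcal P\times\mathcal Y$ with marginal $\rho_\mu$ on $\mathcal P$; $L^2=L^2(\mathcal P,\rho_\mu)$; $f_\rho(m)=\int_{\mathcal Y}y\,d\rho(y|m)$ is the regression function. $S_K:\mathcal H_K\to L^2$ is the inclusion, $L_K=S_KS_K^*$ (the kernel integral operator on $L^2$; powers via spectral calculus), and $\mathcal N(\lambda)=\mathrm{trace}(L_K(L_K+\lambda)^{-1})$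 for $\lambda>0$. Data. First stage: $(x_j,y_j)$, $j=1,\dots,n$, i.i.d. on $\mathcal M^+(\mathcal X)\times\mathcal Y$ such that $(\mu_{x_j},y_j)\sim\rho$; $D=\{(\mu_{x_j},y_j)\}_{j=1}^n$. Second stage: for each $j$, $x_{j,1},\dots,x_{j,N}$ are i.i.d. from $x_j$; $\mu_{\hat x_j}=\frac1N\sum_{i=1}^NG(x_{j,i},\cdot)$; $\hat D=\{(\mu_{\hat x_j},y_j)\}_{j=1}^n$. $\mathbb E_{\hat D|D}$ denotes the conditional expectation with respect to the sample $\hat D$ given $D$. Algorithm (second-stage tail-averaged SGD with batch size $b\in\{1,\dots,n\}$, step size $\eta>0$). With $j_1,\dots,j_{bT}$ i.i.d. uniform on $\{1,\dots,n\}$, starting with $\hat h_0\in\mathcal H_K$, $\hat h_{t+1}=\hat h_t-\eta\frac1b\sum_{i=bt+1}^{b(t+1)}(\hat h_t(\mu_{\hat x_{j_i}})-y_{j_i})K_{\mu_{\hat x_{j_i}}}$; $\ \bar{\hat h}_T=\frac2T\sum_{t=\lfloor T/2\rfloor+1}^T\hat h_t$. *)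

theory Defs
  imports "HOL-Probability.Probability"
begin

section \<open>Kernels and reproducing kernel Hilbert spaces\<close>

definition psd_kernel :: "'a set \<Rightarrow> ('a \<Rightarrow> 'a \<Rightarrow> real) \<Rightarrow> bool" where
  "psd_kernel A k \<longleftrightarrow>
     (\<forall>a\<in>A. \<forall>b\<in>A. k a b = k b a) \<and>
     (\<forall>S c. finite S \<and> S \<subseteq> A \<longrightarrow> 0 \<le> (\<Sum>a\<in>S. \<Sum>b\<in>S. c a * c b * k a b))"

definition mercer_kernel :: "('a::topological_space \<Rightarrow> 'a \<Rightarrow> real) \<Rightarrow> bool" where
  "mercer_kernel k \<longleftrightarrow> psd_kernel UNIV k \<and> continuous_on UNIV (\<lambda>(s, t). k s t)"

text \<open>
  A reproducing kernel Hilbert space is a Hilbert space of functions on \<open>A\<close>.  Its elements are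
  the elements of a Hilbert space type \<open>'h\<close>, and \<open>app h\<close> is the function on \<open>A\<close> that \<open>h\<close> stands
  for; values outside \<open>A\<close> are irrelevant.  Completeness is left to the type class of \<open>'h\<close>.
\<close>
definition rkhs :: "'a set \<Rightarrow> ('a \<Rightarrow> 'a \<Rightarrow> real) \<Rightarrow> ('h::real_inner \<Rightarrow> 'a \<Rightarrow> real) \<Rightarrow> bool" where
  "rkhs A k app \<longleftrightarrow>
     (\<forall>a\<in>A. linear (\<lambda>f. app f a)) \<and>
     (\<forall>f g. (\<forall>a\<in>A. app f a = app g a) \<longrightarrow> f = g) \<and>
     (\<forall>a\<in>A. \<exists>h. (\<forall>b\<in>A. app h b = k a b) \<and> (\<forall>f. app f a = f \<bullet> h))"

definition ksec :: "'a set \<Rightarrow> ('a \<Rightarrow> 'a \<Rightarrow> real) \<Rightarrow> ('h::real_inner \<Rightarrow> 'a \<Rightarrow> real) \<Rightarrow> 'a \<Rightarrow> 'h" where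
  "ksec A k app a = (THE h. \<forall>b\<in>A. app h b = k a b)"

text \<open>
  In the next two definitions \<open>\<phi> s\<close> is the kernel section \<open>G(s, \<cdot>)\<close>.  The Bochner integral needs a
  second countable range; the RKHS of a continuous kernel on a compact space is separable, so
  this costs no generality.
\<close>
definition mean_embedding ::
    "('x::topological_space \<Rightarrow> 'g::{real_inner, banach, second_countable_topology}) \<Rightarrow> 'x measure \<Rightarrow> 'g" where
  "mean_embedding \<phi> x = (\<integral>s. \<phi> s \<partial>x)"

definition empirical_embedding :: "('x \<Rightarrow> 'g::real_vector) \<Rightarrow> nat \<Rightarrow> (nat \<Rightarrow> 'x) \<Rightarrow> 'g" where
  "empirical_embedding \<phi> N s = (1 / real N) *\<^sub>R (\<Sum>i<N. \<phi> (s i))"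

section \<open>The space \<open>L\<^sup>2\<close> and operators on a Hilbert space\<close>

definition square_integrable :: "'a measure \<Rightarrow> ('a \<Rightarrow> real) \<Rightarrow> bool" where
  "square_integrable M f \<longleftrightarrow> f \<in> borel_measurable M \<and> integrable M (\<lambda>x. (f x)\<^sup>2)"

text \<open>
  The Hilbert space type \<open>'l\<close> is \<open>L\<^sup>2(M)\<close>, where \<open>cls f\<close> is the class of the square integrable
  function \<open>f\<close>.  Linearity of \<open>cls\<close> and the fact that \<open>cls f = cls g\<close> holds iff \<open>f = g\<close> almost
  everywhere follow from the inner product formula.
\<close>
definition L2_space :: "'a measure \<Rightarrow> (('a \<Rightarrow> real) \<Rightarrow> 'l::real_inner) \<Rightarrow> bool" where
  "L2_space M cls \<longleftrightarrow>
     (\<forall>f g. square_integrable M f \<and> square_integrable M g \<longrightarrow> cls f \<bullet> cls g = (\<integral>x. f x * g x \<partial>M)) \<and>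
     (\<forall>u. \<exists>f. square_integrable M f \<and> cls f = u)"

definition hilbert_basis :: "'l::real_inner set \<Rightarrow> bool" where
  "hilbert_basis E \<longleftrightarrow> pairwise orthogonal E \<and> (\<forall>e\<in>E. norm e = 1) \<and> closure (span E) = UNIV"

text \<open>For positive and for trace class operators the sum does not depend on the basis.\<close>
definition op_trace :: "('l::real_inner \<Rightarrow> 'l) \<Rightarrow> real" where
  "op_trace A = (\<Sum>\<^sub>\<infinity>e\<in>(SOME E. hilbert_basis E). A e \<bullet> e)"

definition effective_dim :: "('l::real_inner \<Rightarrow> 'l) \<Rightarrow> real \<Rightarrow> real" where
  "effective_dim A l = op_trace (A \<circ> inv (\<lambda>u. A u + l *\<^sub>R u))"

text \<open>
  Powers via spectral calculus, for compact self-adjoint positive operators: these have an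
  orthonormal basis of eigenvectors \<open>e\<close>, with eigenvalue \<open>A e \<bullet> e\<close>, and the value of the power
  does not depend on the choice of that basis.  Note that \<open>0 powr r = 0\<close>.
\<close>
definition eigenbasis :: "('l::real_inner \<Rightarrow> 'l) \<Rightarrow> 'l set" where
  "eigenbasis A = (SOME E. hilbert_basis E \<and> (\<forall>e\<in>E. \<exists>c. A e = c *\<^sub>R e))"

definition op_powr :: "('l::real_inner \<Rightarrow> 'l) \<Rightarrow> real \<Rightarrow> 'l \<Rightarrow> 'l" where
  "op_powr A r u = (\<Sum>\<^sub>\<infinity>e\<in>eigenbasis A. ((A e \<bullet> e) powr r * (u \<bullet> e)) *\<^sub>R e)"

section \<open>Regression function\<close>

text \<open>\<open>\<kappa>\<close> is a regular conditional distribution of the second component given the first.\<close>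
definition conditional_law ::
    "'a measure \<Rightarrow> 'b measure \<Rightarrow> ('a \<times> 'b) measure \<Rightarrow> ('a \<Rightarrow> 'b measure) \<Rightarrow> bool" where
  "conditional_law MA MB \<rho> \<kappa> \<longleftrightarrow>
     \<kappa> \<in> MA \<rightarrow>\<^sub>M prob_algebra MB \<and>
     (\<forall>A\<in>sets MA. \<forall>B\<in>sets MB.
        emeasure \<rho> (A \<times> B) = (\<integral>\<^sup>+m\<in>A. emeasure (\<kappa> m) B \<partial>distr \<rho> MA fst))"

definition regression_fun :: "('a \<Rightarrow> real measure) \<Rightarrow> 'a \<Rightarrow> real" where
  "regression_fun \<kappa> m = (\<integral>y. y \<partial>\<kappa> m)"

section \<open>Sampling\<close>

text \<open>
  First stage: the pairs \<open>(x j, y j)\<close>, \<open>j < n\<close>, are independent with law \<open>Q\<close>.  Second stage: given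
  all the pairs, the points \<open>xs j i\<close> with \<open>j < n\<close>, \<open>i < N\<close> are independent and \<open>xs j i\<close> has law \<open>x j\<close>.
\<close>
definition two_stage_sample ::
    "'w measure \<Rightarrow> ('x::topological_space measure \<times> real) measure \<Rightarrow> nat \<Rightarrow> nat \<Rightarrow>
     (nat \<Rightarrow> 'w \<Rightarrow> 'x measure) \<Rightarrow> (nat \<Rightarrow> 'w \<Rightarrow> real) \<Rightarrow> (nat \<Rightarrow> nat \<Rightarrow> 'w \<Rightarrow> 'x) \<Rightarrow> bool" where
  "two_stage_sample \<Omega> Q n N x y xs \<longleftrightarrow>
     prob_space \<Omega> \<and>
     prob_space.indep_vars \<Omega> (\<lambda>_. Q) (\<lambda>j \<omega>. (x j \<omega>, y j \<omega>)) {..<n} \<and>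
     (\<forall>j<n. distr \<Omega> Q (\<lambda>\<omega>. (x j \<omega>, y j \<omega>)) = Q) \<and>
     (\<forall>j<n. \<forall>i<N. xs j i \<in> borel_measurable \<Omega>) \<and>
     (\<forall>A B. (\<forall>j i. A j i \<in> sets borel) \<and>
        B \<in> sets (vimage_algebra (space \<Omega>) (\<lambda>\<omega>. \<lambda>j\<in>{..<n}. (x j \<omega>, y j \<omega>)) (\<Pi>\<^sub>M j\<in>{..<n}. Q)) \<longrightarrow>
        measure \<Omega> {\<omega>\<in>B. \<forall>j<n. \<forall>i<N. xs j i \<omega> \<in> A j i} =
          (\<integral>\<omega>. indicator B \<omega> * (\<Prod>j<n. \<Prod>i<N. measure (x j \<omega>) (A j i)) \<partial>\<Omega>))"

text \<open>The \<open>k\<close> mini-batch indices are uniform on \<open>{..<n}\<close> and independent of both sampling stages.\<close>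
definition uniform_indices ::
    "'w measure \<Rightarrow> ('x::topological_space measure \<times> real) measure \<Rightarrow> nat \<Rightarrow> nat \<Rightarrow>
     (nat \<Rightarrow> 'w \<Rightarrow> 'x measure) \<Rightarrow> (nat \<Rightarrow> 'w \<Rightarrow> real) \<Rightarrow> (nat \<Rightarrow> nat \<Rightarrow> 'w \<Rightarrow> 'x) \<Rightarrow>
     nat \<Rightarrow> (nat \<Rightarrow> 'w \<Rightarrow> nat) \<Rightarrow> bool" where
  "uniform_indices \<Omega> Q n N x y xs k J \<longleftrightarrow>
     prob_space.indep_vars \<Omega> (\<lambda>_. count_space UNIV) J {..<k} \<and>
     (\<forall>i<k. distr \<Omega> (count_space UNIV) (J i) = measure_pmf (pmf_of_set {..<n})) \<and>
     prob_space.indep_set \<Omega>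
       (sets (vimage_algebra (space \<Omega>)
          (\<lambda>\<omega>. (\<lambda>j\<in>{..<n}. (x j \<omega>, y j \<omega>), \<lambda>p\<in>{..<n} \<times> {..<N}. xs (fst p) (snd p) \<omega>))
          ((\<Pi>\<^sub>M j\<in>{..<n}. Q) \<Otimes>\<^sub>M (\<Pi>\<^sub>M p\<in>{..<n} \<times> {..<N}. borel))))
       (sets (vimage_algebra (space \<Omega>) (\<lambda>\<omega>. \<lambda>i\<in>{..<k}. J i \<omega>) (\<Pi>\<^sub>M i\<in>{..<k}. count_space UNIV)))"

section \<open>Tail-averaged mini-batch SGD\<close>

text \<open>
  \<open>z i\<close> is the data point drawn at position \<open>i\<close> of the index sequence.  Positions are counted from
  \<open>0\<close>, so step \<open>t\<close> uses \<open>b * t, \<dots>, b * (t + 1) - 1\<close>.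
\<close>
primrec sgd ::
    "real \<Rightarrow> nat \<Rightarrow> ('h::real_vector \<Rightarrow> 'm \<Rightarrow> real) \<Rightarrow> ('m \<Rightarrow> 'h) \<Rightarrow> 'h \<Rightarrow> (nat \<Rightarrow> 'm \<times> real) \<Rightarrow> nat \<Rightarrow> 'h" where
  "sgd \<eta> b app k h0 z 0 = h0"
| "sgd \<eta> b app k h0 z (Suc t) =
     sgd \<eta> b app k h0 z t - \<eta> *\<^sub>R (1 / real b) *\<^sub>R
       (\<Sum>i = b * t..<b * (t + 1).
          (app (sgd \<eta> b app k h0 z t) (fst (z i)) - snd (z i)) *\<^sub>R k (fst (z i)))"

definition tail_average :: "(nat \<Rightarrow> 'h::real_vector) \<Rightarrow> nat \<Rightarrow> 'h" where
  "tail_average h T = (2 / real T) *\<^sub>R (\<Sum>t = T div 2 + 1..T. h t)"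

end

theory Submission
 imports Defs "HOL-Real_Asymp.Real_Asymp"
begin

text \<open>With \<open>\<lambda> = 1 / (\<eta> T)\<close>, errors are measured in the norm \<open>(\<langle>C u, u\<rangle> + \<lambda> \<parallel>u\<parallel>\<^sup>2)\<^bsup>1/2\<^esup>\<close>, where \<open>C\<close> is the
empirical covariance operator. Given the sample, tail-averaged SGD splits into gradient descent and a
martingale driven by the random indices, whose variance is governed by the effective dimension.
Since \<open>2 r + \<nu> > 1\<close>, a fixed trace moment of the preconditioned deviation of \<open>C\<close> suffices to compare
it with its population counterpart; the label noise is controlled by Pinelis' inequality. In the
second stage, a union bound makes all empirical embeddings close to the true ones, and off that event
the iterates grow too slowly to compensate for its small probability. The bound on the expected risk
passes to the conditional expectation by Markov's inequality on the event, measurable with respect to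
\<open>D\<close>, that the conditional risk is too large.\<close>

text \<open>The regression function need not belong to the range of \<open>S\<close>, so the
  iterates are compared with the Tikhonov solution \<open>w\<close>, whose norm may grow like
  \<lambda>^(r - 1/2); only sqrt \<lambda> |w| is of the right order \<lambda>^r. The residual at
  \<open>w\<close> has no useful uniform bound: in every variance it is split into the bounded label
  noise, weighted by the effective dimension, and a part that is small in mean square only. Only the
  noise at \<open>w\<close> needs an exponential tail, to give the factor log(6/\<delta>). For the
  other events any dependence on \<delta> is absorbed by large n, so weaker tails suffice. This is
  why a trace moment of order p can replace an exponential operator inequality: for n >= c
  \<lambda>^-(2r+\<nu>) it bounds the failure probability by a multiple of
  \<lambda>^(p(2r+\<nu>-1)-\<nu>), and a large fixed p makes this exponent positive. The bound on K
  holds almost surely only, and the empirical embeddings may miss that set. Hoelder continuity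
  carries it over to them, using the slack between \<open>kap\<close> and the largest norm that the
  step size allows.\<close>

notation inner (infixl ".*" 70)
abbreviation "iid n A == Pi\<^sub>M {..<n::nat} (%_. A)"

section \<open>Orthonormal bases and positive operators\<close>

definition orthonormal :: "'a::real_inner set => bool" where
 "orthonormal E \<longleftrightarrow> pairwise orthogonal E \<and> (\<forall>e\<in>E. norm e = 1)"

lemma hilbert_basis_orthonormal: "hilbert_basis E ==> orthonormal E"
 by (simp add: hilbert_basis_def orthonormal_def)

lemma orthonormal_subset: "orthonormal E ==> F \<subseteq> E ==> orthonormal F"
 by (auto simp: orthonormal_def intro: pairwise_subset)

lemma orthonormal_inner:
 "orthonormal E ==> e \<in> E ==> e' \<in> E ==> e .* e' = (if e = e' then 1 else 0)"
 unfolding orthonormal_def pairwise_def orthogonal_def by (auto simp: dot_square_norm)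

lemma orthonormal_inner_sum:
 assumes "orthonormal E" "F \<subseteq> E" "finite F" "e \<in> E"
 shows "(SUM f:F. c f *\<^sub>R f) .* e = (if e \<in> F then c e else 0)"
proof -
 have "(SUM f:F. c f *\<^sub>R f) .* e = (SUM f:F. if f = e then c f else 0)"
  unfolding inner_sum_left by (rule sum.cong) (use assms in \<open>auto simp: orthonormal_inner subset_iff\<close>)
 then show ?thesis using assms by simp
qed

lemma orthonormal_norm_sum:
 assumes "orthonormal F" "finite F"
 shows "(norm (SUM f:F. c f *\<^sub>R f))^2 = (SUM f:F. (c f)^2)"
proof -
 have "(norm (SUM f:F. c f *\<^sub>R f))^2 = (SUM f:F. c f * ((SUM f:F. c f *\<^sub>R f) .* f))"
  by (simp add: power2_norm_eq_inner inner_sum_right)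
 also have "... = (SUM f:F. (c f)^2)"
  by (rule sum.cong) (use assms in \<open>auto simp: orthonormal_inner_sum[OF assms(1) subset_refl] power2_eq_square\<close>)
 finally show ?thesis .
qed

text \<open>Completing the square coordinate by coordinate. The choice \<open>c f = u .* f\<close>
  gives Bessel's inequality, and the sign of the last sum gives the best approximation
  property.\<close>

lemma orthonormal_projection_dist:
 assumes F: "orthonormal F" "finite F"
 shows "(norm (u - (SUM f:F. c f *\<^sub>R f)))^2
   = (norm u)^2 - (SUM f:F. (u .* f)^2) + (SUM f:F. (u .* f - c f)^2)"
proof -
 have "(norm (u - (SUM f:F. c f *\<^sub>R f)))^2
   = (norm u)^2 - 2 * (u .* (SUM f:F. c f *\<^sub>R f)) + (norm (SUM f:F. c f *\<^sub>R f))^2"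
  by (simp add: power2_norm_eq_inner inner_diff_left inner_diff_right inner_commute)
 also have "u .* (SUM f:F. c f *\<^sub>R f) = (SUM f:F. c f * (u .* f))" by (simp add: inner_sum_right)
 also have "(norm (SUM f:F. c f *\<^sub>R f))^2 = (SUM f:F. (c f)^2)" by (rule orthonormal_norm_sum[OF F])
 finally show ?thesis
  by (simp add: power2_diff sum.distrib sum_subtractf sum_distrib_left algebra_simps)
qed

lemma bessel_finite:
 assumes "orthonormal F" "finite F"
 shows "(SUM f:F. (u .* f)^2) <= (norm u)^2"
 using orthonormal_projection_dist[OF assms, of u "%f. u .* f"]
  zero_le_power2[of "norm (u - (SUM f:F. (u .* f) *\<^sub>R f))"] by simp

lemma bessel_summable:
 assumes "orthonormal E"
 shows "(%e. (u .* e)^2) summable_on E"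
proof (rule nonneg_bdd_above_summable_on)
 show "bdd_above (sum (%e. (u .* e)^2) ` {F. F \<subseteq> E \<and> finite F})"
  by (rule bdd_aboveI2[where M = "(norm u)^2"])
   (auto intro: bessel_finite orthonormal_subset[OF assms])
qed simp

text \<open>Distinct elements are at distance sqrt 2, so the balls of radius 1/2 around them are
  disjoint open sets. Countability lets the later truncations form a sequence, as Fatou's lemma
  requires.\<close>

lemma orthonormal_countable:
 fixes E :: "'a::{real_inner, second_countable_topology} set"
 assumes "orthonormal E"
 shows "countable E"
proof -
 have far: "dist e f >= 1" if "e \<in> E" "f \<in> E" "e \<noteq> f" for e f
 proof -
  have "(norm (e - f))^2 = 2"
   using that orthonormal_inner[OF assms]
   by (simp add: power2_norm_eq_inner inner_diff_left inner_diff_right)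
  then show ?thesis
   by (simp add: dist_norm) (smt (verit) norm_ge_zero power_le_one)
 qed
 have "countable ((%e. ball e (1/2)) ` E)"
 proof (rule countable_disjoint_open_subsets)
  show "disjoint ((%e. ball e (1/2)) ` E)"
  proof (rule disjointI)
   fix A B assume "A \<in> (%e. ball e (1/2)) ` E" "B \<in> (%e. ball e (1/2)) ` E" "A \<noteq> B"
   then obtain e f where ef: "e \<in> E" "f \<in> E" "e \<noteq> f" "A = ball e (1/2)" "B = ball f (1/2)" by auto
   show "A \<inter> B = {}" unfolding ef using far[OF ef(1-3)]
    by (auto simp: disjoint_iff) (smt (verit) dist_commute dist_triangle field_sum_of_halves)
  qed
 qed auto
 moreover have "inj_on (%e. ball e (1/2)) E"
 proof (rule inj_onI, rule ccontr)
  fix e f assume ef: "e \<in> E" "f \<in> E" "ball e (1/2) = ball f (1/2)" "e \<noteq> f"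
  have "e \<in> ball f (1/2)" unfolding ef(3)[symmetric] by simp
  then show False using far[of f e] ef by simp
 qed
 ultimately show ?thesis by (simp add: countable_image_inj_eq)
qed

text \<open>By Pythagoras the partial sums inherit the Cauchy property from the sums of squares.
  Completeness is applied to the filter of finite subsets, as \<open>E\<close> may be
  uncountable.\<close>

lemma orthonormal_series_summable:
 fixes E :: "'a::{real_inner, banach} set"
 assumes E: "orthonormal E" and c: "(%e. (c e)^2) summable_on E"
 shows "(%e. c e *\<^sub>R e) summable_on E"
proof -
 let ?L = "infsum (%e. (c e)^2) E"
 have lim: "(sum (%e. (c e)^2) \<longlongrightarrow> ?L) (finite_subsets_at_top E)"
  using has_sum_infsum[OF c] by (simp add: has_sum_def)
 have "\<exists>P. eventually P (finite_subsets_at_top E) \<and>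
   (\<forall>F1 F2. P F1 \<and> P F2 --> dist (SUM e:F1. c e *\<^sub>R e) (SUM e:F2. c e *\<^sub>R e) < d)"
  if "d > 0" for d :: real
 proof -
  \<comment> \<open>Two errors of d^2 / 8 add up to (d / 2)^2.\<close>
  have "eventually (%F. dist (SUM e:F. (c e)^2) ?L < d^2 / 8) (finite_subsets_at_top E)"
   by (rule tendstoD[OF lim]) (use \<open>d > 0\<close> in simp)
  then have "\<exists>X. finite X \<and> X \<subseteq> E \<and>
    (\<forall>Y. finite Y \<and> X \<subseteq> Y \<and> Y \<subseteq> E --> dist (SUM e:Y. (c e)^2) ?L < d^2 / 8)"
   by (simp only: eventually_finite_subsets_at_top)
  then obtain F0 where F0: "finite F0" "F0 \<subseteq> E"
   and near: "!!F. finite F ==> F0 \<subseteq> F ==> F \<subseteq> E ==> dist (SUM e:F. (c e)^2) ?L < d^2 / 8"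
   by metis
  have small: "norm ((SUM e:F. c e *\<^sub>R e) - (SUM e:F0. c e *\<^sub>R e)) < d / 2"
   if F: "finite F" "F0 \<subseteq> F" "F \<subseteq> E" for F
  proof -
   have "(norm ((SUM e:F. c e *\<^sub>R e) - (SUM e:F0. c e *\<^sub>R e)))^2 = (norm (SUM e:F - F0. c e *\<^sub>R e))^2"
    using F by (simp add: sum_diff)
   also have "... = (SUM e:F - F0. (c e)^2)"
    using F by (intro orthonormal_norm_sum orthonormal_subset[OF E]) auto
   also have "... = (SUM e:F. (c e)^2) - (SUM e:F0. (c e)^2)" using F by (simp add: sum_diff)
   also have "... < (d / 2)^2"
    using near[OF F] near[OF F0(1) subset_refl F0(2)]
    unfolding dist_real_def power_divide abs_less_iff by (simp add: field_simps)
   finally show ?thesis by (rule power_less_imp_less_base) (use \<open>d > 0\<close> in simp)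
  qed
  show ?thesis
  proof (intro exI conjI allI impI)
   show "eventually (%F. finite F \<and> F0 \<subseteq> F \<and> F \<subseteq> E) (finite_subsets_at_top E)"
    unfolding eventually_finite_subsets_at_top using F0 by blast
  next
   fix F1 F2 assume "(finite F1 \<and> F0 \<subseteq> F1 \<and> F1 \<subseteq> E) \<and> (finite F2 \<and> F0 \<subseteq> F2 \<and> F2 \<subseteq> E)"
   then show "dist (SUM e:F1. c e *\<^sub>R e) (SUM e:F2. c e *\<^sub>R e) < d"
    using small[of F1] small[of F2]
    by (rule_tac dist_triangle_half_l[where y = "SUM e:F0. c e *\<^sub>R e"]) (auto simp: dist_norm)
  qed
 qed
 then have "cauchy_filter (filtermap (sum (%e. c e *\<^sub>R e)) (finite_subsets_at_top E))"
  by (simp add: cauchy_filter_metric_filtermap)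
 moreover have "Topological_Spaces.complete (UNIV::'a set)"
  by (meson Cauchy_convergent UNIV_I complete_def convergent_def)
 ultimately obtain L' where "(sum (%e. c e *\<^sub>R e) \<longlongrightarrow> L') (finite_subsets_at_top E)"
  using complete_uniform[where S=UNIV] by (force simp add: filterlim_def)
 then show ?thesis using summable_on_def has_sum_def by blast
qed

lemma orthonormal_has_sum_inner:
 assumes E: "orthonormal E" and s: "((%e. c e *\<^sub>R e) has_sum v) E" and "e \<in> E"
 shows "v .* e = c e"
proof -
 have "((%f. (c f *\<^sub>R f) .* e) has_sum v .* e) E"
  using has_sum_bounded_linear[OF bounded_linear_inner_left s, of e] by (simp add: o_def)
 moreover have "((%f. (c f *\<^sub>R f) .* e) has_sum (c e)) E"
 proof (rule has_sum_cong_neutral[THEN iffD1])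
  show "((%f. c f) has_sum (c e)) {e}" using has_sum_finite[of "{e}" c] by simp
 qed (use \<open>e \<in> E\<close> orthonormal_inner[OF E] in auto)
 ultimately show ?thesis by (rule has_sum_unique)
qed

lemma orthonormal_has_sum_norm:
 assumes E: "orthonormal E" and s: "((%e. c e *\<^sub>R e) has_sum v) E"
 shows "((%e. (c e)^2) has_sum (norm v)\<^sup>2) E"
proof -
 have "((%F. (norm (SUM e:F. c e *\<^sub>R e))^2) \<longlongrightarrow> (norm v)\<^sup>2) (finite_subsets_at_top E)"
  using s unfolding has_sum_def by (intro tendsto_intros)
 then show ?thesis unfolding has_sum_def
  by (rule Lim_transform_eventually)
   (auto intro!: eventually_finite_subsets_at_top_weakI orthonormal_norm_sum orthonormal_subset[OF E])
qed

text \<open>A vector \<open>v\<close> of the span close to \<open>u\<close> uses finitely many basis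
  vectors. For every larger finite \<open>F\<close> the Fourier sum is the best approximation within
  the span of \<open>F\<close>, hence at least as close as \<open>v\<close>.\<close>

lemma hilbert_basis_expansion:
 assumes "hilbert_basis E"
 shows "((%e. (u .* e) *\<^sub>R e) has_sum u) E"
proof -
 have E: "orthonormal E" using assms by (rule hilbert_basis_orthonormal)
 show ?thesis unfolding has_sum_def tendsto_iff
 proof (intro allI impI)
  fix d :: real assume "d > 0"
  have "u \<in> closure (span E)" using assms by (simp add: hilbert_basis_def)
  then obtain v where v: "v \<in> span E" "dist v u < d"
   using \<open>d > 0\<close> by (auto simp: closure_approachable)
  then obtain F0 r where F0: "finite F0" "F0 \<subseteq> E" "v = (SUM e:F0. r e *\<^sub>R e)"
   unfolding span_explicit by blast
  show "eventually (%F. dist (SUM e:F. (u .* e) *\<^sub>R e) u < d) (finite_subsets_at_top E)"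
   unfolding eventually_finite_subsets_at_top
  proof (intro exI[of _ F0] conjI F0 allI impI)
   fix F assume F: "finite F \<and> F0 \<subseteq> F \<and> F \<subseteq> E"
   define c where "c e = (if e \<in> F0 then r e else 0)" for e
   have vF: "v = (SUM e:F. c e *\<^sub>R e)"
    unfolding F0(3) c_def by (rule sum.mono_neutral_cong_left) (use F in auto)
   have oF: "orthonormal F" using F orthonormal_subset[OF E] by blast
   have "(norm (u - (SUM e:F. (u .* e) *\<^sub>R e)))^2 <= (norm (u - v))^2"
    unfolding vF using F by (simp add: orthonormal_projection_dist[OF oF] sum_nonneg)
   then have "norm (u - (SUM e:F. (u .* e) *\<^sub>R e)) <= norm (u - v)"
    by (rule power2_le_imp_le) simp
   then show "dist (SUM e:F. (u .* e) *\<^sub>R e) u < d"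
    using v(2) by (simp add: dist_norm norm_minus_commute)
  qed
 qed
qed

lemma hilbert_basis_parseval:
 assumes "hilbert_basis E"
 shows "((%e. (u .* e)^2) has_sum (norm u)\<^sup>2) E"
 using orthonormal_has_sum_norm[OF hilbert_basis_orthonormal[OF assms] hilbert_basis_expansion[OF assms]] .

lemma hilbert_basis_eqI:
 assumes "hilbert_basis E" "!!e. e \<in> E ==> u .* e = v .* e"
 shows "u = v"
proof -
 have "((%e. (u .* e) *\<^sub>R e) has_sum v) E"
  using hilbert_basis_expansion[OF assms(1), of v] by (rule has_sum_cong[THEN iffD2, rotated]) (simp add: assms)
 then show ?thesis using hilbert_basis_expansion[OF assms(1), of u] has_sum_unique by blast
qed

text \<open>The vector \<open>g\<close> is the difference between a point outside the closed span
  and its Fourier sum, which lies in the closed span.\<close>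

lemma orthonormal_extend:
 fixes E :: "'a::{real_inner, banach} set"
 assumes E: "orthonormal E" and "closure (span E) \<noteq> UNIV"
 shows "\<exists>g. g \<noteq> 0 \<and> (\<forall>e\<in>E. g .* e = 0)"
proof -
 obtain u where u: "u \<notin> closure (span E)" using assms(2) by auto
 obtain v where v: "((%e. (u .* e) *\<^sub>R e) has_sum v) E"
  using orthonormal_series_summable[OF E bessel_summable[OF E]] by (auto simp: summable_on_def)
 have "v \<in> closure (span E)"
 proof (rule Lim_in_closed_set[OF closed_closure])
  show "eventually (%F. (SUM e:F. (u .* e) *\<^sub>R e) \<in> closure (span E)) (finite_subsets_at_top E)"
   by (rule eventually_finite_subsets_at_top_weakI)
    (rule subsetD[OF closure_subset], rule span_sum, rule span_scale, rule span_base, auto)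
  show "(sum (%e. (u .* e) *\<^sub>R e) \<longlongrightarrow> v) (finite_subsets_at_top E)"
   using v by (simp add: has_sum_def)
 qed simp
 then have "u - v \<noteq> 0" using u by auto
 moreover have "(u - v) .* e = 0" if "e \<in> E" for e
  using orthonormal_has_sum_inner[OF E v that] by (simp add: inner_diff_left)
 ultimately show ?thesis by blast
qed

section \<open>Positive operators\<close>

definition positive_op :: "('a::real_inner => 'a) => bool" where
 "positive_op A \<longleftrightarrow> linear A \<and> (\<forall>u v. A u .* v = u .* A v) \<and> (\<forall>u. 0 <= A u .* u)"

lemma positive_opD:
 assumes "positive_op A"
 shows "linear A" "A u .* v = u .* A v" "0 <= A u .* u"
 using assms by (auto simp: positive_op_def)

lemma positive_op_quadratic:
 assumes "positive_op A"
 shows "A (u + t *\<^sub>R v) .* (u + t *\<^sub>R v) = A u .* u + 2 * t * (A u .* v) + t^2 * (A v .* v)"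
 using positive_opD(2)[OF assms, of v u]
 by (simp add: linear_add[OF positive_opD(1)[OF assms]] linear_scale[OF positive_opD(1)[OF assms]]
   inner_add_left inner_add_right inner_commute power2_eq_square algebra_simps)

lemma positive_op_CS:
 assumes "positive_op A"
 shows "(A u .* v)^2 <= (A u .* u) * (A v .* v)"
proof -
 have q: "0 <= A u .* u + 2 * t * (A u .* v) + t^2 * (A v .* v)" for t
  using positive_opD(3)[OF assms, of "u + t *\<^sub>R v"] unfolding positive_op_quadratic[OF assms] .
 show ?thesis
 proof (cases "A v .* v = 0")
  case True
  have "A u .* v = 0"
  proof (rule ccontr)
   assume "A u .* v \<noteq> 0"
   \<comment> \<open>With a vanishing leading coefficient the polynomial is affine in t; at this t
     its value is -1.\<close>
   then show False using q[of "- (A u .* u + 1) / (2 * (A u .* v))"] True by (simp add: field_simps)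
  qed
  then show ?thesis using True by simp
 next
  case False
  then have pos: "A v .* v > 0" using positive_opD(3)[OF assms, of v] by simp
  have "0 <= (A v .* v) * (A u .* u + 2 * (- (A u .* v) / (A v .* v)) * (A u .* v)
    + (- (A u .* v) / (A v .* v))^2 * (A v .* v))"
   using q[of "- (A u .* v) / (A v .* v)"] pos by (intro mult_nonneg_nonneg) auto
  also have "... = (A u .* u) * (A v .* v) - (A u .* v)^2"
   using pos by (simp add: field_simps power2_eq_square)
  finally show ?thesis by simp
 qed
qed

text \<open>Cauchy-Schwarz for the form of \<open>A\<close>, applied to \<open>u\<close> and
  \<open>A u\<close>. Stronger than a norm bound: it controls \<open>A u\<close> by the quadratic
  form itself.\<close>

lemma positive_op_norm_le:
 assumes A: "positive_op A" and c: "!!u. A u .* u <= c * (norm u)^2"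
 shows "(norm (A u))^2 <= c * (A u .* u)"
proof (cases "A u = 0")
 case False
 have "((norm (A u))^2)^2 <= (A u .* u) * (A (A u) .* A u)"
  using positive_op_CS[OF A, of u "A u"] by (simp add: power2_norm_eq_inner)
 also have "... <= (A u .* u) * (c * (norm (A u))^2)"
  by (intro mult_left_mono c positive_opD(3)[OF A])
 finally have "(norm (A u))^2 * (norm (A u))^2 <= (c * (A u .* u)) * (norm (A u))^2"
  by (simp add: power2_eq_square algebra_simps)
 then show ?thesis by (rule mult_right_le_imp_le) (use False in simp)
qed (use positive_opD(3)[OF A, of u] in simp)

lemma positive_op_bounded:
 assumes A: "positive_op A" and c: "!!u. A u .* u <= c * (norm u)^2" and "c >= 0"
 shows "norm (A u) <= c * norm u"
proof -
 have "(norm (A u))^2 <= c * (A u .* u)" by (rule positive_op_norm_le[OF A c])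
 also have "... <= c * (c * (norm u)^2)" by (intro mult_left_mono c \<open>c >= 0\<close>)
 also have "... = (c * norm u)^2" by (simp add: power2_eq_square)
 finally show ?thesis by (rule power2_le_imp_le) (use \<open>c >= 0\<close> in simp)
qed

lemma positive_op_bounded_linear:
 assumes A: "positive_op A" and c: "!!u. A u .* u <= c * (norm u)^2" and "c >= 0"
 shows "bounded_linear A"
 using positive_opD(1)[OF A] positive_op_bounded[OF assms]
 by (intro bounded_linear_intro[where K = c]) (auto simp: linear_add linear_scale mult.commute)

text \<open>Banach's fixed point theorem for the map u - d (A u + l u - q). With the lower bound l
  and the upper bound K = c + l of the operator inserted into the expanded square, the step d = l /
  K^2 gives the contraction factor sqrt (1 - l^2 / K^2).\<close>

lemma positive_op_resolvent_surj:
 fixes A :: "'a::{real_inner, banach} => 'a"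
 assumes A: "positive_op A" and c: "!!u. A u .* u <= c * (norm u)^2" and "c >= 0" and "l > 0"
 shows "\<exists>p. A p + l *\<^sub>R p = q"
proof -
 define K where "K = c + l"
 define d where "d = l / K^2"
 define f where "f u = u - d *\<^sub>R (A u + l *\<^sub>R u - q)" for u
 have K: "K > 0" and d: "d > 0" using \<open>c >= 0\<close> \<open>l > 0\<close> by (auto simp: K_def d_def)
 have lK: "l^2 / K^2 <= 1" using \<open>c >= 0\<close> \<open>l > 0\<close> K by (simp add: K_def)
 have "\<exists>!u\<in>UNIV. f u = u"
 proof (rule Banach_fix[where c = "sqrt (1 - l^2 / K^2)"])
  fix u v :: 'a
  define w where "w = u - v"
  have fw: "f u - f v = w - d *\<^sub>R (A w + l *\<^sub>R w)"
   unfolding f_def w_def by (simp add: linear_diff[OF positive_opD(1)[OF A]] algebra_simps)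
  have low: "(A w + l *\<^sub>R w) .* w >= l * (norm w)^2"
   using positive_opD(3)[OF A, of w] by (simp add: inner_add_left power2_norm_eq_inner)
  have "norm (A w + l *\<^sub>R w) <= K * norm w"
   using norm_triangle_ineq[of "A w" "l *\<^sub>R w"] positive_op_bounded[OF A c \<open>c >= 0\<close>, of w] \<open>l > 0\<close>
   by (simp add: K_def algebra_simps)
  then have up: "(norm (A w + l *\<^sub>R w))^2 <= K^2 * (norm w)^2"
   by (metis norm_ge_zero power_mono power_mult_distrib)
  have "(norm (f u - f v))^2 = (norm w)^2 - 2 * d * ((A w + l *\<^sub>R w) .* w) + d^2 * (norm (A w + l *\<^sub>R w))^2"
   unfolding fw power2_norm_eq_inner
   by (simp add: inner_diff_left inner_diff_right inner_commute power2_eq_square algebra_simps)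
  also have "... <= (norm w)^2 - 2 * d * (l * (norm w)^2) + d^2 * (K^2 * (norm w)^2)"
   by (intro add_mono diff_mono mult_left_mono low up) (use d in auto)
  also have "... = (1 - l^2 / K^2) * (norm w)^2"
   using K by (simp add: d_def field_simps power2_eq_square)
  finally have "norm (f u - f v) <= sqrt ((1 - l^2 / K^2) * (norm w)^2)"
   by (rule real_le_rsqrt)
  then show "dist (f u) (f v) <= sqrt (1 - l^2 / K^2) * dist u v"
   by (simp add: dist_norm w_def real_sqrt_mult)
 next
  show "sqrt (1 - l^2 / K^2) < 1" "0 <= sqrt (1 - l^2 / K^2)"
   using K \<open>l > 0\<close> lK by auto
 qed (auto simp: complete_UNIV)
 then obtain u where "f u = u" by blast
 then show ?thesis using d by (intro exI[of _ u]) (simp add: f_def)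
qed

section \<open>Trace class operators and their spectral theorem\<close>

lemma compact_finite_box:
 fixes F :: "'a::real_normed_vector set"
 assumes "finite F"
 shows "compact {(SUM f:F. c f *\<^sub>R f) | c. \<forall>f. \<bar>c f\<bar> <= (1::real)}"
 using assms
proof (induction F)
 case empty
 have "{(SUM f:{}. c f *\<^sub>R f) | c. \<forall>f. \<bar>c f\<bar> <= (1::real)} = {0::'a}"
  by (auto intro!: exI[of _ "%_. 0"])
 then show ?case by simp
next
 case (insert g F)
 let ?B = "%F. {(SUM f:F. c f *\<^sub>R f) | c. \<forall>f. \<bar>c f\<bar> <= (1::real)}"
 have "?B (insert g F) = {x + y | x y. x \<in> (%t. t *\<^sub>R g) ` {-1..1} \<and> y \<in> ?B F}" (is "_ = ?S")
 proof (intro equalityI subsetI)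
  fix x assume "x \<in> ?B (insert g F)"
  then obtain c where c: "\<forall>f. \<bar>c f\<bar> <= 1" "x = (SUM f:insert g F. c f *\<^sub>R f)" by auto
  have "x = c g *\<^sub>R g + (SUM f:F. c f *\<^sub>R f)" using c insert by simp
  moreover have "c g \<in> {-1..1}" using c by (metis abs_le_iff atLeastAtMost_iff minus_le_iff)
  ultimately show "x \<in> ?S" using c(1) by blast
 next
  fix x assume "x \<in> ?S"
  then obtain t c where c: "t \<in> {-1..1}" "\<forall>f. \<bar>c f\<bar> <= 1" "x = t *\<^sub>R g + (SUM f:F. c f *\<^sub>R f)" by auto
  have "x = (SUM f:insert g F. (c(g := t)) f *\<^sub>R f)"
   using insert c(3) by (simp) (rule sum.cong, auto)
  then show "x \<in> ?B (insert g F)" using c by (intro CollectI exI[of _ "c(g := t)"]) (auto simp: abs_le_iff)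
 qed
 moreover have "compact ?S"
  by (intro compact_sums compact_continuous_image insert.IH continuous_intros) simp
 ultimately show ?case by simp
qed

text \<open>The trace class condition for positive operators in a form that involves neither a basis
  nor an infinite sum.\<close>

definition trace_bounded :: "('a::real_inner => 'a) => real => bool" where
 "trace_bounded A c \<longleftrightarrow> (\<forall>F. finite F \<and> orthonormal F --> (SUM e:F. A e .* e) <= c)"

lemma trace_bounded_nonneg: "trace_bounded A c ==> 0 <= c"
 unfolding trace_bounded_def by (drule spec[of _ "{}"]) (simp add: orthonormal_def)

lemma quadratic_le_of_unit:
 assumes "linear A" "!!v. norm v = 1 ==> (\<forall>e\<in>E. v .* e = 0) ==> A v .* v <= c" "\<forall>e\<in>E. u .* e = 0"
 shows "A u .* u <= c * (norm (u::'a::real_inner))^2"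
proof (cases "u = 0")
 case True
 then show ?thesis using linear_0[OF assms(1)] by simp
next
 case False
 define v where "v = (1 / norm u) *\<^sub>R u"
 have "A v .* v <= c" by (rule assms(2)) (use False assms(3) in \<open>auto simp: v_def\<close>)
 moreover have "A v .* v = (A u .* u) / (norm u)^2"
  unfolding v_def by (simp add: linear_scale[OF assms(1)] power2_eq_square)
 ultimately show ?thesis using False by (simp add: divide_le_eq)
qed

lemma trace_bounded_quadratic:
 assumes A: "positive_op A" "trace_bounded A c"
 shows "A u .* u <= c * (norm u)^2"
proof (rule quadratic_le_of_unit[where E = "{}"])
 fix v :: 'a assume "norm v = 1"
 then have "orthonormal {v}" by (simp add: orthonormal_def)
 then have "(SUM e:{v}. A e .* e) <= c" using A(2) unfolding trace_bounded_def by blast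
 then show "A v .* v <= c" by simp
qed (use positive_opD(1)[OF A(1)] in auto)

text \<open>A finite orthonormal \<open>F\<close> almost exhausts the trace. On its orthogonal
  complement the form of \<open>A\<close> is at most \<open>ep\<close>, so \<open>A\<close> maps the
  unit ball into a small neighbourhood of the image of a finite-dimensional box, which is compact;
  hence total boundedness.\<close>

lemma trace_bounded_compact:
 fixes A :: "'a::{real_inner, banach} => 'a"
 assumes A: "positive_op A" "trace_bounded A c"
 shows "compact (closure (A ` cball 0 1))"
proof -
 have c0: "c >= 0" by (rule trace_bounded_nonneg[OF A(2)])
 have lin: "linear A" by (rule positive_opD(1)[OF A(1)])
 have bl: "bounded_linear A"
  by (rule positive_op_bounded_linear[OF A(1) trace_bounded_quadratic[OF A] c0])
 have tb0: "\<exists>k. finite k \<and> A ` cball 0 1 \<subseteq> (\<Union>x\<in>k. ball x d)" if "d > 0" for d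
 proof -
  \<comment> \<open>Makes c ep at most (d / 3)^2, the bound for |A (u - p)|^2 below.\<close>
  define ep where "ep = (d / 3)^2 / (c + 1)"
  have eps: "ep > 0" using \<open>d > 0\<close> c0 by (simp add: ep_def)
  let ?T = "(%F. SUM e:F. A e .* e) ` {F. finite F \<and> orthonormal F}"
  have bdd: "bdd_above ?T" using A(2) unfolding trace_bounded_def by (auto intro!: bdd_aboveI2)
  have "{} \<in> {F. finite F \<and> orthonormal F}" by (simp add: orthonormal_def)
  then have "?T \<noteq> {}" by blast
  then obtain F where F: "finite F" "orthonormal F" "Sup ?T - ep < (SUM e:F. A e .* e)"
   using less_cSup_iff[OF _ bdd, of "Sup ?T - ep"] eps by auto
  \<comment> \<open>A unit vector orthogonal to \<open>F\<close> with a value above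
    \<open>ep\<close> could be added to \<open>F\<close>, and the trace would exceed its
    supremum.\<close>
  have tail: "A u .* u <= ep * (norm u)^2" if u: "\<forall>e\<in>F. u .* e = 0" for u
  proof (rule quadratic_le_of_unit[OF lin _ u])
   fix v assume v: "norm v = 1" "\<forall>e\<in>F. v .* e = 0"
   have nF: "v \<notin> F" using v by (metis inner_eq_zero_iff norm_zero zero_neq_one)
   have "orthonormal (insert v F)"
    using F(2) v unfolding orthonormal_def pairwise_insert by (auto simp: orthogonal_def inner_commute)
   then have "(SUM e:insert v F. A e .* e) <= Sup ?T" using F(1) by (intro cSup_upper bdd) auto
   then show "A v .* v <= ep" using F(1,3) nF by simp
  qed
  let ?K = "A ` {(SUM f:F. c f *\<^sub>R f) | c. \<forall>f. \<bar>c f\<bar> <= (1::real)}"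
  have "compact ?K"
   by (intro compact_continuous_image compact_finite_box F(1) linear_continuous_on bl)
  from conjunct2[OF this[unfolded compact_eq_totally_bounded], rule_format, of "d/2"] \<open>d > 0\<close>
  have "\<exists>k. finite k \<and> ?K \<subseteq> (\<Union>x\<in>k. ball x (d/2))" by simp
  then obtain k where k0: "finite k \<and> ?K \<subseteq> (\<Union>x\<in>k. ball x (d/2))" ..
  note k = conjunct1[OF k0] conjunct2[OF k0]
  show ?thesis
  proof (rule exI[of _ k], rule conjI[OF k(1)], rule subsetI)
   fix y assume "y \<in> A ` cball 0 1"
   then obtain u where u: "norm u <= 1" "y = A u" by auto
   define p where "p = (SUM e:F. (u .* e) *\<^sub>R e)"
   have perp: "\<forall>e\<in>F. (u - p) .* e = 0"
    using orthonormal_inner_sum[OF F(2) subset_refl F(1)] by (simp add: p_def inner_diff_left)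
   have "p = (SUM e:F. (if e \<in> F then u .* e else 0) *\<^sub>R e)" by (simp add: p_def)
   moreover have "\<bar>if e \<in> F then u .* e else 0\<bar> <= 1" for e
    using Cauchy_Schwarz_ineq2[of u e] u(1) F(2) by (auto simp: orthonormal_def)
   ultimately have "A p \<in> ?K" by (intro imageI CollectI exI[of _ "%e. if e \<in> F then u .* e else 0"]) auto
   then have "A p \<in> (\<Union>x\<in>k. ball x (d/2))" by (rule subsetD[OF k(2)])
   then obtain x where x: "x \<in> k" "dist x (A p) < d / 2" unfolding UN_iff mem_ball by blast
   have "(norm (u - p))^2 <= (norm u)^2"
    unfolding p_def by (subst orthonormal_projection_dist[OF F(2,1)]) (simp add: sum_nonneg)
   also have "... <= 1" using u(1) by (simp add: power_le_one)
   finally have up: "(norm (u - p))^2 <= 1" .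
   have "(norm (A (u - p)))^2 <= c * (A (u - p) .* (u - p))"
    by (rule positive_op_norm_le[OF A(1) trace_bounded_quadratic[OF A]])
   also have "... <= c * (ep * 1)"
    by (intro mult_left_mono c0 order_trans[OF tail[OF perp]] up) (use eps in simp)
   also have "... <= (d / 3)^2"
    using c0 by (simp add: ep_def field_simps)
   finally have "norm (A (u - p)) <= d / 3" by (rule power2_le_imp_le) (use \<open>d > 0\<close> in simp)
   then have "norm (A u - A p) < d / 2" using \<open>d > 0\<close> by (simp add: linear_diff[OF lin])
   then have "dist x y < d"
    using x(2) dist_triangle_less_add[of x "A p" "d/2" y "d/2"] by (simp add: u(2) dist_norm norm_minus_commute)
   then have "y \<in> ball x d" by (simp only: mem_ball)
   then show "y \<in> (\<Union>x\<in>k. ball x d)" by (rule UN_I[OF x(1)])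
  qed
 qed
 have tb: "\<exists>k. finite k \<and> closure (A ` cball 0 1) \<subseteq> (\<Union>x\<in>k. ball x d)" if "d > 0" for d
 proof -
  from tb0[OF half_gt_zero[OF \<open>d > 0\<close>]]
  obtain k where k0: "finite k \<and> A ` cball 0 1 \<subseteq> (\<Union>x\<in>k. ball x (d/2))" ..
  note k = conjunct1[OF k0] conjunct2[OF k0]
  have "closure (A ` cball 0 1) \<subseteq> (\<Union>x\<in>k. cball x (d/2))"
  proof (rule closure_minimal)
   have "(\<Union>x\<in>k. ball x (d/2)) \<subseteq> (\<Union>x\<in>k. cball x (d/2))" by (intro UN_mono ball_subset_cball subset_refl)
   then show "A ` cball 0 1 \<subseteq> (\<Union>x\<in>k. cball x (d/2))" by (rule subset_trans[OF k(2)])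
   show "closed (\<Union>x\<in>k. cball x (d/2))" by (rule closed_UN[OF k(1)]) simp
  qed
  also have "... \<subseteq> (\<Union>x\<in>k. ball x d)" using \<open>d > 0\<close> by auto
  finally show ?thesis using k(1) by blast
 qed
 show ?thesis unfolding compact_eq_totally_bounded using tb by (simp add: complete_eq_closed)
qed

text \<open>The Rayleigh quotient is maximised over the unit vectors orthogonal to \<open>E\<close>,
  a subspace that \<open>A\<close> preserves. A maximising sequence consists of approximate
  eigenvectors by \<open>near\<close>; compactness makes \<open>A (u n)\<close> converge along a
  subsequence, and then \<open>u n\<close> itself because m > 0.\<close>

lemma positive_op_eigenvector:
 fixes A :: "'a::{real_inner, banach} => 'a"
 assumes A: "positive_op A" "trace_bounded A c"
  and inv: "!!u. (\<forall>e\<in>E. u .* e = 0) ==> (\<forall>e\<in>E. A u .* e = 0)"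
  and g: "g \<noteq> 0" "\<forall>e\<in>E. g .* e = 0"
 shows "\<exists>v m. norm v = 1 \<and> (\<forall>e\<in>E. v .* e = 0) \<and> A v = m *\<^sub>R v"
proof -
 have lin: "linear A" by (rule positive_opD(1)[OF A(1)])
 define V where "V = {u. \<forall>e\<in>E. u .* e = 0}"
 define U where "U = {u\<in>V. norm u = 1}"
 define m where "m = Sup ((%u. A u .* u) ` U)"
 have gU: "(1 / norm g) *\<^sub>R g \<in> U" using g by (simp add: U_def V_def)
 have bdd: "bdd_above ((%u. A u .* u) ` U)"
 proof (rule bdd_aboveI2)
  show "A u .* u <= c" if "u \<in> U" for u
   using trace_bounded_quadratic[OF A, of u] that by (simp add: U_def)
 qed
 have m_ub: "A u .* u <= m * (norm u)^2" if "u \<in> V" for u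
 proof (rule quadratic_le_of_unit[OF lin, where E = E])
  fix v assume "norm v = 1" "\<forall>e\<in>E. v .* e = 0"
  then have "v \<in> U" by (simp add: U_def V_def)
  then show "A v .* v <= m" unfolding m_def by (intro cSup_upper bdd) auto
 qed (use that in \<open>simp add: V_def\<close>)
 have m0: "m >= 0" using m_ub[of "(1 / norm g) *\<^sub>R g"] gU positive_opD(3)[OF A(1), of "(1 / norm g) *\<^sub>R g"]
  by (simp add: U_def)
 have ex: "\<exists>u\<in>U. m - 1 / real (Suc n) < A u .* u" for n
  using less_cSup_iff[OF _ bdd, of "m - 1 / real (Suc n)"] gU unfolding m_def[symmetric] by auto
 then obtain u where u: "!!n. u n \<in> U" "!!n. m - 1 / real (Suc n) < A (u n) .* u n" by metis
 have subV: "x - y \<in> V" if "x \<in> V" "y \<in> V" for x y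
  using that by (auto simp: V_def inner_diff_left)
 have scV: "t *\<^sub>R x \<in> V" if "x \<in> V" for x t
  using that by (auto simp: V_def)
 have AV: "A x \<in> V" if "x \<in> V" for x using inv[of x] that by (auto simp: V_def)
 show ?thesis
 proof (cases "m = 0")
  \<comment> \<open>Then the form vanishes at \<open>g\<close>, hence so does \<open>A g\<close>,
    and the normalised \<open>g\<close> is an eigenvector.\<close>
  case True
  have "A g .* g <= 0" using m_ub[of g] g True by (simp add: V_def)
  then have "(norm (A g))^2 <= 0"
   using positive_op_norm_le[OF A(1) trace_bounded_quadratic[OF A], of g] trace_bounded_nonneg[OF A(2)]
   by (smt (verit) mult_nonneg_nonpos)
  then have "A g = 0" by simp
  then have "A ((1 / norm g) *\<^sub>R g) = 0 *\<^sub>R ((1 / norm g) *\<^sub>R g)" by (simp add: linear_scale[OF lin])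
  then show ?thesis using gU unfolding U_def V_def by blast
 next
  case False
  then have mpos: "m > 0" using m0 by simp
  \<comment> \<open>The form q(z) = m |z|^2 - A z .* z is nonnegative on the subspace, and y is half
    its gradient at x. Evaluating q at x - (1 / m) y bounds |y|^2 by m q(x).\<close>
  have near: "(norm (m *\<^sub>R x - A x))^2 <= m * (m * (norm x)^2 - A x .* x)" if x: "x \<in> V" for x
  proof -
   define y where "y = m *\<^sub>R x - A x"
   have yV: "y \<in> V" unfolding y_def by (intro subV scV AV x)
   define q where "q z = m * (norm z)^2 - A z .* z" for z
   have q0: "q z >= 0" if "z \<in> V" for z using m_ub[OF that] by (simp add: q_def)
   have qe: "q (x - t *\<^sub>R y) = q x - 2 * t * (y .* y) + t^2 * q y" for t
   proof -
    have e1: "A (x - t *\<^sub>R y) .* (x - t *\<^sub>R y) = A x .* x - 2 * t * (A x .* y) + t^2 * (A y .* y)"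
     using positive_op_quadratic[OF A(1), of x "-t" y] by simp
    have e2: "(norm (x - t *\<^sub>R y))^2 = (norm x)^2 - 2 * t * (x .* y) + t^2 * (norm y)^2"
     unfolding power2_norm_eq_inner
     by (simp add: inner_diff_left inner_diff_right inner_commute power2_eq_square algebra_simps)
    have e3: "y .* y = m * (x .* y) - A x .* y" unfolding y_def by (simp add: inner_diff_left)
    show ?thesis unfolding q_def e1 e2 e3 by (simp add: algebra_simps)
   qed
   have "q y <= m * (norm y)^2" using positive_opD(3)[OF A(1), of y] by (simp add: q_def)
   then have "(1/m)^2 * q y <= (1/m)^2 * (m * (norm y)^2)" by (rule mult_left_mono) simp
   moreover have "0 <= q (x - (1/m) *\<^sub>R y)"
    by (rule q0) (rule subV[OF x scV[OF yV]])
   ultimately have "0 <= q x - 2 * (1/m) * (norm y)^2 + (1/m)^2 * (m * (norm y)^2)"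
    unfolding qe by (simp add: power2_norm_eq_inner)
   also have "... = q x - (norm y)^2 / m" using mpos by (simp add: field_simps power2_eq_square)
   finally show ?thesis using mpos by (simp add: q_def y_def field_simps)
  qed
  have comp: "compact (closure (A ` cball 0 1))" by (rule trace_bounded_compact[OF A])
  have inC: "A (u n) \<in> closure (A ` cball 0 1)" for n
   using u(1)[of n] closure_subset by (force simp: U_def)
  obtain z s where z: "strict_mono (s :: nat => nat)" "(%n. A (u (s n))) \<longlonglongrightarrow> z"
   using comp[unfolded compact_def, rule_format, of "%n. A (u n)"] inC unfolding o_def by blast
  have bnd: "(norm (m *\<^sub>R u n - A (u n)))^2 <= m * (1 / real (Suc n))" for n
  proof -
   have "(norm (m *\<^sub>R u n - A (u n)))^2 <= m * (m * (norm (u n))^2 - A (u n) .* u n)"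
    by (rule near) (use u(1)[of n] in \<open>simp add: U_def\<close>)
   also have "... <= m * (1 / real (Suc n))"
    using u(1)[of n] u(2)[of n] mpos by (intro mult_left_mono) (auto simp: U_def)
   finally show ?thesis .
  qed
  have "(%n. m * (1 / real (Suc n))) \<longlonglongrightarrow> m * 0"
   by (intro tendsto_mult tendsto_const LIMSEQ_inverse_real_of_nat[unfolded inverse_eq_divide])
  note lim = this
  have "(%n. (norm (m *\<^sub>R u n - A (u n)))^2) \<longlonglongrightarrow> 0"
  proof (rule tendsto_sandwich[OF _ _ tendsto_const, rotated 2])
   show "(%n. m * (1 / real (Suc n))) \<longlonglongrightarrow> 0" using lim by (simp only: mult_zero_right)
   show "eventually (%n. (norm (m *\<^sub>R u n - A (u n)))^2 <= m * (1 / real (Suc n))) sequentially"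
    by (rule always_eventually) (rule allI, rule bnd)
  qed simp
  then have "(%n. sqrt ((norm (m *\<^sub>R u n - A (u n)))^2)) \<longlonglongrightarrow> sqrt 0" by (rule tendsto_real_sqrt)
  then have "(%n. m *\<^sub>R u n - A (u n)) \<longlonglongrightarrow> 0" by (simp add: tendsto_norm_zero_iff)
  from LIMSEQ_subseq_LIMSEQ[OF this z(1)]
  have "(%n. (m *\<^sub>R u (s n) - A (u (s n))) + A (u (s n))) \<longlonglongrightarrow> 0 + z"
   using z(2) by (intro tendsto_add) (auto simp: o_def)
  then have "(%n. (1/m) *\<^sub>R (m *\<^sub>R u (s n))) \<longlonglongrightarrow> (1/m) *\<^sub>R z" by (intro tendsto_scaleR tendsto_const) simp
  then have lim: "(%n. u (s n)) \<longlonglongrightarrow> (1/m) *\<^sub>R z" using mpos by simp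
  define v where "v = (1/m) *\<^sub>R z"
  have bl: "bounded_linear A"
   by (rule positive_op_bounded_linear[OF A(1) trace_bounded_quadratic[OF A] trace_bounded_nonneg[OF A(2)]])
  have "(%n. A (u (s n))) \<longlonglongrightarrow> A v"
   using bounded_linear.tendsto[OF bl lim] by (simp add: v_def)
  then have "A v = z" using z(2) LIMSEQ_unique by blast
  then have ev: "A v = m *\<^sub>R v" using mpos by (simp add: v_def)
  have "(%n. norm (u (s n))) \<longlonglongrightarrow> norm v" using tendsto_norm[OF lim] by (simp add: v_def)
  moreover have "(%n. norm (u (s n))) = (%_. 1)" using u(1) by (auto simp: U_def)
  ultimately have "norm v = 1" using LIMSEQ_unique tendsto_const by metis
  moreover have "v .* e = 0" if "e \<in> E" for e
  proof -
   have "(%n. u (s n) .* e) \<longlonglongrightarrow> v .* e" using tendsto_inner[OF lim tendsto_const, of e] by (simp add: v_def)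
   moreover have "(%n. u (s n) .* e) = (%_. 0)" using u(1) that by (auto simp: U_def V_def)
   ultimately show ?thesis using LIMSEQ_unique tendsto_const by metis
  qed
  ultimately show ?thesis using ev by blast
 qed
qed

text \<open>Zorn's lemma for orthonormal sets of eigenvectors: if the span of a maximal one were not
  dense, its orthogonal complement would be invariant and contain a further eigenvector. This makes
  the choice in \<open>eigenbasis\<close> legitimate.\<close>

theorem spectral_theorem_trace_bounded:
 fixes A :: "'a::{real_inner, banach} => 'a"
 assumes A: "positive_op A" "trace_bounded A c"
 shows "\<exists>E. hilbert_basis E \<and> (\<forall>e\<in>E. \<exists>c. A e = c *\<^sub>R e)"
proof -
 let ?S = "{E. orthonormal E \<and> (\<forall>e\<in>E. \<exists>c. A e = c *\<^sub>R e)}"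
 have "\<exists>E\<in>?S. \<forall>X\<in>?S. E \<subseteq> X --> X = E"
 proof (rule Zorn_Lemma, intro ballI)
  fix C assume C: "C \<in> chains ?S"
  have sub: "C \<subseteq> ?S" and ch: "!!x y. x \<in> C ==> y \<in> C ==> x \<subseteq> y \<or> y \<subseteq> x"
   using C by (auto simp: chains_def chain_subset_def)
  have "orthonormal (\<Union>C)"
   unfolding orthonormal_def pairwise_def
  proof (intro conjI ballI impI)
   fix x y assume "x \<in> \<Union>C" "y \<in> \<Union>C" "x \<noteq> y"
   then obtain X where "X \<in> C" "x \<in> X" "y \<in> X"
   proof -
    obtain X1 X2 where "X1 \<in> C" "x \<in> X1" "X2 \<in> C" "y \<in> X2"
     using \<open>x \<in> \<Union>C\<close> \<open>y \<in> \<Union>C\<close> by blast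
    then show thesis using ch[of X1 X2] that[of X1] that[of X2] by blast
   qed
   moreover have "orthonormal X" using sub \<open>X \<in> C\<close> by blast
   ultimately show "orthogonal x y" using \<open>x \<noteq> y\<close> unfolding orthonormal_def pairwise_def by metis
  next
   fix x assume "x \<in> \<Union>C"
   then obtain X where "X \<in> C" "x \<in> X" by blast
   then have "orthonormal X" using sub by blast
   then show "norm x = 1" using \<open>x \<in> X\<close> unfolding orthonormal_def by blast
  qed
  moreover have "\<forall>e\<in>\<Union>C. \<exists>c. A e = c *\<^sub>R e" using sub by blast
  ultimately show "\<Union>C \<in> ?S" by blast
 qed
 then obtain E where E: "orthonormal E" "!!e. e \<in> E ==> \<exists>c. A e = c *\<^sub>R e"
  and max: "!!X. orthonormal X ==> (\<forall>e\<in>X. \<exists>c. A e = c *\<^sub>R e) ==> E \<subseteq> X ==> X = E"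
  by auto
 have "closure (span E) = UNIV"
 proof (rule ccontr)
  assume "closure (span E) \<noteq> UNIV"
  then obtain g where g: "g \<noteq> 0" "\<forall>e\<in>E. g .* e = 0" using orthonormal_extend[OF E(1)] by blast
  have "\<forall>e\<in>E. A u .* e = 0" if "\<forall>e\<in>E. u .* e = 0" for u
   using E(2) that positive_opD(2)[OF A(1)] by (metis inner_scaleR_right mult_zero_right)
  then obtain v m where v: "norm v = 1" "\<forall>e\<in>E. v .* e = 0" "A v = m *\<^sub>R v"
   using positive_op_eigenvector[OF A _ g] by blast
  have "orthonormal (insert v E)"
   using E(1) v unfolding orthonormal_def pairwise_insert by (auto simp: orthogonal_def inner_commute)
  then have "insert v E = E" using max[of "insert v E"] E(2) v(3) by blast
  then have "v .* v = 0" using v(2) by blast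
  then show False using v(1) by simp
 qed
 then show ?thesis using E unfolding hilbert_basis_def orthonormal_def by blast
qed

lemma spectral_eigenbasis:
 fixes A :: "'a::{real_inner, banach} => 'a"
 assumes "positive_op A" "trace_bounded A c"
 shows "hilbert_basis (eigenbasis A)" "e \<in> eigenbasis A ==> A e = (A e .* e) *\<^sub>R e"
proof -
 have E: "hilbert_basis (eigenbasis A) \<and> (\<forall>e\<in>eigenbasis A. \<exists>c. A e = c *\<^sub>R e)"
  unfolding eigenbasis_def by (rule someI_ex[OF spectral_theorem_trace_bounded[OF assms]])
 then show "hilbert_basis (eigenbasis A)" by blast
 assume e: "e \<in> eigenbasis A"
 then obtain c where "A e = c *\<^sub>R e" using E by blast
 moreover have "e .* e = 1"
  using orthonormal_inner[OF hilbert_basis_orthonormal, of "eigenbasis A" e e] E e by simp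
 ultimately show "A e = (A e .* e) *\<^sub>R e" by simp
qed

text \<open>The spectral theorem for the zero operator. It makes the choice of a basis in
  \<open>op_trace\<close> legitimate.\<close>

lemma hilbert_basis_exists: "\<exists>E :: 'a::{real_inner, banach} set. hilbert_basis E"
proof -
 have "positive_op (%_::'a. 0::'a)" by (simp add: positive_op_def linear_0 module_hom_zero)
 moreover have "trace_bounded (%_::'a. 0::'a) 0" by (simp add: trace_bounded_def)
 ultimately show ?thesis using spectral_theorem_trace_bounded by blast
qed

lemma hilbert_basis_has_sum_inner:
 assumes "hilbert_basis E"
 shows "((%e. (u .* e) * (v .* e)) has_sum u .* v) E"
proof -
 have "((%e. ((u .* e) *\<^sub>R e) .* v) has_sum u .* v) E"
  using has_sum_bounded_linear[OF bounded_linear_inner_left hilbert_basis_expansion[OF assms], of u v]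
  by (simp add: o_def)
 then show ?thesis by (simp add: inner_commute)
qed

section \<open>Functions of an operator as diagonal operators\<close>

definition diag :: "'a::real_inner set => ('a => real) => 'a => 'a" where
 "diag E \<psi> u = (\<Sum>\<^sub>\<infinity>e\<in>E. (\<psi> e * (u .* e)) *\<^sub>R e)"

lemma op_powr_eq_diag: "op_powr A r = diag (eigenbasis A) (%e. (A e .* e) powr r)"
 by (rule ext) (simp add: op_powr_def diag_def)

context
 fixes E :: "'a::{real_inner, banach} set" and \<psi> :: "'a => real" and b :: real
 assumes E: "hilbert_basis E" and b: "!!e. e \<in> E ==> \<bar>\<psi> e\<bar> <= b"
begin

lemma diag_has_sum: "((%e. (\<psi> e * (u .* e)) *\<^sub>R e) has_sum diag E \<psi> u) E"
proof -
 have "(%e. (\<psi> e * (u .* e))^2) summable_on E"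
 proof (rule summable_on_comparison_test)
  show "(%e. b^2 * (u .* e)^2) summable_on E"
   by (intro summable_on_cmult_right bessel_summable hilbert_basis_orthonormal E)
  show "(\<psi> e * (u .* e))^2 <= b^2 * (u .* e)^2" if "e \<in> E" for e
   unfolding power_mult_distrib
   by (intro mult_right_mono power2_le_iff_abs_le[THEN iffD2]) (use b[OF that] abs_ge_zero[of "\<psi> e"] in auto)
 qed simp
 from orthonormal_series_summable[OF hilbert_basis_orthonormal[OF E] this]
 show ?thesis unfolding diag_def by (rule has_sum_infsum)
qed

lemma diag_inner_basis: "e \<in> E ==> diag E \<psi> u .* e = \<psi> e * (u .* e)"
 by (rule orthonormal_has_sum_inner[OF hilbert_basis_orthonormal[OF E] diag_has_sum])

lemma diag_norm_has_sum: "((%e. (\<psi> e * (u .* e))^2) has_sum (norm (diag E \<psi> u))\<^sup>2) E"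
 by (rule orthonormal_has_sum_norm[OF hilbert_basis_orthonormal[OF E] diag_has_sum])

lemma diag_inner_has_sum: "((%e. \<psi> e * (u .* e) * (v .* e)) has_sum diag E \<psi> u .* v) E"
 using hilbert_basis_has_sum_inner[OF E, of "diag E \<psi> u" v]
 by (rule has_sum_cong[THEN iffD1, rotated]) (simp add: diag_inner_basis)

lemma diag_linear: "linear (diag E \<psi>)"
proof (rule linearI)
 show "diag E \<psi> (u + v) = diag E \<psi> u + diag E \<psi> v" for u v
  by (rule hilbert_basis_eqI[OF E]) (simp add: diag_inner_basis inner_add_left algebra_simps)
 show "diag E \<psi> (c *\<^sub>R u) = c *\<^sub>R diag E \<psi> u" for c u
  by (rule hilbert_basis_eqI[OF E]) (simp add: diag_inner_basis)
qed

lemma diag_bounded: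
 assumes "b >= 0"
 shows "norm (diag E \<psi> u) <= b * norm u"
proof -
 have "(norm (diag E \<psi> u))^2 <= b^2 * (norm u)^2"
 proof (rule has_sum_mono[OF diag_norm_has_sum has_sum_cmult_right[OF hilbert_basis_parseval[OF E]]])
  show "(\<psi> e * (u .* e))^2 <= b^2 * (u .* e)^2" if "e \<in> E" for e
   unfolding power_mult_distrib
   by (intro mult_right_mono power2_le_iff_abs_le[THEN iffD2]) (use b[OF that] abs_ge_zero[of "\<psi> e"] in auto)
 qed
 then have "(norm (diag E \<psi> u))^2 <= (b * norm u)^2" by (simp only: power_mult_distrib)
 then show ?thesis by (rule power2_le_imp_le) (use assms in simp)
qed

lemma diag_bounded_linear: "bounded_linear (diag E \<psi>)"
\<comment> \<open>For empty \<open>E\<close> the hypothesis says nothing about \<open>b\<close>,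
  which may then be negative.\<close>
proof (rule bounded_linear_intro[where K = "max b 0"])
 show "norm (diag E \<psi> u) <= norm u * max b 0" for u
 proof (cases "E = {}")
  case True
  then show ?thesis by (simp add: diag_def)
 next
  case False
  then obtain e where "e \<in> E" by blast
  then have "b >= 0" using b[of e] abs_ge_zero[of "\<psi> e"] by linarith
  then show ?thesis using diag_bounded[of u] by (simp add: mult.commute)
 qed
qed (use diag_linear in \<open>auto simp: linear_add linear_scale\<close>)

lemma diag_selfadjoint: "diag E \<psi> u .* v = u .* diag E \<psi> v"
proof -
 have "((%e. \<psi> e * (u .* e) * (v .* e)) has_sum diag E \<psi> v .* u) E"
  using diag_inner_has_sum[of v u] by (simp add: mult.assoc mult.commute[of "u .* _"])
 then show ?thesis using has_sum_unique[OF diag_inner_has_sum] by (simp add: inner_commute)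
qed

end

text \<open>The trace of \<open>B \<circ> S \<circ> S\<^sup>* \<circ> B\<close>-like operators: the two iterated sums of
 \<open>(B f .* e)^2 = (f .* C e)^2\<close> agree.\<close>

lemma hilbert_schmidt_swap:
 fixes E :: "'a::{real_inner, banach} set" and F :: "'b::{real_inner, banach} set"
 assumes E: "hilbert_basis E" and F: "hilbert_basis F"
  and adj: "!!e f. B f .* e = f .* C e"
  and s: "(%e. (norm (C e))^2) summable_on E"
 shows "((%f. (norm (B f))^2) has_sum (\<Sum>\<^sub>\<infinity>e\<in>E. (norm (C e))^2)) F"
proof -
 have pe: "((%f. (B f .* e)^2) has_sum (norm (C e))\<^sup>2) F" for e
  using hilbert_basis_parseval[OF F, of "C e"] unfolding adj inner_commute[of "C e"] .
 have pf: "((%e. (B f .* e)^2) has_sum (norm (B f))\<^sup>2) E" for f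
  by (rule hilbert_basis_parseval[OF E])
 have sum2: "(%(e, f). (B f .* e)^2) summable_on E \<times> F"
 proof (rule summable_on_SigmaI[where g = "%e. (norm (C e))^2"])
 qed (use pe s in auto)
 have "((%(e, f). (B f .* e)^2) has_sum (\<Sum>\<^sub>\<infinity>e\<in>E. (norm (C e))^2)) (E \<times> F)"
  by (rule has_sum_SigmaI[OF _ _ sum2]) (use pe has_sum_infsum[OF s] in auto)
 then have h: "((%(f, e). (B f .* e)^2) has_sum (\<Sum>\<^sub>\<infinity>e\<in>E. (norm (C e))^2)) (F \<times> E)"
  by (subst has_sum_swap) simp
 show ?thesis by (rule has_sum_SigmaD[OF h]) (use pf in auto)
qed

section \<open>Exponential tail bounds\<close>

text \<open>The series of cosh (sqrt u) has nonnegative coefficients in u, so this function is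
  convex for u >= 0, and its argument is the mean of (a - b)^2 and (a + b)^2 with weights (1 - c) /
  2 and (1 + c) / 2. In the application a and b are two norms and c is the cosine of the angle
  between the vectors.\<close>

lemma cosh_sqrt_interpolation:
 fixes a b c :: real
 assumes "a >= 0" "b >= 0" "\<bar>c\<bar> <= 1"
 shows "cosh (sqrt (a^2 + 2 * a * b * c + b^2)) <= (1 + c) / 2 * cosh (a + b) + (1 - c) / 2 * cosh (a - b)"
proof -
 define u where "u = a^2 + 2 * a * b * c + b^2"
 define t where "t = (1 + c) / 2"
 have t: "0 <= t" "0 <= 1 - t" "(1 - c) / 2 = 1 - t" using assms(3) by (auto simp: t_def field_simps)
 have ut: "u = (1 - t) * (a - b)^2 + t * (a + b)^2"
  by (simp add: u_def t_def field_simps power2_eq_square)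
 have u0: "u >= 0" unfolding ut using t by simp
 have pow: "u ^ k <= (1 - t) * ((a - b)^2) ^ k + t * ((a + b)^2) ^ k" for k
 proof (cases "even k")
  case True
  from convex_onD[OF convex_power_even[OF True], of t "(a - b)^2" "(a + b)^2"] t
  show ?thesis by (simp add: ut)
 next
  case False
  from convex_onD[OF convex_power_odd[OF False], of t "(a - b)^2" "(a + b)^2"] t
  show ?thesis by (simp add: ut)
 qed
 let ?s = "%x n. if even n then x ^ n /\<^sub>R fact n else (0::real)"
 have "cosh (sqrt u) <= (1 - t) * cosh (a - b) + t * cosh (a + b)"
 proof (rule sums_le[OF _ cosh_converges sums_add[OF sums_mult sums_mult]])
  show "(%n. ?s (a - b) n) sums cosh (a - b)" "(%n. ?s (a + b) n) sums cosh (a + b)"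
   by (rule cosh_converges)+
  show "?s (sqrt u) n <= (1 - t) * ?s (a - b) n + t * ?s (a + b) n" for n
  proof (cases "even n")
   case True
   then obtain k where n: "n = 2 * k" by (elim evenE)
   have "sqrt u ^ n = u ^ k" unfolding n power_mult using u0 by simp
   moreover have "(a - b) ^ n = ((a - b)^2) ^ k" "(a + b) ^ n = ((a + b)^2) ^ k"
    unfolding n by (rule power_mult)+
   ultimately show ?thesis using True mult_left_mono[OF pow[of k], of "inverse (fact n)"]
    by (simp add: algebra_simps)
  qed simp
 qed
 then show ?thesis by (simp add: u_def t(3)) (simp add: t_def)
qed

text \<open>The deterministic step of Pinelis' inequality.  The term linear in \<open>x\<close> disappears in
 expectation for centred \<open>x\<close>.\<close>

lemma cosh_norm_add_le:
 fixes s x :: "'a::real_inner"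
 shows "cosh (norm (s + x)) <= cosh (norm s) * (exp (norm x) - norm x) + (s .* x) * (sinh (norm s) / norm s)"
proof -
 define a where "a = norm s"
 define b where "b = norm x"
 have ab: "a >= 0" "b >= 0" by (auto simp: a_def b_def)
 have sb: "b <= sinh b" using real_le_x_sinh[of b] ab by (simp add: sinh_field_def exp_minus)
 have eb: "exp b = cosh b + sinh b" by (simp add: cosh_plus_sinh)
 show ?thesis
 proof (cases "a = 0 \<or> b = 0")
  case True
  then show ?thesis
  proof
   assume "a = 0"
   then have "s = 0" by (simp add: a_def)
   then show ?thesis using sb eb by (simp add: b_def)
  next
   assume "b = 0"
   then show ?thesis by (simp add: b_def)
  qed
 next
  case False
  then have pos: "a > 0" "b > 0" using ab by auto
  define c where "c = (s .* x) / (a * b)"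
  have sx: "s .* x = a * b * c" using pos by (simp add: c_def)
  have c1: "\<bar>c\<bar> <= 1" using Cauchy_Schwarz_ineq2[of s x] pos
   by (simp add: c_def a_def b_def abs_mult)
  have "norm (s + x) = sqrt (a^2 + 2 * a * b * c + b^2)"
   using sx by (simp add: norm_eq_sqrt_inner a_def b_def inner_add_left inner_add_right inner_commute
     power2_norm_eq_inner algebra_simps)
  then have "cosh (norm (s + x)) <= (1 + c) / 2 * cosh (a + b) + (1 - c) / 2 * cosh (a - b)"
   using cosh_sqrt_interpolation[OF ab c1] by simp
  also have "... = cosh a * cosh b + c * (sinh a * sinh b)"
   by (simp add: cosh_add cosh_diff field_simps)
  \<comment> \<open>Writing sinh b as (sinh b - b) + b isolates the part linear in x, which is kept
    exactly; the remainder is bounded by |c| <= 1 and sinh a <= cosh a.\<close>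
  also have "... = cosh a * cosh b + c * (sinh a * (sinh b - b)) + (s .* x) * (sinh a / a)"
   using pos by (simp add: sx algebra_simps)
  also have "c * (sinh a * (sinh b - b)) <= 1 * (cosh a * (sinh b - b))"
   using c1 sb pos sinh_le_cosh_real[of a]
   by (intro mult_mono mult_right_mono mult_nonneg_nonneg) (auto simp: abs_le_iff)
  finally show ?thesis by (simp add: eb a_def[symmetric] b_def[symmetric] algebra_simps)
 qed
qed

lemma exp_le_quadratic: "0 <= x ==> x <= 1 ==> exp x - x <= 1 + (x::real)^2"
 using exp_bound[of x] by simp

lemma borel_measurable_cosh [measurable]:
 assumes [measurable]: "f \<in> borel_measurable M"
 shows "(%x. cosh (f x :: real)) \<in> borel_measurable M"
proof -
 have [measurable]: "(cosh :: real => real) \<in> borel_measurable borel"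
  by (intro borel_measurable_continuous_onI continuous_intros)
 show ?thesis by measurable
qed

text \<open>Since exp t - t <= 1 + t^2 on [0, 1] and the linear term integrates to 0, one
  independent centred summand multiplies the moment by at most 1 + v, whatever the past sum
  \<open>s\<close>.\<close>

lemma cosh_moment_step:
 fixes X :: "'a => 'h::{real_inner, banach, second_countable_topology}"
 assumes "prob_space A" and X[measurable]: "X \<in> borel_measurable A"
  and bnd: "AE x in A. norm (X x) <= 1" and mean: "(LINT x|A. X x) = 0"
  and var: "(LINT x|A. (norm (X x))^2) <= v"
 shows "(\<integral>\<^sup>+x. ennreal (cosh (norm (s + X x))) \<partial>A) <= ennreal (cosh (norm s)) * ennreal (1 + v)"
proof -
 interpret prob_space A by fact
 have iX: "integrable A X" by (rule integrable_const_bound[OF bnd X])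
 have "(norm (X x))^2 <= 1" if "norm (X x) <= 1" for x using that by (simp add: power_le_one)
 then have iX2: "integrable A (%x. (norm (X x))^2)"
  using bnd by (intro integrable_const_bound[where B = 1]) auto
 have v0: "v >= 0" using var by (rule order_trans[rotated]) simp
 let ?g = "%x. cosh (norm s) * (1 + (norm (X x))^2) + (s .* X x) * (sinh (norm s) / norm s)"
 have ig: "integrable A ?g" using iX iX2 by (intro Bochner_Integration.integrable_add integrable_mult_right
    integrable_mult_left integrable_inner_right) auto
 have le: "AE x in A. cosh (norm (s + X x)) <= ?g x"
  using bnd
 proof eventually_elim
  case (elim x)
  have "cosh (norm (s + X x)) <= cosh (norm s) * (exp (norm (X x)) - norm (X x)) + (s .* X x) * (sinh (norm s) / norm s)"
   by (rule cosh_norm_add_le)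
  also have "cosh (norm s) * (exp (norm (X x)) - norm (X x)) <= cosh (norm s) * (1 + (norm (X x))^2)"
   using elim by (intro mult_left_mono exp_le_quadratic) auto
  finally show ?case by simp
 qed
 have "(\<integral>\<^sup>+x. ennreal (cosh (norm (s + X x))) \<partial>A) <= (\<integral>\<^sup>+x. ennreal (?g x) \<partial>A)"
  using le by (intro nn_integral_mono_AE) (auto elim!: eventually_mono simp: ennreal_leI)
 also have "... = ennreal (LINT x|A. ?g x)"
  using le by (intro nn_integral_eq_integral ig)
   (auto elim!: eventually_mono intro: order_trans[OF cosh_real_nonneg])
 also have "(LINT x|A. ?g x) = cosh (norm s) * (1 + (LINT x|A. (norm (X x))^2)) + (s .* (LINT x|A. X x)) * (sinh (norm s) / norm s)"
  using iX iX2 by (simp add: prob_space)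
 also have "... <= cosh (norm s) * (1 + v)" using var by (simp add: mean)
 also have "ennreal (cosh (norm s) * (1 + v)) = ennreal (cosh (norm s)) * ennreal (1 + v)"
  using v0 by (intro ennreal_mult) auto
 finally show ?thesis by (simp add: ennreal_leI)
qed

text \<open>Induction with Fubini: the new summand is integrated first, with the others as the fixed
  past.\<close>

lemma cosh_moment_sum:
 fixes X :: "'a => 'h::{real_inner, banach, second_countable_topology}"
 assumes A: "prob_space A" and X[measurable]: "X \<in> borel_measurable A"
  and bnd: "AE x in A. norm (X x) <= 1" and mean: "(LINT x|A. X x) = 0"
  and var: "(LINT x|A. (norm (X x))^2) <= v" and I: "finite I"
 shows "(\<integral>\<^sup>+z. ennreal (cosh (norm (SUM i:I. X (z i)))) \<partial>(\<Pi>\<^sub>M i\<in>I. A)) <= ennreal (1 + v) ^ card I"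
 using I
proof (induction I)
 case empty
 interpret product_prob_space "%_. A" "{}" by (intro product_prob_spaceI A)
 show ?case by (simp add: nn_integral_const emeasure_space_1)
next
 case (insert i I)
 interpret P: prob_space A by fact
 interpret product_sigma_finite "%_. A" ..
 have "(\<integral>\<^sup>+z. ennreal (cosh (norm (SUM i:insert i I. X (z i)))) \<partial>(\<Pi>\<^sub>M i\<in>insert i I. A))
  = (\<integral>\<^sup>+z. (\<integral>\<^sup>+y. ennreal (cosh (norm (SUM j:insert i I. X ((z(i := y)) j)))) \<partial>A) \<partial>(\<Pi>\<^sub>M i\<in>I. A))"
  by (rule product_nn_integral_insert[OF insert.hyps]) measurable
 also have "... = (\<integral>\<^sup>+z. (\<integral>\<^sup>+y. ennreal (cosh (norm ((SUM j:I. X (z j)) + X y))) \<partial>A) \<partial>(\<Pi>\<^sub>M i\<in>I. A))"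
 proof -
  have "(SUM j:insert i I. X ((z(i := y)) j)) = (SUM j:I. X (z j)) + X y" for z y
  proof -
   have "(SUM j:I. X ((z(i := y)) j)) = (SUM j:I. X (z j))"
    by (rule sum.cong) (use insert in auto)
   then show ?thesis using insert by (simp add: add.commute)
  qed
  then show ?thesis by simp
 qed
 also have "... <= (\<integral>\<^sup>+z. ennreal (cosh (norm (SUM j:I. X (z j)))) * ennreal (1 + v) \<partial>(\<Pi>\<^sub>M i\<in>I. A))"
  by (intro nn_integral_mono cosh_moment_step[OF A X bnd mean var])
 also have "... = (\<integral>\<^sup>+z. ennreal (cosh (norm (SUM j:I. X (z j)))) \<partial>(\<Pi>\<^sub>M i\<in>I. A)) * ennreal (1 + v)"
  by (rule nn_integral_multc) measurable
 also have "... <= ennreal (1 + v) ^ card I * ennreal (1 + v)"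
  by (rule mult_right_mono[OF insert.IH]) simp
 also have "... = ennreal (1 + v) ^ card (insert i I)" using insert by (simp add: mult.commute)
 finally show ?case .
qed

text \<open>Chernoff's method with cosh in place of exp: exp t <= 2 cosh t accounts for the factor
  2, and no dimension enters. The parameter \<open>th\<close> stays free; for negative
  \<open>s\<close> the right-hand side is at least 1.\<close>

theorem pinelis_bernstein:
 fixes X :: "'a => 'h::{real_inner, banach, second_countable_topology}"
 assumes A: "prob_space A" and X[measurable]: "X \<in> borel_measurable A"
  and bnd: "AE x in A. th * norm (X x) <= 1" and mean: "(LINT x|A. X x) = 0"
  and var: "(LINT x|A. (norm (X x))^2) <= v" and I: "finite I" and th: "th >= 0"
 shows "measure (\<Pi>\<^sub>M i\<in>I. A) {z \<in> space (\<Pi>\<^sub>M i\<in>I. A). norm (SUM i:I. X (z i)) >= s}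
  <= 2 * exp (real (card I) * th^2 * v - th * s)"
proof (cases "s >= 0")
 case s: True
 interpret PI: prob_space "\<Pi>\<^sub>M i\<in>I. A" by (intro prob_space_PiM A)
 let ?P = "\<Pi>\<^sub>M i\<in>I. A"
 let ?S = "%z. SUM i:I. X (z i)"
 let ?f = "%z. ennreal (cosh (norm (SUM i:I. th *\<^sub>R X (z i))))"
 have v0: "v >= 0" using var by (rule order_trans[rotated]) simp
 have "(\<integral>\<^sup>+z. ?f z \<partial>?P) <= ennreal (1 + th^2 * v) ^ card I"
 proof (rule cosh_moment_sum[OF A _ _ _ _ I])
  show "AE x in A. norm (th *\<^sub>R X x) <= 1" using bnd th by simp
  show "(LINT x|A. th *\<^sub>R X x) = 0" by (simp add: mean)
  show "(LINT x|A. (norm (th *\<^sub>R X x))^2) <= th^2 * v"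
   using var by (simp add: power_mult_distrib mult_left_mono)
 qed measurable
 also have "... = ennreal ((1 + th^2 * v) ^ card I)" using v0 by (intro ennreal_power) simp
 also have "... <= ennreal (exp (real (card I) * th^2 * v))"
 proof (rule ennreal_leI)
  have "(1 + th^2 * v) ^ card I <= exp (th^2 * v) ^ card I"
   by (intro power_mono exp_ge_add_one_self) (use v0 in simp)
  then show "(1 + th^2 * v) ^ card I <= exp (real (card I) * th^2 * v)"
   by (simp add: exp_of_nat_mult[symmetric] mult.assoc)
 qed
 finally have E: "(\<integral>\<^sup>+z. ?f z \<partial>?P) <= ennreal (exp (real (card I) * th^2 * v))" .
 have "emeasure ?P {z \<in> space ?P. s <= norm (?S z)}
   <= emeasure ?P {z \<in> space ?P. 1 <= ennreal (2 * exp (- th * s)) * ?f z}"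
 proof (intro emeasure_mono subsetI)
  fix z assume z: "z \<in> {z \<in> space ?P. s <= norm (?S z)}"
  have "th * s <= th * norm (?S z)" using z th by (intro mult_left_mono) auto
  also have "th * norm (?S z) = norm (SUM i:I. th *\<^sub>R X (z i))"
   using th by (simp add: scaleR_sum_right[symmetric])
  finally have "cosh (th * s) <= cosh (norm (SUM i:I. th *\<^sub>R X (z i)))"
   using th s by (intro cosh_real_nonneg_le_iff[THEN iffD2]) auto
  moreover have "exp (th * s) <= 2 * cosh (th * s)" by (simp add: cosh_field_def)
  ultimately have "exp (- th * s) * exp (th * s) <= exp (- th * s) * (2 * cosh (norm (SUM i:I. th *\<^sub>R X (z i))))"
   by (intro mult_left_mono) auto
  then have "1 <= 2 * exp (- th * s) * cosh (norm (SUM i:I. th *\<^sub>R X (z i)))"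
   by (simp add: exp_add[symmetric] algebra_simps)
  then have "ennreal 1 <= ennreal (2 * exp (- th * s) * cosh (norm (SUM i:I. th *\<^sub>R X (z i))))"
   by (rule ennreal_leI)
  then have "1 <= ennreal (2 * exp (- th * s)) * ?f z"
   by (simp add: ennreal_mult[symmetric])
  then show "z \<in> {z \<in> space ?P. 1 <= ennreal (2 * exp (- th * s)) * ?f z}" using z by simp
 qed measurable
 also have "... <= ennreal (2 * exp (- th * s)) * (\<integral>\<^sup>+z. ?f z \<partial>?P)"
  using nn_integral_Markov_inequality[of ?f "space ?P" ?P "ennreal (2 * exp (- th * s))"]
  by (simp add: Int_def conj_commute cong: conj_cong)
 also have "... <= ennreal (2 * exp (- th * s)) * ennreal (exp (real (card I) * th^2 * v))"
  by (rule mult_left_mono[OF E]) simp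
 also have "... = ennreal (2 * exp (real (card I) * th^2 * v - th * s))"
  by (simp add: ennreal_mult[symmetric] exp_add[symmetric] algebra_simps)
 finally show ?thesis
  unfolding PI.emeasure_eq_measure by simp
next
 case False
 interpret PI: prob_space "\<Pi>\<^sub>M i\<in>I. A" by (intro prob_space_PiM A)
 have v0: "v >= 0" using var by (rule order_trans[rotated]) simp
 have "measure (\<Pi>\<^sub>M i\<in>I. A) {z \<in> space (\<Pi>\<^sub>M i\<in>I. A). norm (SUM i:I. X (z i)) >= s} <= 1" by (rule PI.prob_le_1)
 moreover have "th * s <= 0" using th False by (intro mult_nonneg_nonpos) auto
 then have "0 <= real (card I) * th^2 * v - th * s"
 proof -
  have "0 <= real (card I) * th^2 * v" by (intro mult_nonneg_nonneg v0) auto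
  then show ?thesis using \<open>th * s <= 0\<close> by linarith
 qed
 then have "1 <= exp (real (card I) * th^2 * v - th * s)" by simp
 ultimately show ?thesis by linarith
qed

section \<open>Traces and moments of random operators\<close>

text \<open>The third condition places the range in the span of \<open>F\<close>. For orthonormal
  \<open>F\<close>, sums over \<open>F\<close> are then full traces, and cyclicity becomes a
  statement about finite sums.\<close>

definition selfadjoint_on :: "'a::real_inner set => ('a => 'a) => bool" where
 "selfadjoint_on F A \<longleftrightarrow> linear A \<and> (\<forall>u v. A u .* v = u .* A v) \<and>
   (\<forall>u. A u = (SUM f:F. (A u .* f) *\<^sub>R f))"

lemma selfadjoint_onD:
 assumes "selfadjoint_on F A"
 shows "linear A" "A u .* v = u .* A v" "A u = (SUM f:F. (A u .* f) *\<^sub>R f)"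
 using assms unfolding selfadjoint_on_def by blast+

lemma linear_funpow:
 fixes A :: "'a::real_vector => 'a"
 shows "linear A ==> linear (A ^^ k)"
 by (induction k) (auto intro: linear_compose linear_id simp: id_def[symmetric])

lemma selfadjoint_funpow:
 assumes "selfadjoint_on F A"
 shows "(A ^^ k) u .* v = u .* (A ^^ k) v"
proof (induction k arbitrary: u)
 case (Suc k)
 have "(A ^^ Suc k) u .* v = (A ^^ k) (A u) .* v" by (simp add: funpow_swap1)
 also have "... = u .* A ((A ^^ k) v)" by (simp add: Suc.IH selfadjoint_onD(2)[OF assms])
 finally show ?case by simp
qed simp

lemma selfadjoint_funpow_inner:
 assumes "selfadjoint_on F A"
 shows "(A ^^ i) u .* (A ^^ j) v = (A ^^ (i + j)) u .* v"
proof -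
 have "(A ^^ (i + j)) u = (A ^^ j) ((A ^^ i) u)" by (simp add: funpow_add add.commute[of i])
 then show ?thesis by (simp only: selfadjoint_funpow[OF assms])
qed

lemma norm_span_sum:
 assumes "orthonormal F" "finite F" "u = (SUM f:F. (u .* f) *\<^sub>R f)"
 shows "(norm u)^2 = (SUM f:F. (u .* f)^2)"
 by (subst assms(3)) (rule orthonormal_norm_sum[OF assms(1,2)])

text \<open>Cyclicity of the trace: \<open>Z e\<close> is expanded along \<open>F\<close>, the two
  sums are exchanged and the symmetric matrix of \<open>Z\<close> is transposed.\<close>

lemma selfadjoint_cyclic:
 assumes Z: "selfadjoint_on F Z" and W: "linear W" and V: "linear V"
 shows "(SUM e:F. W (Z e) .* V e) = (SUM e:F. W e .* V (Z e))"
proof -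
 have "(SUM e:F. W (Z e) .* V e) = (SUM e:F. SUM f:F. (Z e .* f) * (W f .* V e))"
  by (subst selfadjoint_onD(3)[OF Z], rule sum.cong[OF refl])
   (simp add: linear_sum[OF W] linear_scale[OF W] inner_sum_left)
 also have "... = (SUM f:F. SUM e:F. (Z e .* f) * (W f .* V e))" by (rule sum.swap)
 also have "... = (SUM f:F. SUM e:F. (Z f .* e) * (W f .* V e))"
 proof -
  have "Z e .* f = Z f .* e" for e f
   using selfadjoint_onD(2)[OF Z, of e f] by (simp add: inner_commute)
  then show ?thesis by (intro sum.cong refl arg_cong2[where f = "(*)"])
 qed
 also have "... = (SUM e:F. W e .* V (Z e))"
  by (subst (2) selfadjoint_onD(3)[OF Z], rule sum.cong[OF refl])
   (simp add: linear_sum[OF V] linear_scale[OF V] inner_sum_right)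
 finally show ?thesis .
qed

lemma selfadjoint_cyclic_funpow:
 assumes Z: "selfadjoint_on F Z" and W: "linear W" and V: "linear V"
 shows "(SUM e:F. W ((Z ^^ k) e) .* V e) = (SUM e:F. W e .* V ((Z ^^ k) e))"
 using W
proof (induction k arbitrary: W)
 case (Suc k)
 have "(SUM e:F. W ((Z ^^ Suc k) e) .* V e) = (SUM e:F. (W \<circ> Z) ((Z ^^ k) e) .* V e)" by simp
 also have "... = (SUM e:F. W (Z e) .* (V \<circ> (Z ^^ k)) e)"
  using Suc.IH[OF linear_compose[OF selfadjoint_onD(1)[OF Z] Suc.prems]] by (simp only: o_apply)
 also have "... = (SUM e:F. W e .* (V \<circ> (Z ^^ k)) (Z e))"
  by (intro selfadjoint_cyclic Z Suc.prems linear_compose V linear_funpow selfadjoint_onD(1)[OF Z])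
 finally show ?case by (simp add: funpow_swap1)
qed simp

text \<open>An operator and its adjoint have the same Hilbert-Schmidt norm; here the adjoint of X^q
  Y is Y X^q.\<close>

lemma hs_norm_adjoint:
 assumes F: "orthonormal F" "finite F" and Y: "selfadjoint_on F Y" and X: "selfadjoint_on F X"
 shows "(SUM e:F. (norm ((X ^^ q) (Y e)))^2) = (SUM e:F. (norm (Y ((X ^^ q) e)))^2)"
proof -
 have sp: "(X ^^ q) (Y e) = (SUM f:F. ((X ^^ q) (Y e) .* f) *\<^sub>R f)" for e
  by (cases q) (use selfadjoint_onD(3)[OF Y] selfadjoint_onD(3)[OF X] in simp_all)
 have "(SUM e:F. (norm ((X ^^ q) (Y e)))^2) = (SUM e:F. SUM f:F. ((X ^^ q) (Y e) .* f)^2)"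
  by (intro sum.cong refl norm_span_sum F sp)
 also have "... = (SUM f:F. SUM e:F. ((X ^^ q) (Y e) .* f)^2)" by (rule sum.swap)
 also have "... = (SUM f:F. SUM e:F. (Y ((X ^^ q) f) .* e)^2)"
 proof (intro sum.cong refl arg_cong[where f = "%x. x^2"])
  fix e f
  have "(X ^^ q) (Y e) .* f = Y e .* (X ^^ q) f" by (rule selfadjoint_funpow[OF X])
  also have "... = e .* Y ((X ^^ q) f)" by (rule selfadjoint_onD(2)[OF Y])
  finally show "(X ^^ q) (Y e) .* f = Y ((X ^^ q) f) .* e" by (simp only: inner_commute)
 qed
 also have "... = (SUM e:F. (norm (Y ((X ^^ q) e)))^2)"
  by (intro sum.cong refl norm_span_sum[symmetric] F selfadjoint_onD(3)[OF Y])
 finally show ?thesis .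
qed

lemma funpow_diff_sum:
 assumes X: "linear X" and d: "!!u. X u = Z u + Y u"
 shows "(X ^^ m) u - (Z ^^ m) u = (SUM a<m. (X ^^ a) (Y ((Z ^^ (m - 1 - a)) u)))"
proof (induction m arbitrary: u)
 case (Suc m)
 have "(X ^^ Suc m) u = (X ^^ m) (Z u) + (X ^^ m) (Y u)"
  using linear_add[OF linear_funpow[OF X], of m "Z u" "Y u"] by (simp add: funpow_swap1 d)
 then have "(X ^^ Suc m) u - (Z ^^ Suc m) u = ((X ^^ m) (Z u) - (Z ^^ m) (Z u)) + (X ^^ m) (Y u)"
  by (simp add: funpow_swap1)
 also have "(X ^^ m) (Z u) - (Z ^^ m) (Z u) = (SUM a<m. (X ^^ a) (Y ((Z ^^ (m - a)) u)))"
  unfolding Suc.IH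
 proof (rule sum.cong[OF refl])
  fix a assume "a \<in> {..<m}"
  then have "m - a = Suc (m - 1 - a)" by simp
  then have "(Z ^^ (m - a)) u = (Z ^^ (m - 1 - a)) (Z u)"
   by (metis comp_apply funpow_Suc_right)
  then show "(X ^^ a) (Y ((Z ^^ (m - 1 - a)) (Z u))) = (X ^^ a) (Y ((Z ^^ (m - a)) u))"
   by (simp only:)
 qed
 finally show ?case by simp
qed simp

text \<open>A discrete maximum principle: at the leftmost interior maximiser the left neighbour is
  strictly smaller, against midpoint convexity. For nonnegative end values their sum replaces their
  maximum.\<close>

lemma midpoint_convex_le_ends:
 fixes d :: "nat => real"
 assumes conv: "!!i. 0 < i ==> i < q ==> d i <= (d (i - 1) + d (i + 1)) / 2"
  and nn: "0 <= d 0" "0 <= d q" and "i <= q"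
 shows "d i <= d 0 + d q"
proof (rule ccontr)
 assume neg: "\<not> d i <= d 0 + d q"
 define D where "D = Max (d ` {..q})"
 have ub: "d j <= D" if "j <= q" for j unfolding D_def using that by (intro Max_ge) auto
 have "D \<in> d ` {..q}" unfolding D_def by (intro Max_in) auto
 then have ex: "\<exists>j. j <= q \<and> d j = D" by auto
 define j where "j = (LEAST j. j <= q \<and> d j = D)"
 have j: "j <= q" "d j = D" using LeastI_ex[OF ex] by (simp_all add: j_def)
 have big: "D > d 0 + d q" using neg ub[OF \<open>i <= q\<close>] by simp
 then have "j \<noteq> 0" "j \<noteq> q" using j(2) nn by (metis add_increasing add_increasing2 le_less_trans less_irrefl order_refl not_le)+
 then have jj: "0 < j" "j < q" using j by auto
 have "d (j - 1) \<noteq> D" using not_less_Least[of "j - 1" "%j. j <= q \<and> d j = D"] jj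
  unfolding j_def[symmetric] by auto
 moreover have "d (j - 1) <= D" by (rule ub) (use jj in simp)
 ultimately have "d (j - 1) < D" by linarith
 moreover have "d (j + 1) <= D" by (rule ub) (use jj in simp)
 ultimately have "d (j - 1) + d (j + 1) < D + D" by (rule add_less_le_mono)
 moreover have "D + D <= d (j - 1) + d (j + 1)" using conv[OF jj] j(2) by (simp add: field_simps)
 ultimately show False by simp
qed

text \<open>A trace inequality \<open>tr (Y X\<^sup>a Y Z\<^sup>b) <= tr (Y^2 X\<^sup>a\<^sup>+\<^sup>b) + tr (Y^2 Z\<^sup>a\<^sup>+\<^sup>b)\<close> for even \<open>a + b\<close>.  The Cauchy-Schwarz
 inequality makes \<open>i \<mapsto> \<parallel>X\<^sup>i Y Z\<^sup>q\<^sup>-\<^sup>i\<parallel>\<^sup>2\<close> midpoint convex, so no spectral decomposition is needed.\<close>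

lemma trace_word_le:
 assumes F: "orthonormal F" "finite F"
  and X: "selfadjoint_on F X" and Z: "selfadjoint_on F Z" and Y: "selfadjoint_on F Y"
  and a: "a <= 2 * q"
 shows "(SUM e:F. Y e .* (X ^^ a) (Y ((Z ^^ (2 * q - a)) e)))
  <= (SUM e:F. (norm (Y ((X ^^ q) e)))^2) + (SUM e:F. (norm (Y ((Z ^^ q) e)))^2)"
proof -
 define c where "c a = (SUM e:F. Y e .* (X ^^ a) (Y ((Z ^^ (2 * q - a)) e)))" for a
 define d where "d i = (SUM e:F. (norm ((X ^^ i) (Y ((Z ^^ (q - i)) e))))^2)" for i
 \<comment> \<open>By cyclicity a power of \<open>Z\<close> moves from one side to the other, so the
   word depends on i + j only and is an inner product of two vectors of the family defining
   \<open>d\<close>.\<close>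
 have c: "c (i + j) = (SUM e:F. (X ^^ i) (Y ((Z ^^ (q - i)) e)) .* (X ^^ j) (Y ((Z ^^ (q - j)) e)))"
  if ij: "i <= q" "j <= q" for i j
 proof -
  have lin: "linear (%e. (X ^^ (i + j)) (Y ((Z ^^ (q - i)) e)))"
   using linear_compose[OF linear_compose[OF linear_funpow[OF selfadjoint_onD(1)[OF Z], of "q - i"]
     selfadjoint_onD(1)[OF Y]] linear_funpow[OF selfadjoint_onD(1)[OF X], of "i + j"]]
   by (simp add: o_def)
  have "(SUM e:F. (X ^^ i) (Y ((Z ^^ (q - i)) e)) .* (X ^^ j) (Y ((Z ^^ (q - j)) e)))
   = (SUM e:F. (X ^^ (i + j)) (Y ((Z ^^ (q - i)) e)) .* Y ((Z ^^ (q - j)) e))"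
   by (intro sum.cong refl) (rule selfadjoint_funpow_inner[OF X])
  also have "... = (SUM e:F. (X ^^ (i + j)) (Y ((Z ^^ (q - i)) ((Z ^^ (q - j)) e))) .* Y e)"
   by (rule selfadjoint_cyclic_funpow[OF Z lin selfadjoint_onD(1)[OF Y], symmetric])
  also have "... = c (i + j)"
  proof -
   have "(Z ^^ (q - i)) ((Z ^^ (q - j)) e) = (Z ^^ (2 * q - (i + j))) e" for e
   proof -
    have "2 * q - (i + j) = (q - i) + (q - j)" using ij by simp
    then show ?thesis by (simp only: funpow_add o_apply)
   qed
   then show ?thesis unfolding c_def by (simp only: inner_commute)
  qed
  finally show ?thesis by simp
 qed
 have cle: "c (i + j) <= (d i + d j) / 2" if ij: "i <= q" "j <= q" for i j
 proof -
  have "u .* v <= ((norm u)^2 + (norm v)^2) / 2" for u v :: 'a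
  proof -
   have "0 <= (norm (u - v))^2" by simp
   also have "... = (norm u)^2 - 2 * (u .* v) + (norm v)^2"
    unfolding power2_norm_eq_inner by (simp add: inner_diff_left inner_diff_right inner_commute)
   finally show ?thesis by simp
  qed
  then have "c (i + j) <= (SUM e:F. ((norm ((X ^^ i) (Y ((Z ^^ (q - i)) e))))^2
    + (norm ((X ^^ j) (Y ((Z ^^ (q - j)) e))))^2) / 2)"
   unfolding c[OF ij] by (intro sum_mono)
  then show ?thesis by (simp add: d_def sum_divide_distrib[symmetric] sum.distrib)
 qed
 have cd: "c (i + i) = d i" if "i <= q" for i
  unfolding c[OF that that] d_def by (simp add: power2_norm_eq_inner)
 have d: "d i <= d 0 + d q" if "i <= q" for i
 proof (rule midpoint_convex_le_ends[OF _ _ _ that])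
  fix i assume i: "0 < i" "i < q"
  have "d i = c ((i - 1) + (i + 1))" using i cd[of i] by (simp flip: add.assoc)
  also have "... <= (d (i - 1) + d (i + 1)) / 2" by (rule cle) (use i in auto)
  finally show "d i <= (d (i - 1) + d (i + 1)) / 2" .
 qed (auto simp: d_def intro!: sum_nonneg)
 \<comment> \<open>Both halves are at most q, also for odd a.\<close>
 have "c a = c (a div 2 + (a - a div 2))" by simp
 also have "... <= (d (a div 2) + d (a - a div 2)) / 2" by (rule cle) (use a in auto)
 also have "... <= d 0 + d q"
 proof -
  have "d (a div 2) <= d 0 + d q" "d (a - a div 2) <= d 0 + d q" using a by (auto intro!: d)
  from add_mono[OF this] show ?thesis by (simp add: field_simps)
 qed
 also have "d q = (SUM e:F. (norm (Y ((X ^^ q) e)))^2)"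
  using hs_norm_adjoint[OF F Y X, of q] by (simp add: d_def)
 finally show ?thesis by (simp add: c_def d_def add.commute)
qed

text \<open>Telescoping X^(2q+1) - Z^(2q+1) leaves words with two factors \<open>Y\<close> and 2q
  further factors, an even number, to which \<open>trace_word_le\<close> applies. Later
  \<open>Z\<close> is the sum without the summand \<open>Y\<close>, so the first trace on the right
  has mean zero.\<close>

lemma trace_power_diff_le:
 assumes F: "orthonormal F" "finite F"
  and X: "selfadjoint_on F X" and Z: "selfadjoint_on F Z" and Y: "selfadjoint_on F Y"
  and d: "!!u. X u = Z u + Y u"
 shows "(SUM e:F. Y e .* (X ^^ (2 * q + 1)) e) <= (SUM e:F. Y e .* (Z ^^ (2 * q + 1)) e) +
   real (2 * q + 1) * ((SUM e:F. (norm (Y ((X ^^ q) e)))^2) + (SUM e:F. (norm (Y ((Z ^^ q) e)))^2))"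
proof -
 have "(SUM e:F. Y e .* (X ^^ (2 * q + 1)) e) - (SUM e:F. Y e .* (Z ^^ (2 * q + 1)) e)
  = (SUM e:F. Y e .* ((X ^^ (2 * q + 1)) e - (Z ^^ (2 * q + 1)) e))"
  by (simp only: inner_diff_right sum_subtractf)
 also have "... = (SUM e:F. SUM a<2 * q + 1. Y e .* (X ^^ a) (Y ((Z ^^ (2 * q - a)) e)))"
  by (simp only: funpow_diff_sum[OF selfadjoint_onD(1)[OF X] d] inner_sum_right diff_add_inverse2)
 also have "... = (SUM a<2 * q + 1. SUM e:F. Y e .* (X ^^ a) (Y ((Z ^^ (2 * q - a)) e)))" by (rule sum.swap)
 also have "... <= (SUM a<2 * q + 1. (SUM e:F. (norm (Y ((X ^^ q) e)))^2) + (SUM e:F. (norm (Y ((Z ^^ q) e)))^2))"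
  by (intro sum_mono trace_word_le F X Y Z) auto
 finally show ?thesis by simp
qed

text \<open>An abstract form of the whitened and truncated features: \<open>ze\<close> stands for
  (\<Sigma> + \<lambda>)^(-1/2) a projected onto the span of \<open>F\<close>, \<open>Mo\<close> for
  its covariance. The moment bounds have to be free of the cardinality of \<open>F\<close>.\<close>

locale rank_one_sample = prob_space A for A :: "'a measure" +
 fixes ze :: "'a => 'h::{real_inner, banach, second_countable_topology}"
  and F :: "'h set" and Mo :: "'h => 'h" and B :: real and n :: nat
 assumes ze_meas [measurable]: "ze \<in> borel_measurable A"
  and F: "orthonormal F" "finite F"
  and ze_span: "!!x. ze x = (SUM f:F. (ze x .* f) *\<^sub>R f)"
  and ze_bound: "!!x. (norm (ze x))^2 <= B" and B1: "B >= 1" and n: "n > 0"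
  and Mo: "selfadjoint_on F Mo" and Mo_pos: "!!u. 0 <= Mo u .* u" and Mo_le: "!!u. Mo u .* u <= (norm u)^2"
  and cov: "!!u v. (LINT x|A. (ze x .* u) * (ze x .* v)) = Mo u .* v"
begin

definition "Y x u = (1 / real n) *\<^sub>R ((ze x .* u) *\<^sub>R ze x - Mo u)"
definition "X I z u = (SUM i:I. Y (z i) u)"

lemma Mo_positive: "positive_op Mo"
 using Mo Mo_pos by (simp add: positive_op_def selfadjoint_on_def)

lemma Mo_bounded_linear: "bounded_linear Mo"
 by (rule positive_op_bounded_linear[OF Mo_positive, of 1]) (use Mo_le in auto)

lemma Mo_measurable [measurable]: "Mo \<in> borel_measurable borel"
 by (intro borel_measurable_continuous_onI linear_continuous_on Mo_bounded_linear)

lemma Y_selfadjoint: "selfadjoint_on F (Y x)"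
 unfolding selfadjoint_on_def
proof (intro conjI allI)
 show "linear (Y x)" unfolding Y_def
  by (rule linearI) (simp_all add: linear_add[OF selfadjoint_onD(1)[OF Mo]] linear_scale[OF selfadjoint_onD(1)[OF Mo]]
    inner_add_right algebra_simps)
 show "Y x u .* v = u .* Y x v" for u v unfolding Y_def
  using selfadjoint_onD(2)[OF Mo, of u v]
  by (simp add: inner_diff_left inner_diff_right inner_commute[of u "ze x"])
 show "Y x u = (SUM f:F. (Y x u .* f) *\<^sub>R f)" for u
 proof -
  have "(SUM f:F. (Y x u .* f) *\<^sub>R f)
   = (1 / real n) *\<^sub>R ((ze x .* u) *\<^sub>R (SUM f:F. (ze x .* f) *\<^sub>R f) - (SUM f:F. (Mo u .* f) *\<^sub>R f))"
   unfolding Y_def by (simp add: scaleR_sum_right sum_subtractf[symmetric] inner_diff_left algebra_simps)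
  also have "... = Y x u"
   unfolding Y_def by (simp only: ze_span[symmetric] selfadjoint_onD(3)[OF Mo, symmetric])
  finally show ?thesis by simp
 qed
qed

lemma X_selfadjoint: "selfadjoint_on F (X I z)"
 unfolding selfadjoint_on_def
proof (intro conjI allI)
 show "linear (X I z)" unfolding X_def
  by (rule linearI) (simp_all add: linear_add[OF selfadjoint_onD(1)[OF Y_selfadjoint]]
    linear_scale[OF selfadjoint_onD(1)[OF Y_selfadjoint]] sum.distrib scaleR_sum_right)
 show "X I z u .* v = u .* X I z v" for u v unfolding X_def
  by (simp add: inner_sum_left inner_sum_right selfadjoint_onD(2)[OF Y_selfadjoint])
 show "X I z u = (SUM f:F. (X I z u .* f) *\<^sub>R f)" for u
 proof -
  have "(SUM f:F. (X I z u .* f) *\<^sub>R f) = (SUM f:F. SUM i:I. (Y (z i) u .* f) *\<^sub>R f)"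
   unfolding X_def by (simp add: inner_sum_left scaleR_sum_left)
  also have "... = (SUM i:I. SUM f:F. (Y (z i) u .* f) *\<^sub>R f)" by (rule sum.swap)
  also have "... = X I z u" unfolding X_def
   by (simp only: selfadjoint_onD(3)[OF Y_selfadjoint, symmetric])
  finally show ?thesis by simp
 qed
qed

text \<open>The rank one part is kept as (ze .* u)^2 instead of being bounded: summed over the
  sample it gives back the empirical quadratic form, and integrated it gives
  \<open>Mo\<close>.\<close>

lemma Y_norm_square_le: "(norm (Y x u))^2 <= 2 / (real n)^2 * (B * (ze x .* u)^2 + Mo u .* u)"
proof -
 have par: "(norm (a - b))^2 <= 2 * (norm a)^2 + 2 * (norm b)^2" for a b :: 'h
 proof -
  have "0 <= (norm (a + b))^2" by simp
  then show ?thesis unfolding power2_norm_eq_inner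
   by (simp add: inner_diff_left inner_diff_right inner_add_left inner_add_right inner_commute)
 qed
 have "(norm (Mo u))^2 <= 1 * (Mo u .* u)"
  by (rule positive_op_norm_le[OF Mo_positive]) (use Mo_le in simp)
 moreover have "(norm ((ze x .* u) *\<^sub>R ze x))^2 <= B * (ze x .* u)^2"
  using mult_right_mono[OF ze_bound, of "(ze x .* u)^2" x] by (simp add: power_mult_distrib mult.commute)
 ultimately have "(norm ((ze x .* u) *\<^sub>R ze x - Mo u))^2 <= 2 * (B * (ze x .* u)^2 + Mo u .* u)"
  using par[of "(ze x .* u) *\<^sub>R ze x" "Mo u"] by simp
 then have "(norm ((ze x .* u) *\<^sub>R ze x - Mo u))^2 / (real n)^2 <= 2 * (B * (ze x .* u)^2 + Mo u .* u) / (real n)^2"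
  by (rule divide_right_mono) simp
 then show ?thesis unfolding Y_def by (simp add: power_divide)
qed

text \<open>This bound and the next two are crude; they only serve integrability.\<close>

lemma Y_bounded: "norm (Y x u) <= 2 * B * norm u"
proof -
 have "(ze x .* u)^2 <= (norm (ze x))^2 * (norm u)^2"
  using Cauchy_Schwarz_ineq[of "ze x" u] by (simp add: power2_norm_eq_inner)
 also have "... <= B * (norm u)^2" by (intro mult_right_mono ze_bound) simp
 finally have "B * (ze x .* u)^2 + Mo u .* u <= B * (B * (norm u)^2) + (B * B) * (norm u)^2"
  using B1 Mo_le[of u] mult_right_mono[of 1 "B * B" "(norm u)^2"] mult_mono[of 1 B 1 B]
  by (intro add_mono mult_left_mono) auto
 moreover have "2 / (real n)^2 <= 2" using n by (simp add: divide_le_eq)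
 ultimately have "2 / (real n)^2 * (B * (ze x .* u)^2 + Mo u .* u) <= 2 * (B * (B * (norm u)^2) + (B * B) * (norm u)^2)"
  using B1 Mo_pos by (intro mult_mono) auto
 then have "(norm (Y x u))^2 <= 2 * (B * (B * (norm u)^2) + (B * B) * (norm u)^2)"
  using Y_norm_square_le[of x u] by linarith
 also have "... = (2 * B * norm u)^2" by (simp add: power2_eq_square)
 finally show ?thesis by (rule power2_le_imp_le) (use B1 in simp)
qed

lemma X_bounded: "norm (X I z u) <= real (card I) * (2 * B) * norm u"
proof -
 have "norm (X I z u) <= (SUM i:I. 2 * B * norm u)" unfolding X_def
  by (rule sum_norm_le) (rule Y_bounded)
 then show ?thesis by simp
qed

lemma X_funpow_bounded: "norm ((X I z ^^ q) u) <= (real (card I) * (2 * B)) ^ q * norm u"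
proof (induction q)
 case (Suc q)
 have "norm ((X I z ^^ Suc q) u) <= real (card I) * (2 * B) * norm ((X I z ^^ q) u)"
  using X_bounded by simp
 also have "... <= real (card I) * (2 * B) * ((real (card I) * (2 * B)) ^ q * norm u)"
  using B1 by (intro mult_left_mono Suc.IH) auto
 finally show ?case by (simp add: mult.assoc)
qed simp

lemma Y_measurable [measurable]:
 assumes [measurable]: "i \<in> J" "g \<in> borel_measurable (\<Pi>\<^sub>M i\<in>J. A)"
 shows "(%z. Y (z i) (g z)) \<in> borel_measurable (\<Pi>\<^sub>M i\<in>J. A)"
 unfolding Y_def by measurable

lemma X_funpow_measurable [measurable]:
 assumes "I \<subseteq> J"
 shows "(%z. (X I z ^^ q) u) \<in> borel_measurable (\<Pi>\<^sub>M i\<in>J. A)"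
proof (induction q)
 case (Suc q)
 then show ?case unfolding funpow.simps o_apply X_def[of I]
  by (intro borel_measurable_sum Y_measurable) (use assms in \<open>auto simp: X_def[symmetric]\<close>)
qed simp

lemma integrable_bounded_PiM:
 fixes f :: "_ => real"
 assumes "f \<in> borel_measurable (\<Pi>\<^sub>M i\<in>J. A)" "!!z. \<bar>f z\<bar> <= c"
 shows "integrable (\<Pi>\<^sub>M i\<in>J. A) f"
proof -
 interpret PI: prob_space "\<Pi>\<^sub>M i\<in>J. A" by (intro prob_space_PiM prob_space_axioms)
 show ?thesis by (rule PI.integrable_const_bound[of _ c]) (use assms in auto)
qed

definition "m q I = (\<integral>z. (SUM e:F. (norm ((X I z ^^ q) e))^2) \<partial>(\<Pi>\<^sub>M i\<in>I. A))"

lemma integrable_Y_mean: "(LINT x|A. Y x u .* v) = 0"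
proof -
 have "integrable A (%x. (ze x .* u) * (ze x .* v))"
 proof (rule integrable_const_bound[of _ "(sqrt B * norm u) * (sqrt B * norm v)"])
  have *: "\<bar>ze x .* w\<bar> <= sqrt B * norm w" for x w
  proof -
   have "norm (ze x) <= sqrt B" by (rule real_le_rsqrt[OF ze_bound])
   then show ?thesis using Cauchy_Schwarz_ineq2[of "ze x" w] mult_right_mono[of "norm (ze x)" "sqrt B" "norm w"]
    by simp
  qed
  show "AE x in A. norm ((ze x .* u) * (ze x .* v)) <= (sqrt B * norm u) * (sqrt B * norm v)"
   by (rule AE_I2) (use * B1 in \<open>simp add: abs_mult mult_mono\<close>)
 qed measurable
 then show ?thesis
  unfolding Y_def by (simp add: inner_diff_left right_diff_distrib cov prob_space)
qed

lemma Y_second_moment: "(LINT x|A. (norm (Y x u))^2) <= 4 * B / (real n)^2 * (Mo u .* u)"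
proof -
 have m: "(%x. (norm (Y x u))^2) \<in> borel_measurable A" unfolding Y_def by measurable
 have i1: "integrable A (%x. (norm (Y x u))^2)"
 proof (rule integrable_const_bound[of _ "(2 * B * norm u)^2"])
  have "(norm (Y x u))^2 <= (2 * B * norm u)^2" for x by (rule power_mono[OF Y_bounded]) simp
  then show "AE x in A. norm ((norm (Y x u))^2) <= (2 * B * norm u)^2" by simp
 qed (rule m)
 have i2: "integrable A (%x. (ze x .* u)^2)"
 proof (rule integrable_const_bound[of _ "B * (norm u)^2"])
  have "(ze x .* u)^2 <= B * (norm u)^2" for x
   using Cauchy_Schwarz_ineq[of "ze x" u] mult_right_mono[OF ze_bound[of x], of "(norm u)^2"]
   by (simp add: power2_norm_eq_inner)
  then show "AE x in A. norm ((ze x .* u)^2) <= B * (norm u)^2" by simp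
 qed measurable
 have "(LINT x|A. (norm (Y x u))^2) <= (LINT x|A. 2 / (real n)^2 * (B * (ze x .* u)^2 + Mo u .* u))"
  by (intro integral_mono i1 Y_norm_square_le) (use i2 in simp)
 also have "... = 2 / (real n)^2 * (B * (Mo u .* u) + Mo u .* u)"
  using i2 cov[of u u] by (simp add: prob_space power2_eq_square)
 also have "... <= 2 / (real n)^2 * (2 * B * (Mo u .* u))"
  using B1 Mo_pos[of u] mult_right_mono[of 1 B "Mo u .* u"] by (intro mult_left_mono) auto
 finally show ?thesis by simp
qed

lemma X_fun_upd: "i \<notin> I ==> X I (z(i := y)) = X I z"
 unfolding X_def by (intro ext sum.cong) auto

text \<open>The summand i is independent of the sum over \<open>I\<close> and centred, so
  integrating it first gives 0.\<close>

lemma fresh_mean_zero: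
 assumes I: "finite I" "i \<notin> I"
 shows "(\<integral>z. Y (z i) e .* (X I z ^^ q) e \<partial>(\<Pi>\<^sub>M j\<in>insert i I. A)) = 0"
proof -
 interpret product_sigma_finite "%_. A" ..
 have int: "integrable (\<Pi>\<^sub>M j\<in>insert i I. A) (%z. Y (z i) e .* (X I z ^^ q) e)"
 proof (rule integrable_bounded_PiM)
  show "(%z. Y (z i) e .* (X I z ^^ q) e) \<in> borel_measurable (\<Pi>\<^sub>M j\<in>insert i I. A)"
   by (intro borel_measurable_inner Y_measurable X_funpow_measurable) auto
  show "\<bar>Y (z i) e .* (X I z ^^ q) e\<bar> <= (2 * B * norm e) * ((real (card I) * (2 * B)) ^ q * norm e)" for z
   using B1 by (intro order_trans[OF Cauchy_Schwarz_ineq2] mult_mono Y_bounded X_funpow_bounded) auto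
 qed
 show ?thesis
  unfolding product_integral_insert[OF I int]
  by (simp add: X_fun_upd[OF I(2)] integrable_Y_mean)
qed

lemma fresh_second_moment:
 assumes I: "finite I" "i \<notin> I"
 shows "(\<integral>z. (norm (Y (z i) ((X I z ^^ q) e)))^2 \<partial>(\<Pi>\<^sub>M j\<in>insert i I. A))
  <= 4 * B / (real n)^2 * (\<integral>z. Mo ((X I z ^^ q) e) .* ((X I z ^^ q) e) \<partial>(\<Pi>\<^sub>M j\<in>I. A))"
proof -
 interpret product_sigma_finite "%_. A" ..
 let ?c = "(real (card I) * (2 * B)) ^ q * norm e"
 have c0: "?c >= 0" using B1 by simp
 have bd: "(norm (Y (z i) ((X I z ^^ q) e)))^2 <= (2 * B * ?c)^2" for z
  using B1 by (intro power_mono order_trans[OF Y_bounded] mult_left_mono X_funpow_bounded) auto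
 have int: "integrable (\<Pi>\<^sub>M j\<in>insert i I. A) (%z. (norm (Y (z i) ((X I z ^^ q) e)))^2)"
 proof (rule integrable_bounded_PiM)
  show "(%z. (norm (Y (z i) ((X I z ^^ q) e)))^2) \<in> borel_measurable (\<Pi>\<^sub>M j\<in>insert i I. A)"
   by (intro borel_measurable_power borel_measurable_norm[THEN measurable_compose[rotated]]
     Y_measurable X_funpow_measurable) auto
 qed (use bd in simp)
 have mm: "(%z. Mo ((X I z ^^ q) e) .* ((X I z ^^ q) e)) \<in> borel_measurable (\<Pi>\<^sub>M j\<in>I. A)"
  by (intro borel_measurable_inner measurable_compose[OF X_funpow_measurable Mo_measurable] X_funpow_measurable) auto
 have Mb: "0 <= Mo ((X I z ^^ q) e) .* ((X I z ^^ q) e)" "Mo ((X I z ^^ q) e) .* ((X I z ^^ q) e) <= ?c^2" for z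
  using Mo_pos Mo_le[of "(X I z ^^ q) e"] X_funpow_bounded[where I = I and z = z and q = q and u = e]
   power_mono[of "norm ((X I z ^^ q) e)" ?c 2] by auto
 have int2: "integrable (\<Pi>\<^sub>M j\<in>I. A) (%z. Mo ((X I z ^^ q) e) .* ((X I z ^^ q) e))"
  by (rule integrable_bounded_PiM[OF mm, of "?c^2"]) (use Mb in \<open>simp add: abs_of_nonneg\<close>)
 have "(\<integral>z. (norm (Y (z i) ((X I z ^^ q) e)))^2 \<partial>(\<Pi>\<^sub>M j\<in>insert i I. A))
   = (\<integral>z. (LINT y|A. (norm (Y y ((X I z ^^ q) e)))^2) \<partial>(\<Pi>\<^sub>M j\<in>I. A))"
  unfolding product_integral_insert[OF I int] by (simp add: X_fun_upd[OF I(2)])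
 also have "... <= (\<integral>z. 4 * B / (real n)^2 * (Mo ((X I z ^^ q) e) .* ((X I z ^^ q) e)) \<partial>(\<Pi>\<^sub>M j\<in>I. A))"
  by (rule integral_mono'[OF _ Y_second_moment]) (use int2 B1 Mb in auto)
 finally show ?thesis by simp
qed

lemma integrable_hs:
 assumes "I \<subseteq> J"
 shows "integrable (\<Pi>\<^sub>M j\<in>J. A) (%z. (norm ((X I z ^^ q) e))^2)"
proof (rule integrable_bounded_PiM)
 show "(%z. (norm ((X I z ^^ q) e))^2) \<in> borel_measurable (\<Pi>\<^sub>M j\<in>J. A)"
  by (intro borel_measurable_power borel_measurable_norm[THEN measurable_compose[rotated]]
    X_funpow_measurable assms)
 show "\<bar>(norm ((X I z ^^ q) e))\<^sup>2\<bar> <= ((real (card I) * (2 * B)) ^ q * norm e)^2" for z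
  using power_mono[OF X_funpow_bounded[where I = I and z = z and q = q and u = e], of 2] by simp
qed

lemma m_nonneg: "0 <= m q I"
 unfolding m_def by (intro integral_nonneg_AE AE_I2 sum_nonneg) simp

end

text \<open>For \<open>q = 2^k\<close> the Hilbert-Schmidt norm of \<open>X^q\<close> controls the operator norm of \<open>X\<close>.\<close>

lemma norm_le_of_square:
 assumes "!!u. (norm ((A::'b::real_inner => 'b) (A u))) <= c^2 * norm u" "!!u v. A u .* v = u .* A v" "c >= 0"
 shows "norm (A u) <= c * norm u"
proof -
 have "(norm (A u))^2 = u .* A (A u)" by (simp add: power2_norm_eq_inner assms(2))
 also have "... <= norm u * norm (A (A u))" by (rule norm_cauchy_schwarz)
 also have "... <= norm u * (c^2 * norm u)" by (intro mult_left_mono assms(1)) simp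
 also have "... = (c * norm u)^2" by (simp add: power2_eq_square)
 finally show ?thesis by (rule power2_le_imp_le) (use assms(3) in simp)
qed

text \<open>For self-adjoint operators a bound on the square gives one on the operator, so the
  exponent can be halved k times. This takes the place of a spectral decomposition and is why
  moments of order 2^k are used.\<close>

lemma norm_le_of_funpow:
 assumes sa: "!!u v. (A::'b::real_inner => 'b) u .* v = u .* A v" and c: "c >= 0"
  and "!!u. norm ((A ^^ (2 ^ k)) u) <= c ^ (2 ^ k) * norm u"
 shows "norm (A u) <= c * norm u"
 using assms(3)
proof (induction k arbitrary: u)
 case (Suc k)
 have saP: "(A ^^ j) u .* v = u .* (A ^^ j) v" for j u v
 proof (induction j arbitrary: u)
  case (Suc j)
  have "(A ^^ Suc j) u .* v = (A ^^ j) (A u) .* v" by (simp add: funpow_swap1)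
  then show ?case by (simp add: Suc.IH sa)
 qed simp
 have "norm ((A ^^ (2 ^ k)) u) <= c ^ (2 ^ k) * norm u" for u
 proof (rule norm_le_of_square)
  show "norm ((A ^^ 2 ^ k) ((A ^^ 2 ^ k) u)) <= (c ^ 2 ^ k)^2 * norm u" for u
  proof -
   have "(A ^^ 2 ^ k) ((A ^^ 2 ^ k) u) = (A ^^ (2 ^ Suc k)) u"
    by (simp only: power_Suc mult_2 funpow_add o_apply)
   moreover have "(c ^ 2 ^ k)^2 = c ^ (2 ^ Suc k)" by (simp only: power_mult[symmetric] power_Suc mult.commute)
   ultimately show ?thesis using Suc.prems[of u] by simp
  qed
 qed (use saP c in auto)
 then show ?case by (rule Suc.IH)
qed simp

context rank_one_sample
begin

text \<open>In the trace of X^(2q+2) one factor is expanded into its summands.\<close>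

lemma hs_power_eq:
 "(SUM e:F. (norm ((X I z ^^ Suc q) e))^2) = (SUM i:I. SUM e:F. Y (z i) e .* (X I z ^^ (2 * q + 1)) e)"
proof -
 have "(norm ((X I z ^^ Suc q) e))^2 = (SUM i:I. Y (z i) e .* (X I z ^^ (2 * q + 1)) e)" for e
 proof -
  have "(norm ((X I z ^^ Suc q) e))^2 = (X I z ^^ (Suc q + Suc q)) e .* e"
   by (simp only: power2_norm_eq_inner selfadjoint_funpow_inner[OF X_selfadjoint])
  also have "... = (X I z ^^ (1 + (2 * q + 1))) e .* e" by (simp only: add_Suc_right add_Suc mult_2 One_nat_def add_0 add_0_right)
  also have "... = (X I z ^^ 1) e .* (X I z ^^ (2 * q + 1)) e"
   by (rule selfadjoint_funpow_inner[OF X_selfadjoint, symmetric])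
  also have "(X I z ^^ 1) e = (SUM i:I. Y (z i) e)" by (simp add: X_def)
  finally show ?thesis by (simp only: inner_sum_left)
 qed
 then show ?thesis by (simp only: sum.swap[of _ F I])
qed

text \<open>Leave one out: in the trace against \<open>Y (z i)\<close> the sum is replaced by the
  sum without i, which is independent of that summand.\<close>

lemma hs_power_step:
 assumes I: "finite I" "i \<in> I"
 shows "(SUM e:F. Y (z i) e .* (X I z ^^ (2 * q + 1)) e)
  <= (SUM e:F. Y (z i) e .* (X (I - {i}) z ^^ (2 * q + 1)) e) + real (2 * q + 1) *
   ((SUM e:F. (norm (Y (z i) ((X I z ^^ q) e)))^2) + (SUM e:F. (norm (Y (z i) ((X (I - {i}) z ^^ q) e)))^2))"
proof (rule trace_power_diff_le[OF F X_selfadjoint X_selfadjoint Y_selfadjoint])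
 show "X I z u = X (I - {i}) z u + Y (z i) u" for u
  unfolding X_def by (subst sum.remove[OF I]) (rule add.commute)
qed

text \<open>The squared inner products add up to n times the empirical form, which is expressed
  through \<open>X\<close> and \<open>Mo\<close>. The square of \<open>X v\<close> returns with the
  small factor B / n, so that the highest moment can be absorbed later.\<close>

lemma sum_Y_square_le:
 assumes "card I <= n"
 shows "(SUM i:I. (norm (Y (z i) v))^2) <= 2 * B / n * ((norm (X I z v))^2 / 2 + 5 / 2 * (norm v)^2)"
proof -
 let ?s = "SUM i:I. (ze (z i) .* v)^2"
 have np: "real n > 0" using n by simp
 have "X I z v .* v = (1 / real n) * (?s - real (card I) * (Mo v .* v))"
  unfolding X_def Y_def
  by (simp add: inner_sum_left inner_diff_left sum_subtractf sum_divide_distrib[symmetric] power2_eq_square)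
 then have s: "?s = real n * (X I z v .* v) + real (card I) * (Mo v .* v)"
  using np by (simp add: field_simps)
 have cM: "real (card I) * (Mo v .* v) <= real n * (norm v)^2"
  using assms Mo_le[of v] Mo_pos[of v] by (intro mult_mono) auto
 have Xv: "X I z v .* v <= (norm (X I z v))^2 / 2 + (norm v)^2 / 2"
 proof -
  have "0 <= (norm (X I z v - v))^2" by simp
  then show ?thesis unfolding power2_norm_eq_inner
   by (simp add: inner_diff_left inner_diff_right inner_commute)
 qed
 have "(SUM i:I. (norm (Y (z i) v))^2) <= (SUM i:I. 2 / (real n)^2 * (B * (ze (z i) .* v)^2 + Mo v .* v))"
  by (intro sum_mono Y_norm_square_le)
 also have "... = 2 / (real n)^2 * (B * ?s + real (card I) * (Mo v .* v))"
  by (subst sum_distrib_left[symmetric]) (simp add: sum.distrib sum_distrib_left)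
 also have "... <= 2 / (real n)^2 * (B * (real n * ((norm (X I z v))^2 / 2 + (norm v)^2 / 2) + real n * (norm v)^2)
    + B * (real n * (norm v)^2))"
 proof (intro mult_left_mono add_mono)
  show "?s <= real n * ((norm (X I z v))^2 / 2 + (norm v)^2 / 2) + real n * (norm v)^2"
   unfolding s by (intro add_mono mult_left_mono Xv cM) simp
  have "real n * (norm v)^2 <= B * (real n * (norm v)^2)" using B1 mult_right_mono[of 1 B "real n * (norm v)^2"] by simp
  then show "real (card I) * (Mo v .* v) <= B * (real n * (norm v)^2)" using cM by linarith
 qed (use B1 in auto)
 also have "... = 2 * B / n * ((norm (X I z v))^2 / 2 + 5 / 2 * (norm v)^2)"
  using np by (simp add: field_simps power2_eq_square)
 finally show ?thesis .
qed

lemma Y_funpow_square_integrable: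
 assumes "i \<in> J" "I \<subseteq> J"
 shows "integrable (\<Pi>\<^sub>M j\<in>J. A) (%z. (norm (Y (z i) ((X I z ^^ q) e)))^2)"
proof (rule integrable_bounded_PiM)
 show "(%z. (norm (Y (z i) ((X I z ^^ q) e)))^2) \<in> borel_measurable (\<Pi>\<^sub>M j\<in>J. A)"
  by (intro borel_measurable_power borel_measurable_norm[THEN measurable_compose[rotated]]
    Y_measurable X_funpow_measurable assms)
 have "norm (Y (z i) ((X I z ^^ q) e)) <= 2 * B * ((real (card I) * (2 * B)) ^ q * norm e)" for z
  using B1 by (intro order_trans[OF Y_bounded] mult_left_mono X_funpow_bounded) auto
 then show "\<bar>(norm (Y (z i) ((X I z ^^ q) e)))\<^sup>2\<bar> <= (2 * B * ((real (card I) * (2 * B)) ^ q * norm e))^2" for z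
  by (simp add: power_mono)
qed

lemma Y_inner_funpow_integrable:
 assumes "i \<in> J" "I \<subseteq> J"
 shows "integrable (\<Pi>\<^sub>M j\<in>J. A) (%z. Y (z i) e .* (X I z ^^ q) e)"
proof (rule integrable_bounded_PiM)
 show "(%z. Y (z i) e .* (X I z ^^ q) e) \<in> borel_measurable (\<Pi>\<^sub>M j\<in>J. A)"
  by (intro borel_measurable_inner Y_measurable X_funpow_measurable assms) simp
 show "\<bar>Y (z i) e .* (X I z ^^ q) e\<bar> <= (2 * B * norm e) * ((real (card I) * (2 * B)) ^ q * norm e)" for z
  using B1 by (intro order_trans[OF Cauchy_Schwarz_ineq2] mult_mono Y_bounded X_funpow_bounded) auto
qed

text \<open>The moment weighted by \<open>Mo\<close>. For q = 0 it is the trace of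
  \<open>Mo\<close>, later bounded by the effective dimension, whereas the unweighted moment is the
  cardinality of \<open>F\<close>.\<close>

definition "mM q I = (\<integral>z. (SUM e:F. Mo ((X I z ^^ q) e) .* ((X I z ^^ q) e)) \<partial>(\<Pi>\<^sub>M i\<in>I. A))"

lemma Mo_funpow_integrable:
 "integrable (\<Pi>\<^sub>M j\<in>I. A) (%z. Mo ((X I z ^^ q) e) .* ((X I z ^^ q) e))"
proof -
 let ?c = "(real (card I) * (2 * B)) ^ q * norm e"
 have mm: "(%z. Mo ((X I z ^^ q) e) .* ((X I z ^^ q) e)) \<in> borel_measurable (\<Pi>\<^sub>M j\<in>I. A)"
  by (intro borel_measurable_inner measurable_compose[OF X_funpow_measurable Mo_measurable] X_funpow_measurable) auto
 have Mb: "0 <= Mo ((X I z ^^ q) e) .* ((X I z ^^ q) e)" "Mo ((X I z ^^ q) e) .* ((X I z ^^ q) e) <= ?c^2" for z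
  using Mo_pos Mo_le[of "(X I z ^^ q) e"] X_funpow_bounded[where I = I and z = z and q = q and u = e]
   power_mono[of "norm ((X I z ^^ q) e)" ?c 2] by auto
 show ?thesis
  by (rule integrable_bounded_PiM[OF mm, of "?c^2"]) (use Mb in \<open>simp add: abs_of_nonneg\<close>)
qed

lemma mM_le_m: "mM q I <= m q I"
 unfolding mM_def m_def
 by (intro integral_mono sum_mono Mo_le Bochner_Integration.integrable_sum Mo_funpow_integrable integrable_hs) simp

text \<open>The leave-one-out traces have mean zero. What remains are squares in which
  \<open>Y (z i)\<close> meets a power of the full sum, to be handled pointwise, and squares in
  which it is independent of the power.\<close>

lemma m_Suc_le:
 assumes I: "finite I"
 shows "m (Suc q) I <= real (2 * q + 1) *
  ((\<integral>z. (SUM i:I. SUM e:F. (norm (Y (z i) ((X I z ^^ q) e)))^2) \<partial>(\<Pi>\<^sub>M i\<in>I. A))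
   + (SUM i:I. 4 * B / (real n)^2 * mM q (I - {i})))"
proof -
 let ?P = "\<Pi>\<^sub>M i\<in>I. A"
 let ?T = "%i z. SUM e:F. Y (z i) e .* (X (I - {i}) z ^^ (2 * q + 1)) e"
 let ?U = "%i z. SUM e:F. (norm (Y (z i) ((X I z ^^ q) e)))^2"
 let ?V = "%i z. SUM e:F. (norm (Y (z i) ((X (I - {i}) z ^^ q) e)))^2"
 have iT: "integrable ?P (?T i)" and iU: "integrable ?P (?U i)" and iV: "integrable ?P (?V i)" if "i \<in> I" for i
  using that by (intro Bochner_Integration.integrable_sum Y_inner_funpow_integrable Y_funpow_square_integrable; auto)+
 have "m (Suc q) I = (\<integral>z. (SUM i:I. SUM e:F. Y (z i) e .* (X I z ^^ (2 * q + 1)) e) \<partial>?P)"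
  unfolding m_def hs_power_eq ..
 also have "... <= (\<integral>z. (SUM i:I. ?T i z + real (2 * q + 1) * (?U i z + ?V i z)) \<partial>?P)"
 proof (rule integral_mono)
  show "integrable ?P (%z. SUM i:I. SUM e:F. Y (z i) e .* (X I z ^^ (2 * q + 1)) e)"
   by (intro Bochner_Integration.integrable_sum Y_inner_funpow_integrable) auto
  show "integrable ?P (%z. SUM i:I. ?T i z + real (2 * q + 1) * (?U i z + ?V i z))"
   by (intro Bochner_Integration.integrable_sum[OF Bochner_Integration.integrable_add]
     integrable_mult_right Bochner_Integration.integrable_add iT iU iV)
 qed (intro sum_mono hs_power_step I)
 also have "... = (SUM i:I. (\<integral>z. ?T i z \<partial>?P) + real (2 * q + 1) * ((\<integral>z. ?U i z \<partial>?P) + (\<integral>z. ?V i z \<partial>?P)))"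
  using iT iU iV by (subst Bochner_Integration.integral_sum) auto
 also have "... <= (SUM i:I. 0 + real (2 * q + 1) * ((\<integral>z. ?U i z \<partial>?P) + 4 * B / (real n)^2 * mM q (I - {i})))"
 proof (intro sum_mono add_mono mult_left_mono order_refl)
  fix i assume i: "i \<in> I"
  then have ins: "insert i (I - {i}) = I" "finite (I - {i})" "i \<notin> I - {i}" using I by auto
  have "(\<integral>z. ?T i z \<partial>?P) = (SUM e:F. \<integral>z. Y (z i) e .* (X (I - {i}) z ^^ (2 * q + 1)) e \<partial>?P)"
   using i by (intro Bochner_Integration.integral_sum Y_inner_funpow_integrable) auto
  also have "... = 0" by (intro sum.neutral ballI fresh_mean_zero[OF ins(2,3), unfolded ins(1)])
  finally show "(\<integral>z. ?T i z \<partial>?P) <= 0" by simp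
  have "(\<integral>z. ?V i z \<partial>?P) = (SUM e:F. \<integral>z. (norm (Y (z i) ((X (I - {i}) z ^^ q) e)))^2 \<partial>?P)"
   using i by (intro Bochner_Integration.integral_sum Y_funpow_square_integrable) auto
  also have "... <= (SUM e:F. 4 * B / (real n)^2 *
    (\<integral>z. Mo ((X (I - {i}) z ^^ q) e) .* ((X (I - {i}) z ^^ q) e) \<partial>(\<Pi>\<^sub>M j\<in>I - {i}. A)))"
   using fresh_second_moment[OF ins(2,3)] unfolding ins(1) by (intro sum_mono)
  also have "... = 4 * B / (real n)^2 * mM q (I - {i})"
   unfolding mM_def by (simp only: Bochner_Integration.integral_sum[OF Mo_funpow_integrable] sum_distrib_left)
  finally show "(\<integral>z. ?V i z \<partial>?P) <= 4 * B / (real n)^2 * mM q (I - {i})" .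
 qed simp
 also have "... = real (2 * q + 1) * ((SUM i:I. \<integral>z. ?U i z \<partial>?P) + (SUM i:I. 4 * B / (real n)^2 * mM q (I - {i})))"
  by (simp only: add_0 sum_distrib_left[symmetric] sum.distrib)
 also have "(SUM i:I. \<integral>z. ?U i z \<partial>?P) = (\<integral>z. (SUM i:I. ?U i z) \<partial>?P)"
  using iU by (intro Bochner_Integration.integral_sum[symmetric]) auto
 finally show ?thesis .
qed

definition "tr = (SUM e:F. Mo e .* e)"

lemma tr_nonneg: "0 <= tr"
 unfolding tr_def by (intro sum_nonneg Mo_pos)

lemma mM_0: "mM 0 I = tr"
proof -
 interpret PI: prob_space "\<Pi>\<^sub>M i\<in>I. A" by (intro prob_space_PiM prob_space_axioms)
 show ?thesis unfolding mM_def tr_def by (simp add: PI.prob_space)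
qed

text \<open>A separate start of the induction: since X^0 does not depend on the sample, both kinds
  of squares can be integrated with \<open>fresh_second_moment\<close>, and only the trace of
  \<open>Mo\<close> appears, not the size of \<open>F\<close>.\<close>

lemma m_1_le:
 assumes I: "finite I" "card I <= n"
 shows "m 1 I <= 8 * B / n * tr"
proof -
 let ?P = "\<Pi>\<^sub>M i\<in>I. A"
 have np: "real n > 0" using n by simp
 have "(\<integral>z. (SUM i:I. SUM e:F. (norm (Y (z i) ((X I z ^^ 0) e)))^2) \<partial>?P)
   = (SUM i:I. SUM e:F. \<integral>z. (norm (Y (z i) ((X I z ^^ 0) e)))^2 \<partial>?P)"
  by (subst Bochner_Integration.integral_sum, intro Bochner_Integration.integrable_sum Y_funpow_square_integrable; simp)
   (intro sum.cong refl Bochner_Integration.integral_sum,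
    use Y_funpow_square_integrable[where q = 0 and I = "{}"] in auto)
 also have "... <= (SUM i:I. SUM e:F. 4 * B / (real n)^2 * (Mo e .* e))"
 proof (intro sum_mono)
  fix i e assume i: "i \<in> I"
  then have ins: "insert i (I - {i}) = I" "finite (I - {i})" "i \<notin> I - {i}" using I by auto
  interpret PI: prob_space "\<Pi>\<^sub>M j\<in>I - {i}. A" by (intro prob_space_PiM prob_space_axioms)
  show "(\<integral>z. (norm (Y (z i) ((X I z ^^ 0) e)))^2 \<partial>?P) <= 4 * B / (real n)^2 * (Mo e .* e)"
   using fresh_second_moment[OF ins(2,3), of 0 e] unfolding ins(1) by (simp add: PI.prob_space)
 qed
 also have "... = real (card I) * (4 * B / (real n)^2 * tr)" by (simp add: tr_def sum_distrib_left)
 finally have U: "(\<integral>z. (SUM i:I. SUM e:F. (norm (Y (z i) ((X I z ^^ 0) e)))^2) \<partial>?P)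
   <= real (card I) * (4 * B / (real n)^2 * tr)" .
 have S: "(SUM i:I. 4 * B / (real n)^2 * mM 0 (I - {i})) = real (card I) * (4 * B / (real n)^2 * tr)"
  by (simp only: mM_0 sum_constant)
 have "m (Suc 0) I <= real (card I) * (4 * B / (real n)^2 * tr) + real (card I) * (4 * B / (real n)^2 * tr)"
  using m_Suc_le[OF I(1), of 0] U unfolding S by (simp only: mult_0_right add_0 of_nat_1 mult_1_left)
 also have "... <= real n * (4 * B / (real n)^2 * tr) + real n * (4 * B / (real n)^2 * tr)"
  using I(2) B1 tr_nonneg by (intro add_mono mult_right_mono) auto
 also have "... = 8 * B / n * tr" using np by (simp add: field_simps power2_eq_square)
 finally show ?thesis by simp
qed

theorem trace_moment_le:
 assumes p: "4 * real p * B <= n" and "q < p" and I: "finite I" "card I <= n"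
 shows "m (Suc q) I <= (36 * real p * B / n) ^ Suc q * tr"
 using \<open>q < p\<close> I
proof (induction q arbitrary: I)
 case 0
 have "8 * B / n * tr <= 36 * real p * B / n * tr"
  using 0 B1 tr_nonneg by (intro mult_right_mono divide_right_mono) auto
 then show ?case using m_1_le[OF 0(2,3)] by simp
next
 case (Suc q)
 let ?P = "\<Pi>\<^sub>M i\<in>I. A"
 have np: "real n > 0" using n by simp
 \<comment> \<open>An upper bound for the recursion coefficient (2q + 3) 2B / n, at most 1 by the
   assumption on n.\<close>
 define a where "a = 2 * real p * (2 * B / n)"
 define c where "c = (36 * real p * B / n) ^ Suc q * tr"
 have a: "0 <= a" "a <= 1" using p np B1 by (auto simp: a_def field_simps)
 have c0: "0 <= c" using B1 tr_nonneg by (simp add: c_def)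
 have q2: "real (2 * Suc q + 1) <= 2 * real p" using Suc.prems(1) by simp
 have mq: "m (Suc q) I <= c" unfolding c_def by (rule Suc.IH) (use Suc.prems in auto)
 have mq': "mM (Suc q) (I - {i}) <= c" if "i \<in> I" for i
  using Suc.IH[of "I - {i}"] Suc.prems mM_le_m[of "Suc q" "I - {i}"] card_Diff1_le[of I i]
  unfolding c_def by fastforce
 have "(\<integral>z. (SUM i:I. SUM e:F. (norm (Y (z i) ((X I z ^^ Suc q) e)))^2) \<partial>?P)
   = (\<integral>z. (SUM e:F. SUM i:I. (norm (Y (z i) ((X I z ^^ Suc q) e)))^2) \<partial>?P)"
  by (simp only: sum.swap[of _ I F])
 also have "... <= (\<integral>z. (SUM e:F. 2 * B / n * ((norm ((X I z ^^ Suc (Suc q)) e))^2 / 2 + 5 / 2 * (norm ((X I z ^^ Suc q) e))^2)) \<partial>?P)"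
 proof (rule integral_mono)
  show "integrable ?P (%z. SUM e:F. SUM i:I. (norm (Y (z i) ((X I z ^^ Suc q) e)))^2)"
   by (intro Bochner_Integration.integrable_sum Y_funpow_square_integrable) auto
  show "integrable ?P (%z. SUM e:F. 2 * B / n * ((norm ((X I z ^^ Suc (Suc q)) e))^2 / 2 + 5 / 2 * (norm ((X I z ^^ Suc q) e))^2))"
   by (intro Bochner_Integration.integrable_sum integrable_mult_right Bochner_Integration.integrable_add
     integrable_divide integrable_hs order_refl)
  show "(SUM e:F. SUM i:I. (norm (Y (z i) ((X I z ^^ Suc q) e)))^2)
   <= (SUM e:F. 2 * B / n * ((norm ((X I z ^^ Suc (Suc q)) e))^2 / 2 + 5 / 2 * (norm ((X I z ^^ Suc q) e))^2))" for z
   unfolding funpow.simps(2)[of "Suc q"] o_apply by (intro sum_mono sum_Y_square_le Suc.prems)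
 qed
 also have "... = 2 * B / n * (m (Suc (Suc q)) I / 2 + 5 / 2 * m (Suc q) I)"
 proof -
  have i: "integrable ?P (%z. SUM e:F. (norm ((X I z ^^ k) e))^2)" for k
   by (intro Bochner_Integration.integrable_sum integrable_hs order_refl)
  have "(SUM e:F. 2 * B / n * ((norm ((X I z ^^ Suc (Suc q)) e))^2 / 2 + 5 / 2 * (norm ((X I z ^^ Suc q) e))^2))
   = 2 * B / n * ((SUM e:F. (norm ((X I z ^^ Suc (Suc q)) e))^2) / 2 + 5 / 2 * (SUM e:F. (norm ((X I z ^^ Suc q) e))^2))" for z
   by (simp only: sum_distrib_left[symmetric] sum.distrib sum_divide_distrib[symmetric])
  moreover have "(\<integral>z. k * (f z / 2 + 5 / 2 * g z) \<partial>?P) = k * ((\<integral>z. f z \<partial>?P) / 2 + 5 / 2 * (\<integral>z. g z \<partial>?P))"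
   if "integrable ?P f" "integrable ?P g" for f g and k :: real using that by simp
  ultimately show ?thesis unfolding m_def using i[of "Suc q"] i[of "Suc (Suc q)"] by (simp only:)
 qed
 finally have U: "(\<integral>z. (SUM i:I. SUM e:F. (norm (Y (z i) ((X I z ^^ Suc q) e)))^2) \<partial>?P)
   <= 2 * B / n * (m (Suc (Suc q)) I / 2 + 5 / 2 * m (Suc q) I)" .
 have "(SUM i:I. 4 * B / (real n)^2 * mM (Suc q) (I - {i})) <= (SUM i:I. 4 * B / (real n)^2 * c)"
  using B1 by (intro sum_mono mult_left_mono mq') auto
 also have "... <= real n * (4 * B / (real n)^2 * c)"
  unfolding sum_constant using Suc.prems(3) B1 c0 by (intro mult_right_mono) auto
 also have "... = 2 * B / n * (2 * c)" using np by (simp add: field_simps power2_eq_square)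
 finally have V: "(SUM i:I. 4 * B / (real n)^2 * mM (Suc q) (I - {i})) <= 2 * B / n * (2 * c)" .
 let ?m = "m (Suc (Suc q)) I"
 have "?m <= real (2 * Suc q + 1) * (2 * B / n * (?m / 2 + 5 / 2 * c) + 2 * B / n * (2 * c))"
 proof (rule order_trans[OF m_Suc_le[OF Suc.prems(2)]], intro mult_left_mono add_mono V)
  show "(\<integral>z. (SUM i:I. SUM e:F. (norm (Y (z i) ((X I z ^^ Suc q) e)))^2) \<partial>?P)
   <= 2 * B / n * (?m / 2 + 5 / 2 * c)"
   by (rule order_trans[OF U]) (use mq B1 in \<open>intro mult_left_mono add_mono; simp\<close>)
 qed simp
 also have "... <= 2 * real p * (2 * B / n * (?m / 2 + 5 / 2 * c) + 2 * B / n * (2 * c))"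
  using B1 c0 m_nonneg[of "Suc (Suc q)" I] by (intro mult_right_mono[OF q2]) auto
 also have "... = a * (?m / 2) + a * (9 / 2 * c)" by (simp add: a_def algebra_simps)
 \<comment> \<open>As a <= 1, half of the unknown moment moves to the left-hand side; 9 a = 36 p B /
   n is the factor per step.\<close>
 also have "a * (?m / 2) <= 1 * (?m / 2)" using a m_nonneg[of "Suc (Suc q)" I] by (intro mult_right_mono) auto
 finally have "?m <= 9 * a * c" by simp
 also have "... = (36 * real p * B / n) ^ Suc (Suc q) * tr" by (simp add: a_def c_def)
 finally show ?case .
qed

text \<open>The Hilbert-Schmidt norm dominates the operator norm of X^(2^k); taking roots by
  \<open>norm_le_of_funpow\<close> bounds \<open>X\<close> itself.\<close>

lemma X_quadratic_le_of_hs: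
 assumes hs: "(SUM e:F. (norm ((X I z ^^ (2 ^ k)) e))^2) <= (c ^ 2 ^ k)^2" and c: "c >= 0" and u: "u \<in> span F"
 shows "\<bar>X I z u .* u\<bar> <= c * (norm u)^2"
proof -
 let ?Q = "X I z ^^ (2 ^ k)"
 have "(norm (?Q v))^2 <= (c ^ 2 ^ k)^2 * (norm v)^2" for v
 proof -
  obtain j where j: "(2::nat) ^ k = Suc j" by (metis not0_implies_Suc power_eq_0_iff zero_neq_numeral)
  have "?Q v = (SUM f:F. (?Q v .* f) *\<^sub>R f)" unfolding j funpow.simps o_apply
   by (rule selfadjoint_onD(3)[OF X_selfadjoint])
  from norm_span_sum[OF F this] have "(norm (?Q v))^2 = (SUM f:F. (?Q v .* f)^2)" .
  also have "... <= (SUM f:F. (norm (?Q f))^2 * (norm v)^2)"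
  proof (rule sum_mono)
   fix f
   have "?Q v .* f = v .* ?Q f" by (rule selfadjoint_funpow[OF X_selfadjoint])
   then have "(?Q v .* f)^2 = (?Q f .* v)^2" by (simp only: inner_commute)
   also have "... <= (norm (?Q f))^2 * (norm v)^2"
    using Cauchy_Schwarz_ineq[of "?Q f" v] by (simp add: power2_norm_eq_inner)
   finally show "(?Q v .* f)^2 <= (norm (?Q f))^2 * (norm v)^2" .
  qed
  also have "... <= (c ^ 2 ^ k)^2 * (norm v)^2" unfolding sum_distrib_right[symmetric] by (rule mult_right_mono[OF hs]) simp
  finally show ?thesis .
 qed
 then have "norm (?Q v) <= c ^ 2 ^ k * norm v" for v
  by (intro power2_le_imp_le[of "norm (?Q v)"]) (auto simp: power_mult_distrib c)
 then have "norm (X I z u) <= c * norm u"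
  by (rule norm_le_of_funpow[OF selfadjoint_onD(2)[OF X_selfadjoint] c])
 then have "norm (X I z u) * norm u <= c * norm u * norm u" by (rule mult_right_mono) simp
 then show ?thesis using Cauchy_Schwarz_ineq2[of "X I z u" u] by (simp add: power2_eq_square mult.assoc)
qed

end

section \<open>Averages over index sequences\<close>

text \<open>Entries of the index sequence from \<open>k\<close> on are fixed to \<open>0\<close>.\<close>

primrec index_mean :: "nat => nat => ((nat => nat) => real) => real" where
 "index_mean n 0 f = f (%_. 0)"
| "index_mean n (Suc k) f = index_mean n k (%j. (1 / real n) * (SUM l<n. f (j(k := l))))"

lemma index_mean_mono_on:
 assumes "!!j. (\<forall>i<k. j i < n) ==> f j <= g j"
 shows "index_mean n k f <= index_mean n k g"
 using assms
proof (induction k arbitrary: f g)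
 case (Suc k)
 show ?case unfolding index_mean.simps
  by (rule Suc.IH, intro mult_left_mono sum_mono Suc.prems) (auto simp: less_Suc_eq)
qed simp

lemma index_mean_mono: "(!!j. f j <= g j) ==> index_mean n k f <= index_mean n k g"
 by (rule index_mean_mono_on)

lemma index_mean_add: "index_mean n k (%j. f j + g j) = index_mean n k f + index_mean n k g"
 by (induction k arbitrary: f g) (simp_all add: sum.distrib distrib_left)

lemma index_mean_cmult: "index_mean n k (%j. c * f j) = c * index_mean n k f"
proof (induction k arbitrary: f)
 case (Suc k)
 have "(1 / real n) * (SUM l<n. c * f (j(k := l))) = c * ((1 / real n) * (SUM l<n. f (j(k := l))))" for j
  by (simp add: sum_distrib_left)
 then show ?case by (simp only: index_mean.simps Suc.IH)
qed simp

lemma index_mean_const: "n > 0 ==> index_mean n k (%j. c) = c"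
 by (induction k) simp_all

lemma index_mean_nonneg: "(!!j. 0 <= f j) ==> 0 <= index_mean n k f"
 using index_mean_mono[of "%_. 0" f n k] index_mean_cmult[of n k 0 "%_. 0"] by simp

lemma index_mean_Suc_indep:
 assumes "n > 0" "!!j l. f (j(k := l)) = f j"
 shows "index_mean n (Suc k) f = index_mean n k f"
 using assms by simp

lemma index_mean_indep:
 assumes n: "n > 0" and "k <= k'" and f: "!!j i l. k <= i ==> f (j(i := l)) = f j"
 shows "index_mean n k' f = index_mean n k f"
 using \<open>k <= k'\<close>
proof (induction k' rule: dec_induct)
 case (step m)
 then show ?case using index_mean_Suc_indep[OF n, of f m] f by simp
qed simp

lemma index_mean_square_le:
 assumes n: "n > 0"
 shows "(index_mean n k f)^2 <= index_mean n k (%j. (f j)^2)"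
proof -
 define a where "a = index_mean n k f"
 have "0 <= index_mean n k (%j. (f j - a)^2)" by (rule index_mean_nonneg) simp
 also have "(%j. (f j - a)^2) = (%j. (f j)^2 + ((- 2 * a) * f j + a^2))"
  by (rule ext) (simp add: power2_diff algebra_simps)
 also have "index_mean n k ... = index_mean n k (%j. (f j)^2) + ((- 2 * a) * a + a^2)"
  unfolding index_mean_add index_mean_cmult index_mean_const[OF n] a_def ..
 finally show ?thesis by (simp add: a_def power2_eq_square)
qed

section \<open>Stochastic gradient descent on a fixed sample\<close>

text \<open>Only finitely many feature vectors and labels enter, without any distribution, so the
  results apply to the features of the second stage as well.\<close>

locale sgd_sample =
 fixes n b :: nat and eta :: real and k :: "nat => 'h::{real_inner, banach}" and y :: "nat => real" and h0 :: 'h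
 assumes n: "n > 0" and b: "b > 0" and eta: "eta > 0"
  and k_bound: "!!l. l < n ==> 4 * eta * (norm (k l))^2 <= 1"
begin

definition "Tn u = (1 / real n) *\<^sub>R (SUM l<n. (k l .* u) *\<^sub>R k l)"
definition "gn = (1 / real n) *\<^sub>R (SUM l<n. y l *\<^sub>R k l)"
definition "Bn u = u - eta *\<^sub>R Tn u"

definition h :: "nat => (nat => nat) => 'h" where
 "h t j = sgd eta b (.*) (%v. v) h0 (%i. (k (j i), y (j i))) t"

primrec gd :: "nat => 'h" where
 "gd 0 = h0"
| "gd (Suc t) = gd t - eta *\<^sub>R (Tn (gd t) - gn)"

lemma Tn_inner: "Tn u .* v = (1 / real n) * (SUM l<n. (k l .* u) * (k l .* v))"
 by (simp add: Tn_def inner_sum_left)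

lemma Tn_quadratic: "Tn u .* u = (1 / real n) * (SUM l<n. (k l .* u)^2)"
 by (simp add: Tn_inner power2_eq_square)

lemma Tn_linear: "linear Tn"
 unfolding Tn_def
 by (rule linearI) (simp_all add: inner_add_right sum.distrib algebra_simps scaleR_sum_right)

lemma Tn_positive: "positive_op Tn"
 unfolding positive_op_def
proof (intro conjI allI Tn_linear)
 show "Tn u .* v = u .* Tn v" for u v
  unfolding inner_commute[of u] Tn_inner by (simp add: mult.commute)
 show "0 <= Tn u .* u" for u unfolding Tn_quadratic by (intro mult_nonneg_nonneg sum_nonneg) auto
qed

lemma Tn_le: "Tn u .* u <= 1 / (4 * eta) * (norm u)^2"
proof -
 have "(k l .* u)^2 <= 1 / (4 * eta) * (norm u)^2" if "l < n" for l
 proof -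
  have "(k l .* u)^2 <= (norm (k l))^2 * (norm u)^2"
   using Cauchy_Schwarz_ineq[of "k l" u] by (simp add: power2_norm_eq_inner)
  also have "... <= 1 / (4 * eta) * (norm u)^2"
   using k_bound[OF that] eta by (intro mult_right_mono) (auto simp: field_simps)
  finally show ?thesis .
 qed
 then have "(SUM l<n. (k l .* u)^2) <= (SUM l<n. 1 / (4 * eta) * (norm u)^2)" by (intro sum_mono) auto
 then have "(1 / real n) * (SUM l<n. (k l .* u)^2) <= (1 / real n) * (real n * (1 / (4 * eta) * (norm u)^2))"
  by (intro mult_left_mono) auto
 then show ?thesis using n by (simp add: Tn_quadratic)
qed

lemma Tn_norm_le: "4 * eta * (norm (Tn u))^2 <= Tn u .* u"
 using positive_op_norm_le[OF Tn_positive Tn_le, of u] eta by (simp add: field_simps)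

lemma Bn_linear: "linear Bn"
 unfolding Bn_def by (rule linearI) (simp_all add: linear_add[OF Tn_linear] linear_scale[OF Tn_linear] algebra_simps)

lemma Tn_Bn: "Tn (Bn u) = Bn (Tn u)"
 by (simp add: Bn_def linear_diff[OF Tn_linear] linear_scale[OF Tn_linear])

lemma Bn_selfadjoint: "Bn u .* v = u .* Bn v"
 using positive_opD(2)[OF Tn_positive, of u v] by (simp add: Bn_def inner_diff_left inner_diff_right)

lemma Bn_norm_square_le: "(norm (Bn u))^2 <= (norm u)^2 - eta * (Tn u .* u)"
proof -
 have "(norm (Bn u))^2 = (norm u)^2 - 2 * eta * (Tn u .* u) + eta^2 * (norm (Tn u))^2"
  unfolding Bn_def power2_norm_eq_inner
  by (simp add: inner_diff_left inner_diff_right inner_commute power2_eq_square algebra_simps)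
 also have "eta^2 * (norm (Tn u))^2 <= eta * (Tn u .* u)"
 proof -
  have "eta * (4 * eta * (norm (Tn u))^2) <= eta * (Tn u .* u)" using eta by (intro mult_left_mono Tn_norm_le) simp
  moreover have "0 <= eta^2 * (norm (Tn u))^2" by simp
  ultimately show ?thesis by (simp add: power2_eq_square mult.assoc)
 qed
 finally show ?thesis by simp
qed

lemma Bn_Tn_quadratic_le: "Tn (Bn u) .* Bn u <= Tn u .* u"
proof -
 have "Tn (Bn u) .* Bn u = Tn u .* u - 2 * eta * (norm (Tn u))^2 + eta^2 * (Tn (Tn u) .* Tn u)"
 proof -
  have "Tn (Tn u) .* u = (norm (Tn u))^2" "Tn u .* Tn u = (norm (Tn u))^2"
   using positive_opD(2)[OF Tn_positive, of "Tn u" u] by (auto simp: power2_norm_eq_inner)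
  then show ?thesis
   by (simp add: Bn_def linear_diff[OF Tn_linear] linear_scale[OF Tn_linear]
    inner_diff_left inner_diff_right power2_eq_square[of eta] algebra_simps)
 qed
 also have "eta^2 * (Tn (Tn u) .* Tn u) <= eta^2 * (1 / (4 * eta) * (norm (Tn u))^2)"
  by (intro mult_left_mono Tn_le) simp
 also have "... = eta / 4 * (norm (Tn u))^2" using eta by (simp add: power2_eq_square)
 finally have "Tn (Bn u) .* Bn u <= Tn u .* u - 7 / 4 * (eta * (norm (Tn u))^2)" by simp
 moreover have "0 <= eta * (norm (Tn u))^2" using eta by simp
 ultimately show ?thesis by linarith
qed

lemma Bn_funpow_Tn_sum: "(SUM s<t. Tn ((Bn ^^ s) u) .* (Bn ^^ s) u) <= (norm u)^2 / eta"
proof -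
 have "eta * (SUM s<t. Tn ((Bn ^^ s) u) .* (Bn ^^ s) u) <= (norm u)^2 - (norm ((Bn ^^ t) u))^2"
 proof (induction t)
  case (Suc t)
  then show ?case using Bn_norm_square_le[of "(Bn ^^ t) u"] by (simp add: distrib_left)
 qed simp
 then have "eta * (SUM s<t. Tn ((Bn ^^ s) u) .* (Bn ^^ s) u) <= (norm u)^2"
  by (rule order_trans) simp
 then show ?thesis using eta by (simp add: field_simps)
qed

text \<open>The quadratic form decreases along the powers of \<open>Bn\<close>, so its t-th value is
  at most the mean of the t preceding ones, whose sum telescopes. This replaces the spectral bound
  on x (1 - \<eta> x)^(2t).\<close>

lemma Bn_funpow_Tn_le: "real t * (Tn ((Bn ^^ t) u) .* (Bn ^^ t) u) <= (norm u)^2 / eta"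
proof -
 have anti: "Tn ((Bn ^^ t) u) .* (Bn ^^ t) u <= Tn ((Bn ^^ s) u) .* (Bn ^^ s) u" if "s <= t" for s
  using that by (induction t rule: dec_induct) (auto intro: order_trans[OF Bn_Tn_quadratic_le])
 have "real t * (Tn ((Bn ^^ t) u) .* (Bn ^^ t) u) = (SUM s<t. Tn ((Bn ^^ t) u) .* (Bn ^^ t) u)" by simp
 also have "... <= (SUM s<t. Tn ((Bn ^^ s) u) .* (Bn ^^ s) u)" by (intro sum_mono anti) simp
 also have "... <= (norm u)^2 / eta" by (rule Bn_funpow_Tn_sum)
 finally show ?thesis .
qed

lemma Bn_funpow_linear: "linear (Bn ^^ i)"
 by (rule linear_funpow[OF Bn_linear])

lemma Bn_funpow_norm_le: "norm ((Bn ^^ t) u) <= norm u"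
proof (induction t)
 case (Suc t)
 have "(norm (Bn ((Bn ^^ t) u)))^2 <= (norm ((Bn ^^ t) u))^2"
  using Bn_norm_square_le[of "(Bn ^^ t) u"] positive_opD(3)[OF Tn_positive, of "(Bn ^^ t) u"] eta
  by (smt (verit) mult_nonneg_nonneg)
 then have "norm (Bn ((Bn ^^ t) u)) <= norm ((Bn ^^ t) u)" by (rule power2_le_imp_le) simp
 then show ?case using Suc.IH by simp
qed simp

lemma Bn_funpow_Tn_mono: "Tn ((Bn ^^ t) u) .* (Bn ^^ t) u <= Tn u .* u"
 by (induction t) (auto intro: order_trans[OF Bn_Tn_quadratic_le])

text \<open>Discrete variation of constants around an arbitrary point \<open>w\<close>;
  \<open>gn - Tn w\<close> is the empirical descent direction there.\<close>

lemma gd_shift: "gd t - w = (Bn ^^ t) (h0 - w) + eta *\<^sub>R (SUM s<t. (Bn ^^ s) (gn - Tn w))"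
proof (induction t)
 case (Suc t)
 have "gd (Suc t) - w = Bn (gd t - w) + eta *\<^sub>R (gn - Tn w)"
  by (simp add: Bn_def linear_diff[OF Tn_linear] algebra_simps)
 also have "Bn (gd t - w) = (Bn ^^ Suc t) (h0 - w) + eta *\<^sub>R (SUM s<t. (Bn ^^ Suc s) (gn - Tn w))"
  unfolding Suc.IH by (simp add: linear_add[OF Bn_linear] linear_scale[OF Bn_linear] linear_sum[OF Bn_linear])
 finally show ?case
  by (simp only: sum.lessThan_Suc_shift funpow_0 scaleR_add_right)
   (simp add: add.assoc add.commute)
qed simp

text \<open>The descent lemma: the form of \<open>Tn\<close> is at most 1 / (4 \<eta>), so the
  second-order term of a step is dominated by the decrease of the first-order one.\<close>

lemma gd_empirical_risk_le: "(1 / real n) * (SUM l<n. (k l .* gd t - y l)^2) <= (1 / real n) * (SUM l<n. (k l .* h0 - y l)^2)"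
proof (induction t)
 case (Suc t)
 define g where "g = Tn (gd t) - gn"
 have g: "g = (1 / real n) *\<^sub>R (SUM l<n. (k l .* gd t - y l) *\<^sub>R k l)"
  by (simp add: g_def Tn_def gn_def scaleR_diff_right[symmetric] sum_subtractf[symmetric] scaleR_diff_left)
 have gg: "(1 / real n) * (SUM l<n. (k l .* gd t - y l) * (k l .* g)) = (norm g)^2"
 proof -
  have "g .* g = (1 / real n) * (SUM l<n. (k l .* gd t - y l) * (k l .* g))"
   by (subst (1) g) (simp add: inner_sum_left)
  then show ?thesis by (simp add: power2_norm_eq_inner)
 qed
 have sq: "(k l .* gd (Suc t) - y l)^2 = (k l .* gd t - y l)^2 - 2 * eta * ((k l .* gd t - y l) * (k l .* g)) + eta^2 * (k l .* g)^2" for l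
  by (simp add: g_def[symmetric] inner_diff_right power2_eq_square algebra_simps)
 have "(1 / real n) * (SUM l<n. (k l .* gd (Suc t) - y l)^2)
  = (1 / real n) * (SUM l<n. (k l .* gd t - y l)^2) - 2 * eta * ((1 / real n) * (SUM l<n. (k l .* gd t - y l) * (k l .* g)))
   + eta^2 * (Tn g .* g)"
  unfolding Tn_quadratic sq sum.distrib sum_subtractf sum_distrib_left[symmetric] by (simp only: algebra_simps)
 also have "... <= (1 / real n) * (SUM l<n. (k l .* gd t - y l)^2)"
 proof -
  have "eta^2 * (Tn g .* g) <= eta^2 * (1 / (4 * eta) * (norm g)^2)" by (intro mult_left_mono Tn_le) simp
  also have "... = eta * (norm g)^2 / 4" using eta by (simp add: power2_eq_square)
  finally have "eta^2 * (Tn g .* g) <= eta * (norm g)^2 / 4" .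
  moreover have "0 <= eta * (norm g)^2" using eta by simp
  ultimately show ?thesis unfolding gg by linarith
 qed
 finally show ?case using Suc.IH by simp
qed simp

section \<open>The iterates as a martingale\<close>

text \<open>Full gradient minus the gradient at one point, so that the average over the sample
  vanishes for every \<open>u\<close>.\<close>

definition gnoise :: "'h => nat => 'h" where
 "gnoise u l = (Tn u - gn) - (k l .* u - y l) *\<^sub>R k l"

definition \<xi> :: "nat => (nat => nat) => 'h" where
 "\<xi> t j = (1 / real b) *\<^sub>R (\<Sum>i = b * t..<b * (t + 1). gnoise (h t j) (j i))"

lemma h_Suc: "h (Suc t) j = h t j - eta *\<^sub>R (Tn (h t j) - gn) + eta *\<^sub>R \<xi> t j"
proof -
 define G where "G = (1 / real b) *\<^sub>R (\<Sum>i = b * t..<b * (t + 1). (k (j i) .* h t j - y (j i)) *\<^sub>R k (j i))"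
 have hs: "h (Suc t) j = h t j - eta *\<^sub>R G"
  by (simp only: G_def h_def sgd.simps fst_conv snd_conv inner_commute[of _ "k _"])
 have "(\<Sum>i = b * t..<b * (t + 1). gnoise (h t j) (j i))
  = real b *\<^sub>R (Tn (h t j) - gn) - (\<Sum>i = b * t..<b * (t + 1). (k (j i) .* h t j - y (j i)) *\<^sub>R k (j i))"
  unfolding gnoise_def sum_subtractf[of _ _ "{b * t..<b * (t + 1)}"] sum_constant_scaleR
  by (simp add: scaleR_diff_right)
 then have xi: "\<xi> t j = (Tn (h t j) - gn) - G"
  unfolding \<xi>_def G_def using b by (simp only: scaleR_diff_right scaleR_scaleR) simp
 show ?thesis unfolding hs xi by (simp add: algebra_simps)
qed

lemma h_0: "h 0 j = h0"
 by (simp add: h_def)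

lemma h_upd: "b * t <= i ==> h t (j(i := l)) = h t j"
proof (induction t)
 case (Suc t)
 have IH: "h t (j(i := l)) = h t j" by (rule Suc.IH) (use Suc.prems in simp)
 have "\<xi> t (j(i := l)) = \<xi> t j" unfolding \<xi>_def IH
  by (intro arg_cong2[where f = scaleR] refl sum.cong) (use Suc.prems in auto)
 then show ?case by (simp only: h_Suc IH)
qed (simp add: h_0)

lemma sum_gradient: "(SUM l<n. (k l .* u - y l) *\<^sub>R k l) = real n *\<^sub>R (Tn u - gn)"
 using n by (simp add: Tn_def gn_def scaleR_diff_right scaleR_diff_left sum_subtractf)

lemma gnoise_mean: "(SUM l<n. gnoise u l) = 0"
 unfolding gnoise_def sum_subtractf sum_gradient sum_constant_scaleR by (simp add: scaleR_diff_right)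

text \<open>The b indices of a batch are averaged one at a time. Each adds a centred term, so the
  mixed terms vanish and the form grows by the variance, which is at most the uncentred second
  moment. \<open>U\<close> must not depend on the indices of the batch.\<close>

lemma batch_variance:
 assumes C: "positive_op C" and D: "linear D"
  and U: "!!j i l. b * t <= i ==> U (j(i := l)) = U j"
 shows "index_mean n (b * (t + 1)) (%j. C (U j + D (\<xi> t j)) .* (U j + D (\<xi> t j)))
  <= index_mean n (b * t) (%j. C (U j) .* U j
    + (1 / (real b * real n)) * (SUM l<n. (k l .* h t j - y l)^2 * (C (D (k l)) .* D (k l))))"
proof -
 define q where "q u = C u .* u" for u
 define W where "W j = (1 / real n) * (SUM l<n. (k l .* h t j - y l)^2 * q (D (k l)))" for j
 \<comment> \<open>The value after the first c draws of the batch.\<close>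
 define P where "P c j = U j + (1 / real b) *\<^sub>R (\<Sum>i = b * t..<b * t + c. D (gnoise (h t j) (j i)))" for c j
 have qadd: "q (u + v) = q u + 2 * (C u .* v) + q v" for u v
  using positive_op_quadratic[OF C, of u 1 v] by (simp add: q_def)
 have qsc: "q (s *\<^sub>R v) = s^2 * q v" for s v
  unfolding q_def by (simp add: linear_scale[OF positive_opD(1)[OF C]] power2_eq_square)
 have Wupd: "W (j(i := l)) = W j" if "b * t <= i" for j i l unfolding W_def using h_upd[OF that] by simp
 have Pupd: "P c (j(i := l)) = P c j" if "b * t + c <= i" for c j i l
 proof -
  have "h t (j(i := l)) = h t j" "U (j(i := l)) = U j" using that by (auto intro: h_upd U)
  moreover have "(\<Sum>i' = b * t..<b * t + c. D (gnoise (h t j) ((j(i := l)) i'))) = (\<Sum>i' = b * t..<b * t + c. D (gnoise (h t j) (j i')))"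
   by (rule sum.cong) (use that in auto)
  ultimately show ?thesis unfolding P_def by simp
 qed
 have var: "(1 / real n) * (SUM l<n. q (D (gnoise (h t j) l))) <= W j" for j
 proof -
  let ?u = "%l. D ((k l .* h t j - y l) *\<^sub>R k l)"
  let ?m = "D (Tn (h t j) - gn)"
  have mean: "(SUM l<n. ?u l) = real n *\<^sub>R ?m"
  proof -
   have "(SUM l<n. ?u l) = D (SUM l<n. (k l .* h t j - y l) *\<^sub>R k l)" by (rule linear_sum[OF D, symmetric])
   also have "(SUM l<n. (k l .* h t j - y l) *\<^sub>R k l) = real n *\<^sub>R (Tn (h t j) - gn)" by (rule sum_gradient)
   finally show ?thesis by (simp add: linear_scale[OF D])
  qed
  have "q (D (gnoise (h t j) l)) = q (?u l) - 2 * (C ?m .* ?u l) + q ?m" for l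
  proof -
   have Dg: "D (gnoise (h t j) l) = ?m + (-1) *\<^sub>R ?u l"
    unfolding gnoise_def by (simp add: linear_diff[OF D])
   show ?thesis unfolding Dg qadd qsc by simp
  qed
  then have "(SUM l<n. q (D (gnoise (h t j) l))) = (SUM l<n. q (?u l)) - 2 * (C ?m .* (SUM l<n. ?u l)) + real n * q ?m"
   by (simp only: sum.distrib sum_subtractf inner_sum_right sum_distrib_left[symmetric] sum_constant card_lessThan)
  also have "... = (SUM l<n. q (?u l)) - real n * q ?m" unfolding mean q_def by simp
  also have "... <= (SUM l<n. q (?u l))" using positive_opD(3)[OF C, of ?m] by (simp add: q_def)
  also have "... = (SUM l<n. (k l .* h t j - y l)^2 * q (D (k l)))"
   by (simp only: linear_scale[OF D] qsc)
  finally show ?thesis unfolding W_def by (intro mult_left_mono) auto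
 qed
 \<comment> \<open>Each draw contributes 1 / b^2; for c = b the total factor is 1 / b.\<close>
 have main: "index_mean n (b * t + c) (%j. q (P c j)) <= index_mean n (b * t) (%j. q (U j) + real c / (real b)^2 * W j)" for c
 proof (induction c)
  case 0
  then show ?case by (simp add: P_def)
 next
  case (Suc c)
  have step: "(1 / real n) * (SUM l<n. q (P (Suc c) (j(b * t + c := l)))) <= q (P c j) + 1 / (real b)^2 * W j" for j
  proof -
   have P: "P (Suc c) (j(b * t + c := l)) = P c j + (1 / real b) *\<^sub>R D (gnoise (h t j) l)" for l
   proof -
    have "P (Suc c) (j(b * t + c := l)) = P c (j(b * t + c := l)) + (1 / real b) *\<^sub>R D (gnoise (h t (j(b * t + c := l))) l)"
     unfolding P_def by (simp add: scaleR_add_right)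
    then show ?thesis by (simp add: Pupd h_upd)
   qed
   have "(SUM l<n. q (P (Suc c) (j(b * t + c := l))))
     = (SUM l<n. q (P c j) + 2 / real b * (C (P c j) .* D (gnoise (h t j) l)) + 1 / (real b)^2 * q (D (gnoise (h t j) l)))"
    unfolding P qadd qsc by (simp add: power_divide)
   also have "... = real n * q (P c j) + 2 / real b * (C (P c j) .* D (SUM l<n. gnoise (h t j) l))
     + 1 / (real b)^2 * (SUM l<n. q (D (gnoise (h t j) l)))"
    by (simp only: sum.distrib sum_distrib_left[symmetric] inner_sum_right[symmetric] linear_sum[OF D, symmetric]
      sum_constant card_lessThan)
   finally have "(1 / real n) * (SUM l<n. q (P (Suc c) (j(b * t + c := l))))
     = q (P c j) + 1 / (real b)^2 * ((1 / real n) * (SUM l<n. q (D (gnoise (h t j) l))))"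
    using n by (simp add: gnoise_mean linear_0[OF D] field_simps)
   also have "... <= q (P c j) + 1 / (real b)^2 * W j" by (intro add_left_mono mult_left_mono var) simp
   finally show ?thesis .
  qed
  have "index_mean n (b * t + Suc c) (%j. q (P (Suc c) j)) <= index_mean n (b * t + c) (%j. q (P c j) + 1 / (real b)^2 * W j)"
   unfolding add_Suc_right index_mean.simps by (rule index_mean_mono[OF step])
  also have "... = index_mean n (b * t + c) (%j. q (P c j)) + 1 / (real b)^2 * index_mean n (b * t + c) W"
   by (simp only: index_mean_add index_mean_cmult)
  also have "index_mean n (b * t + c) W = index_mean n (b * t) W"
   by (rule index_mean_indep[OF n]) (auto simp: Wupd)
  also have "index_mean n (b * t + c) (%j. q (P c j)) <= index_mean n (b * t) (%j. q (U j) + real c / (real b)^2 * W j)"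
   by (rule Suc.IH)
  finally have "index_mean n (b * t + Suc c) (%j. q (P (Suc c) j))
    <= index_mean n (b * t) (%j. q (U j)) + (real c / (real b)^2 * index_mean n (b * t) W + 1 / (real b)^2 * index_mean n (b * t) W)"
   unfolding index_mean_add index_mean_cmult by simp
  also have "real c / (real b)^2 * index_mean n (b * t) W + 1 / (real b)^2 * index_mean n (b * t) W
    = real (Suc c) / (real b)^2 * index_mean n (b * t) W" by (simp add: add_divide_distrib distrib_right)
  finally show ?case unfolding index_mean_add index_mean_cmult .
 qed
 have "P b j = U j + D (\<xi> t j)" for j
 proof -
  have bt: "b * (t + 1) = b * t + b" by simp
  show ?thesis unfolding P_def \<xi>_def bt by (simp only: linear_scale[OF D] linear_sum[OF D])
 qed
 then have "index_mean n (b * (t + 1)) (%j. q (U j + D (\<xi> t j))) <= index_mean n (b * t) (%j. q (U j) + real b / (real b)^2 * W j)"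
  using main[of b] by (simp add: add.commute)
 also have "... = index_mean n (b * t) (%j. q (U j) + (1 / (real b * real n)) * (SUM l<n. (k l .* h t j - y l)^2 * q (D (k l))))"
  unfolding W_def using b by (simp add: power2_eq_square mult.assoc)
 finally show ?thesis unfolding q_def .
qed

end

lemma square_sum_le2: "(x + y)^2 <= 2 * x^2 + 2 * (y::real)^2"
 using zero_le_power2[of "x - y"] by (simp add: power2_sum power2_diff)

lemma square_sum_le3: "(x + y + z)^2 <= 3 * (x^2 + y^2 + (z::real)^2)"
 using zero_le_power2[of "x - y"] zero_le_power2[of "x - z"] zero_le_power2[of "y - z"]
 by (simp add: power2_eq_square algebra_simps)

section \<open>The seminorm of a positive operator\<close>

definition form_norm :: "('a::real_inner => 'a) => 'a => real" where
 "form_norm C u = sqrt (C u .* u)"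

context
 fixes C :: "'a::real_inner => 'a"
 assumes C: "positive_op C"
begin

lemma form_norm_nonneg: "0 <= form_norm C u"
 by (simp add: form_norm_def positive_opD(3)[OF C])

lemma form_norm_square: "(form_norm C u)^2 = C u .* u"
 by (simp add: form_norm_def positive_opD(3)[OF C])

lemma form_norm_CS: "\<bar>C u .* v\<bar> <= form_norm C u * form_norm C v"
proof -
 have "\<bar>C u .* v\<bar> = sqrt ((C u .* v)^2)" by simp
 also have "... <= sqrt ((C u .* u) * (C v .* v))" by (rule real_sqrt_le_mono[OF positive_op_CS[OF C]])
 finally show ?thesis by (simp add: form_norm_def real_sqrt_mult)
qed

lemma form_norm_triangle: "form_norm C (u + v) <= form_norm C u + form_norm C v"
proof -
 have "(form_norm C (u + v))^2 = (form_norm C u)^2 + 2 * (C u .* v) + (form_norm C v)^2"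
  using positive_op_quadratic[OF C, of u 1 v] by (simp add: form_norm_square)
 also have "... <= (form_norm C u)^2 + 2 * (form_norm C u * form_norm C v) + (form_norm C v)^2"
  using form_norm_CS[of u v] by simp
 also have "... = (form_norm C u + form_norm C v)^2" by (simp add: power2_sum)
 finally show ?thesis by (rule power2_le_imp_le) (simp add: form_norm_nonneg)
qed

lemma form_norm_scaleR: "form_norm C (c *\<^sub>R u) = \<bar>c\<bar> * form_norm C u"
 unfolding form_norm_def linear_scale[OF positive_opD(1)[OF C]] by (simp add: real_sqrt_mult)

lemma form_norm_0: "form_norm C 0 = 0"
 by (simp add: form_norm_def)

lemma form_norm_sum: "form_norm C (SUM i:I. f i) <= (SUM i:I. form_norm C (f i))"
 by (induction I rule: infinite_finite_induct) (auto simp: form_norm_0 intro: order_trans[OF form_norm_triangle])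

lemma form_norm_minus: "form_norm C (u - v) <= form_norm C u + form_norm C v"
 using form_norm_triangle[of u "(-1) *\<^sub>R v"] form_norm_scaleR[of "-1" v] by simp

end

context sgd_sample
begin

definition "Cl l u = Tn u + l *\<^sub>R u"

abbreviation "star l \<equiv> form_norm (Cl l)"

lemma Cl_positive: "l >= 0 ==> positive_op (Cl l)"
 unfolding positive_op_def Cl_def
proof (intro conjI allI)
 show "linear (%u. Tn u + l *\<^sub>R u)"
  by (rule linearI) (simp_all add: linear_add[OF Tn_linear] linear_scale[OF Tn_linear] algebra_simps)
qed (use positive_opD[OF Tn_positive] in \<open>auto simp: inner_add_left inner_add_right\<close>)

lemma star_square: "l >= 0 ==> (star l u)^2 = Tn u .* u + l * (norm u)^2"
 by (subst form_norm_square[OF Cl_positive]) (simp_all add: Cl_def inner_add_left power2_norm_eq_inner)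

lemma star_Bn_funpow: "l >= 0 ==> star l ((Bn ^^ t) u) <= star l u"
proof (rule power2_le_imp_le)
 assume l: "l >= 0"
 show "(star l ((Bn ^^ t) u))^2 <= (star l u)^2"
  unfolding star_square[OF l]
  by (intro add_mono mult_left_mono Bn_funpow_Tn_mono power_mono Bn_funpow_norm_le l) simp
qed (rule form_norm_nonneg[OF Cl_positive])

lemma Bn_funpow_telescope:
 assumes "lo <= hi"
 shows "(SUM i=lo..<hi. eta *\<^sub>R (Bn ^^ i) (Tn p)) = (Bn ^^ lo) p - (Bn ^^ hi) p"
 using assms
proof (induction hi rule: dec_induct)
 case (step m)
 have "eta *\<^sub>R (Bn ^^ m) (Tn p) = (Bn ^^ m) (p - Bn p)"
  by (simp add: Bn_def linear_scale[OF Bn_funpow_linear])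
 also have "... = (Bn ^^ m) p - (Bn ^^ Suc m) p"
  by (simp add: linear_diff[OF Bn_funpow_linear] funpow_swap1)
 finally show ?case using step by simp
qed simp

text \<open>With q = (Tn + \<lambda>) p the part Tn p telescopes to two powers of \<open>Bn\<close>,
  and the part \<lambda> p is a sum of at most 1 / (\<eta> \<lambda>) terms of size \<eta>
  \<lambda>. Hence 2 + 1 = 3 and no logarithmic factor.\<close>

lemma star_geometric_le:
 assumes l: "l >= 0" and lo: "lo <= hi" and hi: "l * eta * real (hi - lo) <= 1" and q: "q = Cl l p"
 shows "star l (SUM i=lo..<hi. eta *\<^sub>R (Bn ^^ i) q) <= 3 * star l p"
proof -
 note Cp = Cl_positive[OF l]
 have "(SUM i=lo..<hi. eta *\<^sub>R (Bn ^^ i) q) = (SUM i=lo..<hi. eta *\<^sub>R (Bn ^^ i) (Tn p) + (eta * l) *\<^sub>R (Bn ^^ i) p)"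
  unfolding q Cl_def by (simp add: linear_add[OF Bn_funpow_linear] linear_scale[OF Bn_funpow_linear] scaleR_add_right)
 also have "... = ((Bn ^^ lo) p - (Bn ^^ hi) p) + (SUM i=lo..<hi. (eta * l) *\<^sub>R (Bn ^^ i) p)"
  by (simp only: sum.distrib Bn_funpow_telescope[OF lo])
 finally have eq: "(SUM i=lo..<hi. eta *\<^sub>R (Bn ^^ i) q) = ((Bn ^^ lo) p - (Bn ^^ hi) p) + (SUM i=lo..<hi. (eta * l) *\<^sub>R (Bn ^^ i) p)" .
 have "star l ((Bn ^^ lo) p - (Bn ^^ hi) p) <= star l p + star l p"
  by (rule order_trans[OF form_norm_minus[OF Cp]]) (intro add_mono star_Bn_funpow l)
 moreover have "star l (SUM i=lo..<hi. (eta * l) *\<^sub>R (Bn ^^ i) p) <= star l p"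
 proof -
  have "star l (SUM i=lo..<hi. (eta * l) *\<^sub>R (Bn ^^ i) p) <= (SUM i=lo..<hi. star l ((eta * l) *\<^sub>R (Bn ^^ i) p))"
   by (rule form_norm_sum[OF Cp])
  also have "... <= (SUM i=lo..<hi. (eta * l) * star l p)"
   unfolding form_norm_scaleR[OF Cp] using eta l by (intro sum_mono mult_mono star_Bn_funpow) (auto simp: form_norm_nonneg[OF Cp])
  also have "... = (l * eta * real (hi - lo)) * star l p" by simp
  also have "... <= 1 * star l p" by (intro mult_right_mono hi form_norm_nonneg[OF Cp])
  finally show ?thesis by simp
 qed
 ultimately show ?thesis unfolding eq
  using form_norm_triangle[OF Cp, of "(Bn ^^ lo) p - (Bn ^^ hi) p" "SUM i=lo..<hi. (eta * l) *\<^sub>R (Bn ^^ i) p"] by linarith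
qed

text \<open>The left-hand side is the ridge leverage score of the point i. This worst case |k|^2 /
  \<lambda> is used for the parts of the residual that are small in mean square only.\<close>

lemma star_resolvent_le:
 assumes l: "l > 0" and p: "Cl l p = k i" and i: "i < n"
 shows "(star l p)^2 <= 1 / (4 * eta * l)"
proof -
 note Cp = Cl_positive[OF less_imp_le[OF l]]
 have s: "(star l p)^2 = k i .* p" unfolding form_norm_square[OF Cp] p ..
 have "l * (norm p)^2 <= (star l p)^2"
  using positive_opD(3)[OF Tn_positive, of p] l by (simp add: star_square)
 moreover have "((star l p)^2)^2 <= (norm (k i))^2 * (norm p)^2"
  unfolding s using Cauchy_Schwarz_ineq[of "k i" p] by (simp add: power2_norm_eq_inner)
 ultimately have "l * ((star l p)^2)^2 <= (norm (k i))^2 * (star l p)^2"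
 proof -
  assume a: "l * (norm p)^2 <= (star l p)^2" "((star l p)^2)^2 <= (norm (k i))^2 * (norm p)^2"
  have "l * ((star l p)^2)^2 <= l * ((norm (k i))^2 * (norm p)^2)" using l by (intro mult_left_mono a(2)) simp
  also have "... = (norm (k i))^2 * (l * (norm p)^2)" by simp
  also have "... <= (norm (k i))^2 * (star l p)^2" by (intro mult_left_mono a(1)) simp
  finally show ?thesis .
 qed
 also have "... <= 1 / (4 * eta) * (star l p)^2"
  using k_bound[OF i] eta by (intro mult_right_mono) (auto simp: field_simps)
 finally have "(l * (star l p)^2) * (star l p)^2 <= 1 / (4 * eta) * (star l p)^2" by (simp add: power2_eq_square mult.assoc)
 then have "(star l p)^2 = 0 \<or> l * (star l p)^2 <= 1 / (4 * eta)"
  by (metis mult_right_le_imp_le order_le_less zero_le_power2)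
 then show ?thesis
 proof
  assume "l * (star l p)^2 <= 1 / (4 * eta)"
  then show ?thesis using l eta by (simp add: field_simps)
 qed (use l eta in simp)
qed

section \<open>Variance of the tail average\<close>

definition "z t j = h t j - gd t"

lemma z_0: "z 0 j = 0"
 by (simp add: z_def h_0)

lemma z_Suc: "z (Suc t) j = Bn (z t j) + eta *\<^sub>R \<xi> t j"
 by (simp add: z_def h_Suc Bn_def linear_diff[OF Tn_linear] algebra_simps)

lemma z_upd: "b * t <= i ==> z t (j(i := l)) = z t j"
 by (simp add: z_def h_upd)

definition "emp_risk t j = (1 / real n) * (SUM l<n. (k l .* h t j - y l)^2)"

text \<open>An energy estimate: one step dissipates \<eta> Tn z .* z and adds \<eta> / (4 b) times
  the empirical risk of the stochastic iterate. That risk is at most twice the energy plus twice the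
  risk of gradient descent, so the energy reappears with a small coefficient and is
  absorbed.\<close>

lemma sum_z_energy_le:
 assumes R0: "(1 / real n) * (SUM l<n. (k l .* h0 - y l)^2) <= R0"
 shows "(SUM t<T. index_mean n (b * t) (%j. Tn (z t j) .* z t j)) <= real T * R0 / b"
proof -
 define S where "S T = (SUM t<T. index_mean n (b * t) (%j. Tn (z t j) .* z t j))" for T
 define Rk where "Rk T = (SUM t<T. index_mean n (b * t) (emp_risk t))" for T
 have pid: "positive_op (%u::'h. u)" by (simp add: positive_op_def linear_id[unfolded id_def])
 have lin: "linear (%u::'h. eta *\<^sub>R u)" by (rule linearI) (simp_all add: algebra_simps)
 have energy: "index_mean n (b * T) (%j. (norm (z T j))^2) + eta * S T <= eta / (4 * b) * Rk T" for T
 proof (induction T)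
  case 0
  then show ?case by (simp add: z_0 S_def Rk_def)
 next
  case (Suc t)
  have "index_mean n (b * Suc t) (%j. (norm (z (Suc t) j))^2)
   <= index_mean n (b * t) (%j. Bn (z t j) .* Bn (z t j)
    + (1 / (real b * real n)) * (SUM l<n. (k l .* h t j - y l)^2 * ((eta *\<^sub>R k l) .* (eta *\<^sub>R k l))))"
   using batch_variance[OF pid lin, of t "%j. Bn (z t j)"] z_upd
   by (simp add: z_Suc power2_norm_eq_inner)
  also have "... <= index_mean n (b * t) (%j. (norm (z t j))^2 + ((- eta) * (Tn (z t j) .* z t j) + eta / (4 * b) * emp_risk t j))"
  proof (rule index_mean_mono)
   fix j
   have "(SUM l<n. (k l .* h t j - y l)^2 * ((eta *\<^sub>R k l) .* (eta *\<^sub>R k l))) <= (SUM l<n. (k l .* h t j - y l)^2 * (eta / 4))"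
   proof (intro sum_mono mult_left_mono)
    fix l assume "l \<in> {..<n}"
    then have "eta * (4 * eta * (norm (k l))^2) <= eta * 1" using eta by (intro mult_left_mono k_bound) auto
    then show "(eta *\<^sub>R k l) .* (eta *\<^sub>R k l) <= eta / 4" by (simp add: power2_norm_eq_inner)
   qed simp
   then have "(1 / (real b * real n)) * (SUM l<n. (k l .* h t j - y l)^2 * ((eta *\<^sub>R k l) .* (eta *\<^sub>R k l)))
     <= (1 / (real b * real n)) * (SUM l<n. (k l .* h t j - y l)^2 * (eta / 4))" by (rule mult_left_mono) simp
   also have "... = eta / (4 * b) * emp_risk t j"
    unfolding emp_risk_def sum_distrib_right[symmetric] by (simp add: field_simps)
   finally show "Bn (z t j) .* Bn (z t j)
    + (1 / (real b * real n)) * (SUM l<n. (k l .* h t j - y l)^2 * ((eta *\<^sub>R k l) .* (eta *\<^sub>R k l)))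
    <= (norm (z t j))^2 + ((- eta) * (Tn (z t j) .* z t j) + eta / (4 * b) * emp_risk t j)"
    using Bn_norm_square_le[of "z t j"] by (simp add: power2_norm_eq_inner)
  qed
  finally show ?case using Suc.IH unfolding index_mean_add index_mean_cmult S_def Rk_def
   by (simp add: distrib_left)
 qed
 have risk: "index_mean n (b * t) (emp_risk t) <= 2 * index_mean n (b * t) (%j. Tn (z t j) .* z t j) + 2 * R0" for t
 proof -
  have "emp_risk t j <= 2 * (Tn (z t j) .* z t j) + 2 * R0" for j
  proof -
   have "(k l .* h t j - y l)^2 <= 2 * (k l .* z t j)^2 + 2 * (k l .* gd t - y l)^2" for l
    using square_sum_le2[of "k l .* z t j" "k l .* gd t - y l"] by (simp add: z_def inner_diff_right)
   then have "(SUM l<n. (k l .* h t j - y l)^2) <= (SUM l<n. 2 * (k l .* z t j)^2 + 2 * (k l .* gd t - y l)^2)"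
    by (intro sum_mono)
   then have "emp_risk t j <= (1 / real n) * (SUM l<n. 2 * (k l .* z t j)^2 + 2 * (k l .* gd t - y l)^2)"
    unfolding emp_risk_def by (rule mult_left_mono) simp
   also have "... = 2 * (Tn (z t j) .* z t j) + 2 * ((1 / real n) * (SUM l<n. (k l .* gd t - y l)^2))"
    unfolding Tn_quadratic sum.distrib sum_distrib_left[symmetric] by (simp add: distrib_left)
   finally show ?thesis using gd_empirical_risk_le[of t] R0 by linarith
  qed
  then have "index_mean n (b * t) (emp_risk t) <= index_mean n (b * t) (%j. 2 * (Tn (z t j) .* z t j) + 2 * R0)"
   by (rule index_mean_mono)
  then show ?thesis unfolding index_mean_add index_mean_cmult index_mean_const[OF n] .
 qed
 have "Rk T <= (SUM t<T. 2 * index_mean n (b * t) (%j. Tn (z t j) .* z t j) + 2 * R0)"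
  unfolding Rk_def by (intro sum_mono risk)
 also have "... = 2 * S T + 2 * real T * R0" unfolding S_def by (simp add: sum.distrib sum_distrib_left)
 finally have Rk: "Rk T <= 2 * S T + 2 * real T * R0" .
 have b1: "real b >= 1" using b by simp
 have S0: "S T >= 0" unfolding S_def by (intro sum_nonneg index_mean_nonneg positive_opD(3)[OF Tn_positive])
 have "eta * S T <= eta / (4 * b) * Rk T"
  using energy[of T] index_mean_nonneg[of "%j. (norm (z T j))^2" n "b * T"] by simp
 also have "... <= eta / (4 * b) * (2 * S T + 2 * real T * R0)"
  using eta by (intro mult_left_mono Rk) simp
 finally have "eta * S T <= eta * ((2 * S T + 2 * real T * R0) / (4 * b))" by simp
 then have "S T <= (2 * S T + 2 * real T * R0) / (4 * b)" by (rule mult_left_le_imp_le) (rule eta)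
 \<comment> \<open>The feedback \<open>S T\<close> on the right is absorbed in the next lines
   because b >= 1.\<close>
 then have "2 * real b * S T <= S T + real T * R0" using b1 by (simp add: field_simps)
 moreover have "S T <= real b * S T" using mult_right_mono[OF b1 S0] by simp
 ultimately have "real b * S T <= real T * R0" by linarith
 then show ?thesis using b1 unfolding S_def by (simp add: field_simps)
qed

text \<open>\<open>W t\<close> is the conditional expectation, given the first \<open>b t\<close> indices, of the sum of the
 deviations \<open>z\<close> over the tail.\<close>

definition G :: "nat => nat => 'h => 'h" where
 "G T t u = (\<Sum>i = (T div 2 + 1) - t..<T + 1 - t. (Bn ^^ i) u)"

definition W :: "nat => nat => (nat => nat) => 'h" where
 "W T t j = (\<Sum>s = T div 2 + 1..<t. z s j) + G T t (z t j)"

lemma G_linear: "linear (G T t)"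
 unfolding G_def by (rule linearI)
  (simp_all add: linear_add[OF Bn_funpow_linear] linear_scale[OF Bn_funpow_linear] sum.distrib scaleR_sum_right)

text \<open>The power 0 belongs to the sum exactly when step t lies in the tail; truncated
  subtraction makes the lower limit 0 from then on. This term passes from the predicted to the
  observed part of \<open>W\<close>.\<close>

lemma G_step:
 assumes "t <= T"
 shows "G T t u = (if T div 2 + 1 <= t then u else 0) + G T (Suc t) (Bn u)"
proof (cases "T div 2 + 1 <= t")
 case True
 have "T + 1 - t = Suc (T - t)" using assms by simp
 then have "G T t u = (SUM i<Suc (T - t). (Bn ^^ i) u)"
  using True by (simp add: G_def atLeast0LessThan)
 also have "... = u + (SUM i<T - t. (Bn ^^ i) (Bn u))"
  by (simp only: sum.lessThan_Suc_shift funpow_0 funpow_Suc_right o_apply)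
 also have "(SUM i<T - t. (Bn ^^ i) (Bn u)) = G T (Suc t) (Bn u)"
  using True by (simp add: G_def atLeast0LessThan)
 finally show ?thesis using True by simp
next
 case False
 have e: "(T div 2 + 1) - t = Suc (T div 2 + 1 - Suc t)" "T + 1 - t = Suc (T + 1 - Suc t)" using False assms by auto
 have "G T t u = (\<Sum>i = T div 2 + 1 - Suc t..<T + 1 - Suc t. (Bn ^^ Suc i) u)"
  unfolding G_def e by (rule sum.shift_bounds_Suc_ivl)
 then show ?thesis using False by (simp only: G_def funpow_Suc_right o_apply) simp
qed

lemma W_0: "W T 0 j = 0"
 by (simp add: W_def z_0 linear_0[OF G_linear])

lemma W_Suc:
 assumes "t <= T"
 shows "W T (Suc t) j = W T t j + G T (Suc t) (eta *\<^sub>R \<xi> t j)"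
proof -
 have "W T (Suc t) j = (\<Sum>s = T div 2 + 1..<Suc t. z s j) + (G T (Suc t) (Bn (z t j)) + G T (Suc t) (eta *\<^sub>R \<xi> t j))"
  unfolding W_def z_Suc linear_add[OF G_linear] ..
 also have "(\<Sum>s = T div 2 + 1..<Suc t. z s j) = (\<Sum>s = T div 2 + 1..<t. z s j) + (if T div 2 + 1 <= t then z t j else 0)"
  by simp
 finally show ?thesis unfolding W_def G_step[OF assms] by (simp add: add.assoc)
qed

lemma W_final:
 assumes "T > 0"
 shows "W T T j = (\<Sum>s = T div 2 + 1..T. z s j)"
proof -
 have a: "T div 2 + 1 <= T" using assms by linarith
 have "G T T u = u" for u using a by (simp add: G_def)
 then have "W T T j = (\<Sum>s = T div 2 + 1..<Suc T. z s j)" using a by (simp add: W_def)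
 then show ?thesis by (simp only: atLeastLessThanSuc_atLeastAtMost)
qed

lemma W_upd: "b * t <= i ==> W T t (j(i := l)) = W T t j"
proof -
 assume i: "b * t <= i"
 have "(\<Sum>s = T div 2 + 1..<t. z s (j(i := l))) = (\<Sum>s = T div 2 + 1..<t. z s j)"
 proof (rule sum.cong[OF refl])
  fix s assume "s \<in> {T div 2 + 1..<t}"
  then have "b * s <= b * t" by simp
  then show "z s (j(i := l)) = z s j" using i by (intro z_upd) linarith
 qed
 then show ?thesis unfolding W_def using z_upd[OF i] by simp
qed

text \<open>By \<open>W_Suc\<close> the increments of the martingale \<open>W\<close> apply
  \<open>G\<close> to the batch noise. On a feature vector this is a geometric sum as in
  \<open>star_geometric_le\<close>, at most 3 times the norm of \<open>pk i\<close>, which squares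
  to 9 times the leverage score.\<close>

lemma W_variance_le:
 assumes l: "l >= 0" "l * eta * real T <= 1" and pk: "!!i. i < n ==> Cl l (pk i) = k i" and t: "t <= T"
 shows "index_mean n (b * t) (%j. (star l (W T t j))^2)
  <= (SUM s<t. index_mean n (b * s) (%j. 9 / (real b * real n) * (SUM i<n. (k i .* h s j - y i)^2 * (star l (pk i))^2)))"
 using t
proof (induction t)
 case 0
 then show ?case by (simp add: W_0 form_norm_0[OF Cl_positive[OF l(1)]])
next
 case (Suc t)
 note Cp = Cl_positive[OF l(1)]
 let ?D = "%u. G T (Suc t) (eta *\<^sub>R u)"
 have linD: "linear ?D"
  by (rule linearI) (simp_all add: scaleR_add_right linear_add[OF G_linear] linear_scale[OF G_linear])
 have Dk: "Cl l (?D (k i)) .* ?D (k i) <= 9 * (star l (pk i))^2" if i: "i < n" for i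
 proof -
  have "?D (k i) = (\<Sum>s = T div 2 + 1 - Suc t..<T + 1 - Suc t. eta *\<^sub>R (Bn ^^ s) (k i))"
   unfolding G_def by (simp add: linear_scale[OF Bn_funpow_linear])
  moreover have "star l (\<Sum>s = T div 2 + 1 - Suc t..<T + 1 - Suc t. eta *\<^sub>R (Bn ^^ s) (k i)) <= 3 * star l (pk i)"
  proof (rule star_geometric_le[OF l(1) _ _ pk[OF i, symmetric]])
   have "l * eta * real (T + 1 - Suc t - (T div 2 + 1 - Suc t)) <= l * eta * real T"
    using l(1) eta by (intro mult_left_mono) auto
   then show "l * eta * real (T + 1 - Suc t - (T div 2 + 1 - Suc t)) <= 1" using l(2) by linarith
  qed simp
  ultimately have "star l (?D (k i)) <= 3 * star l (pk i)" by simp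
  then have "(star l (?D (k i)))^2 <= (3 * star l (pk i))^2" by (rule power_mono) (rule form_norm_nonneg[OF Cp])
  then show ?thesis unfolding form_norm_square[OF Cp] by (simp add: power_mult_distrib form_norm_square[OF Cp])
 qed
 have "index_mean n (b * Suc t) (%j. (star l (W T (Suc t) j))^2)
  <= index_mean n (b * t) (%j. (star l (W T t j))^2
    + (1 / (real b * real n)) * (SUM i<n. (k i .* h t j - y i)^2 * (Cl l (?D (k i)) .* ?D (k i))))"
  using batch_variance[OF Cp linD, of t "W T t"] W_upd Suc.prems
  unfolding form_norm_square[OF Cp] by (simp add: W_Suc)
 also have "... <= index_mean n (b * t) (%j. (star l (W T t j))^2
    + 9 / (real b * real n) * (SUM i<n. (k i .* h t j - y i)^2 * (star l (pk i))^2))"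
 proof (rule index_mean_mono, rule add_left_mono)
  fix j
  have "(SUM i<n. (k i .* h t j - y i)^2 * (Cl l (?D (k i)) .* ?D (k i)))
    <= (SUM i<n. (k i .* h t j - y i)^2 * (9 * (star l (pk i))^2))"
   by (intro sum_mono mult_left_mono Dk) auto
  then have "(1 / (real b * real n)) * (SUM i<n. (k i .* h t j - y i)^2 * (Cl l (?D (k i)) .* ?D (k i)))
    <= (1 / (real b * real n)) * (SUM i<n. (k i .* h t j - y i)^2 * (9 * (star l (pk i))^2))"
   by (rule mult_left_mono) simp
  also have "... = 9 / (real b * real n) * (SUM i<n. (k i .* h t j - y i)^2 * (star l (pk i))^2)"
   by (simp add: sum_distrib_left mult.left_commute)
  finally show "(1 / (real b * real n)) * (SUM i<n. (k i .* h t j - y i)^2 * (Cl l (?D (k i)) .* ?D (k i)))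
    <= 9 / (real b * real n) * (SUM i<n. (k i .* h t j - y i)^2 * (star l (pk i))^2)" .
 qed
 finally show ?case using Suc.IH Suc.prems unfolding index_mean_add by simp
qed

end

context sgd_sample
begin

text \<open>Here \<open>Th\<close> bounds the empirical gradient at \<open>w\<close> in the dual
  norm, \<open>Nh\<close> the mean leverage score, \<open>Xi\<close> the empirical approximation
  error and \<open>R0\<close> the initial risk. In the variance the bounded label noise is paired
  with the mean leverage; all other parts of the residual are small in mean square and are paired
  with the maximal leverage T / 4.\<close>

theorem sgd_mean_error:
 fixes S :: "'h => 'l::real_normed_vector"
 assumes T: "T > 0" and l: "l = 1 / (eta * real T)"
  and S: "linear S" and c: "c >= 0" "!!u. norm (S u) <= c * star l u"
  and p: "Cl l p = gn - Tn w" "star l p <= Th"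
  and pk: "!!i. i < n ==> Cl l (pk i) = k i" "(1 / real n) * (SUM i<n. (star l (pk i))^2) <= Nh"
  and ph: "!!i. i < n ==> \<bar>ph i - y i\<bar> <= M2" "(1 / real n) * (SUM i<n. (k i .* w - ph i)^2) <= Xi"
  and R0: "(1 / real n) * (SUM i<n. (k i .* h0 - y i)^2) <= R0"
 shows "index_mean n (b * T) (%j. norm (S (tail_average (%t. h t j) T) - f))
  <= c * sqrt (36 / b * (2 * M2^2 * Nh / T + 3 / 2 * (R0 / b + 2 * l * (norm (h0 - w))^2 + 18 * Th^2 + Xi)))
   + 2 * c * (2 * sqrt l * norm (h0 - w) + 3 * Th) + norm (S w - f) + norm (S w) / T"
proof -
 define u0 where "u0 = h0 - w"
 define a where "a = T div 2 + 1"
 have Tr: "real T > 0" using T by simp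
 have l0: "l > 0" using T eta by (simp add: l)
 have lT: "l * eta * real T <= 1" "l * eta * real T = 1" using T eta by (simp_all add: l)
 note Cp = Cl_positive[OF less_imp_le[OF l0]]
 have Th0: "Th >= 0" using p(2) form_norm_nonneg[OF Cp, of p] by linarith
 have aT: "a <= T" using T unfolding a_def by linarith
 define A where "A t = (SUM s<t. eta *\<^sub>R (Bn ^^ s) (gn - Tn w))" for t
 have gdw: "gd t - w = (Bn ^^ t) u0 + A t" for t
  unfolding gd_shift u0_def A_def by (simp add: scaleR_sum_right)
 have starA: "star l (A t) <= 3 * Th" if "t <= T" for t
 proof -
  have "star l (SUM s=0..<t. eta *\<^sub>R (Bn ^^ s) (gn - Tn w)) <= 3 * star l p"
  proof (rule star_geometric_le[OF _ _ _ p(1)[symmetric]])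
   have "l * eta * real t <= l * eta * real T" using that l0 eta by (intro mult_left_mono) auto
   then show "l * eta * real (t - 0) <= 1" using lT by simp
  qed (use l0 in auto)
  then show ?thesis using p(2) by (simp add: A_def atLeast0LessThan)
 qed
 \<comment> \<open>In the tail t >= T / 2, so 1 / (\<eta> t) <= 2 \<lambda>.\<close>
 have star_gd: "star l (gd t - w) <= 2 * sqrt l * norm u0 + 3 * Th" if t: "a <= t" "t <= T" for t
 proof -
  have t0: "real t > 0" and t2: "real T <= 2 * real t" using t unfolding a_def by linarith+
  have "Tn ((Bn ^^ t) u0) .* (Bn ^^ t) u0 <= (norm u0)^2 / (eta * real t)"
   using Bn_funpow_Tn_le[of t u0] t0 eta by (simp add: field_simps)
  also have "... <= 2 * l * (norm u0)^2"
   using t2 t0 Tr eta mult_right_mono[OF t2, of "(norm u0)^2"] by (simp add: l field_simps)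
  finally have "(star l ((Bn ^^ t) u0))^2 <= 2 * l * (norm u0)^2 + l * (norm u0)^2"
   unfolding star_square[OF less_imp_le[OF l0]]
   using l0 by (intro add_mono mult_left_mono power_mono Bn_funpow_norm_le) auto
  also have "... <= 4 * l * (norm u0)^2" using l0 by simp
  also have "... = (2 * sqrt l * norm u0)^2" using l0 by (simp add: power_mult_distrib)
  finally have "star l ((Bn ^^ t) u0) <= 2 * sqrt l * norm u0"
   by (rule power2_le_imp_le) (use l0 in simp)
  then show ?thesis unfolding gdw using form_norm_triangle[OF Cp, of "(Bn ^^ t) u0" "A t"] starA[OF t(2)] by linarith
 qed
 have gd_sum: "(SUM t<T. Tn (gd t - w) .* (gd t - w)) <= 2 * (norm u0)^2 / eta + 18 * real T * Th^2"
 proof -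
  have "Tn (gd t - w) .* (gd t - w) <= 2 * (Tn ((Bn ^^ t) u0) .* (Bn ^^ t) u0) + 18 * Th^2" if "t < T" for t
  proof -
   have "Tn (gd t - w) .* (gd t - w) = (1 / real n) * (SUM i<n. (k i .* (Bn ^^ t) u0 + k i .* A t)^2)"
    unfolding Tn_quadratic gdw by (simp only: inner_add_right)
   also have "... <= (1 / real n) * (SUM i<n. 2 * (k i .* (Bn ^^ t) u0)^2 + 2 * (k i .* A t)^2)"
    by (intro mult_left_mono sum_mono square_sum_le2) simp
   also have "... = 2 * (Tn ((Bn ^^ t) u0) .* (Bn ^^ t) u0) + 2 * (Tn (A t) .* A t)"
    unfolding Tn_quadratic sum.distrib sum_distrib_left[symmetric] by (simp add: distrib_left)
   also have "Tn (A t) .* A t <= (star l (A t))^2" unfolding star_square[OF less_imp_le[OF l0]] using l0 by simp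
   also have "... <= (3 * Th)^2" using that by (intro power_mono starA form_norm_nonneg[OF Cp]) simp
   finally show ?thesis by (simp add: power_mult_distrib)
  qed
  then have "(SUM t<T. Tn (gd t - w) .* (gd t - w)) <= (SUM t<T. 2 * (Tn ((Bn ^^ t) u0) .* (Bn ^^ t) u0) + 18 * Th^2)"
   by (intro sum_mono) simp
  also have "... = 2 * (SUM t<T. Tn ((Bn ^^ t) u0) .* (Bn ^^ t) u0) + 18 * real T * Th^2"
   by (simp add: sum.distrib sum_distrib_left)
  also have "... <= 2 * ((norm u0)^2 / eta) + 18 * real T * Th^2"
   using Bn_funpow_Tn_sum[where t = T and u = u0] by linarith
  finally show ?thesis by simp
 qed
 define s where "s i = (star l (pk i))^2" for i
 have s: "s i >= 0" for i by (simp add: s_def)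
 have sT: "s i <= real T / 4" if "i < n" for i
  using star_resolvent_le[OF l0 pk(1)[OF that] that] eta Tr by (simp add: s_def l)
 have Nh0: "Nh >= 0" using pk(2) by (rule order_trans[rotated]) (intro mult_nonneg_nonneg sum_nonneg; simp)
 have pt: "(1 / real n) * (SUM i<n. (k i .* h t j - y i)^2 * s i)
   <= 2 * M2^2 * Nh + 3 / 2 * real T * (Tn (z t j) .* z t j + Tn (gd t - w) .* (gd t - w) + Xi)" for t j
 proof -
  have "(k i .* h t j - y i)^2 * s i <= 2 * M2^2 * s i
    + 3 / 2 * real T * ((k i .* z t j)^2 + (k i .* (gd t - w))^2 + (k i .* w - ph i)^2)" if i: "i < n" for i
  proof -
   let ?q = "(k i .* z t j)^2 + (k i .* (gd t - w))^2 + (k i .* w - ph i)^2"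
   \<comment> \<open>Stochastic deviation, error of gradient descent, approximation error and label
     noise.\<close>
   have "k i .* h t j - y i = (k i .* z t j + k i .* (gd t - w) + (k i .* w - ph i)) + (ph i - y i)"
    by (simp add: z_def inner_diff_right)
   then have "(k i .* h t j - y i)^2 <= 2 * (k i .* z t j + k i .* (gd t - w) + (k i .* w - ph i))^2 + 2 * (ph i - y i)^2"
    by (simp only: square_sum_le2)
   also have "... <= 2 * (3 * ?q) + 2 * M2^2"
   proof (intro add_mono mult_left_mono square_sum_le3)
    have "\<bar>ph i - y i\<bar>\<^sup>2 <= M2^2" by (rule power_mono[OF ph(1)[OF i]]) simp
    then show "(ph i - y i)^2 <= M2^2" by simp
   qed auto
   finally have "(k i .* h t j - y i)^2 * s i <= (6 * ?q + 2 * M2^2) * s i" by (intro mult_right_mono s) simp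
   also have "... <= 6 * ?q * (real T / 4) + 2 * M2^2 * s i"
    unfolding distrib_right[of "6 * ?q"] by (intro add_mono mult_left_mono sT i) auto
   also have "6 * ?q * (real T / 4) = 3 / 2 * real T * ?q" by simp
   finally show ?thesis by (simp only: add.commute)
  qed
  then have "(SUM i<n. (k i .* h t j - y i)^2 * s i) <= (SUM i<n. 2 * M2^2 * s i
    + 3 / 2 * real T * ((k i .* z t j)^2 + (k i .* (gd t - w))^2 + (k i .* w - ph i)^2))"
   by (intro sum_mono) simp
  then have "(1 / real n) * (SUM i<n. (k i .* h t j - y i)^2 * s i) <= (1 / real n) * (SUM i<n. 2 * M2^2 * s i
    + 3 / 2 * real T * ((k i .* z t j)^2 + (k i .* (gd t - w))^2 + (k i .* w - ph i)^2))"
   by (rule mult_left_mono) simp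
  also have "... = 2 * M2^2 * ((1 / real n) * (SUM i<n. s i)) + 3 / 2 * real T * (Tn (z t j) .* z t j
    + Tn (gd t - w) .* (gd t - w) + (1 / real n) * (SUM i<n. (k i .* w - ph i)^2))"
   unfolding Tn_quadratic sum.distrib sum_distrib_left[symmetric] by (simp add: distrib_left)
  also have "... <= 2 * M2^2 * Nh + 3 / 2 * real T * (Tn (z t j) .* z t j + Tn (gd t - w) .* (gd t - w) + Xi)"
   using pk(2) ph(2) unfolding s_def by (intro add_mono mult_left_mono order_refl) auto
  finally show ?thesis .
 qed
 define V where "V = index_mean n (b * T) (%j. (star l (W T T j))^2)"
 have "V <= (SUM t<T. index_mean n (b * t) (%j. 9 / (real b * real n) * (SUM i<n. (k i .* h t j - y i)^2 * s i)))"
  unfolding V_def s_def by (rule W_variance_le[OF less_imp_le[OF l0] lT(1) pk(1)]) simp_all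
 also have "... <= (SUM t<T. index_mean n (b * t) (%j. 9 / b * (3 / 2 * real T) * (Tn (z t j) .* z t j)
   + 9 / b * (2 * M2^2 * Nh + 3 / 2 * real T * (Tn (gd t - w) .* (gd t - w) + Xi))))"
 proof (intro sum_mono index_mean_mono)
  fix t j
  have "9 / (real b * real n) * (SUM i<n. (k i .* h t j - y i)^2 * s i)
   = 9 / b * ((1 / real n) * (SUM i<n. (k i .* h t j - y i)^2 * s i))" by simp
  also have "... <= 9 / b * (2 * M2^2 * Nh + 3 / 2 * real T * (Tn (z t j) .* z t j + Tn (gd t - w) .* (gd t - w) + Xi))"
   by (intro mult_left_mono pt) simp
  finally show "9 / (real b * real n) * (SUM i<n. (k i .* h t j - y i)^2 * s i) <=
   9 / b * (3 / 2 * real T) * (Tn (z t j) .* z t j)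
   + 9 / b * (2 * M2^2 * Nh + 3 / 2 * real T * (Tn (gd t - w) .* (gd t - w) + Xi))"
   by (simp add: algebra_simps)
 qed
 also have "... = 9 / b * (3 / 2 * real T) * (SUM t<T. index_mean n (b * t) (%j. Tn (z t j) .* z t j))
   + (SUM t<T. 9 / b * (2 * M2^2 * Nh + 3 / 2 * real T * (Tn (gd t - w) .* (gd t - w) + Xi)))"
  by (simp only: index_mean_add index_mean_cmult index_mean_const[OF n] sum.distrib sum_distrib_left[symmetric])
 also have "(SUM t<T. 9 / b * (2 * M2^2 * Nh + 3 / 2 * real T * (Tn (gd t - w) .* (gd t - w) + Xi)))
   = 9 / b * (real T * (2 * M2^2 * Nh) + 3 / 2 * real T * ((SUM t<T. Tn (gd t - w) .* (gd t - w)) + real T * Xi))"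
  unfolding sum_distrib_left[symmetric] sum.distrib by simp
 also have "9 / b * (3 / 2 * real T) * (SUM t<T. index_mean n (b * t) (%j. Tn (z t j) .* z t j))
   + 9 / b * (real T * (2 * M2^2 * Nh) + 3 / 2 * real T * ((SUM t<T. Tn (gd t - w) .* (gd t - w)) + real T * Xi))
  <= 9 / b * (3 / 2 * real T) * (real T * R0 / b)
   + 9 / b * (real T * (2 * M2^2 * Nh) + 3 / 2 * real T * ((2 * (norm u0)^2 / eta + 18 * real T * Th^2) + real T * Xi))"
  by (intro add_mono mult_left_mono sum_z_energy_le[OF R0] gd_sum order_refl) auto
 finally have V: "V <= 9 / b * (3 / 2 * real T) * (real T * R0 / b)
   + 9 / b * (real T * (2 * M2^2 * Nh) + 3 / 2 * real T * ((2 * (norm u0)^2 / eta + 18 * real T * Th^2) + real T * Xi))" .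
 define E where "E = 36 / b * (2 * M2^2 * Nh / T + 3 / 2 * (R0 / b + 2 * l * (norm u0)^2 + 18 * Th^2 + Xi))"
 have EV: "9 / b * (3 / 2 * real T) * (real T * R0 / b)
   + 9 / b * (real T * (2 * M2^2 * Nh) + 3 / 2 * real T * ((2 * (norm u0)^2 / eta + 18 * real T * Th^2) + real T * Xi))
   = (real T / 2)^2 * E"
 proof -
  have "2 * (norm u0)^2 / eta = real T * (2 * l * (norm u0)^2)" using eta Tr by (simp add: l)
  then show ?thesis using Tr b unfolding E_def by (simp add: field_simps power2_eq_square)
 qed
 have VE: "V <= (real T / 2)^2 * E" using V unfolding EV .
 have meanW: "index_mean n (b * T) (%j. star l (W T T j)) <= real T / 2 * sqrt E"
 proof -
  have "(index_mean n (b * T) (%j. star l (W T T j)))^2 <= V" unfolding V_def by (rule index_mean_square_le[OF n])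
  then have "index_mean n (b * T) (%j. star l (W T T j)) <= sqrt ((real T / 2)^2 * E)"
   using VE by (intro real_le_rsqrt) linarith
  then show ?thesis by (simp add: real_sqrt_mult real_sqrt_divide)
 qed
 define D where "D = 2 * c * (2 * sqrt l * norm u0 + 3 * Th) + norm (S w - f) + norm (S w) / T"
 have card: "card {a..T} = T - T div 2" unfolding a_def by simp
 \<comment> \<open>For odd T the tail has (T + 1) / 2 terms, so the weights 2 / T add up to 1 + 1 /
   T; the excess yields the term \<open>norm (S w) / T\<close>.\<close>
 have cT: "real (card {a..T}) <= real T" "0 <= 2 / real T * real (card {a..T}) - 1"
  "2 / real T * real (card {a..T}) - 1 <= 1 / real T"
 proof -
  have "2 * (T - T div 2) <= T + 1" "T <= 2 * (T - T div 2)" "T - T div 2 <= T" by linarith+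
  then have "2 * real (card {a..T}) <= real T + 1" "real T <= 2 * real (card {a..T})" "real (card {a..T}) <= real T"
   unfolding card by linarith+
  moreover have "x <= real T \<and> 0 <= 2 / real T * x - 1 \<and> 2 / real T * x - 1 <= 1 / real T"
   if x: "2 * x <= real T + 1" "real T <= 2 * x" "x <= real T" for x
  proof -
   have "2 / real T * x - 1 = (2 * x - real T) / real T" using Tr by (simp add: field_simps)
   moreover have "(2 * x - real T) / real T <= 1 / real T" using x Tr by (intro divide_right_mono) auto
   ultimately show ?thesis using x Tr by simp
  qed
  ultimately show "real (card {a..T}) <= real T" "0 <= 2 / real T * real (card {a..T}) - 1"
   "2 / real T * real (card {a..T}) - 1 <= 1 / real T" by blast+
 qed
 have point: "norm (S (tail_average (%t. h t j) T) - f) <= 2 / real T * c * star l (W T T j) + D" for j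
 proof -
  let ?g = "SUM t=a..T. gd t - w"
  have "(SUM t=a..T. h t j) = W T T j + ?g + real (card {a..T}) *\<^sub>R w"
   unfolding W_final[OF T] a_def[symmetric] z_def by (simp add: sum.distrib sum_subtractf sum_constant_scaleR)
  then have ta: "tail_average (%t. h t j) T = (2 / real T) *\<^sub>R W T T j + (2 / real T) *\<^sub>R ?g
    + (2 / real T * real (card {a..T})) *\<^sub>R w"
   unfolding tail_average_def a_def[symmetric] by (simp add: scaleR_add_right)
  have "S (tail_average (%t. h t j) T) - f = (2 / real T) *\<^sub>R S (W T T j) + (2 / real T) *\<^sub>R S ?g
    + ((S w - f) + (2 / real T * real (card {a..T}) - 1) *\<^sub>R S w)"
   unfolding ta by (simp add: linear_add[OF S] linear_scale[OF S] scaleR_diff_left)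
  then have "norm (S (tail_average (%t. h t j) T) - f) <= norm ((2 / real T) *\<^sub>R S (W T T j)) + norm ((2 / real T) *\<^sub>R S ?g)
    + (norm (S w - f) + norm ((2 / real T * real (card {a..T}) - 1) *\<^sub>R S w))"
   by (simp only:) (intro norm_triangle_le add_mono norm_triangle_ineq)
  moreover have "norm ((2 / real T) *\<^sub>R S (W T T j)) <= 2 / real T * c * star l (W T T j)"
   using mult_left_mono[OF c(2)[of "W T T j"], of "2 / real T"] Tr by simp
  moreover have "norm ((2 / real T) *\<^sub>R S ?g) <= 2 * c * (2 * sqrt l * norm u0 + 3 * Th)"
  proof -
   let ?B = "2 * sqrt l * norm u0 + 3 * Th"
   have B0: "?B >= 0" using l0 Th0 by simp
   have "star l ?g <= (SUM t=a..T. star l (gd t - w))" by (rule form_norm_sum[OF Cp])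
   also have "... <= (SUM t=a..T. ?B)" by (intro sum_mono star_gd) auto
   also have "... <= real T * ?B" using mult_right_mono[OF cT(1) B0] by simp
   finally have "c * star l ?g <= c * (real T * ?B)" by (rule mult_left_mono) (rule c)
   then have "norm (S ?g) <= c * (real T * ?B)" using c(2)[of ?g] by linarith
   then have "2 / real T * norm (S ?g) <= 2 / real T * (c * (real T * ?B))" using Tr by (intro mult_left_mono) auto
   then show ?thesis using Tr by simp
  qed
  moreover have "norm ((2 / real T * real (card {a..T}) - 1) *\<^sub>R S w) <= norm (S w) / T"
  proof -
   have "\<bar>2 / real T * real (card {a..T}) - 1\<bar> * norm (S w) <= 1 / real T * norm (S w)"
    unfolding abs_of_nonneg[OF cT(2)] by (rule mult_right_mono[OF cT(3)]) simp
   then show ?thesis by simp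
  qed
  ultimately show ?thesis unfolding D_def by linarith
 qed
 have "index_mean n (b * T) (%j. norm (S (tail_average (%t. h t j) T) - f))
  <= index_mean n (b * T) (%j. (2 / real T * c) * star l (W T T j) + D)"
  by (rule index_mean_mono) (rule point)
 also have "... = (2 / real T * c) * index_mean n (b * T) (%j. star l (W T T j)) + D"
  unfolding index_mean_add index_mean_cmult index_mean_const[OF n] ..
 also have "... <= (2 / real T * c) * (real T / 2 * sqrt E) + D"
  using Tr c(1) by (intro add_right_mono mult_left_mono meanW) auto
 also have "... = c * sqrt E + D" using Tr by simp
 finally show ?thesis unfolding E_def D_def u0_def by simp
qed

end

section \<open>The regression model\<close>

lemma has_sum_finite_sum:
 fixes g :: "'i => 'e => real"
 assumes "!!i. (g i has_sum s i) E"
 shows "((%e. SUM i:F. g i e) has_sum (SUM i:F. s i)) E"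
 by (induction F rule: infinite_finite_induct) (auto intro: has_sum_add assms)

text \<open>Both powers are bounded by powers of the larger of x and l.\<close>

lemma powr_le_weighted:
 fixes x l s :: real
 assumes "0 <= x" "0 < l" "0 < s" "s <= 1"
 shows "x powr s * l powr (1 - s) <= x + l"
proof (cases "x <= l")
 case True
 have "x powr s * l powr (1 - s) <= l powr s * l powr (1 - s)"
  using assms True by (intro mult_right_mono powr_mono2) auto
 also have "... = l" using assms by (simp add: powr_add[symmetric])
 finally show ?thesis using assms by simp
next
 case False
 have "x powr s * l powr (1 - s) <= x powr s * x powr (1 - s)"
  using assms False by (intro mult_left_mono powr_mono2) auto
 also have "... = x" using assms False by (simp add: powr_add[symmetric])
 finally show ?thesis using assms by simp
qed

text \<open>The feature vector of a sample point \<open>z\<close> is \<open>a z\<close>, its label \<open>y z\<close>; \<open>S\<close> is the inclusion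
 into \<open>L^2\<close>, \<open>Sa\<close> its adjoint, \<open>f\<close> the class of the regression function \<open>ph\<close>.\<close>

locale regression_model = prob_space rho for rho :: "'z measure" +
 fixes a :: "'z => 'h::{real_inner, banach, second_countable_topology}" and y ph :: "'z => real"
  and S :: "'h => 'l::{real_inner, banach, second_countable_topology}" and Sa :: "'l => 'h" and f :: 'l
  and kap M :: real
 assumes a_meas [measurable]: "a \<in> borel_measurable rho" and a_bound: "!!z. norm (a z) <= kap" and kap: "kap > 0"
  and y_meas [measurable]: "y \<in> borel_measurable rho" and y_bound: "!!z. z \<in> space rho ==> \<bar>y z\<bar> <= M"
  and ph_meas [measurable]: "ph \<in> borel_measurable rho" and ph_bound: "!!z. z \<in> space rho ==> \<bar>ph z\<bar> <= M"
  and M: "M > 0"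
  and S_inner: "!!u v. S u .* S v = (LINT z|rho. (a z .* u) * (a z .* v))"
  and S_linear: "linear S" and S_adj: "!!u v. S u .* v = u .* Sa v"
  and f_y: "!!u. S u .* f = (LINT z|rho. (a z .* u) * y z)"
  and f_dist: "!!u. (norm (S u - f))^2 = (LINT z|rho. (a z .* u - ph z)^2)"
begin

definition "\<Sigma> u = Sa (S u)"
definition "L v = S (Sa v)"

lemma abs_a_inner_le: "\<bar>a z .* u\<bar> <= kap * norm u"
 using Cauchy_Schwarz_ineq2[of "a z" u] mult_right_mono[OF a_bound[of z], of "norm u"] by simp

lemma a_prod_integrable [simp]: "integrable rho (%z. (a z .* u) * (a z .* v))"
proof (rule integrable_const_bound[of _ "(kap * norm u) * (kap * norm v)"])
 show "AE z in rho. norm ((a z .* u) * (a z .* v)) <= (kap * norm u) * (kap * norm v)"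
  using kap by (intro AE_I2) (simp add: abs_mult mult_mono abs_a_inner_le)
qed measurable

lemma a_square_integrable [simp]: "integrable rho (%z. (a z .* u)^2)"
 using a_prod_integrable[of u u] unfolding power2_eq_square .

lemma S_norm_square: "(norm (S u))^2 = (LINT z|rho. (a z .* u)^2)"
 unfolding power2_norm_eq_inner S_inner by (simp add: power2_eq_square)

lemma S_norm_le: "norm (S u) <= kap * norm u"
proof -
 have "(norm (S u))^2 <= (LINT z|rho. (kap * norm u)^2)"
  unfolding S_norm_square
 proof (rule integral_mono)
  show "integrable rho (%z. (a z .* u)^2)" by (rule a_square_integrable)
  show "(a z .* u)^2 <= (kap * norm u)^2" for z
  proof -
   have "\<bar>a z .* u\<bar>^2 <= (kap * norm u)^2" by (rule power_mono[OF abs_a_inner_le]) simp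
   then show ?thesis by (simp only: power2_abs)
  qed
 qed simp
 then have "(norm (S u))^2 <= (kap * norm u)^2" by (simp add: prob_space)
 then show ?thesis by (rule power2_le_imp_le) (use kap in simp)
qed

lemma Sa_linear: "linear Sa"
proof (rule linearI)
 have eqI: "u = v" if "!!w. w .* u = w .* v" for u v :: 'h
 proof -
  have "(u - v) .* (u - v) = 0" using that[of "u - v"] by (simp add: inner_diff_right)
  then show ?thesis by simp
 qed
 show "Sa (u + v) = Sa u + Sa v" for u v by (rule eqI) (simp add: S_adj[symmetric] inner_add_right)
 show "Sa (c *\<^sub>R u) = c *\<^sub>R Sa u" for c u by (rule eqI) (simp add: S_adj[symmetric])
qed

lemma \<Sigma>_inner: "\<Sigma> u .* v = S u .* S v"
 using S_adj[of v "S u"] by (simp add: \<Sigma>_def inner_commute)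

lemma \<Sigma>_positive: "positive_op \<Sigma>"
 unfolding positive_op_def
proof (intro conjI allI)
 show "linear \<Sigma>" unfolding \<Sigma>_def using linear_compose[OF S_linear Sa_linear] by (simp add: o_def)
 show "\<Sigma> u .* v = u .* \<Sigma> v" for u v
  unfolding inner_commute[of u "\<Sigma> v"] \<Sigma>_inner by (rule inner_commute)
qed (simp add: \<Sigma>_inner)

lemma L_inner: "L u .* v = Sa u .* Sa v"
 by (simp add: L_def S_adj)

lemma L_positive: "positive_op L"
 unfolding positive_op_def
proof (intro conjI allI)
 show "linear L" unfolding L_def using linear_compose[OF Sa_linear S_linear] by (simp add: o_def)
 show "L u .* v = u .* L v" for u v
  unfolding inner_commute[of u "L v"] L_inner by (rule inner_commute)
qed (simp add: L_inner)

lemma \<Sigma>_trace: "trace_bounded \<Sigma> (kap^2)"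
 unfolding trace_bounded_def
proof (intro allI impI)
 fix F :: "'h set" assume F: "finite F \<and> orthonormal F"
 have "(SUM e:F. \<Sigma> e .* e) = (LINT z|rho. (SUM e:F. (a z .* e)^2))"
  by (simp add: \<Sigma>_inner S_norm_square flip: power2_norm_eq_inner)
 also have "... <= (LINT z|rho. kap^2)"
 proof (rule integral_mono)
  show "integrable rho (%z. SUM e:F. (a z .* e)^2)" by simp
  show "(SUM e:F. (a z .* e)^2) <= kap^2" for z
  proof -
   have "(SUM e:F. (a z .* e)^2) <= (norm (a z))^2" using F by (intro bessel_finite) auto
   also have "... <= kap^2" by (rule power_mono[OF a_bound]) simp
   finally show ?thesis .
  qed
 qed simp
 finally show "(SUM e:F. \<Sigma> e .* e) <= kap^2" by (simp add: prob_space)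
qed

definition "Eh = eigenbasis \<Sigma>"
definition "sig e = \<Sigma> e .* e"

lemma Eh: "hilbert_basis Eh" and \<Sigma>_eigen: "e \<in> Eh ==> \<Sigma> e = sig e *\<^sub>R e"
 unfolding Eh_def sig_def using spectral_eigenbasis[OF \<Sigma>_positive \<Sigma>_trace] by auto

lemma sig_nonneg: "0 <= sig e"
 unfolding sig_def by (rule positive_opD(3)[OF \<Sigma>_positive])

lemma sig_le: "e \<in> Eh ==> sig e <= kap^2"
 using trace_bounded_quadratic[OF \<Sigma>_positive \<Sigma>_trace, of e] hilbert_basis_orthonormal[OF Eh]
 by (simp add: sig_def orthonormal_def)

lemma sig_summable: "sig summable_on Eh"
proof (rule nonneg_bdd_above_summable_on[OF sig_nonneg])
 show "bdd_above (sum sig ` {F. F \<subseteq> Eh \<and> finite F})"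
  using \<Sigma>_trace orthonormal_subset[OF hilbert_basis_orthonormal[OF Eh]] unfolding trace_bounded_def sig_def
  by (intro bdd_aboveI2[where M = "kap^2"]) auto
qed

lemma S_norm_basis: "(norm (S e))^2 = sig e"
 by (simp add: sig_def \<Sigma>_inner power2_norm_eq_inner)

text \<open>Exchanging the Fourier sums of \<open>Sa f\<close> and \<open>S e\<close> shows that the
  trace of \<open>L\<close> does not exceed that of \<open>\<Sigma>\<close>.\<close>

lemma L_trace: "trace_bounded L (infsum sig Eh)"
 unfolding trace_bounded_def
proof (intro allI impI)
 fix F :: "'l set" assume F: "finite F \<and> orthonormal F"
 have "((%e. SUM f:F. (Sa f .* e)^2) has_sum (SUM f:F. (norm (Sa f))^2)) Eh"
  by (rule has_sum_finite_sum) (rule hilbert_basis_parseval[OF Eh])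
 moreover have "(SUM f:F. (Sa f .* e)^2) <= sig e" for e
 proof -
  have "(SUM f:F. (Sa f .* e)^2) = (SUM f:F. (S e .* f)^2)" unfolding S_adj inner_commute[of "Sa _"] ..
  also have "... <= (norm (S e))^2" using F by (intro bessel_finite) auto
  finally show ?thesis by (simp add: S_norm_basis)
 qed
 ultimately have "(SUM f:F. (norm (Sa f))^2) <= infsum sig Eh"
  by (intro has_sum_mono[OF _ has_sum_infsum[OF sig_summable]])
 then show "(SUM f:F. L f .* f) <= infsum sig Eh" by (simp add: L_inner power2_norm_eq_inner)
qed

section \<open>The regularised square root of the covariance operator\<close>

text \<open>The operator (\<Sigma> + \<lambda>)^(-1/2); its inverse (\<Sigma> + \<lambda>)^(1/2) is
  \<open>Q l\<close>.\<close>

definition "R l = diag Eh (%e. 1 / sqrt (sig e + l))"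
definition "Q l = diag Eh (%e. sqrt (sig e + l))"

context
 fixes l :: real
 assumes l: "l > 0"
begin

lemma R_coeff: "\<bar>1 / sqrt (sig e + l)\<bar> <= 1 / sqrt l"
 using l sig_nonneg[of e] by (simp add: frac_le)

lemma Q_coeff: "e \<in> Eh ==> \<bar>sqrt (sig e + l)\<bar> <= sqrt (kap^2 + l)"
 using l sig_nonneg[of e] sig_le[of e] by simp

lemma R_inner_basis: "e \<in> Eh ==> R l u .* e = 1 / sqrt (sig e + l) * (u .* e)"
 unfolding R_def by (rule diag_inner_basis[OF Eh R_coeff])

lemma Q_inner_basis: "e \<in> Eh ==> Q l u .* e = sqrt (sig e + l) * (u .* e)"
 unfolding Q_def by (rule diag_inner_basis[OF Eh Q_coeff])

lemma R_bounded_linear: "bounded_linear (R l)"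
 unfolding R_def by (rule diag_bounded_linear[OF Eh R_coeff])

lemma R_selfadjoint: "R l u .* v = u .* R l v"
 unfolding R_def by (rule diag_selfadjoint[OF Eh R_coeff])

lemma R_norm_le: "norm (R l u) <= norm u / sqrt l"
proof -
 have "norm (R l u) <= 1 / sqrt l * norm u"
  unfolding R_def by (rule diag_bounded[OF Eh R_coeff]) (use l in simp)
 then show ?thesis by simp
qed

lemma R_norm_square_le: "norm u <= c ==> (norm (R l u))^2 <= c^2 / l"
proof -
 assume "norm u <= c"
 then have "norm (R l u) <= c / sqrt l" using R_norm_le[of u] l divide_right_mono[of "norm u" c "sqrt l"] by simp
 then have "(norm (R l u))^2 <= (c / sqrt l)^2" by (rule power_mono) simp
 then show ?thesis using l by (simp add: power_divide)
qed

lemma inner_eq_Q_R: "p .* q = Q l p .* R l q"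
proof -
 have "((%e. (Q l p .* e) * (R l q .* e)) has_sum Q l p .* R l q) Eh"
  by (rule hilbert_basis_has_sum_inner[OF Eh])
 moreover have "(Q l p .* e) * (R l q .* e) = (p .* e) * (q .* e)" if "e \<in> Eh" for e
 proof -
  have "sqrt (sig e + l) > 0" using l sig_nonneg[of e] by simp
  then show ?thesis by (simp add: Q_inner_basis[OF that] R_inner_basis[OF that])
 qed
 ultimately have "((%e. (p .* e) * (q .* e)) has_sum Q l p .* R l q) Eh"
  by (subst (asm) has_sum_cong) auto
 then show ?thesis using hilbert_basis_has_sum_inner[OF Eh, of p q] has_sum_unique by blast
qed

lemma S_norm_has_sum: "((%e. sig e * (p .* e)^2) has_sum (norm (S p))\<^sup>2) Eh"
proof -
 have "((%e. (\<Sigma> p .* e) * (p .* e)) has_sum \<Sigma> p .* p) Eh" by (rule hilbert_basis_has_sum_inner[OF Eh])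
 moreover have "(\<Sigma> p .* e) * (p .* e) = sig e * (p .* e)^2" if "e \<in> Eh" for e
  using positive_opD(2)[OF \<Sigma>_positive, of p e] \<Sigma>_eigen[OF that] by (simp add: power2_eq_square)
 ultimately show ?thesis
  by (subst (asm) has_sum_cong) (auto simp: \<Sigma>_inner power2_norm_eq_inner)
qed

lemma Q_norm_square: "(norm (Q l p))^2 = (norm (S p))^2 + l * (norm p)^2"
proof -
 have "((%e. sig e * (p .* e)^2 + l * (p .* e)^2) has_sum (norm (S p))\<^sup>2 + l * (norm p)^2) Eh"
  by (intro has_sum_add S_norm_has_sum has_sum_cmult_right hilbert_basis_parseval Eh)
 moreover have "sig e * (p .* e)^2 + l * (p .* e)^2 = (Q l p .* e)^2" if "e \<in> Eh" for e
  using l sig_nonneg[of e] by (simp add: Q_inner_basis[OF that] power_mult_distrib distrib_right)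
 ultimately have "((%e. (Q l p .* e)^2) has_sum (norm (S p))\<^sup>2 + l * (norm p)^2) Eh"
  by (subst (asm) has_sum_cong) auto
 then show ?thesis using hilbert_basis_parseval[OF Eh, of "Q l p"] has_sum_unique by blast
qed

text \<open>Duality between the population norm (|S p|^2 + \<lambda> |p|^2)^(1/2) = |Q p| and |R q|.
  Noise and features are tested against errors through this inequality.\<close>

lemma inner_le_dual: "\<bar>p .* q\<bar> <= sqrt ((norm (S p))^2 + l * (norm p)^2) * norm (R l q)"
proof -
 have "\<bar>p .* q\<bar> <= norm (Q l p) * norm (R l q)" by (subst inner_eq_Q_R) (rule Cauchy_Schwarz_ineq2)
 moreover have "norm (Q l p) = sqrt ((norm (S p))^2 + l * (norm p)^2)" unfolding Q_norm_square[symmetric] by simp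
 ultimately show ?thesis by simp
qed

lemma S_R_norm_square: "e \<in> Eh ==> (norm (S (R l e)))^2 = sig e / (sig e + l)"
proof -
 assume e: "e \<in> Eh"
 have pos: "sig e + l > 0" using l sig_nonneg[of e] by simp
 have Re: "R l e = (1 / sqrt (sig e + l)) *\<^sub>R e"
  by (rule hilbert_basis_eqI[OF Eh])
   (use orthonormal_inner[OF hilbert_basis_orthonormal[OF Eh] e] in \<open>auto simp: R_inner_basis\<close>)
 have "(norm (S (R l e)))^2 = (1 / sqrt (sig e + l))^2 * (norm (S e))^2"
  by (simp only: Re linear_scale[OF S_linear] norm_scaleR power_mult_distrib power2_abs)
 then show ?thesis using pos by (simp add: S_norm_basis power_divide)
qed

definition "N = (\<Sum>\<^sub>\<infinity>e\<in>Eh. sig e / (sig e + l))"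

lemma N_summable: "(%e. sig e / (sig e + l)) summable_on Eh"
proof (rule summable_on_comparison_test)
 show "(%e. (1 / l) * sig e) summable_on Eh" by (intro summable_on_cmult_right sig_summable)
 show "sig e / (sig e + l) <= (1 / l) * sig e" "0 <= sig e / (sig e + l)" for e
  using l sig_nonneg[of e] by (auto simp: frac_le)
qed

lemma N_partial: "finite F ==> F \<subseteq> Eh ==> (SUM e:F. sig e / (sig e + l)) <= N"
 unfolding N_def using l sig_nonneg by (intro finite_sum_le_infsum N_summable) (auto simp: add_nonneg_nonneg)

text \<open>\<open>op_trace\<close> sums over some basis of the L2 space, \<open>N\<close> over the
  eigenbasis of \<open>\<Sigma>\<close>. Each term L (L + \<lambda>)^(-1) g .* g equals |R (Sa
  g)|^2, and exchanging the Hilbert-Schmidt sums moves from one basis to the other.\<close>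

lemma effective_dim_eq: "effective_dim L l = N"
proof -
 let ?F = "SOME E :: 'l set. hilbert_basis E"
 have F: "hilbert_basis ?F" by (rule someI_ex[OF hilbert_basis_exists])
 note Lq = trace_bounded_quadratic[OF L_positive L_trace]
 \<comment> \<open>\<open>effective_dim\<close> is stated with the function inverse, which is the
   resolvent because the map is injective.\<close>
 have inj: "inj (%u. L u + l *\<^sub>R u)"
 proof (rule injI)
  fix u v assume e: "L u + l *\<^sub>R u = L v + l *\<^sub>R v"
  have "L (u - v) + l *\<^sub>R (u - v) = 0"
   using e by (simp add: linear_diff[OF positive_opD(1)[OF L_positive]] algebra_simps)
  then have "(L (u - v) + l *\<^sub>R (u - v)) .* (u - v) = 0" by simp
  then have "L (u - v) .* (u - v) + l * (norm (u - v))^2 = 0" by (simp add: inner_add_left power2_norm_eq_inner)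
  moreover have "0 <= l * (norm (u - v))^2" using l by simp
  ultimately have "l * (norm (u - v))^2 = 0" using positive_opD(3)[OF L_positive, of "u - v"] by linarith
  then show "u = v" using l by simp
 qed
 have key: "(L \<circ> inv (%u. L u + l *\<^sub>R u)) g .* g = (norm (R l (Sa g)))^2" for g
 proof -
  obtain h where h: "L h + l *\<^sub>R h = g"
   using positive_op_resolvent_surj[OF L_positive Lq trace_bounded_nonneg[OF L_trace] l] by blast
  have "inv (%u. L u + l *\<^sub>R u) g = h" using inv_f_f[OF inj, of h] h by simp
  then have "(L \<circ> inv (%u. L u + l *\<^sub>R u)) g .* g = Sa h .* Sa g" by (simp add: L_inner)
  moreover have "((%e. (R l (Sa g) .* e)^2) has_sum (norm (R l (Sa g)))\<^sup>2) Eh"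
   by (rule hilbert_basis_parseval[OF Eh])
  moreover have "(R l (Sa g) .* e)^2 = (Sa h .* e) * (Sa g .* e)" if e: "e \<in> Eh" for e
  proof -
   have pos: "sig e + l > 0" using l sig_nonneg[of e] by simp
   have "Sa g = \<Sigma> (Sa h) + l *\<^sub>R Sa h"
    unfolding h[symmetric] by (simp add: linear_add[OF Sa_linear] linear_scale[OF Sa_linear] \<Sigma>_def L_def)
   then have "Sa g .* e = (sig e + l) * (Sa h .* e)"
    using positive_opD(2)[OF \<Sigma>_positive, of "Sa h" e] \<Sigma>_eigen[OF e] by (simp add: inner_add_left algebra_simps)
   then show ?thesis using pos by (simp add: R_inner_basis[OF e] power_mult_distrib power_divide power2_eq_square)
  qed
  ultimately have "((%e. (Sa h .* e) * (Sa g .* e)) has_sum (norm (R l (Sa g)))\<^sup>2) Eh"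
   by (subst (asm) has_sum_cong) auto
  then show ?thesis using hilbert_basis_has_sum_inner[OF Eh, of "Sa h" "Sa g"] has_sum_unique
   \<open>(L \<circ> inv (%u. L u + l *\<^sub>R u)) g .* g = Sa h .* Sa g\<close> by metis
 qed
 have "((%g. (norm (R l (Sa g)))^2) has_sum (\<Sum>\<^sub>\<infinity>e\<in>Eh. (norm (S (R l e)))^2)) ?F"
 proof (rule hilbert_schmidt_swap[OF Eh F])
  show "R l (Sa g) .* e = g .* S (R l e)" for e g
   using S_adj[of "R l e" g] R_selfadjoint[of "Sa g" e] by (simp add: inner_commute)
  show "(%e. (norm (S (R l e)))^2) summable_on Eh"
   using N_summable by (rule summable_on_cong[THEN iffD1, rotated]) (simp add: S_R_norm_square)
 qed
 moreover have "(\<Sum>\<^sub>\<infinity>e\<in>Eh. (norm (S (R l e)))^2) = N"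
  unfolding N_def by (rule infsum_cong) (rule S_R_norm_square)
 ultimately show ?thesis
  unfolding effective_dim_def op_trace_def key using infsumI by metis
qed

end

section \<open>The source condition\<close>

context
 fixes r Rad :: real and h :: 'l and l :: real
 assumes r: "0 < r" "r <= 1 / 2" and src: "f = op_powr L r h" and h: "norm h <= Rad" and l: "l > 0"
begin

abbreviation "EL \<equiv> eigenbasis L"

lemma EL: "hilbert_basis EL" and L_eigen: "e \<in> EL ==> L e = (L e .* e) *\<^sub>R e"
 using spectral_eigenbasis[OF L_positive L_trace] by auto

lemma L_eigenvalue: "0 <= L e .* e" by (rule positive_opD(3)[OF L_positive])

lemma L_eigenvalue_le: "e \<in> EL ==> L e .* e <= infsum sig Eh"
 using trace_bounded_quadratic[OF L_positive L_trace, of e] hilbert_basis_orthonormal[OF EL]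
 by (simp add: orthonormal_def)

lemma f_coeff: "e \<in> EL ==> f .* e = (L e .* e) powr r * (h .* e)"
proof -
 have "\<bar>(L e .* e) powr r\<bar> <= (infsum sig Eh) powr r" if "e \<in> EL" for e
  using L_eigenvalue[of e] L_eigenvalue_le[OF that] r by (simp add: powr_mono2)
 from diag_inner_basis[OF EL this] show "e \<in> EL ==> f .* e = (L e .* e) powr r * (h .* e)"
  unfolding src op_powr_eq_diag .
qed

lemma resolvent_coeff: "\<bar>1 / ((L e .* e) + l)\<bar> <= 1 / l"
 using l L_eigenvalue[of e] by (simp add: frac_le)

text \<open>\<open>g\<close> is (L + \<lambda>)^(-1) f, and \<open>w\<close> = Sa g = (\<Sigma> +
  \<lambda>)^(-1) (Sa f) is the Tikhonov solution, an element of the RKHS even if f is not in the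
  range of \<open>S\<close>.\<close>

definition "g = diag EL (%e. 1 / ((L e .* e) + l)) f"
definition "w = Sa g"

lemma g_coeff: "e \<in> EL ==> g .* e = 1 / ((L e .* e) + l) * (f .* e)"
 unfolding g_def by (rule diag_inner_basis[OF EL resolvent_coeff])

lemma L_coeff: "e \<in> EL ==> L u .* e = (L e .* e) * (u .* e)"
 using positive_opD(2)[OF L_positive, of u e] L_eigen[of e] by (metis inner_scaleR_right)

lemma resolvent_eq: "L g + l *\<^sub>R g = f"
proof (rule hilbert_basis_eqI[OF EL])
 fix e assume e: "e \<in> EL"
 have "(L e .* e) + l > 0" using l L_eigenvalue[of e] by simp
 then show "(L g + l *\<^sub>R g) .* e = f .* e"
  unfolding inner_add_left inner_scaleR_left L_coeff[OF e, of g] g_coeff[OF e] distrib_right[symmetric] by simp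
qed

lemma S_w_minus_f: "S w - f = - (l *\<^sub>R g)"
 using resolvent_eq by (simp add: w_def L_def algebra_simps)

lemma residual_eq: "Sa f - \<Sigma> w = l *\<^sub>R w"
proof -
 have fw: "f - S w = l *\<^sub>R g" using resolvent_eq by (simp add: w_def L_def algebra_simps)
 have "Sa f - \<Sigma> w = Sa (f - S w)"
  by (simp add: \<Sigma>_def linear_diff[OF Sa_linear])
 then show ?thesis by (simp only: fw linear_scale[OF Sa_linear] w_def[symmetric])
qed

text \<open>In the eigenbasis of \<open>L\<close> the symbol is \<lambda> x^r / (x + \<lambda>), at
  most \<lambda>^r because x^r \<lambda>^(1-r) <= x + \<lambda>.\<close>

lemma approximation_error: "norm (S w - f) <= l powr r * Rad"
proof -
 let ?\<psi> = "%e. l * (L e .* e) powr r / ((L e .* e) + l)"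
 have b: "\<bar>?\<psi> e\<bar> <= l powr r" for e
 proof -
  have pos: "(L e .* e) + l > 0" using l L_eigenvalue[of e] by simp
  have "(L e .* e) powr r * l powr (1 - r) <= (L e .* e) + l"
   by (rule powr_le_weighted) (use l L_eigenvalue r in auto)
  then have "l powr r * ((L e .* e) powr r * l powr (1 - r)) <= l powr r * ((L e .* e) + l)"
   by (rule mult_left_mono) simp
  moreover have "l powr r * ((L e .* e) powr r * l powr (1 - r)) = l * (L e .* e) powr r"
   using l by (simp add: powr_diff)
  ultimately show ?thesis using pos l by (simp add: divide_le_eq)
 qed
 have "l *\<^sub>R g = diag EL ?\<psi> h"
  by (rule hilbert_basis_eqI[OF EL]) (simp add: diag_inner_basis[OF EL b] g_coeff f_coeff)
 then have "norm (l *\<^sub>R g) <= l powr r * norm h" using diag_bounded[OF EL b] by simp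
 also have "... <= l powr r * Rad" by (intro mult_left_mono h) simp
 finally show ?thesis by (simp add: S_w_minus_f)
qed

text \<open>|w|^2 = L g .* g, so the symbol is x^(1/2+r) / (x + \<lambda>), at most
  \<lambda>^(r-1/2). The exponent 1/2 + r must not exceed 1, which is the condition r <=
  1/2.\<close>

lemma w_norm_le: "norm w <= l powr (r - 1 / 2) * Rad"
proof -
 let ?\<psi> = "%e. sqrt (L e .* e) * (L e .* e) powr r / ((L e .* e) + l)"
 have b: "\<bar>?\<psi> e\<bar> <= l powr (r - 1 / 2)" for e
 proof -
  have pos: "(L e .* e) + l > 0" using l L_eigenvalue[of e] by simp
  have "(L e .* e) powr (1 / 2 + r) * l powr (1 - (1 / 2 + r)) <= (L e .* e) + l"
   by (rule powr_le_weighted) (use l L_eigenvalue r in auto)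
  then have k1: "l powr (r - 1 / 2) * ((L e .* e) powr (1 / 2 + r) * l powr (1 - (1 / 2 + r))) <= l powr (r - 1 / 2) * ((L e .* e) + l)"
   by (rule mult_left_mono) simp
  have k2: "l powr (r - 1 / 2) * ((L e .* e) powr (1 / 2 + r) * l powr (1 - (1 / 2 + r))) = (L e .* e) powr (1 / 2 + r)"
  proof -
   have "l powr (r - 1 / 2) * l powr (1 - (1 / 2 + r)) = 1"
    unfolding powr_add[symmetric] using l by simp
   then show ?thesis by simp
  qed
  have k3: "(L e .* e) powr (1 / 2 + r) = sqrt (L e .* e) * (L e .* e) powr r"
   using L_eigenvalue[of e] by (simp add: powr_add powr_half_sqrt)
  have "sqrt (L e .* e) * (L e .* e) powr r <= l powr (r - 1 / 2) * ((L e .* e) + l)"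
   using k1[unfolded k2] unfolding k3 .
  then have "?\<psi> e <= l powr (r - 1 / 2)" using pos by (simp add: divide_le_eq)
  moreover have "0 <= ?\<psi> e" using pos L_eigenvalue[of e] by simp
  ultimately show ?thesis by (simp only: abs_of_nonneg)
 qed
 have "((%e. (L g .* e) * (g .* e)) has_sum L g .* g) EL" by (rule hilbert_basis_has_sum_inner[OF EL])
 moreover have "(L g .* e) * (g .* e) = (?\<psi> e * (h .* e))^2" if e: "e \<in> EL" for e
 proof -
  define A where "A = L e .* e"
  have "A * (1 / (A + l) * (A powr r * (h .* e))) * (1 / (A + l) * (A powr r * (h .* e)))
   = (sqrt A)^2 * (A powr r)^2 / (A + l)^2 * (h .* e)^2"
   using L_eigenvalue[of e] by (simp add: A_def[symmetric] power2_eq_square)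
  then show ?thesis
   unfolding L_coeff[OF e, of g] g_coeff[OF e] f_coeff[OF e] A_def by (simp add: power_mult_distrib power_divide)
 qed
 ultimately have "((%e. (?\<psi> e * (h .* e))^2) has_sum L g .* g) EL"
  by (subst (asm) has_sum_cong) auto
 moreover have "((%e. (?\<psi> e * (h .* e))^2) has_sum (norm (diag EL ?\<psi> h))\<^sup>2) EL"
  by (rule diag_norm_has_sum[OF EL]) (rule b)
 ultimately have "L g .* g = (norm (diag EL ?\<psi> h))^2" by (rule has_sum_unique)
 then have "(norm w)^2 = (norm (diag EL ?\<psi> h))^2" unfolding w_def L_inner power2_norm_eq_inner .
 then have "norm w = norm (diag EL ?\<psi> h)" by (simp add: power2_eq_iff_nonneg)
 also have "... <= l powr (r - 1 / 2) * norm h"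
 proof (rule diag_bounded[OF EL])
  show "\<bar>?\<psi> e\<bar> <= l powr (r - 1 / 2)" for e by (rule b)
 qed simp
 also have "... <= l powr (r - 1 / 2) * Rad" by (intro mult_left_mono h) simp
 finally show ?thesis .
qed

end

end

context regression_model
begin

section \<open>Finite-dimensional truncations\<close>

text \<open>Initial segments of an enumeration of the eigenbasis; for a finite basis they are
  eventually the whole basis.\<close>

definition "Ed d = {e \<in> Eh. to_nat_on Eh e < d}"

lemma Eh_countable: "countable Eh"
 by (rule orthonormal_countable[OF hilbert_basis_orthonormal[OF Eh]])

lemma Ed_finite: "finite (Ed d)"
proof (rule finite_imageD)
 show "finite (to_nat_on Eh ` Ed d)" by (rule finite_subset[of _ "{..<d}"]) (auto simp: Ed_def)
 show "inj_on (to_nat_on Eh) (Ed d)"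
  by (rule inj_on_subset[OF inj_on_to_nat_on[OF Eh_countable]]) (auto simp: Ed_def)
qed

lemma Ed_subset: "Ed d \<subseteq> Eh"
 by (auto simp: Ed_def)

lemma Ed_eventually:
 assumes "finite F" "F \<subseteq> Eh"
 shows "eventually (%d. F \<subseteq> Ed d) sequentially"
proof -
 have "\<forall>e\<in>F. eventually (%d. e \<in> Ed d) sequentially"
  using assms(2) by (auto simp: Ed_def eventually_gt_at_top subset_iff)
 then have "eventually (%d. \<forall>e\<in>F. e \<in> Ed d) sequentially" by (simp add: eventually_ball_finite_distrib assms(1))
 then show ?thesis by (rule eventually_mono) blast
qed

lemma Ed_tendsto:
 assumes "(t has_sum s) Eh"
 shows "(%d. sum t (Ed d)) \<longlonglongrightarrow> s"
proof -
 have "filterlim Ed (finite_subsets_at_top Eh) sequentially"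
  unfolding filterlim_finite_subsets_at_top
  using Ed_finite Ed_subset by (auto intro: eventually_mono[OF Ed_eventually])
 with assms[unfolded has_sum_def] show ?thesis by (rule filterlim_compose)
qed

lemma Ed_orthonormal: "orthonormal (Ed d)"
 by (rule orthonormal_subset[OF hilbert_basis_orthonormal[OF Eh] Ed_subset])

lemma R_a_measurable [measurable]: "l > 0 ==> (%z. R l (a z)) \<in> borel_measurable rho"
 by (rule measurable_compose[OF a_meas])
  (intro borel_measurable_continuous_onI linear_continuous_on R_bounded_linear)

text \<open>The mean of |R a|^2 is the trace of \<Sigma> (\<Sigma> + \<lambda>)^(-1). One inequality
  is enough, and Fatou's lemma gives it from the truncations.\<close>

lemma R_second_moment_nn:
 assumes l: "l > 0"
 shows "(\<integral>\<^sup>+z. ennreal ((norm (R l (a z)))^2) \<partial>rho) <= ennreal (N l)"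
proof -
 have "(\<integral>\<^sup>+z. ennreal ((norm (R l (a z)))^2) \<partial>rho)
   = (\<integral>\<^sup>+z. liminf (%d. ennreal (SUM e:Ed d. (R l (a z) .* e)^2)) \<partial>rho)"
 proof (rule nn_integral_cong)
  fix z
  have "(%d. SUM e:Ed d. (R l (a z) .* e)^2) \<longlonglongrightarrow> (norm (R l (a z)))\<^sup>2"
   by (rule Ed_tendsto) (rule hilbert_basis_parseval[OF Eh])
  then have "(%d. ennreal (SUM e:Ed d. (R l (a z) .* e)^2)) \<longlonglongrightarrow> ennreal ((norm (R l (a z)))^2)"
   by (rule tendsto_ennrealI)
  then show "ennreal ((norm (R l (a z)))^2) = liminf (%d. ennreal (SUM e:Ed d. (R l (a z) .* e)^2))"
   by (intro lim_imp_Liminf[symmetric]) auto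
 qed
 also have "... <= liminf (%d. \<integral>\<^sup>+z. ennreal (SUM e:Ed d. (R l (a z) .* e)^2) \<partial>rho)"
  using l by (intro nn_integral_liminf) measurable
 also have "... <= liminf (%d. ennreal (N l))"
 proof (rule Liminf_mono, rule always_eventually, rule allI)
  fix d
  have "(\<integral>\<^sup>+z. ennreal (SUM e:Ed d. (R l (a z) .* e)^2) \<partial>rho) = (\<integral>\<^sup>+z. ennreal (SUM e:Ed d. (a z .* R l e)^2) \<partial>rho)"
   by (simp only: R_selfadjoint[OF l])
  also have "... = ennreal (LINT z|rho. (SUM e:Ed d. (a z .* R l e)^2))"
   by (rule nn_integral_eq_integral) (auto intro!: sum_nonneg)
  also have "(LINT z|rho. (SUM e:Ed d. (a z .* R l e)^2)) = (SUM e:Ed d. (norm (S (R l e)))^2)"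
   by (simp add: S_norm_square)
  also have "... = (SUM e:Ed d. sig e / (sig e + l))"
   using Ed_subset by (intro sum.cong refl S_R_norm_square[OF l]) auto
  also have "... <= N l" by (rule N_partial[OF l Ed_finite Ed_subset])
  finally show "(\<integral>\<^sup>+z. ennreal (SUM e:Ed d. (R l (a z) .* e)^2) \<partial>rho) <= ennreal (N l)" by (simp add: ennreal_leI)
 qed
 also have "... = ennreal (N l)" by (simp add: Liminf_const)
 finally show ?thesis .
qed

lemma R_a_norm_square_le: "l > 0 ==> (norm (R l (a z)))^2 <= kap^2 / l"
 by (rule R_norm_square_le[OF _ a_bound])

lemma R_a_integrable: "l > 0 ==> integrable rho (%z. (norm (R l (a z)))^2)"
 by (rule integrable_const_bound[of _ "kap^2 / l"]) (auto simp: R_a_norm_square_le)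

lemma N_nonneg: "l > 0 ==> 0 <= N l"
 using N_partial[of l "{}"] by simp

lemma R_second_moment: "l > 0 ==> (LINT z|rho. (norm (R l (a z)))^2) <= N l"
 using R_second_moment_nn[of l] nn_integral_eq_integral[OF R_a_integrable, of l] N_nonneg[of l]
 by (simp add: ennreal_le_iff)

section \<open>Concentration of the empirical covariance operator\<close>

definition "ze l d z = (SUM e:Ed d. (1 / sqrt (sig e + l) * (a z .* e)) *\<^sub>R e)"
definition "Mo l d u = (SUM e:Ed d. (sig e / (sig e + l) * (u .* e)) *\<^sub>R e)"

lemma rank_one_sample:
 assumes l: "l > 0" and n: "n > 0"
 shows "rank_one_sample rho (ze l d) (Ed d) (Mo l d) (max 1 (kap^2 / l)) n"
proof
 note oE = orthonormal_inner_sum[OF Ed_orthonormal subset_refl Ed_finite]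
 have pos: "sig e + l > 0" for e using l sig_nonneg[of e] by simp
 show "ze l d \<in> borel_measurable rho" unfolding ze_def by measurable
 show "orthonormal (Ed d)" "finite (Ed d)" by (rule Ed_orthonormal Ed_finite)+
 show "ze l d x = (SUM f:Ed d. (ze l d x .* f) *\<^sub>R f)" for x
  unfolding ze_def by (rule sum.cong[OF refl]) (simp add: oE)
 show "(norm (ze l d x))^2 <= max 1 (kap^2 / l)" for x
 proof -
  have "(norm (ze l d x))^2 = (SUM e:Ed d. (1 / sqrt (sig e + l) * (a x .* e))^2)"
   unfolding ze_def by (rule orthonormal_norm_sum[OF Ed_orthonormal Ed_finite])
  also have "... <= (SUM e:Ed d. 1 / l * (a x .* e)^2)"
  proof (rule sum_mono)
   fix e
   have "(1 / sqrt (sig e + l))^2 <= 1 / l" using pos[of e] sig_nonneg[of e] l by (simp add: power_divide frac_le)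
   then show "(1 / sqrt (sig e + l) * (a x .* e))^2 <= 1 / l * (a x .* e)^2"
    unfolding power_mult_distrib by (rule mult_right_mono) simp
  qed
  also have "... = 1 / l * (SUM e:Ed d. (a x .* e)^2)" by (rule sum_distrib_left[symmetric])
  also have "... <= 1 / l * kap^2"
  proof (rule mult_left_mono)
   have "(SUM e:Ed d. (a x .* e)^2) <= (norm (a x))^2" by (rule bessel_finite[OF Ed_orthonormal Ed_finite])
   also have "... <= kap^2" by (rule power_mono[OF a_bound]) simp
   finally show "(SUM e:Ed d. (a x .* e)^2) <= kap^2" .
  qed (use l in simp)
  finally show ?thesis by simp
 qed
 show "1 <= max 1 (kap^2 / l)" "0 < n" using n by auto
 have Mo_inner: "Mo l d u .* v = (SUM e:Ed d. sig e / (sig e + l) * (u .* e) * (v .* e))" for u v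
  unfolding Mo_def inner_sum_left inner_scaleR_left inner_commute[of v] ..
 show "selfadjoint_on (Ed d) (Mo l d)"
  unfolding selfadjoint_on_def
 proof (intro conjI allI)
  show "linear (Mo l d)"
  proof (rule linearI)
   show "Mo l d (u + v) = Mo l d u + Mo l d v" for u v
    unfolding Mo_def inner_add_left distrib_left scaleR_add_left sum.distrib ..
   show "Mo l d (c *\<^sub>R u) = c *\<^sub>R Mo l d u" for c u
    unfolding Mo_def by (simp add: scaleR_sum_right mult.left_commute)
  qed
  show "Mo l d u .* v = u .* Mo l d v" for u v
   unfolding inner_commute[of u "Mo l d v"] Mo_inner by (rule sum.cong) simp_all
  show "Mo l d u = (SUM f:Ed d. (Mo l d u .* f) *\<^sub>R f)" for u
   unfolding Mo_def by (rule sum.cong[OF refl]) (simp add: oE)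
 qed
 show "0 <= Mo l d u .* u" for u
  unfolding Mo_inner using pos sig_nonneg
  by (intro sum_nonneg) (simp add: mult.assoc less_imp_le)
 show "Mo l d u .* u <= (norm u)^2" for u
 proof -
  have "Mo l d u .* u <= (SUM e:Ed d. (u .* e)^2)"
   unfolding Mo_inner
  proof (rule sum_mono)
   fix e
   have "sig e / (sig e + l) <= 1" using pos[of e] l by simp
   from mult_right_mono[OF this, of "(u .* e)^2"]
   show "sig e / (sig e + l) * (u .* e) * (u .* e) <= (u .* e)^2" by (simp add: power2_eq_square)
  qed
  also have "... <= (norm u)^2" by (rule bessel_finite[OF Ed_orthonormal Ed_finite])
  finally show ?thesis .
 qed
 show "(LINT x|rho. (ze l d x .* u) * (ze l d x .* v)) = Mo l d u .* v" for u v
 proof -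
  \<comment> \<open>The truncated whitening is symmetric; moving it to \<open>u\<close> reduces the
    claim to the covariance of \<open>a\<close>.\<close>
  define t where "t u = (SUM e:Ed d. (1 / sqrt (sig e + l) * (u .* e)) *\<^sub>R e)" for u
  have zt: "ze l d x .* u = a x .* t u" for x u
   unfolding ze_def t_def by (simp add: inner_sum_left inner_sum_right inner_commute mult.commute mult.left_commute)
  have "(LINT x|rho. (ze l d x .* u) * (ze l d x .* v)) = \<Sigma> (t u) .* t v" unfolding zt \<Sigma>_inner S_inner ..
  also have "\<Sigma> (t u) = (SUM e:Ed d. (1 / sqrt (sig e + l) * (u .* e) * sig e) *\<^sub>R e)"
   unfolding t_def using Ed_subset
   by (simp add: linear_sum[OF positive_opD(1)[OF \<Sigma>_positive]] linear_scale[OF positive_opD(1)[OF \<Sigma>_positive]])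
    (intro sum.cong refl, use \<Sigma>_eigen in force)
  also have "... .* t v = (SUM e:Ed d. 1 / sqrt (sig e + l) * (u .* e) * sig e * (1 / sqrt (sig e + l) * (v .* e)))"
  proof -
   have "e .* t v = 1 / sqrt (sig e + l) * (v .* e)" if "e \<in> Ed d" for e
    unfolding inner_commute[of e] t_def using that by (simp add: oE)
   then show ?thesis by (simp add: inner_sum_left)
  qed
  also have "... = Mo l d u .* v"
   unfolding Mo_inner
  proof (rule sum.cong[OF refl])
   fix e
   have "1 / sqrt (sig e + l) * (1 / sqrt (sig e + l)) = 1 / (sig e + l)" using pos[of e] by simp
   then show "1 / sqrt (sig e + l) * (u .* e) * sig e * (1 / sqrt (sig e + l) * (v .* e)) = sig e / (sig e + l) * (u .* e) * (v .* e)"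
   proof -
    assume t: "1 / sqrt (sig e + l) * (1 / sqrt (sig e + l)) = 1 / (sig e + l)"
    have "1 / sqrt (sig e + l) * (u .* e) * sig e * (1 / sqrt (sig e + l) * (v .* e))
     = (1 / sqrt (sig e + l) * (1 / sqrt (sig e + l))) * (sig e * (u .* e) * (v .* e))"
     by (simp only: mult_ac)
    then show ?thesis unfolding t by simp
   qed
  qed
  finally show ?thesis .
 qed
qed

text \<open>Fatou's lemma passes from the truncations, whose moments are bounded uniformly, to the full
 operator.\<close>

theorem operator_event:
 fixes n k :: nat
 assumes l: "l > 0" and n: "n > 0" and B: "B = max 1 (kap^2 / l)" and nB: "4 * real (2 ^ k) * B <= n"
 shows "\<exists>G\<in>sets (iid n rho).
  measure (iid n rho) G >= 1 - 4 ^ (2 ^ k) * (36 * real (2 ^ k) * B / n) ^ (2 ^ k) * N l \<and>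
  (\<forall>z\<in>G. \<forall>u. (norm (S u))^2 <= 2 * ((1 / n) * (SUM i<n. (a (z i) .* u)^2)) + l * (norm u)^2)"
proof -
 let ?P = "iid n rho"
 define p :: nat where "p = 2 ^ k"
 obtain q where q: "p = Suc q" using not0_implies_Suc[of p] by (auto simp: p_def)
 interpret PI: prob_space ?P by (intro prob_space_PiM prob_space_axioms)
 interpret T: rank_one_sample rho "ze l d" "Ed d" "Mo l d" B n for d
  unfolding B by (rule rank_one_sample[OF l n])
 have nr: "real n > 0" using n by simp
 define Z where "Z d z = (SUM e:Ed d. (norm ((T.X d {..<n} z ^^ p) e))^2)" for d z
 define K where "K = (36 * real p * B / n) ^ p * N l"
 \<comment> \<open>A squared Hilbert-Schmidt norm of X^p below (1/2)^(2p) forces |X| <= 1/2.\<close>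
 define c where "c = (1 / 4 :: real) ^ p"
 have B1: "B >= 1" by (simp add: B)
 have Zm: "Z d \<in> borel_measurable ?P" for d
  unfolding Z_def by (intro borel_measurable_sum borel_measurable_power
    borel_measurable_norm[THEN measurable_compose[rotated]] T.X_funpow_measurable order_refl)
 have Zi: "integrable ?P (Z d)" for d
  unfolding Z_def by (intro Bochner_Integration.integrable_sum T.integrable_hs order_refl)
 have Z0: "0 <= Z d z" for d z unfolding Z_def by (intro sum_nonneg) simp
 have EZ: "(\<integral>z. Z d z \<partial>?P) <= K" for d
 proof -
  have "T.m d (Suc q) {..<n} <= (36 * real p * B / n) ^ Suc q * T.tr d"
   by (rule T.trace_moment_le) (use nB q in \<open>auto simp: p_def[symmetric]\<close>)
  then have "T.m d p {..<n} <= (36 * real p * B / n) ^ p * T.tr d" by (simp only: q[symmetric])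
  moreover have "T.tr d <= N l"
  proof -
   have "T.tr d = (SUM e:Ed d. sig e / (sig e + l))"
    unfolding T.tr_def
   proof (rule sum.cong[OF refl])
    fix e assume e: "e \<in> Ed d"
    have "e .* e = 1" using orthonormal_inner[OF Ed_orthonormal e e] by simp
    then show "Mo l d e .* e = sig e / (sig e + l)"
     unfolding Mo_def orthonormal_inner_sum[OF Ed_orthonormal subset_refl Ed_finite e] using e by simp
   qed
   then show ?thesis using N_partial[OF l Ed_finite Ed_subset] by simp
  qed
  moreover have "0 <= (36 * real p * B / n) ^ p" using B1 by simp
  ultimately have "T.m d p {..<n} <= (36 * real p * B / n) ^ p * N l"
   using mult_left_mono[of "T.tr d" "N l" "(36 * real p * B / n) ^ p"] by linarith
  then show ?thesis unfolding T.m_def Z_def K_def .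
 qed
 define Zl where "Zl z = liminf (%d. ennreal (Z d z))" for z
 note Zm [measurable]
 have Zlm [measurable]: "Zl \<in> borel_measurable ?P" unfolding Zl_def by measurable
 have "0 <= (\<integral>z. Z 0 z \<partial>?P)" by (rule integral_nonneg_AE) (simp add: Z0)
 then have K0: "K >= 0" using EZ[of 0] by linarith
 have "(\<integral>\<^sup>+z. Zl z \<partial>?P) <= liminf (%d. \<integral>\<^sup>+z. ennreal (Z d z) \<partial>?P)"
  unfolding Zl_def by (intro nn_integral_liminf) measurable
 also have "... <= liminf (%d. ennreal K)"
 proof (rule Liminf_mono, rule always_eventually, rule allI)
  fix d
  have "(\<integral>\<^sup>+z. ennreal (Z d z) \<partial>?P) = ennreal (\<integral>z. Z d z \<partial>?P)"
   by (rule nn_integral_eq_integral[OF Zi]) (simp add: Z0)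
  then show "(\<integral>\<^sup>+z. ennreal (Z d z) \<partial>?P) <= ennreal K" by (simp only: ennreal_leI[OF EZ])
 qed
 also have "... = ennreal K" by (simp add: Liminf_const)
 finally have EZl: "(\<integral>\<^sup>+z. Zl z \<partial>?P) <= ennreal K" .
 define G where "G = {z \<in> space ?P. Zl z < ennreal c}"
 have c0: "c > 0" by (simp add: c_def)
 have G: "G \<in> sets ?P" unfolding G_def by measurable
 have "emeasure ?P (space ?P - G) <= emeasure ?P {z \<in> space ?P. 1 <= ennreal (1 / c) * Zl z}"
 proof (rule emeasure_mono)
  show "space ?P - G \<subseteq> {z \<in> space ?P. 1 <= ennreal (1 / c) * Zl z}"
  proof
   fix z assume z: "z \<in> space ?P - G"
   then have "ennreal c <= Zl z" by (auto simp: G_def not_less)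
   then have "ennreal (1 / c) * ennreal c <= ennreal (1 / c) * Zl z" by (rule mult_left_mono) simp
   moreover have "ennreal (1 / c) * ennreal c = 1" using c0 by (simp add: ennreal_mult[symmetric])
   ultimately show "z \<in> {z \<in> space ?P. 1 <= ennreal (1 / c) * Zl z}" using z by simp
  qed
  show "{z \<in> space ?P. 1 <= ennreal (1 / c) * Zl z} \<in> sets ?P" by measurable
 qed
 also have "... <= ennreal (1 / c) * (\<integral>\<^sup>+z. Zl z * indicator (space ?P) z \<partial>?P)"
  by (rule nn_integral_Markov_inequality) auto
 also have "(\<integral>\<^sup>+z. Zl z * indicator (space ?P) z \<partial>?P) = (\<integral>\<^sup>+z. Zl z \<partial>?P)"
  by (rule nn_integral_cong) simp
 also have "ennreal (1 / c) * (\<integral>\<^sup>+z. Zl z \<partial>?P) <= ennreal (1 / c) * ennreal K" by (rule mult_left_mono[OF EZl]) simp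
 also have "... = ennreal (K / c)" using c0 K0 by (simp add: ennreal_mult[symmetric])
 finally have "measure ?P (space ?P - G) <= K / c"
  unfolding PI.emeasure_eq_measure using c0 K0 by simp
 then have "measure ?P G >= 1 - K / c" using PI.prob_compl[OF G] by simp
 moreover have "K / c = 4 ^ p * (36 * real p * B / n) ^ p * N l" by (simp add: K_def c_def power_one_over)
 ultimately have mG: "measure ?P G >= 1 - 4 ^ p * (36 * real p * B / n) ^ p * N l" by simp
 have good: "(norm (S u))^2 <= 2 * ((1 / n) * (SUM i<n. (a (z i) .* u)^2)) + l * (norm u)^2" if z: "z \<in> G" for z u
 proof -
  \<comment> \<open>The lower limit only yields infinitely many good d; since the sets
    \<open>Ed d\<close> increase, one of these contains any given finite part of the basis.\<close>
  have fr: "frequently (%d. Z d z < c) sequentially"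
  proof (rule ccontr)
   assume "\<not> frequently (%d. Z d z < c) sequentially"
   then have "eventually (%d. ennreal c <= ennreal (Z d z)) sequentially"
    unfolding frequently_def not_not by (rule eventually_mono) (simp add: not_less ennreal_leI)
   then have "ennreal c <= Zl z" unfolding Zl_def by (rule Liminf_bounded)
   then show False using z by (auto simp: G_def not_less[symmetric])
  qed
  have span: "(norm (S v))^2 <= 2 * ((1 / n) * (SUM i<n. (a (z i) .* v)^2)) + l * (norm v)^2"
   if v: "v \<in> span Eh" for v
  proof -
   obtain F cv where F: "finite F" "F \<subseteq> Eh" "v = (SUM e:F. cv e *\<^sub>R e)" using v unfolding span_explicit by blast
   obtain d where d: "Z d z < c" "F \<subseteq> Ed d"
    using frequently_eventually_conj[OF fr Ed_eventually[OF F(1,2)]] by (auto simp: frequently_def dest: not_eventuallyD)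
   have vs: "v \<in> span (Ed d)" unfolding F(3) using d(2) by (intro span_sum span_scale span_base) auto
   define cc where "cc e = (if e \<in> F then cv e else 0)" for e
   have vd0: "v = (SUM e:Ed d. cc e *\<^sub>R e)"
    unfolding F(3) cc_def by (rule sum.mono_neutral_cong_left) (use d(2) Ed_finite in auto)
   note oE = orthonormal_inner_sum[OF Ed_orthonormal subset_refl Ed_finite]
   have vcc: "v .* e = cc e" if "e \<in> Ed d" for e unfolding vd0 using that by (simp add: oE)
   \<comment> \<open>Coordinates of (\<Sigma> + \<lambda>)^(1/2) v, which undoes the whitening in
     \<open>ze\<close>.\<close>
   define u where "u = (SUM e:Ed d. (sqrt (sig e + l) * cc e) *\<^sub>R e)"
   have pos: "sig e + l > 0" for e using l sig_nonneg[of e] by simp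
   have ue: "u .* e = sqrt (sig e + l) * cc e" if "e \<in> Ed d" for e unfolding u_def using that by (simp add: oE)
   have us: "u \<in> span (Ed d)" unfolding u_def by (intro span_sum span_scale span_base)
   have zu: "ze l d x .* u = a x .* v" for x
   proof -
    have "ze l d x .* u = (SUM e:Ed d. 1 / sqrt (sig e + l) * (a x .* e) * (u .* e))"
     unfolding ze_def inner_sum_left inner_scaleR_left inner_commute[of u] ..
    also have "... = (SUM e:Ed d. cc e * (a x .* e))"
    proof (rule sum.cong[OF refl])
     fix e assume e: "e \<in> Ed d"
     have "sqrt (sig e + l) > 0" using pos[of e] by simp
     then show "1 / sqrt (sig e + l) * (a x .* e) * (u .* e) = cc e * (a x .* e)" unfolding ue[OF e] by simp
    qed
    also have "... = a x .* v" unfolding vd0 by (simp add: inner_sum_right)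
    finally show ?thesis .
   qed
   have Sv: "(norm (S v))^2 = (SUM e:Ed d. sig e * (cc e)^2)"
   proof -
    have "(norm (S v))^2 = \<Sigma> v .* v" by (simp add: \<Sigma>_inner power2_norm_eq_inner)
    also have "\<Sigma> v = (SUM e:Ed d. (cc e * sig e) *\<^sub>R e)"
     unfolding vd0 linear_sum[OF positive_opD(1)[OF \<Sigma>_positive]] linear_scale[OF positive_opD(1)[OF \<Sigma>_positive]]
     by (intro sum.cong refl) (use Ed_subset \<Sigma>_eigen in force)
    also have "... .* v = (SUM e:Ed d. cc e * sig e * (v .* e))"
     unfolding inner_sum_left inner_scaleR_left inner_commute[of v] ..
    also have "... = (SUM e:Ed d. sig e * (cc e)^2)" by (intro sum.cong refl) (simp add: vcc power2_eq_square)
    finally show ?thesis .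
   qed
   have nv: "(norm v)^2 = (SUM e:Ed d. (cc e)^2)"
    unfolding vd0 by (rule orthonormal_norm_sum[OF Ed_orthonormal Ed_finite])
   have nu: "(norm u)^2 = (norm (S v))^2 + l * (norm v)^2"
   proof -
    have "(norm u)^2 = (SUM e:Ed d. (sqrt (sig e + l) * cc e)^2)"
     unfolding u_def by (rule orthonormal_norm_sum[OF Ed_orthonormal Ed_finite])
    also have "... = (SUM e:Ed d. sig e * (cc e)^2 + l * (cc e)^2)"
     by (intro sum.cong refl) (use pos in \<open>simp add: power_mult_distrib distrib_right less_imp_le\<close>)
    finally show ?thesis unfolding Sv nv by (simp add: sum.distrib sum_distrib_left)
   qed
   have Mu: "Mo l d u .* u = (norm (S v))^2"
   proof -
    have "Mo l d u .* u = (SUM e:Ed d. sig e / (sig e + l) * (u .* e) * (u .* e))"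
     unfolding Mo_def inner_sum_left inner_scaleR_left inner_commute[of u] ..
    also have "... = (SUM e:Ed d. sig e * (cc e)^2)"
    proof (rule sum.cong[OF refl])
     fix e assume e: "e \<in> Ed d"
     have ss: "sqrt (sig e + l) * sqrt (sig e + l) = sig e + l" using pos[of e] by simp
     have "sig e / (sig e + l) * (sqrt (sig e + l) * cc e) * (sqrt (sig e + l) * cc e)
      = sig e / (sig e + l) * ((sqrt (sig e + l) * sqrt (sig e + l)) * (cc e)^2)"
      by (simp only: mult_ac power2_eq_square)
     then have "sig e / (sig e + l) * (sqrt (sig e + l) * cc e) * (sqrt (sig e + l) * cc e)
      = sig e / (sig e + l) * ((sig e + l) * (cc e)^2)" unfolding ss .
     then show "sig e / (sig e + l) * (u .* e) * (u .* e) = sig e * (cc e)^2"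
      unfolding ue[OF e] using pos[of e] by simp
    qed
    finally show ?thesis unfolding Sv .
   qed
   have "T.X d {..<n} z u .* u = (1 / real n) * ((SUM i<n. (ze l d (z i) .* u)^2) - real n * (Mo l d u .* u))"
    unfolding T.X_def T.Y_def
    by (simp add: inner_sum_left inner_diff_left sum_subtractf sum_divide_distrib[symmetric] power2_eq_square)
   then have Xu: "T.X d {..<n} z u .* u = (1 / n) * (SUM i<n. (a (z i) .* v)^2) - (norm (S v))^2"
    unfolding zu Mu using nr by (simp add: field_simps)
   have "\<bar>T.X d {..<n} z u .* u\<bar> <= 1 / 2 * (norm u)^2"
   proof (rule T.X_quadratic_le_of_hs[OF _ _ us, where k = k])
    have "Z d z <= ((1 / 2) ^ p)^2"
     using d(1) by (simp add: c_def power2_eq_square power_mult_distrib[symmetric])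
    then show "(SUM e:Ed d. (norm ((T.X d {..<n} z ^^ 2 ^ k) e))^2) <= ((1 / 2) ^ 2 ^ k)^2"
     unfolding Z_def p_def .
   qed simp
   \<comment> \<open>Half of |S v|^2 is absorbed, whence the factor 2 and a full \<lambda>
     |v|^2.\<close>
   then have "(norm (S v))^2 - (1 / n) * (SUM i<n. (a (z i) .* v)^2) <= 1 / 2 * ((norm (S v))^2 + l * (norm v)^2)"
    unfolding Xu nu by linarith
   then show ?thesis by (simp add: field_simps)
  qed
  have bS: "bounded_linear S"
   by (rule bounded_linear_intro[where K = kap]) (use S_linear S_norm_le in \<open>auto simp: linear_add linear_scale mult.commute\<close>)
  let ?C = "{v. (norm (S v))^2 <= 2 * ((1 / n) * (SUM i<n. (a (z i) .* v)^2)) + l * (norm v)^2}"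
  have "closed ?C"
   by (intro closed_Collect_le continuous_intros linear_continuous_on bS)
  then have "closure (span Eh) \<subseteq> ?C" using span by (intro closure_minimal) auto
  then show ?thesis using Eh by (auto simp: hilbert_basis_def)
 qed
 show ?thesis using G mG good unfolding p_def by blast
qed

end

section \<open>Concentration of the noise, the leverage scores and the approximation error\<close>

lemma pinelis_centered:
 fixes X :: "'a => 'h::{real_inner, banach, second_countable_topology}"
 assumes A: "prob_space A" and X [measurable]: "X \<in> borel_measurable A"
  and c: "!!x. x \<in> space A ==> norm (X x) <= c" and var: "(LINT x|A. (norm (X x))^2) <= v"
  and th: "th >= 0" "th * (2 * c) <= 1" and I: "finite I"
 shows "measure (\<Pi>\<^sub>M i\<in>I. A) {z \<in> space (\<Pi>\<^sub>M i\<in>I. A). norm (SUM i:I. X (z i) - (LINT x|A. X x)) >= s}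
  <= 2 * exp (real (card I) * th^2 * v - th * s)"
proof (rule pinelis_bernstein[OF A _ _ _ _ I th(1)])
 interpret prob_space A by (rule A)
 define e where "e = (LINT x|A. X x)"
 have i: "integrable A X" by (rule integrable_const_bound[of _ c]) (use c in auto)
 have i2: "integrable A (%x. (norm (X x))^2)"
 proof (rule integrable_const_bound[of _ "c^2"])
  show "AE x in A. norm ((norm (X x))^2) <= c^2" using power_mono[OF c, of _ 2] by (intro AE_I2) simp
 qed measurable
 have ec: "norm e <= c"
 proof -
  have "norm e <= (LINT x|A. norm (X x))" unfolding e_def by (rule integral_norm_bound)
  also have "... <= (LINT x|A. c)" using i c by (intro integral_mono) auto
  finally show ?thesis by (simp add: prob_space)
 qed
 show "AE x in A. th * norm (X x - (LINT x|A. X x)) <= 1"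
  unfolding e_def[symmetric]
 proof (rule AE_I2)
  fix x assume "x \<in> space A"
  then have "norm (X x - e) <= 2 * c" using norm_triangle_ineq4[of "X x" e] c[of x] ec by linarith
  from mult_left_mono[OF this th(1)] show "th * norm (X x - e) <= 1" using th(2) by linarith
 qed
 have "(LINT x|A. (norm (X x - e))^2) = (LINT x|A. (norm (X x))^2 - 2 * (X x .* e) + (norm e)^2)"
  by (rule Bochner_Integration.integral_cong[OF refl])
   (simp add: power2_norm_eq_inner inner_diff_left inner_diff_right inner_commute)
 also have "... = (LINT x|A. (norm (X x))^2) - 2 * (e .* e) + (norm e)^2"
  using i2 i by (simp add: prob_space e_def)
 also have "... <= v" unfolding power2_norm_eq_inner[of e] using var inner_ge_zero[of e] by linarith
 finally show "(LINT x|A. (norm (X x - (\<integral>x. X x \<partial>A)))^2) <= v" unfolding e_def .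
 show "(LINT x|A. X x - (\<integral>x. X x \<partial>A)) = 0" using i by (simp add: prob_space)
qed simp

text \<open>\<open>tau\<close> dominates both the range of a summand and the standard deviation of
  the sum; with th = 1 / tau the exponent is at most 1 - (1 + x).\<close>

lemma pinelis_scaled:
 fixes X :: "'a => 'h::{real_inner, banach, second_countable_topology}"
 assumes A: "prob_space A" and X: "X \<in> borel_measurable A"
  and c: "!!x. x \<in> space A ==> norm (X x) <= c" and var: "(LINT x|A. (norm (X x))^2) <= v"
  and tau: "tau > 0" "2 * c <= tau" "real n * v <= tau^2"
 shows "measure (iid n A) {z \<in> space (iid n A). norm (SUM i<n. X (z i) - (LINT x|A. X x)) >= tau * (1 + x)} <= 2 * exp (- x)"
proof -
 have "real n * (1 / tau)^2 * v <= 1" using tau by (simp add: power_divide divide_le_eq)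
 then have "2 * exp (real (card {..<n}) * (1 / tau)^2 * v - 1 / tau * (tau * (1 + x))) <= 2 * exp (- x)" using tau(1) by simp
 moreover have th: "0 <= 1 / tau" "1 / tau * (2 * c) <= 1" using tau by (simp_all add: divide_le_eq)
 ultimately show ?thesis by (intro order_trans[OF pinelis_centered[OF A X c var th finite_lessThan]])
qed

context regression_model
begin

text \<open>The descent direction of the squared loss at \<open>w l\<close> minus its mean, which by
  the normal equation is \<lambda> w; the summands are thus centred.\<close>

definition "residual l z = (y z - a z .* w l) *\<^sub>R a z - l *\<^sub>R w l"

lemma residual_measurable [measurable]: "residual l \<in> borel_measurable rho"
 unfolding residual_def by measurable

lemma y_a_integrable: "integrable rho (%z. (a z .* u) * y z)"
proof (rule integrable_const_bound[of _ "(kap * norm u) * M"])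
 show "AE z in rho. norm ((a z .* u) * y z) <= (kap * norm u) * M"
  using kap by (intro AE_I2) (simp add: abs_mult mult_mono abs_a_inner_le y_bound)
qed measurable

lemma residual_norm_le:
 assumes "z \<in> space rho"
 shows "norm ((y z - a z .* w l) *\<^sub>R a z) <= (M + kap * norm (w l)) * kap"
proof -
 have "\<bar>y z - a z .* w l\<bar> <= M + kap * norm (w l)"
  using y_bound[OF assms] abs_a_inner_le[of z "w l"] by linarith
 then show ?thesis using a_bound[of z] kap by (simp add: mult_mono)
qed

lemma residual_integrable: "integrable rho (%z. (y z - a z .* w l) *\<^sub>R a z)"
 by (rule integrable_const_bound[OF AE_I2[OF residual_norm_le]]) measurable

lemma deviation_integrable: "integrable rho (%z. (a z .* u - ph z)^2)"
proof (rule integrable_const_bound[of _ "(kap * norm u + M)^2"])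
 have "\<bar>a z .* u - ph z\<bar> <= kap * norm u + M" if "z \<in> space rho" for z
  using abs_a_inner_le[of z u] ph_bound[OF that] by linarith
 then show "AE z in rho. norm ((a z .* u - ph z)^2) <= (kap * norm u + M)^2"
  using power_mono[of "\<bar>a _ .* u - ph _\<bar>" "kap * norm u + M" 2] by (intro AE_I2) simp
qed measurable

lemma residual_mean:
 assumes "Sa f - \<Sigma> (w l) = l *\<^sub>R w l"
 shows "(LINT z|rho. (y z - a z .* w l) *\<^sub>R a z) = l *\<^sub>R w l"
proof -
 define e where "e = (LINT z|rho. (y z - a z .* w l) *\<^sub>R a z)"
 have "e .* u = (l *\<^sub>R w l) .* u" for u
 proof -
  have "e .* u = (LINT z|rho. (a z .* u) * y z - (a z .* w l) * (a z .* u))"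
   unfolding e_def by (subst integral_inner_left[OF residual_integrable, symmetric]) (simp add: algebra_simps)
  also have "... = S u .* f - S (w l) .* S u"
   by (simp add: y_a_integrable f_y S_inner)
  also have "... = (Sa f - \<Sigma> (w l)) .* u"
   using S_adj[of u f] by (simp only: inner_diff_left \<Sigma>_inner inner_commute[of u "Sa f"])
  finally show ?thesis unfolding assms .
 qed
 then have "(e - l *\<^sub>R w l) .* (e - l *\<^sub>R w l) = 0" by (simp add: inner_diff_left)
 then show ?thesis by (simp add: e_def)
qed

text \<open>With y - w = (y - ph) + (ph - w) the second moment splits: |y - ph| <= 2 M is weighted
  by the mean of |R a|^2, at most \<open>N l\<close>, whereas the approximation error is small in
  mean square and takes the worst case |R a|^2 <= kap^2 / \<lambda>.\<close>

lemma noise_event: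
 assumes l: "l > 0" and res: "Sa f - \<Sigma> (w l) = l *\<^sub>R w l"
  and tau: "2 * ((M + kap * norm (w l)) * kap / sqrt l) <= tau"
   "real n * (8 * M^2 * N l + 2 * (kap^2 / l) * (norm (S (w l) - f))^2) <= tau^2"
 shows "measure (iid n rho) {z \<in> space (iid n rho). norm (SUM i<n. R l (residual l (z i))) >= tau * (1 + x)}
  <= 2 * exp (- x)"
proof -
 note blR = R_bounded_linear[OF l]
 have Rm [measurable]: "R l \<in> borel_measurable borel"
  by (intro borel_measurable_continuous_onI linear_continuous_on blR)
 define D where "D z = (y z - a z .* w l) *\<^sub>R a z" for z
 have Dm [measurable]: "D \<in> borel_measurable rho" unfolding D_def by measurable
 have RD: "norm (R l (D z)) <= (M + kap * norm (w l)) * kap / sqrt l" if "z \<in> space rho" for z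
  unfolding D_def by (rule order_trans[OF R_norm_le[OF l] divide_right_mono[OF residual_norm_le[OF that]]]) (use l in simp)
 have "(LINT z|rho. R l (D z)) = R l (l *\<^sub>R w l)"
  using integral_bounded_linear[OF blR residual_integrable[of l]] residual_mean[OF res] by (simp add: D_def)
 then have RX: "R l (residual l z) = R l (D z) - (LINT z|rho. R l (D z))" for z
  unfolding residual_def D_def by (simp add: linear_diff[OF bounded_linear.linear[OF blR]])
 show ?thesis
  unfolding RX
 proof (rule pinelis_scaled[OF prob_space_axioms _ RD _ _ tau])
  show "(%z. R l (D z)) \<in> borel_measurable rho" by measurable
  have "0 < (M + kap * norm (w l)) * kap / sqrt l" using M kap l by (simp add: add_pos_nonneg)
  then show "tau > 0" using tau(1) by linarith
  have iRD2: "integrable rho (%z. (norm (R l (D z)))^2)"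
  proof (rule integrable_const_bound)
   show "AE z in rho. norm ((norm (R l (D z)))^2) <= ((M + kap * norm (w l)) * kap / sqrt l)^2"
    by (rule AE_I2) (use power_mono[OF RD, of _ 2] in simp)
  qed measurable
  have "(LINT z|rho. (norm (R l (D z)))^2) <= (LINT z|rho. 8 * M^2 * (norm (R l (a z)))^2 + 2 * (kap^2 / l) * (a z .* w l - ph z)^2)"
  proof (rule integral_mono[OF iRD2])
   show "integrable rho (%z. 8 * M^2 * (norm (R l (a z)))^2 + 2 * (kap^2 / l) * (a z .* w l - ph z)^2)"
    using R_a_integrable[OF l] deviation_integrable by simp
   fix z assume z: "z \<in> space rho"
   let ?R = "(norm (R l (a z)))^2"
   have "R l (D z) = (y z - a z .* w l) *\<^sub>R R l (a z)"
    unfolding D_def by (rule linear_scale[OF bounded_linear.linear[OF blR]])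
   then have "(norm (R l (D z)))^2 = (y z - a z .* w l)^2 * ?R" by (simp add: power_mult_distrib)
   also have "(y z - a z .* w l)^2 <= 2 * (y z - ph z)^2 + 2 * (a z .* w l - ph z)^2"
    using square_sum_le2[of "y z - ph z" "ph z - a z .* w l"] by (simp add: power2_commute)
   also have "(y z - ph z)^2 <= (2 * M)^2"
   proof -
    have "\<bar>y z - ph z\<bar> <= 2 * M" using y_bound[OF z] ph_bound[OF z] by linarith
    from power_mono[OF this, of 2] show ?thesis by simp
   qed
   finally have "(norm (R l (D z)))^2 <= (2 * (2 * M)^2 + 2 * (a z .* w l - ph z)^2) * ?R"
    by (simp add: mult_right_mono)
   also have "... = 8 * M^2 * ?R + 2 * (a z .* w l - ph z)^2 * ?R" by (simp add: power_mult_distrib distrib_right)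
   also have "2 * (a z .* w l - ph z)^2 * ?R <= 2 * (a z .* w l - ph z)^2 * (kap^2 / l)"
    by (intro mult_left_mono R_a_norm_square_le l) simp
   finally show "(norm (R l (D z)))^2 <= 8 * M^2 * ?R + 2 * (kap^2 / l) * (a z .* w l - ph z)^2"
    by (simp only: mult_ac)
  qed
  also have "... = 8 * M^2 * (LINT z|rho. (norm (R l (a z)))^2) + 2 * (kap^2 / l) * (norm (S (w l) - f))^2"
   using R_a_integrable[OF l] deviation_integrable by (simp add: f_dist)
  also have "... <= 8 * M^2 * N l + 2 * (kap^2 / l) * (norm (S (w l) - f))^2"
   by (intro add_right_mono mult_left_mono R_second_moment l) simp
  finally show "(LINT z|rho. (norm (R l (D z)))^2) <= 8 * M^2 * N l + 2 * (kap^2 / l) * (norm (S (w l) - f))^2" .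
 qed
qed

text \<open>The summands are nonnegative and at most kap^2 / \<lambda>, so their second moment is at
  most this bound times their mean.\<close>

lemma dimension_event:
 assumes l: "l > 0" and tau: "2 * (kap^2 / l) <= tau" "real n * (kap^2 / l * N l) <= tau^2"
 shows "measure (iid n rho) {z \<in> space (iid n rho).
   (SUM i<n. (norm (R l (a (z i))))^2) >= n * N l + tau * (1 + x)} <= 2 * exp (- x)"
proof -
 interpret PI: prob_space "iid n rho" by (intro prob_space_PiM prob_space_axioms)
 define X where "X z = (norm (R l (a z)))^2" for z
 have kl: "0 < kap^2 / l" using kap l by simp
 have Xm [measurable]: "X \<in> borel_measurable rho" using R_a_measurable[OF l] unfolding X_def by measurable
 have X: "X z <= kap^2 / l" "0 <= X z" for z using R_a_norm_square_le[OF l, of z] by (simp_all add: X_def)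
 have eN: "(LINT z|rho. X z) <= N l" unfolding X_def by (rule R_second_moment[OF l])
 have iX: "integrable rho X" unfolding X_def by (rule R_a_integrable[OF l])
 have "measure (iid n rho) {z \<in> space (iid n rho). norm (SUM i<n. X (z i) - (LINT z|rho. X z)) >= tau * (1 + x)} <= 2 * exp (- x)"
 proof (rule pinelis_scaled[OF prob_space_axioms Xm _ _ _ tau])
  have X2: "(norm (X z))^2 <= kap^2 / l * X z" for z
   using mult_right_mono[OF X(1) X(2), of z] by (simp add: power2_eq_square)
  have "(LINT z|rho. (norm (X z))^2) <= (LINT z|rho. kap^2 / l * X z)"
   by (rule integral_mono') (use iX X2 X(2) l in auto)
  also have "... <= kap^2 / l * N l" using eN kl by (simp add: mult_left_mono del: times_divide_eq_left)
  finally show "(LINT z|rho. (norm (X z))^2) <= kap^2 / l * N l" .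
  show "tau > 0" using kl tau(1) by linarith
 qed (use X in auto)
 moreover have "measure (iid n rho) {z \<in> space (iid n rho). (SUM i<n. X (z i)) >= n * N l + tau * (1 + x)}
  <= measure (iid n rho) {z \<in> space (iid n rho). norm (SUM i<n. X (z i) - (LINT z|rho. X z)) >= tau * (1 + x)}"
 proof (rule PI.finite_measure_mono)
  have "n * (LINT z|rho. X z) <= n * N l" using eN by (intro mult_left_mono) auto
  then show "{z \<in> space (iid n rho). (SUM i<n. X (z i)) >= n * N l + tau * (1 + x)}
   \<subseteq> {z \<in> space (iid n rho). norm (SUM i<n. X (z i) - (LINT z|rho. X z)) >= tau * (1 + x)}"
   by (auto simp: sum_subtractf)
 qed measurable
 ultimately show ?thesis unfolding X_def by linarith
qed

text \<open>Markov's inequality suffices: the factor 1 / \<delta> in the resulting threshold is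
  compensated later by the batch size.\<close>

lemma approximation_event:
 fixes n :: nat and t :: real
 assumes t: "t > 0" and n: "n > 0"
 shows "measure (iid n rho) {z \<in> space (iid n rho).
   (SUM i<n. (a (z i) .* u - ph (z i))^2) >= n * t} <= (norm (S u - f))^2 / t"
proof -
 let ?P = "iid n rho"
 interpret PI: prob_space ?P by (intro prob_space_PiM prob_space_axioms)
 interpret PP: product_prob_space "%_. rho" "{..<n}" by (intro product_prob_spaceI prob_space_axioms)
 define q where "q z = (a z .* u - ph z)^2" for z
 have qm [measurable]: "q \<in> borel_measurable rho" unfolding q_def by measurable
 have qi: "integrable rho q" unfolding q_def by (rule deviation_integrable)
 have comp: "(\<integral>\<^sup>+z. ennreal (q (z i)) \<partial>?P) = ennreal ((norm (S u - f))^2)" if i: "i < n" for i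
 proof -
  have "(\<integral>\<^sup>+z. ennreal (q (z i)) \<partial>?P) = (\<integral>\<^sup>+z. ennreal (q z) \<partial>distr ?P rho (%z. z i))"
   using i by (subst nn_integral_distr) auto
  also have "distr ?P rho (%z. z i) = rho" using i by (intro PP.PiM_component) auto
  also have "(\<integral>\<^sup>+z. ennreal (q z) \<partial>rho) = ennreal (LINT z|rho. q z)"
   by (rule nn_integral_eq_integral[OF qi]) (simp add: q_def)
  finally show ?thesis by (simp add: q_def f_dist)
 qed
 have nt: "n * t > 0" using n t by simp
 have "emeasure ?P {z \<in> space ?P. (SUM i<n. q (z i)) >= n * t}
   <= emeasure ?P {z \<in> space ?P. 1 <= ennreal (1 / (n * t)) * ennreal (SUM i<n. q (z i))}"
 proof (rule emeasure_mono)
  show "{z \<in> space ?P. (SUM i<n. q (z i)) >= n * t} \<subseteq> {z \<in> space ?P. 1 <= ennreal (1 / (n * t)) * ennreal (SUM i<n. q (z i))}"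
  proof safe
   fix z assume "n * t <= (SUM i<n. q (z i))"
   then have "1 <= 1 / (n * t) * (SUM i<n. q (z i))" using nt by (simp add: field_simps)
   then have "ennreal 1 <= ennreal (1 / (n * t) * (SUM i<n. q (z i)))" by (rule ennreal_leI)
   also have "... = ennreal (1 / (n * t)) * ennreal (SUM i<n. q (z i))"
    using nt by (intro ennreal_mult) (auto simp: q_def intro!: sum_nonneg)
   finally show "1 <= ennreal (1 / (n * t)) * ennreal (SUM i<n. q (z i))" by simp
  qed
 qed measurable
 also have "... <= ennreal (1 / (n * t)) * (\<integral>\<^sup>+z. ennreal (SUM i<n. q (z i)) * indicator (space ?P) z \<partial>?P)"
  by (rule nn_integral_Markov_inequality) measurable
 also have "(\<integral>\<^sup>+z. ennreal (SUM i<n. q (z i)) * indicator (space ?P) z \<partial>?P) = (\<integral>\<^sup>+z. (SUM i<n. ennreal (q (z i))) \<partial>?P)"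
  by (rule nn_integral_cong) (simp add: q_def sum_ennreal)
 also have "... = (SUM i<n. \<integral>\<^sup>+z. ennreal (q (z i)) \<partial>?P)" by (rule nn_integral_sum) measurable
 also have "... = (SUM i<n. ennreal ((norm (S u - f))^2))" by (rule sum.cong) (auto simp: comp)
 also have "... = ennreal (n * (norm (S u - f))^2)" by (simp add: ennreal_of_nat_eq_real_of_nat ennreal_mult)
 also have "ennreal (1 / (n * t)) * ... = ennreal ((norm (S u - f))^2 / t)"
  using nt n t by (simp add: ennreal_mult[symmetric])
 finally show ?thesis unfolding PI.emeasure_eq_measure q_def using t by simp
qed

end

lemma mean_le:
 fixes f :: "nat => real"
 assumes "n > 0" "(SUM i<n. f i) <= real n * c"
 shows "(1 / real n) * (SUM i<n. f i) <= c"
 using assms by (simp add: field_simps)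

section \<open>Error for a good sample and nearby features\<close>

context regression_model
begin

text \<open>The distance l / (4 kap) is small enough for the change of the quadratic form to be
  absorbed by \<lambda> |u|^2.\<close>

definition "near_features l n z k \<longleftrightarrow> (\<forall>i<n. norm (k i - a (z i)) <= l / (4 * kap) \<and> norm (k i) <= kap)"

definition "risk eta b T h0 n k y' =
 index_mean n (b * T) (%j. norm (S (tail_average (sgd eta b (.*) (%v. v) h0 (%i. (k (j i), y' (j i)))) T) - f))"

text \<open>The hypotheses of \<open>sgd_mean_error\<close> are checked for the perturbed features
  \<open>k\<close>, while the probabilistic bounds concern the true features \<open>a\<close>. Up to
  a constant the norm \<open>star\<close> of the perturbed sample dominates the population norm, so
  the dual bounds by \<open>R\<close> carry over.\<close>

theorem perturbed_sample_error:
 fixes z :: "nat => 'z" and k :: "nat => 'h" and n b T :: nat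
 assumes n: "n > 0" and b: "b > 0" and T: "T > 0" and eta: "eta > 0" "4 * eta * kap^2 <= 1" and l: "l = 1 / (eta * real T)"
  and z: "!!i. i < n ==> z i \<in> space rho"
  and op: "!!u. (norm (S u))^2 <= 2 * ((1 / real n) * (SUM i<n. (a (z i) .* u)^2)) + l * (norm u)^2"
  and noise: "norm (SUM i<n. R l (residual l (z i))) <= real n * E2"
  and dim: "(SUM i<n. (norm (R l (a (z i))))^2) <= real n * N2"
  and app: "(SUM i<n. (a (z i) .* w l - ph (z i))^2) <= real n * t"
  and k: "!!i. i < n ==> norm (k i - a (z i)) <= d" "!!i. i < n ==> norm (k i) <= kap" and d: "4 * kap * d <= l"
  and Th: "Th = 2 * E2 + sqrt l * norm (w l) + (M + 2 * kap * norm (w l)) * d / sqrt l"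
 shows "risk eta b T h0 n k (%i. y (z i))
  <= 2 * sqrt (36 / b * (2 * (2 * M)^2 * (8 * N2 + 2 * d^2 / l) / T
     + 3 / 2 * ((kap * norm h0 + M)^2 / b + 2 * l * (norm (h0 - w l))^2 + 18 * Th^2 + (2 * t + 2 * d^2 * (norm (w l))^2))))
   + 2 * 2 * (2 * sqrt l * norm (h0 - w l) + 3 * Th) + norm (S (w l) - f) + norm (S (w l)) / T"
proof -
 interpret s: sgd_sample n b eta k "%i. y (z i)" h0
 proof
  fix i assume "i < n"
  then have "4 * eta * (norm (k i))^2 <= 4 * eta * kap^2" using eta k(2)[of i] by (intro mult_left_mono power_mono) auto
  then show "4 * eta * (norm (k i))^2 <= 1" using eta(2) by linarith
 qed (use n b eta in auto)
 have l0: "l > 0" using T eta by (simp add: l)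
 note Cp = s.Cl_positive[OF less_imp_le[OF l0]]
 have sn: "0 <= s.star l u" for u by (rule form_norm_nonneg[OF Cp])
 have d0: "0 <= d" using k(1)[OF n] norm_ge_zero[of "k 0 - a (z 0)"] by linarith
 define w0 where "w0 = w l"
 have kad: "\<bar>k i .* u - a (z i) .* u\<bar> <= d * norm u" if "i < n" for i u
  using Cauchy_Schwarz_ineq2[of "k i - a (z i)" u] mult_right_mono[OF k(1)[OF that], of "norm u"]
  by (simp add: inner_diff_left)
 have ku: "\<bar>k i .* u\<bar> <= kap * norm u" if "i < n" for i u
  using Cauchy_Schwarz_ineq2[of "k i" u] mult_right_mono[OF k(2)[OF that], of "norm u"] by simp
 \<comment> \<open>The true empirical form exceeds the perturbed one by at most 2 kap d |u|^2;
   doubled by \<open>op\<close> this is at most \<lambda> |u|^2.\<close>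
 have Su: "(norm (S u))^2 <= 2 * (s.star l u)^2" for u
 proof -
  have "(a (z i) .* u)^2 <= (k i .* u)^2 + 2 * kap * d * (norm u)^2" if i: "i < n" for i
  proof -
   have "(a (z i) .* u)^2 - (k i .* u)^2 = (a (z i) .* u - k i .* u) * (a (z i) .* u + k i .* u)"
    by (simp add: power2_eq_square algebra_simps)
   also have "... <= \<bar>a (z i) .* u - k i .* u\<bar> * \<bar>a (z i) .* u + k i .* u\<bar>"
    unfolding abs_mult[symmetric] by (rule abs_ge_self)
   also have "... <= (d * norm u) * (2 * kap * norm u)"
    using kad[OF i, of u] ku[OF i, of u] abs_a_inner_le[of "z i" u] d0
    by (intro mult_mono) auto
   finally show ?thesis by (simp add: power2_eq_square mult_ac)
  qed
  then have "(SUM i<n. (a (z i) .* u)^2) <= (SUM i<n. (k i .* u)^2 + 2 * kap * d * (norm u)^2)" by (intro sum_mono) auto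
  then have "(1 / real n) * (SUM i<n. (a (z i) .* u)^2) <= (1 / real n) * (SUM i<n. (k i .* u)^2 + 2 * kap * d * (norm u)^2)"
   by (rule mult_left_mono) simp
  also have "... = s.Tn u .* u + 2 * kap * d * (norm u)^2"
   using n unfolding s.Tn_quadratic by (simp add: sum.distrib field_simps)
  finally have m: "(1 / real n) * (SUM i<n. (a (z i) .* u)^2) <= s.Tn u .* u + 2 * kap * d * (norm u)^2" .
  have "(norm (S u))^2 <= 2 * (s.Tn u .* u + 2 * kap * d * (norm u)^2) + l * (norm u)^2"
   by (rule order_trans[OF op add_right_mono[OF mult_left_mono[OF m]]]) simp
  moreover have "4 * kap * d * (norm u)^2 <= l * (norm u)^2" using d by (rule mult_right_mono) simp
  ultimately show ?thesis unfolding s.star_square[OF less_imp_le[OF l0]] by (simp add: algebra_simps)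
 qed
 have lp: "sqrt l * norm u <= s.star l u" for u
 proof -
  have "(sqrt l * norm u)^2 <= (s.star l u)^2"
   unfolding s.star_square[OF less_imp_le[OF l0]] using l0 positive_opD(3)[OF s.Tn_positive, of u]
   by (simp add: power_mult_distrib)
  then show ?thesis by (rule power2_le_imp_le[OF _ sn])
 qed
 have dual: "\<bar>u .* q\<bar> <= 2 * s.star l u * norm (R l q)" for u q
 proof -
  have "l * (norm u)^2 <= (s.star l u)^2"
   unfolding s.star_square[OF less_imp_le[OF l0]] using positive_opD(3)[OF s.Tn_positive, of u] by simp
  then have "(norm (S u))^2 + l * (norm u)^2 <= (2 * s.star l u)^2"
   using Su[of u] zero_le_power2[of "s.star l u"] four_x_squared[of "s.star l u"] by linarith
  then have "sqrt ((norm (S u))^2 + l * (norm u)^2) <= 2 * s.star l u"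
   using sn[of u] by (intro real_le_lsqrt) auto
  then show ?thesis using order_trans[OF inner_le_dual[OF l0, of u q] mult_right_mono] by auto
 qed
 have normdual: "\<bar>u .* q\<bar> <= s.star l u * (c / sqrt l)" if "norm q <= c" for u q c
 proof -
  have "\<bar>u .* q\<bar> <= norm u * c"
   using Cauchy_Schwarz_ineq2[of u q] mult_left_mono[OF that, of "norm u"] by simp
  also have "norm u * c = sqrt l * norm u * (c / sqrt l)" using l0 by simp
  also have "... <= s.star l u * (c / sqrt l)"
   using order_trans[OF norm_ge_zero that] l0 by (intro mult_right_mono lp) auto
  finally show ?thesis .
 qed
 have cancel: "s.star l u <= B" if "B >= 0" "(s.star l u)^2 <= s.star l u * B" for u B
 proof (cases "s.star l u = 0")
  case False
  then show ?thesis using that sn[of u] by (simp add: power2_eq_square)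
 qed (use that in simp)
 have E2: "E2 >= 0"
  using order_trans[OF norm_ge_zero noise] n by (simp add: zero_le_mult_iff)
 have MK: "0 <= (M + 2 * kap * norm (w l)) * d" using M kap d0 by simp
 have Th0: "Th >= 0" unfolding Th using E2 l0 MK by (intro add_nonneg_nonneg divide_nonneg_nonneg) auto
 have resolvent: "\<exists>p. s.Cl l p = q" for q
  unfolding s.Cl_def by (rule positive_op_resolvent_surj[OF s.Tn_positive s.Tn_le _ l0]) (use eta in simp)
 obtain p where p: "s.Cl l p = s.gn - s.Tn (w l)" using resolvent by blast
 have "\<forall>i. \<exists>p. s.Cl l p = k i" using resolvent by blast
 then obtain pk where pk: "!!i. s.Cl l (pk i) = k i" by metis
 have star_Cl: "(s.star l u)^2 = u .* s.Cl l u" for u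
  unfolding form_norm_square[OF Cp] by (rule inner_commute)
 have Rlin: "linear (R l)" by (rule bounded_linear.linear[OF R_bounded_linear[OF l0]])
 have star_p: "s.star l p <= Th"
 proof (rule cancel[OF Th0])
  \<comment> \<open>The change of the gradient at \<open>w l\<close> caused by replacing
    \<open>a (z i)\<close> by \<open>k i\<close>.\<close>
  define D where "D i = ((y (z i) - k i .* w l) *\<^sub>R k i) - ((y (z i) - a (z i) .* w l) *\<^sub>R a (z i))" for i
  have Dn: "norm (D i) <= (M + 2 * kap * norm (w l)) * d" if i: "i < n" for i
  proof -
   have "D i = (y (z i) - k i .* w l) *\<^sub>R (k i - a (z i)) + (a (z i) .* w l - k i .* w l) *\<^sub>R a (z i)"
    by (simp add: D_def algebra_simps)
   then have "norm (D i) <= \<bar>y (z i) - k i .* w l\<bar> * norm (k i - a (z i)) + \<bar>a (z i) .* w l - k i .* w l\<bar> * norm (a (z i))"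
    by (metis norm_triangle_ineq norm_scaleR)
   also have "... <= (M + kap * norm (w l)) * d + (d * norm (w l)) * kap"
    using ku[OF i, of "w l"] y_bound[OF z[OF i]] kad[OF i, of "w l"] a_bound[of "z i"] k(1)[OF i] d0 kap
    by (intro add_mono mult_mono) auto
   finally show ?thesis by (simp add: algebra_simps)
  qed
  have "real n *\<^sub>R (s.gn - s.Tn (w l)) = (SUM i<n. (y (z i) - k i .* w l) *\<^sub>R k i)"
   using n by (simp add: s.gn_def s.Tn_def scaleR_diff_right scaleR_diff_left sum_subtractf)
  \<comment> \<open>Centred noise, its mean \<lambda> w and the perturbation; these yield the three
    terms of \<open>Th\<close>.\<close>
  also have "... = (SUM i<n. residual l (z i)) + real n *\<^sub>R (l *\<^sub>R w l) + (SUM i<n. D i)"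
   by (simp add: residual_def D_def sum_subtractf sum_constant_scaleR)
  finally have q: "p .* (real n *\<^sub>R (s.gn - s.Tn (w l))) =
    p .* (SUM i<n. residual l (z i)) + real n * (p .* (l *\<^sub>R w l)) + p .* (SUM i<n. D i)"
   by (simp only: inner_add_right inner_scaleR_right)
  have 1: "p .* (SUM i<n. residual l (z i)) <= s.star l p * (2 * (real n * E2))"
  proof -
   have "norm (R l (SUM i<n. residual l (z i))) <= real n * E2"
    using noise by (simp add: linear_sum[OF Rlin])
   then have "2 * s.star l p * norm (R l (SUM i<n. residual l (z i))) <= 2 * s.star l p * (real n * E2)"
    using sn[of p] by (intro mult_left_mono) auto
   then show ?thesis using dual[of p "SUM i<n. residual l (z i)"] by (simp add: mult_ac)
  qed
  have 2: "real n * (p .* (l *\<^sub>R w l)) <= real n * (s.star l p * (sqrt l * norm (w l)))"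
  proof (rule mult_left_mono)
   have "norm (l *\<^sub>R w l) <= l * norm (w l)" using l0 by simp
   from normdual[OF this, of p] have "p .* (l *\<^sub>R w l) <= s.star l p * (l / sqrt l * norm (w l))" by simp
   also have "l / sqrt l = sqrt l" using l0 by (rule real_div_sqrt[OF less_imp_le])
   finally show "p .* (l *\<^sub>R w l) <= s.star l p * (sqrt l * norm (w l))" .
  qed simp
  have 3: "p .* (SUM i<n. D i) <= s.star l p * (real n * ((M + 2 * kap * norm (w l)) * d) / sqrt l)"
  proof -
   have "norm (SUM i<n. D i) <= (SUM i<n. (M + 2 * kap * norm (w l)) * d)"
    by (rule order_trans[OF norm_sum sum_mono]) (use Dn in auto)
   then have "norm (SUM i<n. D i) <= real n * ((M + 2 * kap * norm (w l)) * d)" by simp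
   from normdual[OF this, of p] show ?thesis by simp
  qed
  have "real n * (s.star l p)^2 = p .* (real n *\<^sub>R (s.gn - s.Tn (w l)))"
   unfolding star_Cl p by simp
  also have "... <= s.star l p * (2 * (real n * E2)) + real n * (s.star l p * (sqrt l * norm (w l)))
    + s.star l p * (real n * ((M + 2 * kap * norm (w l)) * d) / sqrt l)"
   unfolding q by (intro add_mono 1 2 3)
  also have "... = real n * (s.star l p * Th)" unfolding Th by (simp add: algebra_simps)
  finally show "(s.star l p)^2 <= s.star l p * Th" using n by simp
 qed
 have star_pk: "(s.star l (pk i))^2 <= 8 * (norm (R l (a (z i))))^2 + 2 * d^2 / l" if i: "i < n" for i
 proof -
  have "s.star l (pk i) <= 2 * norm (R l (a (z i))) + d / sqrt l"
  proof (rule cancel)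
   have "pk i .* k i = pk i .* a (z i) + pk i .* (k i - a (z i))" by (simp add: inner_diff_right)
   then show "(s.star l (pk i))^2 <= s.star l (pk i) * (2 * norm (R l (a (z i))) + d / sqrt l)"
    unfolding star_Cl pk using dual[of "pk i" "a (z i)"] normdual[OF k(1)[OF i], of "pk i"]
    by (simp add: distrib_left)
  qed (use l0 d0 in simp)
  then have "(s.star l (pk i))^2 <= (2 * norm (R l (a (z i))) + d / sqrt l)^2" by (rule power_mono) (rule sn)
  also have "... <= 2 * (2 * norm (R l (a (z i))))^2 + 2 * (d / sqrt l)^2" by (rule square_sum_le2)
  finally show ?thesis using l0 by (simp add: power_mult_distrib power_divide)
 qed
 have Nh: "(1 / real n) * (SUM i<n. (s.star l (pk i))^2) <= 8 * N2 + 2 * d^2 / l"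
 proof (rule mean_le[OF n])
  have "(SUM i<n. (s.star l (pk i))^2) <= (SUM i<n. 8 * (norm (R l (a (z i))))^2 + 2 * d^2 / l)"
   by (intro sum_mono star_pk) auto
  also have "... = 8 * (SUM i<n. (norm (R l (a (z i))))^2) + real n * (2 * d^2 / l)"
   by (simp add: sum.distrib sum_distrib_left)
  also have "... <= 8 * (real n * N2) + real n * (2 * d^2 / l)"
   by (intro add_right_mono mult_left_mono dim) simp
  finally show "(SUM i<n. (s.star l (pk i))^2) <= real n * (8 * N2 + 2 * d^2 / l)" by (simp add: distrib_left)
 qed
 have Xi: "(1 / real n) * (SUM i<n. (k i .* w l - ph (z i))^2) <= 2 * t + 2 * d^2 * (norm (w l))^2"
 proof (rule mean_le[OF n])
  have "(SUM i<n. (k i .* w l - ph (z i))^2) <= (SUM i<n. 2 * (a (z i) .* w l - ph (z i))^2 + 2 * (d * norm (w l))^2)"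
  proof (rule sum_mono)
   fix i assume "i \<in> {..<n}"
   then have "\<bar>k i .* w l - a (z i) .* w l\<bar> <= d * norm (w l)" by (intro kad) simp
   from power_mono[OF this abs_ge_zero, of 2]
   have "(k i .* w l - a (z i) .* w l)^2 <= (d * norm (w l))^2" by simp
   then show "(k i .* w l - ph (z i))^2 <= 2 * (a (z i) .* w l - ph (z i))^2 + 2 * (d * norm (w l))^2"
    using square_sum_le2[of "a (z i) .* w l - ph (z i)" "k i .* w l - a (z i) .* w l"] by simp
  qed
  also have "... = 2 * (SUM i<n. (a (z i) .* w l - ph (z i))^2) + real n * (2 * (d * norm (w l))^2)"
   by (simp add: sum.distrib sum_distrib_left)
  also have "... <= 2 * (real n * t) + real n * (2 * (d * norm (w l))^2)"
   by (intro add_right_mono mult_left_mono app) simp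
  finally show "(SUM i<n. (k i .* w l - ph (z i))^2) <= real n * (2 * t + 2 * d^2 * (norm (w l))^2)"
   by (simp add: distrib_left power_mult_distrib mult_ac)
 qed
 have R0: "(1 / real n) * (SUM i<n. (k i .* h0 - y (z i))^2) <= (kap * norm h0 + M)^2"
 proof (rule mean_le[OF n])
  have "(SUM i<n. (k i .* h0 - y (z i))^2) <= (SUM i<n. (kap * norm h0 + M)^2)"
  proof (rule sum_mono)
   fix i assume "i \<in> {..<n}"
   then have "\<bar>k i .* h0 - y (z i)\<bar> <= kap * norm h0 + M" using ku[of i h0] y_bound[OF z[of i]] by auto
   from power_mono[OF this abs_ge_zero, of 2] show "(k i .* h0 - y (z i))^2 <= (kap * norm h0 + M)^2" by simp
  qed
  then show "(SUM i<n. (k i .* h0 - y (z i))^2) <= real n * (kap * norm h0 + M)^2" by simp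
 qed
 have S2: "norm (S u) <= 2 * s.star l u" for u
 proof (rule power2_le_imp_le)
  have "0 <= (s.star l u)^2" by simp
  then show "(norm (S u))^2 <= (2 * s.star l u)^2" using Su[of u] four_x_squared[of "s.star l u"] by linarith
 qed (use sn[of u] in simp)
 have ph_y: "\<bar>ph (z i) - y (z i)\<bar> <= 2 * M" if "i < n" for i
  using y_bound[OF z[OF that]] ph_bound[OF z[OF that]] by linarith
 have hs: "(%t. s.h t j) = sgd eta b (.*) (%v. v) h0 (%i. (k (j i), y (z (j i))))" for j
  by (rule ext) (simp add: s.h_def)
 from s.sgd_mean_error[OF T l S_linear _ S2 p star_p pk Nh ph_y Xi R0, of f]
 show ?thesis unfolding hs risk_def by simp
qed

end

section \<open>Rates for small \<lambda>\<close>

lemma eventually_powr_le: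
 fixes s e :: real
 assumes "s > 0" "e > 0"
 shows "\<forall>\<^sub>F l in at_right 0. l powr s <= e"
 unfolding eventually_at_right_field
proof (intro exI conjI allI impI)
 show "0 < e powr (1 / s)" using assms by simp
 fix l assume l: "0 < l" "l < e powr (1 / s)"
 have "l powr s <= (e powr (1 / s)) powr s" using l assms by (intro powr_mono2) auto
 then show "l powr s <= e" using assms by (simp add: powr_powr)
qed

lemma ln_6_div_ge_1:
 fixes dl :: real
 assumes "0 < dl" "dl <= 1"
 shows "1 <= ln (6 / dl)"
proof -
 have "exp 1 <= (3::real)" by (rule exp_le)
 moreover have "3 <= 6 / dl" using assms by (simp add: field_simps)
 ultimately have "ln (exp 1) <= ln (6 / dl)" using assms by (subst ln_le_cancel_iff) auto
 then show ?thesis by simp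
qed

lemma powr_antimono_exponent:
 fixes l :: real
 assumes "0 < l" "l <= 1" "s <= t"
 shows "l powr t <= l powr s"
 using assms powr_mono'[of s t l] by simp

context regression_model
begin

context
 fixes r Rad nx cnx c1 :: real and hs :: 'l
 assumes r: "0 < r" "r <= 1 / 2" and src: "f = op_powr L r hs" and hs: "norm hs <= Rad" and Rad: "Rad > 0"
  and nx: "0 < nx" "nx <= 1" "2 * r + nx > 1"
  and eff: "!!l. l > 0 ==> effective_dim L l <= cnx * l powr (- nx)" and c1: "c1 > 0"
begin

text \<open>The two summands make tau = n \<open>noise_const\<close> \<lambda>^r large enough for
  the range condition and for the variance condition of \<open>noise_event\<close>.\<close>

definition "noise_const = 2 * kap * (M + kap * Rad) / c1 + sqrt ((8 * M^2 * cnx + 2 * kap^2 * Rad^2) / c1)"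

lemma N_le: "l > 0 ==> N l <= cnx * l powr (- nx)"
 using eff[of l] effective_dim_eq[of l] by simp

lemma N_le_Suc: "l > 0 ==> N l <= (cnx + 1) * l powr (- nx)"
 using N_le[of l] powr_ge_zero[of l "- nx"] unfolding distrib_right by linarith

lemma cnx_nonneg: "cnx >= 0"
 using N_le[of 1] N_nonneg[of 1] by simp

lemma noise_const_pos: "noise_const > 0"
proof -
 have "2 * kap * (M + kap * Rad) / c1 > 0" using kap M Rad c1 by (intro divide_pos_pos mult_pos_pos add_pos_pos) auto
 moreover have "sqrt ((8 * M^2 * cnx + 2 * kap^2 * Rad^2) / c1) >= 0"
  using cnx_nonneg c1 by (intro real_sqrt_ge_zero divide_nonneg_nonneg add_nonneg_nonneg) auto
 ultimately show ?thesis unfolding noise_const_def by linarith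
qed

definition "good_sample l n Lg t z \<longleftrightarrow> (\<forall>i<n. z i \<in> space rho) \<and>
  (\<forall>u. (norm (S u))^2 <= 2 * ((1 / real n) * (SUM i<n. (a (z i) .* u)^2)) + l * (norm u)^2) \<and>
  norm (SUM i<n. R l (residual l (z i))) <= real n * (2 * noise_const * Lg * l powr r) \<and>
  (SUM i<n. (norm (R l (a (z i))))^2) <= real n * ((cnx + 1) * l powr (- nx)) \<and>
  (SUM i<n. (a (z i) .* w l - ph (z i))^2) <= real n * t"

text \<open>As 2r + \<nu> > 1 and n >= c1 \<lambda>^-(2r+\<nu>), the range term \<lambda>^(r-1) is
  at most a multiple of n \<lambda>^r, and in the variance \<lambda>^(2r-1) is at most
  \<lambda>^(-\<nu>). The factor 2 comes from 1 + Lg <= 2 Lg.\<close>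

lemma noise_good:
 assumes l: "0 < l" "l <= 1" and n: "c1 * l powr (- (2 * r + nx)) <= real n" and Lg: "Lg >= 1"
 shows "measure (iid n rho) {z \<in> space (iid n rho).
   norm (SUM i<n. R l (residual l (z i))) > real n * (2 * noise_const * Lg * l powr r)} <= 2 * exp (- Lg)"
proof -
 interpret PI: prob_space "iid n rho" by (intro prob_space_PiM prob_space_axioms)
 define q where "q = noise_const"
 define tau where "tau = real n * q * l powr r"
 have q0: "q > 0" unfolding q_def by (rule noise_const_pos)
 have q1: "2 * kap * (M + kap * Rad) <= q * c1" and q2: "8 * M^2 * cnx + 2 * kap^2 * Rad^2 <= q^2 * c1"
 proof -
  let ?A = "2 * kap * (M + kap * Rad) / c1" and ?B = "(8 * M^2 * cnx + 2 * kap^2 * Rad^2) / c1"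
  have A: "0 <= ?A" using kap M Rad c1 by simp
  have B: "0 <= ?B" using cnx_nonneg c1 by (intro divide_nonneg_nonneg add_nonneg_nonneg) auto
  have "?A <= q" using B unfolding q_def noise_const_def by simp
  then show "2 * kap * (M + kap * Rad) <= q * c1" using c1 by (simp add: divide_le_eq)
  have "?B <= q^2" using A B unfolding q_def noise_const_def by (intro sqrt_le_D) simp
  then show "8 * M^2 * cnx + 2 * kap^2 * Rad^2 <= q^2 * c1" using c1 by (simp add: divide_le_eq)
 qed
 have wl: "norm (w l) <= l powr (r - 1 / 2) * Rad" by (rule w_norm_le[OF r src hs l(1)])
 have Sw: "norm (S (w l) - f) <= l powr r * Rad" by (rule approximation_error[OF r src hs l(1)])
 have t1: "2 * ((M + kap * norm (w l)) * kap / sqrt l) <= tau"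
 proof -
  have "1 <= l powr (r - 1 / 2)" using powr_antimono_exponent[OF l, of "r - 1 / 2" 0] r l by simp
  then have "M + kap * norm (w l) <= M * l powr (r - 1 / 2) + kap * (l powr (r - 1 / 2) * Rad)"
   using wl kap M by (intro add_mono mult_left_mono) auto
  then have "2 * ((M + kap * norm (w l)) * kap / sqrt l) <= 2 * ((M * l powr (r - 1 / 2) + kap * (l powr (r - 1 / 2) * Rad)) * kap / sqrt l)"
   using kap l by (intro mult_left_mono divide_right_mono mult_right_mono) auto
  also have "... = 2 * kap * (M + kap * Rad) * (l powr (r - 1 / 2) * l powr (- 1 / 2))"
   using l by (simp add: powr_minus_divide powr_half_sqrt field_simps)
  also have "l powr (r - 1 / 2) * l powr (- 1 / 2) = l powr (r - 1)" by (simp add: powr_add[symmetric])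
  also have "2 * kap * (M + kap * Rad) * l powr (r - 1) <= q * c1 * l powr (r - 1)" by (intro mult_right_mono q1) simp
  also have "... <= q * c1 * l powr (r - (2 * r + nx))"
   using q0 c1 nx r by (intro mult_left_mono powr_antimono_exponent l) auto
  also have "... = q * l powr r * (c1 * l powr (- (2 * r + nx)))"
   by (simp add: powr_add[symmetric])
  also have "... <= q * l powr r * real n" using q0 by (intro mult_left_mono n) auto
  finally show ?thesis by (simp add: tau_def mult_ac)
 qed
 have t2: "real n * (8 * M^2 * N l + 2 * (kap^2 / l) * (norm (S (w l) - f))^2) <= tau^2"
 proof -
  have "(norm (S (w l) - f))^2 <= (l powr r * Rad)^2" by (rule power_mono[OF Sw]) simp
  then have "8 * M^2 * N l + 2 * (kap^2 / l) * (norm (S (w l) - f))^2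
    <= 8 * M^2 * (cnx * l powr (- nx)) + 2 * (kap^2 / l) * (l powr r * Rad)^2"
   using l by (intro add_mono mult_left_mono N_le) auto
  also have "2 * (kap^2 / l) * (l powr r * Rad)^2 = 2 * kap^2 * Rad^2 * l powr (2 * r - 1)"
   using l by (simp add: power_mult_distrib powr_diff powr_power[symmetric] powr_powr mult.commute powr_realpow[symmetric])
  also have "... <= 2 * kap^2 * Rad^2 * l powr (- nx)"
   using nx by (intro mult_left_mono powr_antimono_exponent l) auto
  also have "8 * M^2 * (cnx * l powr (- nx)) + 2 * kap^2 * Rad^2 * l powr (- nx) = (8 * M^2 * cnx + 2 * kap^2 * Rad^2) * l powr (- nx)"
   by (simp add: algebra_simps)
  also have "... <= q^2 * c1 * l powr (- nx)" by (intro mult_right_mono q2) simp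
  also have "... = q^2 * (l powr r)^2 * (c1 * l powr (- (2 * r + nx)))"
   using l by (simp add: powr_power powr_add[symmetric] mult_ac)
  also have "... <= q^2 * (l powr r)^2 * real n" by (intro mult_left_mono n) auto
  finally have "8 * M^2 * N l + 2 * (kap^2 / l) * (norm (S (w l) - f))^2 <= q^2 * (l powr r)^2 * real n" by simp
  from mult_left_mono[OF this, of "real n"] show ?thesis
   by (simp add: tau_def power2_eq_square mult_ac)
 qed
 have Rm [measurable]: "R l \<in> borel_measurable borel"
  by (intro borel_measurable_continuous_onI linear_continuous_on R_bounded_linear l)
 have "PI.prob {z \<in> space (iid n rho). norm (SUM i<n. R l (residual l (z i))) > real n * (2 * noise_const * Lg * l powr r)}
  <= PI.prob {z \<in> space (iid n rho). norm (SUM i<n. R l (residual l (z i))) >= tau * (1 + Lg)}"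
 proof (rule PI.finite_measure_mono)
  have "tau >= 0" using q0 by (simp add: tau_def)
  then have "tau * (1 + Lg) <= tau * (2 * Lg)" using Lg by (intro mult_left_mono) auto
  then have "tau * (1 + Lg) <= real n * (2 * noise_const * Lg * l powr r)" by (simp add: tau_def q_def mult_ac)
  then show "{z \<in> space (iid n rho). norm (SUM i<n. R l (residual l (z i))) > real n * (2 * noise_const * Lg * l powr r)}
   \<subseteq> {z \<in> space (iid n rho). norm (SUM i<n. R l (residual l (z i))) >= tau * (1 + Lg)}" by auto
 qed measurable
 also have "... <= 2 * exp (- Lg)"
  by (rule noise_event[OF l(1) residual_eq[OF r src hs l(1)] t1 t2])
 finally show ?thesis .
qed

text \<open>For fixed x all factors 1 + x are absorbed by \<lambda>^(2r+2\<nu>-1), which tends to 0.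
  Hence the bound on the leverage scores carries no logarithm.\<close>

lemma dimension_good:
 assumes x: "x >= 0"
 shows "\<forall>\<^sub>F l in at_right 0. \<forall>n. c1 * l powr (- (2 * r + nx)) <= real n -->
  measure (iid n rho) {z \<in> space (iid n rho).
   (SUM i<n. (norm (R l (a (z i))))^2) > real n * ((cnx + 1) * l powr (- nx))} <= 2 * exp (- x)"
proof -
 define e where "e = c1 / ((1 + x)^2 * (2 * kap^2 * (cnx + 1)))"
 have D0: "(1 + x)^2 * (2 * kap^2 * (cnx + 1)) > 0"
  using x kap cnx_nonneg by (intro mult_pos_pos zero_less_power) auto
 have e0: "e > 0" using c1 D0 by (simp add: e_def)
 have "\<forall>\<^sub>F l in at_right 0. l powr (2 * r + 2 * nx - 1) <= e"
  using nx e0 by (intro eventually_powr_le) auto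
 moreover have "\<forall>\<^sub>F l in at_right 0. (0::real) < l" by (rule eventually_at_right_less)
 ultimately show ?thesis
 proof eventually_elim
  case (elim l)
  show ?case
  proof (intro allI impI)
   fix n assume n: "c1 * l powr (- (2 * r + nx)) <= real n"
   interpret PI: prob_space "iid n rho" by (intro prob_space_PiM prob_space_axioms)
   \<comment> \<open>Chosen so that tau (1 + x) is the surplus n \<lambda>^(-\<nu>) of the claim
     over the bound for the mean.\<close>
   define tau where "tau = real n * l powr (- nx) / (1 + x)"
   have "l powr (2 * r + 2 * nx - 1) * ((1 + x)^2 * (2 * kap^2 * (cnx + 1))) <= c1"
    using elim(1) D0 by (simp add: e_def field_simps)
   then have "l powr (2 * r + 2 * nx - 1) * ((1 + x)^2 * (2 * kap^2 * (cnx + 1))) * l powr (- (2 * r + 2 * nx)) <= c1 * l powr (- (2 * r + 2 * nx))"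
    by (rule mult_right_mono) simp
   also have "l powr (2 * r + 2 * nx - 1) * ((1 + x)^2 * (2 * kap^2 * (cnx + 1))) * l powr (- (2 * r + 2 * nx))
    = (1 + x)^2 * (2 * kap^2 * (cnx + 1)) * (l powr (2 * r + 2 * nx - 1) * l powr (- (2 * r + 2 * nx)))" by simp
   also have "l powr (2 * r + 2 * nx - 1) * l powr (- (2 * r + 2 * nx)) = 1 / l"
    using elim(2) by (simp add: powr_add[symmetric] powr_minus_divide)
   also have "c1 * l powr (- (2 * r + 2 * nx)) = c1 * l powr (- (2 * r + nx)) * l powr (- nx)"
    by (simp add: powr_add[symmetric] algebra_simps)
   also have "... <= real n * l powr (- nx)" by (intro mult_right_mono n) simp
   finally have key: "(1 + x)^2 * (2 * kap^2 * (cnx + 1)) * (1 / l) <= real n * l powr (- nx)" .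
   have k0: "0 <= kap^2 / l" using elim(2) by simp
   have t1: "2 * (kap^2 / l) <= tau"
   proof -
    have "2 * (kap^2 / l) * (1 + x) <= 2 * (kap^2 / l) * (1 + x)^2"
     using x k0 by (intro mult_left_mono self_le_power) auto
    also have "... <= 2 * (kap^2 / l) * (1 + x)^2 * (cnx + 1)"
     by (rule mult_right_mono[of 1 "cnx + 1" "2 * (kap^2 / l) * (1 + x)^2", unfolded mult_1 mult.commute[of "cnx + 1"]])
      (use cnx_nonneg mult_nonneg_nonneg[OF k0 zero_le_power2[of "1 + x"]] in auto)
    also have "... = (1 + x)^2 * (2 * kap^2 * (cnx + 1)) * (1 / l)" by simp
    also note key
    finally show ?thesis unfolding tau_def using x by (intro mult_imp_le_div_pos) auto
   qed
   have t2: "real n * (kap^2 / l * N l) <= tau^2"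
   proof -
    have "N l <= (cnx + 1) * l powr (- nx)" by (rule N_le_Suc[OF elim(2)])
    then have "(1 + x)^2 * (real n * (kap^2 / l * N l)) <= (1 + x)^2 * (real n * (kap^2 / l * ((cnx + 1) * l powr (- nx))))"
     using k0 by (intro mult_left_mono) auto
    also have "... <= (1 + x)^2 * (real n * (2 * (kap^2 / l) * ((cnx + 1) * l powr (- nx))))"
     using k0 cnx_nonneg by (intro mult_left_mono mult_right_mono) auto
    also have "... = real n * l powr (- nx) * ((1 + x)^2 * (2 * kap^2 * (cnx + 1)) * (1 / l))"
     by (simp only: times_divide_eq_left times_divide_eq_right mult_1_right mult_1_left mult_ac)
    also have "... <= real n * l powr (- nx) * (real n * l powr (- nx))" by (intro mult_left_mono key) auto
    finally have "real n * (kap^2 / l * N l) * (1 + x)^2 <= (real n * l powr (- nx))^2"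
     unfolding power2_eq_square[of "real n * l powr (- nx)"] mult.commute[of "(1 + x)^2"] .
    then show ?thesis unfolding tau_def power_divide using x by (intro mult_imp_le_div_pos) auto
   qed
   have "PI.prob {z \<in> space (iid n rho). (SUM i<n. (norm (R l (a (z i))))^2) > real n * ((cnx + 1) * l powr (- nx))}
    <= PI.prob {z \<in> space (iid n rho). (SUM i<n. (norm (R l (a (z i))))^2) >= n * N l + tau * (1 + x)}"
   proof (rule PI.finite_measure_mono)
    have "n * N l + tau * (1 + x) <= real n * (cnx * l powr (- nx)) + real n * l powr (- nx)"
     using x by (intro add_mono mult_left_mono N_le elim(2)) (auto simp: tau_def)
    then have "n * N l + tau * (1 + x) <= real n * ((cnx + 1) * l powr (- nx))" by (simp add: algebra_simps)
    then show "{z \<in> space (iid n rho). (SUM i<n. (norm (R l (a (z i))))^2) > real n * ((cnx + 1) * l powr (- nx))}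
     \<subseteq> {z \<in> space (iid n rho). (SUM i<n. (norm (R l (a (z i))))^2) >= n * N l + tau * (1 + x)}" by auto
   qed (use R_a_measurable[OF elim(2)] in measurable)
   also have "... <= 2 * exp (- x)" by (rule dimension_event[OF elim(2) t1 t2])
   finally show "PI.prob {z \<in> space (iid n rho). (SUM i<n. (norm (R l (a (z i))))^2) > real n * ((cnx + 1) * l powr (- nx))}
    <= 2 * exp (- x)" .
  qed
 qed
qed

text \<open>With s = 2r + \<nu> - 1 the ratio B / n is at most of order \<lambda>^s. The moment of
  order p then gives a failure probability of order \<lambda>^(ps - \<nu>), and p s >= \<nu> + 1
  leaves a factor \<lambda>.\<close>

lemma operator_good:
 assumes ep: "ep > 0"
 shows "\<forall>\<^sub>F l in at_right 0. \<forall>n. c1 * l powr (- (2 * r + nx)) <= real n -->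
  (\<exists>A\<in>sets (iid n rho). measure (iid n rho) A >= 1 - ep \<and>
   (\<forall>z\<in>A. \<forall>u. (norm (S u))^2 <= 2 * ((1 / real n) * (SUM i<n. (a (z i) .* u)^2)) + l * (norm u)^2))"
proof -
 define s where "s = 2 * r + nx - 1"
 have s: "s > 0" using nx by (simp add: s_def)
 obtain m :: nat where m: "(nx + 1) / s <= real m" using real_arch_simple by blast
 \<comment> \<open>A power of two, as \<open>operator_event\<close> requires, and at least
   m.\<close>
 define p where "p = (2::nat) ^ m"
 have p0: "p > 0" by (simp add: p_def)
 have "real m <= real p" unfolding p_def by (simp add: less_imp_le of_nat_less_two_power)
 then have "real m * s <= real p * s" using s by (intro mult_right_mono) auto
 then have ps: "nx + 1 <= real p * s" using m pos_divide_le_eq[OF s, of "nx + 1" "real m"] by linarith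
 define B1 where "B1 = (1 + kap^2) / c1"
 have B1: "B1 > 0" using c1 by (simp add: B1_def add_pos_nonneg)
 define Cp where "Cp = 4 ^ p * (36 * real p * B1) ^ p * (cnx + 1)"
 have Cp: "Cp > 0" using B1 cnx_nonneg p0 by (simp add: Cp_def)
 have "\<forall>\<^sub>F l in at_right 0. l powr s <= 1 / (4 * real p * B1)" using s B1 p0 by (intro eventually_powr_le) auto
 moreover have "\<forall>\<^sub>F l in at_right 0. l powr 1 <= min 1 (ep / Cp)" using ep Cp by (intro eventually_powr_le) auto
 moreover have "\<forall>\<^sub>F l in at_right 0. (0::real) < l" by (rule eventually_at_right_less)
 ultimately show ?thesis
 proof eventually_elim
  case (elim l)
  then have l: "0 < l" "l <= 1" "l <= ep / Cp" by auto
  show ?case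
  proof (intro allI impI)
   fix n assume n: "c1 * l powr (- (2 * r + nx)) <= real n"
   have cl: "0 < c1 * l powr (- (2 * r + nx))" using c1 l by simp
   then have n0: "n > 0" using n by (cases n) auto
   define B where "B = max 1 (kap^2 / l)"
   have "B <= (1 + kap^2) / l" using l kap by (simp add: B_def field_simps add_increasing2)
   then have "B / n <= (1 + kap^2) / l / (c1 * l powr (- (2 * r + nx)))"
    using n cl l by (intro frac_le) auto
   also have "... = B1 * (l powr (2 * r + nx) / l)" unfolding B1_def powr_minus[of l "2 * r + nx"] using l by (simp add: divide_inverse mult_ac)
   also have "l powr (2 * r + nx) / l = l powr s" using l by (simp add: s_def powr_diff)
   finally have Bn: "B / n <= B1 * l powr s" .
   have B0: "B > 0" by (simp add: B_def)
   have "B1 * l powr s <= B1 * (1 / (4 * real p * B1))" using elim(1) B1 by (intro mult_left_mono) auto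
   also have "... = 1 / (4 * real p)" using B1 by simp
   finally have "B / n <= 1 / (4 * real p)" using Bn by linarith
   then have nB: "4 * real (2 ^ m) * B <= n" using n0 p0 by (simp add: p_def field_simps)
   obtain A where A: "A \<in> sets (iid n rho)"
    "measure (iid n rho) A >= 1 - 4 ^ p * (36 * real p * B / n) ^ p * N l"
    "\<forall>z\<in>A. \<forall>u. (norm (S u))^2 <= 2 * ((1 / real n) * (SUM i<n. (a (z i) .* u)^2)) + l * (norm u)^2"
    using operator_event[OF l(1) n0 B_def nB] unfolding p_def by auto
   have "4 ^ p * (36 * real p * B / n) ^ p * N l <= 4 ^ p * (36 * real p * (B1 * l powr s)) ^ p * ((cnx + 1) * l powr (- nx))"
   proof (intro mult_mono order_refl power_mono)
    show "36 * real p * B / real n <= 36 * real p * (B1 * l powr s)"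
     using mult_left_mono[OF Bn, of "36 * real p"] by simp
    show "N l <= (cnx + 1) * l powr (- nx)" by (rule N_le_Suc[OF l(1)])
    show "0 <= N l" by (rule N_nonneg[OF l(1)])
   qed (use B0 B1 in auto)
   also have "... = Cp * (l powr (real p * s) * l powr (- nx))"
    using l by (simp add: Cp_def power_mult_distrib powr_power mult_ac)
   also have "l powr (real p * s) * l powr (- nx) = l powr (real p * s - nx)" by (simp add: powr_add[symmetric])
   also have "Cp * l powr (real p * s - nx) <= Cp * l powr 1"
    using ps Cp by (intro mult_left_mono powr_antimono_exponent l) auto
   also have "... <= ep" using l Cp by (simp add: field_simps)
   finally show "\<exists>A\<in>sets (iid n rho). measure (iid n rho) A >= 1 - ep \<and>
    (\<forall>z\<in>A. \<forall>u. (norm (S u))^2 <= 2 * ((1 / real n) * (SUM i<n. (a (z i) .* u)^2)) + l * (norm u)^2)"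
    using A by (intro bexI[of _ A] conjI) auto
  qed
 qed
qed

text \<open>The failure budget: 2 exp (- ln (6 / dl)) = dl / 3 for the noise and dl / 9 for each of
  the three other events, together 2/3 dl. The last third is left to the passage to the conditional
  risk.\<close>

lemma good_sample_event:
 assumes dl: "0 < dl" "dl <= 1"
 shows "\<forall>\<^sub>F l in at_right 0. \<forall>n. c1 * l powr (- (2 * r + nx)) <= real n -->
  (\<exists>A\<in>sets (iid n rho). measure (iid n rho) A >= 1 - 2 / 3 * dl \<and>
   (\<forall>z\<in>A. good_sample l n (ln (6 / dl)) (9 * Rad^2 / dl * (l powr r)^2) z))"
proof -
 have "1 <= 18 / dl" using dl by simp
 then have "0 <= ln (18 / dl)" by (rule ln_ge_zero)
 from dimension_good[OF this]
 have dim: "\<forall>\<^sub>F l in at_right 0. \<forall>n. c1 * l powr (- (2 * r + nx)) <= real n -->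
  measure (iid n rho) {z \<in> space (iid n rho).
   (SUM i<n. (norm (R l (a (z i))))^2) > real n * ((cnx + 1) * l powr (- nx))} <= dl / 9"
  using dl by (simp add: ln_div exp_diff)
 have "dl / 9 > 0" using dl by simp
 note op = operator_good[OF this]
 note Lg = ln_6_div_ge_1[OF dl]
 have "\<forall>\<^sub>F l in at_right 0. l powr 1 <= (1::real)" by (intro eventually_powr_le) auto
 moreover have "\<forall>\<^sub>F l in at_right 0. (0::real) < l" by (rule eventually_at_right_less)
 ultimately show ?thesis using dim op
 proof eventually_elim
  case (elim l)
  then have l: "0 < l" "l <= 1" by auto
  show ?case
  proof (intro allI impI)
   fix n assume n: "c1 * l powr (- (2 * r + nx)) <= real n"
   let ?P = "iid n rho"
   interpret PI: prob_space ?P by (intro prob_space_PiM prob_space_axioms)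
   have "0 < c1 * l powr (- (2 * r + nx))" using c1 l by simp
   then have n0: "n > 0" using n by (cases n) auto
   define t where "t = 9 * Rad^2 / dl * (l powr r)^2"
   have t0: "t > 0" using Rad dl l by (simp add: t_def)
   obtain A where A: "A \<in> sets ?P" "PI.prob A >= 1 - dl / 9"
    "\<forall>z\<in>A. \<forall>u. (norm (S u))^2 <= 2 * ((1 / real n) * (SUM i<n. (a (z i) .* u)^2)) + l * (norm u)^2"
    using elim(4)[rule_format, OF n] by (elim bexE conjE)
   define B1 where "B1 = {z \<in> space ?P. norm (SUM i<n. R l (residual l (z i))) > real n * (2 * noise_const * ln (6 / dl) * l powr r)}"
   define B2 where "B2 = {z \<in> space ?P. (SUM i<n. (norm (R l (a (z i))))^2) > real n * ((cnx + 1) * l powr (- nx))}"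
   define B3 where "B3 = {z \<in> space ?P. (SUM i<n. (a (z i) .* w l - ph (z i))^2) >= n * t}"
   have Rm [measurable]: "R l \<in> borel_measurable borel"
    by (intro borel_measurable_continuous_onI linear_continuous_on R_bounded_linear l)
   have B: "B1 \<in> sets ?P" "B2 \<in> sets ?P" "B3 \<in> sets ?P"
    unfolding B1_def B2_def B3_def by measurable
   have "PI.prob B1 <= 2 * exp (- ln (6 / dl))" unfolding B1_def by (rule noise_good[OF l n Lg])
   also have "... = dl / 3" using dl by (simp add: ln_div exp_diff)
   finally have P1: "PI.prob B1 <= dl / 3" .
   have P2: "PI.prob B2 <= dl / 9" unfolding B2_def by (rule elim(3)[rule_format, OF n])
   have P3: "PI.prob B3 <= dl / 9"
   proof -
    have "PI.prob B3 <= (norm (S (w l) - f))^2 / t"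
     unfolding B3_def by (rule approximation_event[OF t0 n0])
    also have "... <= (l powr r * Rad)^2 / t"
     using approximation_error[OF r src hs l(1)] t0 by (intro divide_right_mono power_mono) auto
    also have "... = dl / 9" using Rad dl l by (simp add: t_def power_mult_distrib)
    finally show ?thesis .
   qed
   have PA: "PI.prob (space ?P - A) <= dl / 9" using A(2) PI.prob_compl[OF A(1)] by simp
   define D where "D = (space ?P - A) \<union> (B1 \<union> (B2 \<union> B3))"
   have Dm: "D \<in> sets ?P" using A(1) B unfolding D_def by auto
   have "PI.prob D <= dl / 9 + (dl / 3 + (dl / 9 + dl / 9))"
    unfolding D_def using A(1) B P1 P2 P3 PA
    by (intro order_trans[OF measure_Un_le add_mono]) auto
   then have "1 - 2 / 3 * dl <= PI.prob (space ?P - D)" using PI.prob_compl[OF Dm] by simp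
   moreover have "good_sample l n (ln (6 / dl)) t z" if z: "z \<in> space ?P - D" for z
   proof -
    have zP: "z \<in> space ?P" and zA: "z \<in> A" and zB: "z \<notin> B1" "z \<notin> B2" "z \<notin> B3" using z by (auto simp: D_def)
    have "\<forall>i<n. z i \<in> space rho" using zP by (auto simp: space_PiM PiE_iff)
    then show ?thesis using zP zB bspec[OF A(3) zA] unfolding good_sample_def B1_def B2_def B3_def by simp
   qed
   ultimately show "\<exists>A\<in>sets ?P. PI.prob A >= 1 - 2 / 3 * dl \<and> (\<forall>z\<in>A. good_sample l n (ln (6 / dl)) (9 * Rad^2 / dl * (l powr r)^2) z)"
    unfolding t_def[symmetric] by (intro bexI[of _ "space ?P - D"] conjI ballI sets.compl_sets[OF Dm])
  qed
 qed
qed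

text \<open>The constant is chosen before the confidence level, which enters through
  \<open>Lg\<close> and through \<open>t\<close> divided by the batch size. Every term is compared
  with \<lambda>^r, or with \<lambda>^(2r) under the square root.\<close>

lemma good_sample_error:
 fixes h0 :: 'h
 assumes eta: "eta > 0" "4 * eta * kap^2 <= 1" and be: "be > 0"
 shows "\<exists>C. \<forall>l n b T Lg t z k. n > 0 \<and> b > 0 \<and> T > 0 \<and> l = 1 / (eta * real T) \<and> l <= 1 \<and> 1 <= Lg \<and>
   good_sample l n Lg t z \<and> 1 / real b <= be * l powr (r + nx / 2) \<and> t / real b <= 9 * Rad^2 * (l powr r)^2 \<and>
   near_features l n z k -->
  risk eta b T h0 n k (%i. y (z i)) <= C * Lg * l powr r"
proof -
 define A1 where "A1 = norm h0 + Rad"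
 define D where "D = 4 * noise_const + Rad + (M + 2 * kap * Rad) / (4 * kap)"
 define C0 where "C0 = (kap * norm h0 + M)^2"
 define X1 where "X1 = 2 * (2 * M)^2 * (8 * (eta * (cnx + 1) * be) + 2 * (eta / (16 * kap^2)))"
 define Y1 where "Y1 = C0 * be^2 + 2 * A1^2 + 18 * D^2 + (2 * (9 * Rad^2) + 2 * (Rad^2 / (16 * kap^2)))"
 define C where "C = 2 * (6 * sqrt (X1 + 3 / 2 * Y1)) + 2 * 2 * (2 * A1 + 3 * D) + Rad + (norm f + Rad) * eta"
 have D0: "D >= 0" using noise_const_pos M kap Rad by (simp add: D_def)
 have A10: "A1 >= 0" using Rad by (simp add: A1_def)
 have X10: "X1 >= 0" using eta cnx_nonneg be by (simp add: X1_def)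
 have Y10: "Y1 >= 0" by (simp add: Y1_def C0_def)
 show ?thesis
 proof (intro exI[of _ C] allI impI; elim conjE)
  fix l n b T Lg t z k
  assume n: "n > 0" and b: "b > 0" and T: "T > 0" and l: "l = 1 / (eta * real T)" and l1: "l <= 1" and Lg: "1 <= Lg"
   and good: "good_sample l n Lg t z" and b1: "1 / real b <= be * l powr (r + nx / 2)"
   and tb: "t / real b <= 9 * Rad^2 * (l powr r)^2"
   and k: "near_features l n z k"
  have l0: "l > 0" using T eta by (simp add: l)
  define q where "q = l powr r"
  define d where "d = l / (4 * kap)"
  define E2 where "E2 = 2 * noise_const * Lg * q"
  define N2 where "N2 = (cnx + 1) * l powr (- nx)"
  define Th where "Th = 2 * E2 + sqrt l * norm (w l) + (M + 2 * kap * norm (w l)) * d / sqrt l"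
  define v where "v = 1 / real b"
  have q0: "q > 0" using l0 by (simp add: q_def)
  have sq: "sqrt l = l powr (1 / 2)" using l0 by (simp add: powr_half_sqrt)
  have sl: "sqrt l <= q" unfolding sq q_def using r by (intro powr_antimono_exponent l0 l1) auto
  have sl0: "0 < sqrt l" using l0 by simp
  have sl2: "sqrt l * sqrt l = l" using l0 by simp
  have ll: "l <= q" using powr_antimono_exponent[OF l0 l1, of r 1] r l0 by (simp add: q_def)
  have lq: "l <= q^2" using mult_mono[OF sl sl] sl2 sl0 q0 by (simp add: power2_eq_square)
  have wl: "norm (w l) <= l powr (r - 1 / 2) * Rad" by (rule w_norm_le[OF r src hs l0])
  have Sw: "norm (S (w l) - f) <= q * Rad" unfolding q_def by (rule approximation_error[OF r src hs l0])
  have sw: "sqrt l * norm (w l) <= Rad * q"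
  proof -
   have "sqrt l * norm (w l) <= sqrt l * (l powr (r - 1 / 2) * Rad)" using sl0 by (intro mult_left_mono wl) auto
   also have "... = Rad * (l powr (1 / 2) * l powr (r - 1 / 2))" unfolding sq by simp
   also have "l powr (1 / 2) * l powr (r - 1 / 2) = q" unfolding q_def by (simp add: powr_add[symmetric])
   finally show ?thesis .
  qed
  have sh: "sqrt l * norm (h0 - w l) <= A1 * q"
  proof -
   have "sqrt l * norm (h0 - w l) <= sqrt l * (norm h0 + norm (w l))"
    using sl0 by (intro mult_left_mono norm_triangle_ineq4) auto
   also have "... = sqrt l * norm h0 + sqrt l * norm (w l)" by (rule distrib_left)
   also have "... <= q * norm h0 + Rad * q" by (intro add_mono sw mult_right_mono sl) auto
   finally show ?thesis by (simp add: A1_def algebra_simps)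
  qed
  have qL: "q <= Lg * q" using Lg q0 by simp
  have E20: "E2 >= 0" using noise_const_pos q0 Lg by (simp add: E2_def)
  have dd: "(M + 2 * kap * norm (w l)) * d / sqrt l <= (M + 2 * kap * Rad) / (4 * kap) * q"
  proof -
   have "d / sqrt l = sqrt l / (4 * kap)" 
    unfolding d_def divide_divide_eq_left mult.commute[of _ "sqrt l"]
    unfolding divide_divide_eq_left[symmetric] real_div_sqrt[OF less_imp_le[OF l0]] ..
   then have "(M + 2 * kap * norm (w l)) * (d / sqrt l) = (M * sqrt l + 2 * kap * (sqrt l * norm (w l))) / (4 * kap)"
    by (simp add: field_simps)
   then have "(M + 2 * kap * norm (w l)) * d / sqrt l = (M * sqrt l + 2 * kap * (sqrt l * norm (w l))) / (4 * kap)"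
    by (simp only: times_divide_eq_right)
   also have "... <= (M * q + 2 * kap * (Rad * q)) / (4 * kap)"
    using M kap by (intro divide_right_mono add_mono mult_left_mono sl sw) auto
   also have "... = (M + 2 * kap * Rad) / (4 * kap) * q" by (simp add: algebra_simps)
   finally show ?thesis .
  qed
  have Th: "Th <= D * Lg * q"
  proof -
   have "0 <= (M + 2 * kap * Rad) / (4 * kap)" using M kap Rad by simp
   have "Th <= 2 * E2 + Rad * q + (M + 2 * kap * Rad) / (4 * kap) * q" unfolding Th_def by (intro add_mono sw dd order_refl)
   also have "... <= 2 * E2 + Rad * (Lg * q) + (M + 2 * kap * Rad) / (4 * kap) * (Lg * q)"
    using Rad M kap by (intro add_mono mult_left_mono qL order_refl) auto
   also have "... = D * Lg * q" by (simp add: E2_def D_def algebra_simps)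
   finally show ?thesis .
  qed
  have Th0: "0 <= Th" unfolding Th_def d_def using E20 M kap l0 by (intro add_nonneg_nonneg divide_nonneg_nonneg mult_nonneg_nonneg) auto
  have v0: "0 <= v" "v <= 1" using b by (auto simp: v_def)
  have err: "risk eta b T h0 n k (%i. y (z i))
   <= 2 * sqrt (36 / b * (2 * (2 * M)^2 * (8 * N2 + 2 * d^2 / l) / T
     + 3 / 2 * ((kap * norm h0 + M)^2 / b + 2 * l * (norm (h0 - w l))^2 + 18 * Th^2 + (2 * t + 2 * d^2 * (norm (w l))^2))))
   + 2 * 2 * (2 * sqrt l * norm (h0 - w l) + 3 * Th) + norm (S (w l) - f) + norm (S (w l)) / T"
   by (rule perturbed_sample_error[OF n b T eta l _ _ _ _ _ _ _ _ Th_def])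
    (use good k kap in \<open>auto simp: good_sample_def near_features_def E2_def q_def N2_def d_def\<close>)
  \<comment> \<open>The exponent is r + 1 - \<nu>/2, at least 2r since r <= 1/2 and \<nu> <=
    1.\<close>
  have N2T: "v * (N2 / T) <= eta * (cnx + 1) * be * q^2"
  proof -
   have "1 / real T = eta * l" using eta T by (simp add: l)
   then have "v * (N2 / T) = v * (N2 * (eta * l))" by (simp only: divide_inverse mult_1_left)
   also have "... <= (be * l powr (r + nx / 2)) * (N2 * (eta * l))"
    unfolding v_def using cnx_nonneg eta l0 by (intro mult_right_mono b1) (auto simp: N2_def)
   also have "... = eta * (cnx + 1) * be * (l powr (r + nx / 2) * l powr (- nx) * l powr 1)" using l0 by (simp add: N2_def)
   also have "l powr (r + nx / 2) * l powr (- nx) * l powr 1 = l powr (r + nx / 2 - nx + 1)" by (simp only: powr_add[symmetric]) simp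
   also have "... <= l powr (r + r)" using nx r by (intro powr_antimono_exponent l0 l1) auto
   also have "... = q^2" unfolding q_def powr_add power2_eq_square ..
   finally show ?thesis using eta cnx_nonneg be by simp
  qed
  have dT: "v * (d^2 / l / T) <= eta / (16 * kap^2) * q^2"
  proof -
   have "v * (d^2 / l / T) <= 1 * (d^2 / l / T)" using v0 l0 by (intro mult_right_mono) auto
   also have "... = eta / (16 * kap^2) * l^2"
   proof -
    have "1 / real T = eta * l" using eta T by (simp add: l)
    then have "d^2 / l / T = d^2 / l * (eta * l)" by (simp only: divide_inverse mult_1_left)
    then show ?thesis using l0 by (simp add: d_def power_divide power_mult_distrib)
   qed
   also have "... <= eta / (16 * kap^2) * q^2"
    using eta ll l0 by (intro mult_left_mono power_mono) auto
   finally show ?thesis .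
  qed
  have vX: "v * (2 * (2 * M)^2 * (8 * N2 + 2 * d^2 / l) / T) <= X1 * q^2"
  proof -
   have "v * (2 * (2 * M)^2 * (8 * N2 + 2 * d^2 / l) / T)
    = 2 * (2 * M)^2 * (8 * (v * (N2 / T)) + 2 * (v * (d^2 / l / T)))" by (simp add: algebra_simps add_divide_distrib)
   also have "... <= 2 * (2 * M)^2 * (8 * (eta * (cnx + 1) * be * q^2) + 2 * (eta / (16 * kap^2) * q^2))"
    by (intro mult_left_mono add_mono N2T dT) auto
   also have "... = X1 * q^2" by (simp add: X1_def algebra_simps)
   finally show ?thesis .
  qed
  have q2L: "q^2 <= Lg^2 * q^2" using power_mono[OF qL, of 2] q0 by (simp add: power_mult_distrib)
  have Y: "v * ((kap * norm h0 + M)^2 / b + 2 * l * (norm (h0 - w l))^2 + 18 * Th^2 + (2 * t + 2 * d^2 * (norm (w l))^2)) <= Y1 * (Lg^2 * q^2)"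
  proof -
   have "v <= be * q"
   proof -
    have "l powr (r + nx / 2) <= q" unfolding q_def using nx by (intro powr_antimono_exponent l0 l1) auto
    then show ?thesis using b1 be mult_left_mono[of "l powr (r + nx / 2)" q be] unfolding v_def by linarith
   qed
   then have "v * v <= (be * q)^2" unfolding power2_eq_square using v0 by (intro mult_mono) auto
   then have 1: "v * (C0 / b) <= C0 * be^2 * q^2"
    using mult_left_mono[of "v * v" "(be * q)^2" C0] by (simp add: v_def C0_def power_mult_distrib mult_ac)
   have "l * (norm (h0 - w l))^2 = (sqrt l * norm (h0 - w l))^2" using l0 by (simp add: power_mult_distrib)
   also have "... <= (A1 * q)^2" using sl0 by (intro power_mono sh) auto
   finally have 2: "l * (norm (h0 - w l))^2 <= A1^2 * q^2" by (simp add: power_mult_distrib)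
   have 3: "Th^2 <= D^2 * (Lg^2 * q^2)" using power_mono[OF Th Th0, of 2] by (simp add: power_mult_distrib mult_ac)
   \<comment> \<open>The batch size cancels the factor 1 / \<delta> hidden in
     \<open>t\<close>.\<close>
   have 4: "v * t <= 9 * Rad^2 * q^2" using tb by (simp add: v_def q_def)
   have 5: "d^2 * (norm (w l))^2 <= Rad^2 / (16 * kap^2) * q^2"
   proof -
    have "d^2 * (norm (w l))^2 = l * (sqrt l * norm (w l))^2 / (16 * kap^2)"
     using l0 by (simp add: d_def power_mult_distrib power_divide power2_eq_square)
    also have "... <= 1 * (Rad * q)^2 / (16 * kap^2)"
     using l0 l1 sl0 by (intro divide_right_mono mult_mono power_mono sw) auto
    finally show ?thesis by (simp add: power_mult_distrib)
   qed
   let ?y2 = "l * (norm (h0 - w l))^2" and ?y5 = "d^2 * (norm (w l))^2"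
   have v2: "v * x <= x" if "x >= 0" for x using mult_right_mono[OF v0(2) that] by simp
   have "v * ((kap * norm h0 + M)^2 / b + 2 * l * (norm (h0 - w l))^2 + 18 * Th^2 + (2 * t + 2 * d^2 * (norm (w l))^2))
    = v * (C0 / b) + 2 * (v * ?y2) + 18 * (v * Th^2) + (2 * (v * t) + 2 * (v * ?y5))"
    by (simp add: C0_def algebra_simps)
   also have "... <= C0 * be^2 * q^2 + 2 * (A1^2 * q^2) + 18 * (D^2 * (Lg^2 * q^2)) + (2 * (9 * Rad^2 * q^2) + 2 * (Rad^2 / (16 * kap^2) * q^2))"
    using l0 by (intro add_mono mult_left_mono 1 4 order_trans[OF v2 2] order_trans[OF v2 3] order_trans[OF v2 5]) auto
   also have "... <= C0 * be^2 * (Lg^2 * q^2) + 2 * (A1^2 * (Lg^2 * q^2)) + 18 * (D^2 * (Lg^2 * q^2)) + (2 * (9 * Rad^2 * (Lg^2 * q^2)) + 2 * (Rad^2 / (16 * kap^2) * (Lg^2 * q^2)))"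
    by (intro add_mono mult_left_mono q2L order_refl) (auto simp: C0_def)
   also have "... = Y1 * (Lg^2 * q^2)" unfolding Y1_def by (simp only: distrib_right mult.assoc)
   finally show ?thesis .
  qed
  let ?X = "2 * (2 * M)^2 * (8 * N2 + 2 * d^2 / l) / T"
   and ?Y = "(kap * norm h0 + M)^2 / b + 2 * l * (norm (h0 - w l))^2 + 18 * Th^2 + (2 * t + 2 * d^2 * (norm (w l))^2)"
  have factor: "36 / b * (u1 + 3 / 2 * u2) = 36 * (v * u1 + 3 / 2 * (v * u2))" for u1 u2
   using b by (simp add: v_def field_simps)
  have "36 / b * (?X + 3 / 2 * ?Y) = 36 * (v * ?X + 3 / 2 * (v * ?Y))" by (rule factor)
  also have "... <= 36 * (X1 * (Lg^2 * q^2) + 3 / 2 * (Y1 * (Lg^2 * q^2)))"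
   by (intro mult_left_mono add_mono Y order_trans[OF vX] q2L X10) auto
  also have "... = (6 * (Lg * q))^2 * (X1 + 3 / 2 * Y1)" by (simp add: power_mult_distrib algebra_simps)
  finally have "sqrt (36 / b * (?X + 3 / 2 * ?Y)) <= sqrt ((6 * (Lg * q))^2 * (X1 + 3 / 2 * Y1))"
   by (rule real_sqrt_le_mono)
  also have "... = 6 * sqrt (X1 + 3 / 2 * Y1) * (Lg * q)" using Lg q0 by (simp add: real_sqrt_mult)
  finally have c1: "2 * sqrt (36 / b * (?X + 3 / 2 * ?Y)) <= 2 * (6 * sqrt (X1 + 3 / 2 * Y1)) * (Lg * q)"
   by linarith
  have c2: "2 * 2 * (2 * sqrt l * norm (h0 - w l) + 3 * Th) <= 2 * 2 * (2 * A1 + 3 * D) * (Lg * q)"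
  proof -
   have "sqrt l * norm (h0 - w l) <= A1 * (Lg * q)" by (rule order_trans[OF sh mult_left_mono[OF qL A10]])
   then show ?thesis using Th by (simp add: algebra_simps)
  qed
  have c3: "norm (S (w l) - f) <= Rad * (Lg * q)"
   using Sw mult_left_mono[OF qL, of Rad] Rad mult.commute[of q Rad] by linarith
  have c4: "norm (S (w l)) / T <= (norm f + Rad) * eta * (Lg * q)"
  proof -
   have "q <= 1" using powr_antimono_exponent[OF l0 l1, of 0 r] r l0 by (simp add: q_def)
   then have "q * Rad <= Rad" using Rad by simp
   have "norm (S (w l)) <= norm (S (w l) - f) + norm f" using norm_triangle_ineq[of "S (w l) - f" f] by simp
   then have "norm (S (w l)) <= norm f + Rad" using Sw \<open>q * Rad <= Rad\<close> by linarith
   then have "norm (S (w l)) / T <= (norm f + Rad) / T" by (rule divide_right_mono) simp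
   also have "... = (norm f + Rad) * eta * l" using eta T by (simp add: l)
   also have "... <= (norm f + Rad) * eta * (Lg * q)" using ll qL Rad eta by (intro mult_left_mono) auto
   finally show ?thesis .
  qed
  have "C * Lg * l powr r = 2 * (6 * sqrt (X1 + 3 / 2 * Y1)) * (Lg * q) + 2 * 2 * (2 * A1 + 3 * D) * (Lg * q)
    + Rad * (Lg * q) + (norm f + Rad) * eta * (Lg * q)"
   unfolding C_def q_def by (simp only: distrib_right mult.assoc)
  then show "risk eta b T h0 n k (%i. y (z i)) <= C * Lg * l powr r"
   using err c1 c2 c3 c4 by linarith
 qed
qed

text \<open>Both batch sizes satisfy b >= sqrt n, which turns n >= c1 \<lambda>^-(2r+\<nu>) into 1 /
  b <= be \<lambda>^(r+\<nu>/2). The features \<open>k\<close> are quantified inside the event, so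
  those of the second stage may depend on the sample.\<close>

theorem sample_rate:
 fixes h0 :: 'h
 assumes eta: "eta > 0" "4 * eta * kap^2 <= 1"
 shows "\<exists>C. \<forall>dl. 0 < dl \<and> dl <= 1 --> (\<forall>\<^sub>F l in at_right 0. \<forall>n b T. T > 0 \<and> l = 1 / (eta * real T) \<and>
  c1 * l powr (- (2 * r + nx)) <= real n \<and> sqrt (real n) <= real b -->
  (\<exists>A\<in>sets (iid n rho). measure (iid n rho) A >= 1 - 2 / 3 * dl \<and>
   (\<forall>z\<in>A. \<forall>k. near_features l n z k -->
    risk eta b T h0 n k (%i. y (z i)) <= C * ln (6 / dl) * l powr r)))"
 (is "\<exists>C. \<forall>dl. _ --> eventually (%l. ?rate C dl l) _")
proof -
 define be where "be = 1 / sqrt c1"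
 have be: "be > 0" using c1 by (simp add: be_def)
 obtain C where C: "\<forall>l n b T Lg t z k. n > 0 \<and> b > 0 \<and> T > 0 \<and> l = 1 / (eta * real T) \<and> l <= 1 \<and> 1 <= Lg \<and>
   good_sample l n Lg t z \<and> 1 / real b <= be * l powr (r + nx / 2) \<and> t / real b <= 9 * Rad^2 * (l powr r)^2 \<and>
   near_features l n z k --> risk eta b T h0 n k (%i. y (z i)) <= C * Lg * l powr r"
  using good_sample_error[OF eta be, of h0] by (rule exE)
 show ?thesis
 proof (intro exI[of _ C] allI impI; elim conjE)
  fix dl :: real assume dl: "0 < dl" "dl <= 1"
  note Lg = ln_6_div_ge_1[OF dl]
  have "\<forall>\<^sub>F l in at_right 0. l powr 1 <= (1::real)" by (intro eventually_powr_le) auto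
  moreover have "\<forall>\<^sub>F l in at_right 0. l powr (r + nx / 2) <= dl / be" using dl be nx r by (intro eventually_powr_le) auto
  moreover have "\<forall>\<^sub>F l in at_right 0. (0::real) < l" by (rule eventually_at_right_less)
  ultimately show "eventually (%l. ?rate C dl l) (at_right 0)"
   using good_sample_event[OF dl]
  proof eventually_elim
   case (elim l)
   then have l: "0 < l" "l <= 1" by auto
   show ?case
   proof (intro allI impI; elim conjE)
    fix n b T :: nat
    assume T: "T > 0" "l = 1 / (eta * real T)" and n: "c1 * l powr (- (2 * r + nx)) <= real n" and b: "sqrt (real n) <= real b"
    have cl: "0 < c1 * l powr (- (2 * r + nx))" using c1 l by simp
    then have n0: "n > 0" using n by (cases n) auto
    have sn: "sqrt (c1 * l powr (- (2 * r + nx))) <= real b" using real_sqrt_le_mono[OF n] b by linarith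
    then have b0: "b > 0" using cl by (cases b) auto
    have "1 / real b <= 1 / sqrt (c1 * l powr (- (2 * r + nx)))" using sn cl by (intro frac_le) auto
    also have "... = be * l powr (r + nx / 2)"
    proof -
     have "sqrt (l powr (- (2 * r + nx))) = l powr (- (r + nx / 2))"
      unfolding powr_half_sqrt[OF powr_ge_zero, symmetric] powr_powr
      by (rule arg_cong[where f = "(powr) l"]) simp
     then show ?thesis unfolding be_def real_sqrt_mult
      by (simp only: powr_minus divide_inverse inverse_mult_distrib inverse_inverse_eq mult_1_left)
    qed
    finally have b1: "1 / real b <= be * l powr (r + nx / 2)" .
    have "be * l powr (r + nx / 2) <= dl" using elim(2) be by (simp add: pos_le_divide_eq mult.commute)
    then have "1 / real b <= dl" using b1 by linarith
    then have "9 * Rad^2 / dl * (l powr r)^2 * (1 / real b) <= 9 * Rad^2 / dl * (l powr r)^2 * dl"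
     using dl by (intro mult_left_mono) auto
    then have tb: "9 * Rad^2 / dl * (l powr r)^2 / real b <= 9 * Rad^2 * (l powr r)^2" using dl by simp
    obtain A where A: "A \<in> sets (iid n rho)" "measure (iid n rho) A >= 1 - 2 / 3 * dl"
     "\<forall>z\<in>A. good_sample l n (ln (6 / dl)) (9 * Rad^2 / dl * (l powr r)^2) z"
     using elim(4)[rule_format, OF n] by (elim bexE conjE)
    show "\<exists>A\<in>sets (iid n rho). measure (iid n rho) A >= 1 - 2 / 3 * dl \<and>
     (\<forall>z\<in>A. \<forall>k. near_features l n z k -->
      risk eta b T h0 n k (%i. y (z i)) <= C * ln (6 / dl) * l powr r)"
    proof (rule bexI[OF _ A(1)], intro conjI ballI allI impI)
     show "measure (iid n rho) A >= 1 - 2 / 3 * dl" by (rule A(2))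
     fix z k assume "z \<in> A" and k: "near_features l n z k"
     then have "good_sample l n (ln (6 / dl)) (9 * Rad^2 / dl * (l powr r)^2) z" using A(3) by simp
     then show "risk eta b T h0 n k (%i. y (z i)) <= C * ln (6 / dl) * l powr r"
      using n0 b0 T l(2) Lg b1 tb k by (intro C[rule_format, of n b T l _ _ z k] conjI) assumption+
    qed
   qed
  qed
 qed
qed

end

end

section \<open>Random indices and the second sampling stage\<close>

text \<open>The rectangle formula fixes the measure, since rectangles form an intersection-stable
  generator. As a bind of kernels the identity extends to integrands that are not products.\<close>

lemma conditional_law_eq_bind:
 assumes law: "conditional_law MA MB rho kap" and rho: "prob_space rho" "sets rho = sets (MA \<Otimes>\<^sub>M MB)"
 shows "rho = distr rho MA fst \<bind> (%m. distr (kap m) (MA \<Otimes>\<^sub>M MB) (Pair m))"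
  and "(%m. distr (kap m) (MA \<Otimes>\<^sub>M MB) (Pair m)) \<in> MA \<rightarrow>\<^sub>M subprob_algebra (MA \<Otimes>\<^sub>M MB)"
proof -
 interpret prob_space rho by (rule rho)
 let ?\<mu> = "distr rho MA fst" and ?D = "%m. distr (kap m) (MA \<Otimes>\<^sub>M MB) (Pair m)"
 have kap [measurable]: "kap \<in> MA \<rightarrow>\<^sub>M subprob_algebra MB"
  using law by (simp add: conditional_law_def measurable_prob_algebraD)
 have kap_s: "sets (kap m) = sets MB" if "m \<in> space MA" for m using measurable_space[OF kap that] by (simp add: space_subprob_algebra)
 have fst_m: "fst \<in> rho \<rightarrow>\<^sub>M MA" unfolding measurable_cong_sets[OF rho(2) refl] by (rule measurable_fst)
 show D: "?D \<in> MA \<rightarrow>\<^sub>M subprob_algebra (MA \<Otimes>\<^sub>M MB)" by (rule measurable_distr2[OF _ kap]) measurable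
 have D': "?D \<in> ?\<mu> \<rightarrow>\<^sub>M subprob_algebra (MA \<Otimes>\<^sub>M MB)" using D by (simp cong: measurable_cong_sets)
 have space_ne: "space MA \<noteq> {}" using not_empty measurable_space[OF fst_m] by auto
 have sb: "sets (?\<mu> \<bind> ?D) = sets (MA \<Otimes>\<^sub>M MB)"
  by (rule sets_bind[of _ _ "MA \<Otimes>\<^sub>M MB"]) (use D' space_ne in \<open>auto simp: sets_kernel\<close>)
 show "rho = ?\<mu> \<bind> ?D"
 proof (rule measure_eqI_generator_eq[OF Int_stable_pair_measure_generator pair_measure_closed])
  show "sets rho = sigma_sets (space MA \<times> space MB) {a \<times> b |a b. a \<in> sets MA \<and> b \<in> sets MB}"
   "sets (?\<mu> \<bind> ?D) = sigma_sets (space MA \<times> space MB) {a \<times> b |a b. a \<in> sets MA \<and> b \<in> sets MB}"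
   unfolding rho(2) sb by (rule sets_pair_measure)+
  fix X assume "X \<in> {a \<times> b |a b. a \<in> sets MA \<and> b \<in> sets MB}"
  then obtain A B where X: "X = A \<times> B" and A: "A \<in> sets MA" and B: "B \<in> sets MB" by auto
  have "emeasure (?\<mu> \<bind> ?D) X = (\<integral>\<^sup>+m. emeasure (?D m) X \<partial>?\<mu>)"
   using A B by (intro emeasure_bind[OF _ D']) (auto simp: X space_ne)
  also have "... = (\<integral>\<^sup>+m. emeasure (kap m) B * indicator A m \<partial>?\<mu>)"
  proof (rule nn_integral_cong)
   fix m assume "m \<in> space ?\<mu>"
   then have m: "m \<in> space MA" by simp
   then have "Pair m \<in> kap m \<rightarrow>\<^sub>M MA \<Otimes>\<^sub>M MB"
    unfolding measurable_cong_sets[OF kap_s[OF m] refl] by (rule measurable_Pair1')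
   then have "emeasure (?D m) X = emeasure (kap m) (Pair m -` X \<inter> space (kap m))"
    using A B by (intro emeasure_distr) (auto simp: X)
   also have "Pair m -` X \<inter> space (kap m) = (if m \<in> A then B else {})"
    using sets.sets_into_space[OF B] sets_eq_imp_space_eq[OF kap_s[OF m]] by (auto simp: X)
   finally show "emeasure (?D m) X = emeasure (kap m) B * indicator A m" by (simp add: indicator_def)
  qed
  also have "... = emeasure rho X" using law A B by (simp add: conditional_law_def X)
  finally show "emeasure rho X = emeasure (?\<mu> \<bind> ?D) X" ..
 next
  show "range (%_. space MA \<times> space MB) \<subseteq> {a \<times> b |a b. a \<in> sets MA \<and> b \<in> sets MB}" by auto
  show "(\<Union>i::nat. space MA \<times> space MB) = space MA \<times> space MB" by simp
 qed simp
qed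

lemma conditional_law_nn_integral:
 assumes law: "conditional_law MA MB rho kap" and rho: "prob_space rho" "sets rho = sets (MA \<Otimes>\<^sub>M MB)"
  and h: "h \<in> borel_measurable (MA \<Otimes>\<^sub>M MB)"
 shows "(\<integral>\<^sup>+z. h z \<partial>rho) = (\<integral>\<^sup>+m. \<integral>\<^sup>+y. h (m, y) \<partial>kap m \<partial>distr rho MA fst)"
proof -
 note b = conditional_law_eq_bind[OF law rho]
 have kap: "kap \<in> MA \<rightarrow>\<^sub>M subprob_algebra MB"
  using law by (simp add: conditional_law_def measurable_prob_algebraD)
 have "(\<integral>\<^sup>+z. h z \<partial>rho) = (\<integral>\<^sup>+z. h z \<partial>(distr rho MA fst \<bind> (%m. distr (kap m) (MA \<Otimes>\<^sub>M MB) (Pair m))))"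
  by (rule arg_cong[OF b(1)])
 also have "... = (\<integral>\<^sup>+m. \<integral>\<^sup>+z. h z \<partial>distr (kap m) (MA \<Otimes>\<^sub>M MB) (Pair m) \<partial>distr rho MA fst)"
  using b(2) by (intro nn_integral_bind[OF h]) (simp cong: measurable_cong_sets)
 also have "... = (\<integral>\<^sup>+m. \<integral>\<^sup>+y. h (m, y) \<partial>kap m \<partial>distr rho MA fst)"
 proof (rule nn_integral_cong)
  fix m assume "m \<in> space (distr rho MA fst)"
  then have m: "m \<in> space MA" by simp
  have "sets (kap m) = sets MB" using measurable_space[OF kap m] by (simp add: space_subprob_algebra)
  then have "Pair m \<in> kap m \<rightarrow>\<^sub>M MA \<Otimes>\<^sub>M MB"
   using measurable_cong_sets[of "kap m" MB] measurable_Pair1'[OF m, of MB] by blast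
  then show "(\<integral>\<^sup>+z. h z \<partial>distr (kap m) (MA \<Otimes>\<^sub>M MB) (Pair m)) = (\<integral>\<^sup>+y. h (m, y) \<partial>kap m)"
   by (rule nn_integral_distr) (use h in simp)
 qed
 finally show ?thesis .
qed

lemma restrict_eq_iff: "j \<in> A \<rightarrow>\<^sub>E B ==> restrict f A = j \<longleftrightarrow> (\<forall>i\<in>A. f i = j i)"
 by (metis PiE_restrict restrict_apply' restrict_ext)

lemma index_mean_eq_sum:
 assumes f: "!!j j'. (\<forall>i<k. j i = j' i) ==> f j = f j'"
 shows "index_mean n k f = (1 / real n ^ k) * (SUM j:{..<k} \<rightarrow>\<^sub>E {..<n}. f j)"
 using f
proof (induction k arbitrary: f)
 case 0
 then show ?case by simp
next
 case (Suc k)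
 have "index_mean n (Suc k) f = (1 / real n ^ k) * (SUM j:{..<k} \<rightarrow>\<^sub>E {..<n}. (1 / real n) * (SUM l<n. f (j(k := l))))"
  unfolding index_mean.simps
 proof (rule Suc.IH)
  fix j j' :: "nat => nat" assume "\<forall>i<k. j i = j' i"
  then have "f (j(k := l)) = f (j'(k := l))" for l by (intro Suc.prems) (simp add: less_Suc_eq)
  then show "(1 / real n) * (SUM l<n. f (j(k := l))) = (1 / real n) * (SUM l<n. f (j'(k := l)))" by simp
 qed
 also have "... = (1 / real n ^ Suc k) * (SUM j:{..<k} \<rightarrow>\<^sub>E {..<n}. SUM l<n. f (j(k := l)))"
  by (simp add: sum_divide_distrib[symmetric] mult.commute)
 also have "(SUM j:{..<k} \<rightarrow>\<^sub>E {..<n}. SUM l<n. f (j(k := l))) = (SUM l<n. SUM j:{..<k} \<rightarrow>\<^sub>E {..<n}. f (j(k := l)))"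
  by (rule sum.swap)
 also have "... = (\<Sum>(l, j)\<in>{..<n} \<times> ({..<k} \<rightarrow>\<^sub>E {..<n}). f (j(k := l)))" by (rule sum.cartesian_product)
 also have "... = sum f ((%(l, j). j(k := l)) ` ({..<n} \<times> ({..<k} \<rightarrow>\<^sub>E {..<n})))"
  by (subst sum.reindex[OF inj_combinator]) (auto simp: case_prod_unfold)
 also have "(%(l, j). j(k := l)) ` ({..<n} \<times> ({..<k} \<rightarrow>\<^sub>E {..<n})) = {..<Suc k} \<rightarrow>\<^sub>E {..<n}"
  unfolding lessThan_Suc PiE_insert_eq ..
 finally show ?case .
qed

lemma uniform_index_prob:
 assumes Om: "prob_space Om" and J: "prob_space.indep_vars Om (%_. count_space UNIV) J {..<k}"
  and unif: "\<forall>i<k. distr Om (count_space UNIV) (J i) = measure_pmf (pmf_of_set {..<n})"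
  and j: "j \<in> {..<k} \<rightarrow>\<^sub>E {..<n}" and n: "n > (0::nat)"
 shows "measure Om {om\<in>space Om. \<forall>i<k. J i om = j i} = 1 / real n ^ k"
proof -
 interpret prob_space Om by (rule Om)
 have Jm: "J i \<in> Om \<rightarrow>\<^sub>M count_space UNIV" if "i < k" for i using J that by (simp add: indep_vars_def2)
 have one: "prob (J i -` {j i} \<inter> space Om) = 1 / real n" if i: "i < k" for i
 proof -
  have "prob (J i -` {j i} \<inter> space Om) = measure (distr Om (count_space UNIV) (J i)) {j i}"
   by (rule measure_distr[symmetric]) (use Jm[OF i] in auto)
  also have "... = measure (measure_pmf (pmf_of_set {..<n})) {j i}" using unif i by simp
  also have "... = 1 / real n" using j i n by (subst measure_pmf_of_set) (auto simp: PiE_iff)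
  finally show ?thesis .
 qed
 show ?thesis
 proof (cases "k = 0")
  case True
  then show ?thesis by (simp add: prob_space)
 next
  case False
  then have "{om\<in>space Om. \<forall>i<k. J i om = j i} = (\<Inter>i\<in>{..<k}. J i -` {j i} \<inter> space Om)" by auto
  also have "prob ... = (\<Prod>i\<in>{..<k}. prob (J i -` {j i} \<inter> space Om))"
   using False by (intro indep_varsD[OF J]) auto
  also have "... = 1 / real n ^ k" using one by (simp add: power_one_over)
  finally show ?thesis .
 qed
qed

lemma uniform_index_less:
 fixes k :: nat
 assumes Om: "prob_space Om" and J: "prob_space.indep_vars Om (%_. count_space UNIV) J {..<k}"
  and unif: "\<forall>i<k. distr Om (count_space UNIV) (J i) = measure_pmf (pmf_of_set {..<n})"
  and n: "n > (0::nat)"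
 shows "AE om in Om. \<forall>i\<in>{..<k}. J i om < n"
proof (subst AE_finite_all)
 interpret prob_space Om by (rule Om)
 show "\<forall>i\<in>{..<k}. AE om in Om. J i om < n"
 proof
  fix i assume i: "i \<in> {..<k}"
  then have Jm: "J i \<in> Om \<rightarrow>\<^sub>M count_space UNIV" using J by (auto simp: indep_vars_def2)
  have "AE l in measure_pmf (pmf_of_set {..<n}). l < n" using n by (intro AE_pmfI) (subst (asm) set_pmf_of_set, auto)
  moreover have "distr Om (count_space UNIV) (J i) = measure_pmf (pmf_of_set {..<n})" using unif i by auto
  ultimately have "AE l in distr Om (count_space UNIV) (J i). l < n" by (simp only:)
  then show "AE om in Om. J i om < n" by (rule AE_distrD[OF Jm])
 qed
qed simp

text \<open>\<open>\<G>\<close> carries the sigma-algebra of the two sampling stages.\<close>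
lemma random_index_integral:
 fixes F :: "(nat => nat) => 'w => real"
 assumes Om: "prob_space Om" and J: "prob_space.indep_vars Om (%_. count_space UNIV) J {..<k}"
  and unif: "\<forall>i<k. distr Om (count_space UNIV) (J i) = measure_pmf (pmf_of_set {..<n})" and n: "n > 0"
  and indep: "prob_space.indep_set Om (sets \<G>)
    (sets (vimage_algebra (space Om) (%om. \<lambda>i\<in>{..<k}. J i om) (\<Pi>\<^sub>M i\<in>{..<k}. count_space UNIV)))"
  and \<G>: "space \<G> = space Om" "sets \<G> \<subseteq> sets Om"
  and F: "!!j. j \<in> {..<k} \<rightarrow>\<^sub>E {..<n} ==> F j \<in> borel_measurable \<G>"
   "!!j om. j \<in> {..<k} \<rightarrow>\<^sub>E {..<n} ==> om \<in> space Om ==> \<bar>F j om\<bar> <= B"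
   "!!j j' om. (\<forall>i<k. j i = j' i) ==> F j om = F j' om"
  and f: "(%om. F (%i. J i om) om) \<in> borel_measurable Om" and W: "W \<in> sets \<G>"
 shows "(LINT om|Om. indicator W om * F (%i. J i om) om) = (LINT om|Om. indicator W om * index_mean n k (%j. F j om))"
  and "AE om in Om. \<bar>F (%i. J i om) om\<bar> <= B"
  and "integrable Om (%om. F (%i. J i om) om)"
  and "integrable Om (%om. index_mean n k (%j. F j om))"
proof -
 interpret prob_space Om by (rule Om)
 let ?I = "{..<k} \<rightarrow>\<^sub>E {..<n}"
 have fin: "finite ?I" by (intro finite_PiE) auto
 have sub: "g \<in> borel_measurable Om" if "g \<in> borel_measurable \<G>" for g :: "'w => real"
  using that \<G> by (intro measurable_from_subalg[of Om \<G>]) (auto simp: subalgebra_def)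
 have W': "W \<in> sets Om" using W \<G> by auto
 have Fi: "integrable Om (F j)" if "j \<in> ?I" for j
 proof (rule integrable_const_bound[of _ B])
  show "AE om in Om. norm (F j om) <= B" using F(2)[OF that] by (intro AE_I2) simp
 qed (rule sub[OF F(1)[OF that]])
 have Jm: "J i \<in> Om \<rightarrow>\<^sub>M count_space UNIV" if "i < k" for i using J that by (simp add: indep_vars_def2)
 \<comment> \<open>Up to a null set the probability space splits into the events that the index
   sequence equals a given j.\<close>
 define E where "E j = {om\<in>space Om. \<forall>i<k. J i om = j i}" for j
 note less = uniform_index_less[OF Om J unif n]
 have Em: "E j \<in> sets (vimage_algebra (space Om) (%om. \<lambda>i\<in>{..<k}. J i om) (\<Pi>\<^sub>M i\<in>{..<k}. count_space UNIV))" if "j \<in> ?I" for j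
 proof -
  have "{j} \<in> sets (\<Pi>\<^sub>M i\<in>{..<k}. count_space (UNIV::nat set))"
  proof -
   have "{j} = (\<Pi>\<^sub>E i\<in>{..<k}. {j i})" by (rule PiE_singleton[symmetric]) (use that in \<open>simp add: PiE_iff\<close>)
   then show ?thesis by (simp add: sets_PiM_I_finite)
  qed
  moreover have "E j = (%om. \<lambda>i\<in>{..<k}. J i om) -` {j} \<inter> space Om"
   using restrict_eq_iff[OF that] by (auto simp: E_def)
  ultimately show ?thesis by (metis in_vimage_algebra)
 qed
 have Em': "E j \<in> sets Om" for j
 proof -
  have "E j = space Om \<inter> (\<Inter>i\<in>{..<k}. J i -` {j i} \<inter> space Om)" if "k \<noteq> 0" using that by (auto simp: E_def)
  moreover have "(\<Inter>i\<in>{..<k}. J i -` {j i} \<inter> space Om) \<in> sets Om" if "k \<noteq> 0"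
   using that Jm by (intro sets.finite_INT) (auto simp: measurable_sets)
  ultimately show ?thesis by (cases "k = 0") (auto simp: E_def)
 qed
 \<comment> \<open>A function of the two stages is independent of the indices, and each index
   sequence has probability 1 / n^k.\<close>
 have prod: "(LINT om|Om. g om * indicator (E j) om) = (LINT om|Om. g om) * (1 / real n ^ k)"
  if g: "g \<in> borel_measurable \<G>" "integrable Om g" and j: "j \<in> ?I" for g j
 proof -
  have g': "g \<in> borel_measurable Om" by (rule sub[OF g(1)])
  have "indep_var borel g borel (indicator (E j) :: 'w => real)"
   unfolding indep_var_eq
  proof (intro conjI)
   show "random_variable borel g" by (rule g')
   show "random_variable borel (indicator (E j) :: 'w => real)" using Em' by simp
   let ?A = "sigma_sets (space Om) {g -` A \<inter> space Om |A. A \<in> sets borel}"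
    and ?B = "sigma_sets (space Om) {(indicator (E j) :: 'w => real) -` A \<inter> space Om |A. A \<in> sets borel}"
   have A: "?A \<subseteq> sets \<G>"
    using measurable_sets[OF g(1)] unfolding \<G>(1)[symmetric] by (intro sets.sigma_sets_subset) auto
   let ?V = "vimage_algebra (space Om) (%om. \<lambda>i\<in>{..<k}. J i om) (\<Pi>\<^sub>M i\<in>{..<k}. count_space (UNIV::nat set))"
   have "(indicator (E j) :: 'w => real) \<in> borel_measurable ?V"
    using Em[OF j] by (rule borel_measurable_indicator)
   from measurable_sets[OF this] have "{(indicator (E j) :: 'w => real) -` A \<inter> space ?V |A. A \<in> sets borel} \<subseteq> sets ?V" by auto
   then have "sigma_sets (space ?V) {(indicator (E j) :: 'w => real) -` A \<inter> space ?V |A. A \<in> sets borel} \<subseteq> sets ?V"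
    by (rule sets.sigma_sets_subset)
   then have B: "?B \<subseteq> sets ?V" by simp
   show "indep_set ?A ?B"
    using indep A B unfolding indep_set_def by (rule_tac indep_sets_mono_sets) (auto split: bool.split)
  qed
  then have "(LINT om|Om. g om * indicator (E j) om) = (LINT om|Om. g om) * (LINT om|Om. indicator (E j) om)"
   using g(2) Em' by (intro indep_var_lebesgue_integral) (auto simp: emeasure_eq_measure)
  also have "(LINT om|Om. indicator (E j) om) = prob (E j)" using Em'[of j] by simp
  also have "... = 1 / real n ^ k" unfolding E_def by (rule uniform_index_prob[OF Om J unif j n])
  finally show ?thesis .
 qed
 have decomp: "F (%i. J i om) om = (SUM j:?I. F j om * indicator (E j) om)" and restr: "(\<lambda>i\<in>{..<k}. J i om) \<in> ?I"
  and res: "F (%i. J i om) om = F (\<lambda>i\<in>{..<k}. J i om) om"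
  if om: "om \<in> space Om" "\<forall>i\<in>{..<k}. J i om < n" for om
 proof -
  let ?j = "\<lambda>i\<in>{..<k}. J i om"
  show jI: "?j \<in> ?I" unfolding restrict_PiE_iff using om(2) by simp
  show F_eq: "F (%i. J i om) om = F ?j om" by (rule F(3)) simp
  have "indicator (E j) om = (if j = ?j then 1 else 0 :: real)" if "j \<in> ?I" for j
   using restrict_eq_iff[OF that, of "%i. J i om"] om(1) by (auto simp: E_def indicator_def)
  then have "(SUM j:?I. F j om * indicator (E j) om) = (SUM j:?I. if j = ?j then F j om else 0)"
   by (intro sum.cong) auto
  also have "... = F ?j om" using fin jI by simp
  finally show "F (%i. J i om) om = (SUM j:?I. F j om * indicator (E j) om)" using F_eq by simp
 qed
 show bnd: "AE om in Om. \<bar>F (%i. J i om) om\<bar> <= B"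
  using less AE_space by eventually_elim (simp add: res F(2) restr)
 show "integrable Om (%om. F (%i. J i om) om)"
  by (rule integrable_const_bound[of _ B]) (use bnd f in auto)
 have im: "index_mean n k (%j. F j om) = (1 / real n ^ k) * (SUM j:?I. F j om)" for om
  by (rule index_mean_eq_sum) (rule F(3))
 show "integrable Om (%om. index_mean n k (%j. F j om))"
  unfolding im using Fi by (intro integrable_mult_right Bochner_Integration.integrable_sum)
 have Wi: "integrable Om (%om. indicator W om * F j om)" if "j \<in> ?I" for j
  using integrable_mult_indicator[OF W' Fi[OF that]] by simp
 have WEi: "integrable Om (%om. indicator W om * F j om * indicator (E j) om)" if "j \<in> ?I" for j
  using integrable_mult_indicator[OF Em' Wi[OF that]] by (simp add: mult.commute)
 have "(LINT om|Om. indicator W om * F (%i. J i om) om) = (LINT om|Om. (SUM j:?I. indicator W om * F j om * indicator (E j) om))"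
 proof (rule integral_cong_AE)
  show "(%om. indicator W om * F (%i. J i om) om) \<in> borel_measurable Om" using f W' by simp
  show "(%om. SUM j:?I. indicator W om * F j om * indicator (E j) om) \<in> borel_measurable Om"
   by (intro borel_measurable_sum borel_measurable_integrable WEi)
  show "AE om in Om. indicator W om * F (%i. J i om) om = (SUM j:?I. indicator W om * F j om * indicator (E j) om)"
   using less AE_space by eventually_elim (simp add: decomp sum_distrib_left mult.assoc)
 qed
 also have "... = (SUM j:?I. \<integral>om. indicator W om * F j om * indicator (E j) om \<partial>Om)"
  using WEi by (rule Bochner_Integration.integral_sum)
 also have "... = (SUM j:?I. (LINT om|Om. indicator W om * F j om) * (1 / real n ^ k))"
 proof (rule sum.cong[OF refl])
  fix j assume j: "j \<in> ?I"
  show "(LINT om|Om. indicator W om * F j om * indicator (E j) om) = (LINT om|Om. indicator W om * F j om) * (1 / real n ^ k)"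
   by (rule prod[OF borel_measurable_times[OF borel_measurable_indicator[OF W] F(1)[OF j]] Wi[OF j] j])
 qed
 also have "... = (LINT om|Om. (SUM j:?I. indicator W om * F j om)) * (1 / real n ^ k)"
  by (subst Bochner_Integration.integral_sum[OF Wi]) (simp_all only: sum_distrib_right)
 also have "... = (LINT om|Om. indicator W om * index_mean n k (%j. F j om))"
  unfolding im integral_mult_left_zero[symmetric]
  by (rule Bochner_Integration.integral_cong[OF refl]) (simp only: sum_distrib_left[symmetric], simp only: mult_ac)
 finally show "(LINT om|Om. indicator W om * F (%i. J i om) om) = (LINT om|Om. indicator W om * index_mean n k (%j. F j om))" .
qed

section \<open>Conditionally independent points and their means\<close>

lemma emeasure_iid_PiM:
 fixes N :: nat
 assumes m: "m \<in> space (prob_algebra MB)" and B: "!!i. i < N ==> B i \<in> sets MB"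
 shows "emeasure (iid N m) (\<Pi>\<^sub>E i\<in>{..<N}. B i) = (\<Prod>i<N. emeasure m (B i))"
proof -
 have m': "prob_space m" "sets m = sets MB" using m by (auto simp: space_prob_algebra)
 interpret product_prob_space "%_. m" "{..<N}" by (intro product_prob_spaceI m')
 show ?thesis using B m' by (intro emeasure_PiM) auto
qed

lemma sets_iid_PiM:
 fixes N :: nat
 assumes "m \<in> space (prob_algebra MB)"
 shows "sets (iid N m) = sets (iid N MB)"
 using assms by (intro sets_PiM_cong) (auto simp: space_prob_algebra)

text \<open>Measurability is checked on product sets, where the measure is a finite product of
  evaluations of m.\<close>

lemma measurable_iid_PiM: "(%m. \<Pi>\<^sub>M i\<in>{..<N::nat}. m) \<in> prob_algebra MB \<rightarrow>\<^sub>M prob_algebra (iid N MB)"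
proof (rule measurable_prob_algebra_generated[OF sets_PiM Int_stable_prod_algebra prod_algebra_sets_into_space])
 fix m assume m: "m \<in> space (prob_algebra MB)"
 show "prob_space (iid N m)" using m by (intro prob_space_PiM) (auto simp: space_prob_algebra)
 show "sets (iid N m) = sets (iid N MB)" by (rule sets_iid_PiM[OF m])
next
 fix X assume "X \<in> prod_algebra {..<N} (%_. MB)"
 then obtain B where X: "X = (\<Pi>\<^sub>E i\<in>{..<N}. B i)" and B: "!!i. i < N ==> B i \<in> sets MB"
  by (auto simp: prod_algebra_eq_finite)
 have "(%m. \<Prod>i<N. emeasure m (B i)) \<in> borel_measurable (prob_algebra MB)"
 proof (rule borel_measurable_prod_ennreal)
  fix i assume "i \<in> {..<N}"
  then show "(%m. emeasure m (B i)) \<in> borel_measurable (prob_algebra MB)"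
   unfolding prob_algebra_def by (intro measurable_restrict_space1 measurable_emeasure_subprob_algebra B) simp
 qed
 then show "(%m. emeasure (iid N m) X) \<in> borel_measurable (prob_algebra MB)"
  unfolding X using emeasure_iid_PiM[OF _ B] by (simp cong: measurable_cong)
qed

text \<open>The hypothesis describes product sets of the points only. For a fixed event in x both
  sides are finite measures in the points, which agree on products and hence everywhere.\<close>

lemma conditional_iid_law:
 fixes N :: nat
 assumes Om: "prob_space Om" and x: "x \<in> Om \<rightarrow>\<^sub>M prob_algebra MB" and X: "!!i. i < N ==> X i \<in> Om \<rightarrow>\<^sub>M MB"
  and law: "!!A B. A \<in> sets (prob_algebra MB) ==> (!!i. i < N ==> B i \<in> sets MB) ==>
   measure Om {om\<in>space Om. x om \<in> A \<and> (\<forall>i<N. X i om \<in> B i)}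
   = (LINT om|Om. indicator A (x om) * (\<Prod>i<N. measure (x om) (B i)))"
 shows "conditional_law (prob_algebra MB) (iid N MB)
  (distr Om (prob_algebra MB \<Otimes>\<^sub>M (iid N MB)) (%om. (x om, \<lambda>i\<in>{..<N}. X i om))) (%m. \<Pi>\<^sub>M i\<in>{..<N}. m)"
 unfolding conditional_law_def
proof (intro conjI ballI measurable_iid_PiM)
 interpret prob_space Om by (rule Om)
 let ?PA = "prob_algebra MB" and ?PB = "iid N MB" and ?X = "%om. \<lambda>i\<in>{..<N}. X i om"
  and ?K = "%m. \<Pi>\<^sub>M i\<in>{..<N}. m"
 fix A B assume A: "A \<in> sets ?PA" and B: "B \<in> sets ?PB"
 have Xm: "?X \<in> Om \<rightarrow>\<^sub>M ?PB" using X by (intro measurable_restrict) auto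
 have xX: "(%om. (x om, ?X om)) \<in> Om \<rightarrow>\<^sub>M ?PA \<Otimes>\<^sub>M ?PB" by (rule measurable_Pair[OF x Xm])
 define W where "W = x -` A \<inter> space Om"
 have W: "W \<in> sets Om" unfolding W_def by (rule measurable_sets[OF x A])
 define nx1 where "nx1 = distr (density Om (indicator W)) ?PB ?X"
 define nx2 where "nx2 = density Om (indicator W) \<bind> (%om. ?K (x om))"
 have Kx: "(%om. ?K (x om)) \<in> Om \<rightarrow>\<^sub>M subprob_algebra ?PB"
  by (rule measurable_prob_algebraD[OF measurable_compose[OF x measurable_iid_PiM]])
 have Kx': "(%om. ?K (x om)) \<in> density Om (indicator W) \<rightarrow>\<^sub>M subprob_algebra ?PB" using Kx by simp
 have e1: "emeasure nx1 C = emeasure Om {om\<in>space Om. x om \<in> A \<and> ?X om \<in> C}" if C: "C \<in> sets ?PB" for C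
 proof -
  have "emeasure nx1 C = emeasure (density Om (indicator W)) (?X -` C \<inter> space Om)"
   unfolding nx1_def using Xm C by (subst emeasure_distr) auto
  also have "... = (\<integral>\<^sup>+om. indicator W om * indicator (?X -` C \<inter> space Om) om \<partial>Om)"
   by (rule emeasure_density) (use W measurable_sets[OF Xm C] in auto)
  also have "... = (\<integral>\<^sup>+om. indicator (W \<inter> (?X -` C \<inter> space Om)) om \<partial>Om)"
   by (intro nn_integral_cong) (auto split: split_indicator)
  also have "... = emeasure Om (W \<inter> (?X -` C \<inter> space Om))"
   by (rule nn_integral_indicator) (use W measurable_sets[OF Xm C] in auto)
  also have "W \<inter> (?X -` C \<inter> space Om) = {om\<in>space Om. x om \<in> A \<and> ?X om \<in> C}" by (auto simp: W_def)
  finally show ?thesis .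
 qed
 have e2: "emeasure nx2 C = (\<integral>\<^sup>+om. indicator W om * emeasure (?K (x om)) C \<partial>Om)" if C: "C \<in> sets ?PB" for C
 proof -
  have "emeasure nx2 C = (\<integral>\<^sup>+om. emeasure (?K (x om)) C \<partial>density Om (indicator W))"
   unfolding nx2_def using not_empty by (intro emeasure_bind[OF _ Kx' C]) simp
  also have "... = (\<integral>\<^sup>+om. indicator W om * emeasure (?K (x om)) C \<partial>Om)"
   using W by (intro nn_integral_density measurable_emeasure_kernel[OF Kx C]) auto
  finally show ?thesis .
 qed
 have "nx1 = nx2"
 proof (rule measure_eqI_generator_eq[OF Int_stable_prod_algebra prod_algebra_sets_into_space])
  have "sets nx2 = sets ?PB"
   unfolding nx2_def by (rule sets_bind[OF sets_kernel[OF Kx]]) (use not_empty in auto)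
  then show "sets nx1 = sigma_sets (\<Pi>\<^sub>E i\<in>{..<N}. space MB) (prod_algebra {..<N} (%_. MB))"
   "sets nx2 = sigma_sets (\<Pi>\<^sub>E i\<in>{..<N}. space MB) (prod_algebra {..<N} (%_. MB))"
   by (simp_all add: nx1_def sets_PiM)
  fix C assume "C \<in> prod_algebra {..<N} (%_. MB)"
  then obtain D where C: "C = (\<Pi>\<^sub>E i\<in>{..<N}. D i)" and D: "!!i. i < N ==> D i \<in> sets MB"
   by (auto simp: prod_algebra_eq_finite)
  have Cs: "C \<in> sets ?PB" unfolding C using D by (intro sets_PiM_I_finite) auto
  have xp: "x om \<in> space ?PA" if "om \<in> space Om" for om using measurable_space[OF x that] .
  have pm: "emeasure (?K (x om)) C = ennreal (\<Prod>i<N. measure (x om) (D i))" if "om \<in> space Om" for om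
  proof -
   interpret p: prob_space "x om" using xp[OF that] by (auto simp: space_prob_algebra)
   have "emeasure (?K (x om)) C = (\<Prod>i<N. emeasure (x om) (D i))"
    unfolding C by (rule emeasure_iid_PiM[OF xp[OF that] D])
   then show ?thesis by (simp add: p.emeasure_eq_measure prod_ennreal)
  qed
  have pmeas: "(%om. indicator W om * (\<Prod>i<N. measure (x om) (D i))) \<in> borel_measurable Om"
  proof (rule borel_measurable_times[OF borel_measurable_indicator[OF W] borel_measurable_prod])
   fix i assume "i \<in> {..<N}"
   then have "(%m. measure m (D i)) \<in> borel_measurable ?PA"
    unfolding prob_algebra_def measure_def
    by (intro measurable_restrict_space1 borel_measurable_enn2real measurable_emeasure_subprob_algebra D) simp
   from measurable_compose[OF x this] show "(%om. measure (x om) (D i)) \<in> borel_measurable Om" .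
  qed
  have "emeasure nx1 C = emeasure Om {om\<in>space Om. x om \<in> A \<and> (\<forall>i<N. X i om \<in> D i)}"
   unfolding e1[OF Cs] unfolding C by (rule arg_cong[where f = "emeasure Om"]) (auto simp: PiE_iff)
  also have "... = ennreal (LINT om|Om. indicator A (x om) * (\<Prod>i<N. measure (x om) (D i)))"
   unfolding emeasure_eq_measure by (rule arg_cong[where f = ennreal], rule law[OF A D])
  also have "(LINT om|Om. indicator A (x om) * (\<Prod>i<N. measure (x om) (D i)))
   = (LINT om|Om. indicator W om * (\<Prod>i<N. measure (x om) (D i)))"
   by (rule Bochner_Integration.integral_cong) (auto simp: W_def indicator_def)
  also have "ennreal ... = (\<integral>\<^sup>+om. ennreal (indicator W om * (\<Prod>i<N. measure (x om) (D i))) \<partial>Om)"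
  proof (rule nn_integral_eq_integral[symmetric])
   show "integrable Om (%om. indicator W om * (\<Prod>i<N. measure (x om) (D i)))"
   proof (rule integrable_const_bound[of _ 1, OF _ pmeas])
    show "AE om in Om. norm (indicator W om * (\<Prod>i<N. measure (x om) (D i))) <= 1"
    proof (rule AE_I2)
     fix om assume "om \<in> space Om"
     then interpret p: prob_space "x om" using xp by (auto simp: space_prob_algebra)
     have "(\<Prod>i<N. measure (x om) (D i)) <= (\<Prod>i<N. 1)" by (intro prod_mono) auto
     moreover have "0 <= (\<Prod>i<N. measure (x om) (D i))" by (intro prod_nonneg) auto
     ultimately show "norm (indicator W om * (\<Prod>i<N. measure (x om) (D i))) <= 1"
      by (simp add: indicator_def)
    qed
   qed
  qed (simp add: prod_nonneg)
  also have "... = emeasure nx2 C"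
   unfolding e2[OF Cs] by (rule nn_integral_cong) (simp add: pm indicator_def)
  finally show "emeasure nx1 C = emeasure nx2 C" .
 next
  show "range (%_::nat. space ?PB) \<subseteq> prod_algebra {..<N} (%_. MB)"
   unfolding space_PiM by (auto intro!: prod_algebraI_finite)
  show "(\<Union>i::nat. space ?PB) = (\<Pi>\<^sub>E i\<in>{..<N}. space MB)" by (simp add: space_PiM)
  show "emeasure nx1 (space ?PB) \<noteq> \<infinity>" unfolding e1[OF sets.top] by (simp add: emeasure_eq_measure)
 qed
 then have eq: "emeasure Om {om\<in>space Om. x om \<in> A \<and> ?X om \<in> B} = (\<integral>\<^sup>+om. indicator W om * emeasure (?K (x om)) B \<partial>Om)"
  using e1[OF B] e2[OF B] by simp
 let ?rho = "distr Om (?PA \<Otimes>\<^sub>M ?PB) (%om. (x om, ?X om))"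
 have fst: "distr ?rho ?PA fst = distr Om ?PA x"
  by (subst distr_distr) (use xX in \<open>auto simp: o_def\<close>)
 have "emeasure ?rho (A \<times> B) = emeasure Om {om\<in>space Om. x om \<in> A \<and> ?X om \<in> B}"
  using A B by (subst emeasure_distr[OF xX]) (auto intro!: arg_cong[where f = "emeasure Om"])
 also note eq
 also have "(\<integral>\<^sup>+om. indicator W om * emeasure (?K (x om)) B \<partial>Om) = (\<integral>\<^sup>+om. emeasure (?K (x om)) B * indicator A (x om) \<partial>Om)"
  by (rule nn_integral_cong) (auto simp: W_def indicator_def)
 also have "... = (\<integral>\<^sup>+m. emeasure (?K m) B * indicator A m \<partial>distr Om ?PA x)"
  using measurable_emeasure_kernel[OF measurable_prob_algebraD[OF measurable_iid_PiM] B] A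
  by (intro nn_integral_distr[symmetric] x) simp
 finally show "emeasure ?rho (A \<times> B) = (\<integral>\<^sup>+m\<in>A. emeasure (?K m) B \<partial>distr ?rho ?PA fst)"
  unfolding fst .
qed

lemma iid_mean_tail:
 fixes ph :: "'s => 'g::{real_inner, banach, second_countable_topology}"
 assumes m: "prob_space m" and ph: "ph \<in> borel_measurable m" and c: "!!s. s \<in> space m ==> norm (ph s) <= c" "c > 0"
  and ep: "0 <= ep" "ep <= 4 * c" and N: "N > 0"
 shows "measure (iid N m) {z \<in> space (iid N m). norm ((1 / real N) *\<^sub>R (SUM i<N. ph (z i)) - (LINT s|m. ph s)) >= ep}
  <= 2 * exp (- (real N * ep^2 / (16 * c^2)))"
proof -
 interpret prob_space m by (rule m)
 define e where "e = (LINT s|m. ph s)"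
 \<comment> \<open>The exponent N (4 c^2 th^2 - th ep) is minimal here; ep <= 4 c is what the range
   condition on \<open>th\<close> requires.\<close>
 define th where "th = ep / (8 * c^2)"
 have th: "th >= 0" "th * (2 * c) <= 1" using ep c(2) by (simp_all add: th_def power2_eq_square divide_le_eq)
 have cc: "(norm (ph s))^2 <= (2 * c)^2" if "s \<in> space m" for s
  using c(1)[OF that] c(2) by (intro power_mono) auto
 have "integrable m (%s. (norm (ph s))^2)"
  by (rule integrable_const_bound[of _ "(2 * c)^2"]) (use ph cc in auto)
 then have "(LINT s|m. (norm (ph s))^2) <= (LINT s|m. (2 * c)^2)" by (rule integral_mono) (use cc in auto)
 then have "(LINT s|m. (norm (ph s))^2) <= (2 * c)^2" by (simp add: prob_space)
 from pinelis_centered[OF m ph c(1) this th finite_lessThan[of N], of "real N * ep"]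
 have "measure (iid N m) {z \<in> space (iid N m). norm (SUM i<N. ph (z i) - e) >= real N * ep}
  <= 2 * exp (real (card {..<N}) * th^2 * (2 * c)^2 - th * (real N * ep))" by (simp add: e_def)
 also have "real (card {..<N}) * th^2 * (2 * c)^2 - th * (real N * ep) = - (real N * ep^2 / (16 * c^2))"
  using c(2) by (simp add: th_def power2_eq_square field_simps)
 also have "{z \<in> space (iid N m). norm (SUM i<N. ph (z i) - e) >= real N * ep}
  = {z \<in> space (iid N m). norm ((1 / real N) *\<^sub>R (SUM i<N. ph (z i)) - e) >= ep}"
 proof -
  have "(norm (SUM i<N. ph (z i) - e) >= real N * ep) = (norm ((1 / real N) *\<^sub>R (SUM i<N. ph (z i)) - e) >= ep)" for z :: "nat => 's"
  proof -
   have "(SUM i<N. ph (z i) - e) = real N *\<^sub>R ((1 / real N) *\<^sub>R (SUM i<N. ph (z i)) - e)"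
    using N by (simp add: sum_subtractf sum_constant_scaleR scaleR_diff_right)
   then have "norm (SUM i<N. ph (z i) - e) = real N * norm ((1 / real N) *\<^sub>R (SUM i<N. ph (z i)) - e)" by simp
   then show ?thesis using N by simp
  qed
  then show ?thesis by simp
 qed
 finally show ?thesis unfolding e_def .
qed

text \<open>Given x the points are independent with law x, so the bound for a fixed law is
  integrated over the law of x.\<close>

lemma conditional_iid_tail:
 fixes ph :: "'s => 'g::{real_inner, banach, second_countable_topology}"
 assumes Om: "prob_space Om" and x: "x \<in> Om \<rightarrow>\<^sub>M prob_algebra MB" and X: "!!i. i < N ==> X i \<in> Om \<rightarrow>\<^sub>M MB"
  and law: "!!A B. A \<in> sets (prob_algebra MB) ==> (!!i. i < N ==> B i \<in> sets MB) ==>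
   measure Om {om\<in>space Om. x om \<in> A \<and> (\<forall>i<N. X i om \<in> B i)}
   = (LINT om|Om. indicator A (x om) * (\<Prod>i<N. measure (x om) (B i)))"
  and ph [measurable]: "ph \<in> borel_measurable MB" and c: "!!s. s \<in> space MB ==> norm (ph s) <= c" "c > 0"
  and ep: "0 <= ep" "ep <= 4 * c" and N: "N > 0"
 shows "measure Om {om \<in> space Om. norm ((1 / real N) *\<^sub>R (SUM i<N. ph (X i om)) - (LINT s|x om. ph s)) >= ep}
  <= 2 * exp (- (real N * ep^2 / (16 * c^2)))"
proof -
 interpret prob_space Om by (rule Om)
 let ?PA = "prob_algebra MB" and ?PB = "iid N MB" and ?X = "%om. \<lambda>i\<in>{..<N}. X i om"
  and ?K = "%m. \<Pi>\<^sub>M i\<in>{..<N}. m"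
 let ?rho = "distr Om (?PA \<Otimes>\<^sub>M ?PB) (%om. (x om, ?X om))"
 have Xm: "?X \<in> Om \<rightarrow>\<^sub>M ?PB" using X by (intro measurable_restrict) auto
 have xX: "(%om. (x om, ?X om)) \<in> Om \<rightarrow>\<^sub>M ?PA \<Otimes>\<^sub>M ?PB" by (rule measurable_Pair[OF x Xm])
 have me [measurable]: "(%m. \<integral>s. ph s \<partial>m) \<in> borel_measurable ?PA"
  unfolding prob_algebra_def by (intro measurable_restrict_space1 integral_measurable_subprob_algebra ph)
 define E where "E = {p \<in> space (?PA \<Otimes>\<^sub>M ?PB). norm ((1 / real N) *\<^sub>R (SUM i<N. ph (snd p i)) - (LINT s|fst p. ph s)) >= ep}"
 have E: "E \<in> sets (?PA \<Otimes>\<^sub>M ?PB)" unfolding E_def by measurable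
 have "emeasure Om {om \<in> space Om. norm ((1 / real N) *\<^sub>R (SUM i<N. ph (X i om)) - (LINT s|x om. ph s)) >= ep} = emeasure ?rho E"
  unfolding emeasure_distr[OF xX E]
  by (rule arg_cong[where f = "emeasure Om"]) (use measurable_space[OF xX] in \<open>auto simp: E_def\<close>)
 also have "... = (\<integral>\<^sup>+p. indicator E p \<partial>?rho)" using E by simp
 also have "... = (\<integral>\<^sup>+m. \<integral>\<^sup>+z. indicator E (m, z) \<partial>?K m \<partial>distr ?rho ?PA fst)"
  by (rule conditional_law_nn_integral[OF conditional_iid_law[OF Om x X law] prob_space_distr[OF xX]]) (use E in auto)
 also have "... <= (\<integral>\<^sup>+m. ennreal (2 * exp (- (real N * ep^2 / (16 * c^2)))) \<partial>distr ?rho ?PA fst)"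
 proof (rule nn_integral_mono)
  fix m assume "m \<in> space (distr ?rho ?PA fst)"
  then have m: "m \<in> space ?PA" by simp
  then have m': "prob_space m" "sets m = sets MB" by (auto simp: space_prob_algebra)
  interpret K: prob_space "?K m" by (intro prob_space_PiM m')
  have sp: "space (?K m) = space ?PB" by (rule sets_eq_imp_space_eq[OF sets_iid_PiM[OF m]])
  define F where "F = {z \<in> space (?K m). norm ((1 / real N) *\<^sub>R (SUM i<N. ph (z i)) - (LINT s|m. ph s)) >= ep}"
  have ph_m [measurable]: "ph \<in> borel_measurable m" using ph measurable_cong_sets[OF m'(2) refl] by blast
  have "(\<integral>\<^sup>+z. indicator E (m, z) \<partial>?K m) = (\<integral>\<^sup>+z. indicator F z \<partial>?K m)"
   by (rule nn_integral_cong) (use m in \<open>auto simp: E_def F_def sp space_pair_measure indicator_def\<close>)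
  also have "... = emeasure (?K m) F" by (rule nn_integral_indicator) (unfold F_def, measurable)
  also have "... = ennreal (K.prob F)" by (rule K.emeasure_eq_measure)
  also have "K.prob F <= 2 * exp (- (real N * ep^2 / (16 * c^2)))"
   unfolding F_def using sets_eq_imp_space_eq[OF m'(2)]
   by (intro iid_mean_tail m' ph_m c ep N) auto
  finally show "(\<integral>\<^sup>+z. indicator E (m, z) \<partial>?K m) <= ennreal (2 * exp (- (real N * ep^2 / (16 * c^2))))"
   by (simp add: ennreal_leI)
 qed
 also have "... = ennreal (2 * exp (- (real N * ep^2 / (16 * c^2))))"
 proof -
  interpret D: prob_space "distr ?rho ?PA fst"
   by (intro prob_space.prob_space_distr prob_space_distr xX) simp
  show ?thesis by (simp add: D.emeasure_space_1[simplified])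
 qed
 finally show ?thesis unfolding emeasure_eq_measure by simp
qed

section \<open>Distribution regression\<close>

lemma rkhs_ksec:
 assumes "rkhs A k app" "a \<in> A"
 shows "b \<in> A ==> app (ksec A k app a) b = k a b" and "app f a = f .* ksec A k app a"
proof -
 obtain h where h: "\<forall>b\<in>A. app h b = k a b" "\<forall>f. app f a = f .* h" using assms unfolding rkhs_def by blast
 have "ksec A k app a = h" unfolding ksec_def
 proof (rule the_equality)
  fix g assume "\<forall>b\<in>A. app g b = k a b"
  then have "\<forall>b\<in>A. app g b = app h b" using h(1) by simp
  then show "g = h" using assms(1) unfolding rkhs_def by blast
 qed (rule h(1))
 then show "b \<in> A ==> app (ksec A k app a) b = k a b" "app f a = f .* ksec A k app a" using h by auto
qed

lemma ksec_norm_square: "rkhs A k app ==> a \<in> A ==> (norm (ksec A k app a))^2 = k a a"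
 by (metis power2_norm_eq_inner rkhs_ksec)

text \<open>The squared distance of two sections is k t t - 2 k t s + k s s, which is continuous in
  t.\<close>

lemma ksec_continuous:
 fixes k :: "'x::topological_space => 'x => real"
 assumes r: "rkhs UNIV k app" and m: "mercer_kernel k"
 shows "continuous_on UNIV (ksec UNIV k app)"
 unfolding continuous_on_def
proof
 fix s :: 'x
 let ?ph = "ksec UNIV k app"
 have k: "continuous_on UNIV (%(s, t). k s t)" using m by (simp add: mercer_kernel_def)
 have inn: "?ph s .* ?ph t = k s t" for s t
  using rkhs_ksec(1)[OF r UNIV_I UNIV_I, of s t] rkhs_ksec(2)[OF r UNIV_I, of "?ph s" t] by simp
 have eq: "(norm (?ph t - ?ph s))^2 = k t t - 2 * k t s + k s s" for t
  unfolding power2_norm_eq_inner inner_diff_left inner_diff_right inn using inn[of t s] inn[of s t] inner_commute[of "?ph s" "?ph t"] by simp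
 have c1: "continuous_on UNIV (%t. k t t)"
  using continuous_on_compose2[OF k, of UNIV "%t. (t, t)"] by (simp add: continuous_on_Pair continuous_on_id)
 have c2: "continuous_on UNIV (%t. k t s)"
  using continuous_on_compose2[OF k, of UNIV "%t. (t, s)"] by (simp add: continuous_on_Pair continuous_on_id)
 have "continuous_on UNIV (%t. sqrt (k t t - 2 * k t s + k s s))"
  by (intro continuous_intros c1 c2)
 then have "((%t. sqrt (k t t - 2 * k t s + k s s)) \<longlongrightarrow> sqrt (k s s - 2 * k s s + k s s)) (at s within UNIV)"
  unfolding continuous_on_def by blast
 then have "((%t. norm (?ph t - ?ph s)) \<longlongrightarrow> 0) (at s within UNIV)"
  unfolding eq[symmetric] by simp
 then show "(?ph \<longlongrightarrow> ?ph s) (at s within UNIV)"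
  by (rule LIM_zero_cancel[OF tendsto_norm_zero_cancel])
qed

text \<open>An empirical embedding is the mean embedding of the empirical measure, the image of the
  uniform law on the indices. It therefore lies in \<open>P\<close>, where the second kernel and the
  Hoelder condition apply.\<close>

lemma empirical_embedding_eq_mean:
 fixes ph :: "'x::topological_space => 'g::{real_inner, banach, second_countable_topology}"
 assumes "N > 0" and ph: "ph \<in> borel_measurable borel"
 shows "empirical_embedding ph N s \<in> mean_embedding ph ` space (prob_algebra borel)"
proof -
 let ?p = "measure_pmf (pmf_of_set {..<N})"
 have s: "s \<in> ?p \<rightarrow>\<^sub>M borel" by simp
 have "distr ?p borel s \<in> space (prob_algebra borel)"
  by (simp add: space_prob_algebra measure_pmf.prob_space_distr)
 moreover have "mean_embedding ph (distr ?p borel s) = empirical_embedding ph N s"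
 proof -
  have "mean_embedding ph (distr ?p borel s) = (\<integral>i. ph (s i) \<partial>?p)"
   unfolding mean_embedding_def by (rule integral_distr[OF s ph])
  also have "... = (SUM i:{..<N}. pmf (pmf_of_set {..<N}) i *\<^sub>R ph (s i))"
   using assms(1) by (intro integral_measure_pmf) (auto dest: iffD1[OF arg_cong[where f = "(\<in>) _", OF set_pmf_of_set]] simp: lessThan_empty_iff)
  also have "... = empirical_embedding ph N s"
   using assms(1) by (simp add: empirical_embedding_def scaleR_sum_right lessThan_empty_iff)
  finally show ?thesis .
 qed
 ultimately show ?thesis by (metis imageI)
qed

locale distribution_regression =
 fixes G :: "'x::topological_space => 'x => real"
  and evG :: "'g::{real_inner, banach, second_countable_topology} => 'x => real"
  and K :: "'g => 'g => real"
  and evK :: "'h::{real_inner, banach, second_countable_topology} => 'g => real"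
  and cls :: "('g => real) => 'l::{real_inner, banach, second_countable_topology}"
  and ph :: "'x => 'g" and P :: "'g set" and PM :: "'g measure"
  and KS :: "'g => 'h"
  and M :: real and Y :: "real set" and YM :: "real measure"
  and rho :: "('g \<times> real) measure" and rho\<mu> :: "'g measure"
  and rho_cond :: "'g => real measure"
  and Q :: "('x measure \<times> real) measure"
  and S :: "'h => 'l" and frho :: 'l
  and gam kap al L eta0 :: real
 assumes mercer_G: "mercer_kernel G" and rkhs_G: "rkhs UNIV G evG" and ph_eq: "ph = ksec UNIV G evG"
  and P_eq: "P = mean_embedding ph ` space (prob_algebra borel)"
  and PM_eq: "PM = restrict_space borel P"
  and rkhs_K: "rkhs P K evK" and KS_eq: "KS = ksec P K evK"
  and M_pos: "M > 0" and Y_bounded: "Y \<subseteq> {-M..M}" and YM_eq: "YM = restrict_space borel Y"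
  and prob_rho: "prob_space rho" and sets_rho: "sets rho = sets (PM \<Otimes>\<^sub>M YM)"
  and rho\<mu>_eq: "rho\<mu> = distr rho PM fst" and cond_rho: "conditional_law PM YM rho rho_cond"
  and prob_Q: "prob_space Q" and sets_Q: "sets Q = sets (prob_algebra borel \<Otimes>\<^sub>M YM)"
  and Q_rho: "distr Q (PM \<Otimes>\<^sub>M YM) (%(x, y). (mean_embedding ph x, y)) = rho"
  and L2: "L2_space rho\<mu> cls" and S_eq: "S = (%h. cls (evK h))" and frho_eq: "frho = cls (regression_fun rho_cond)"
  and G_bounded: "bdd_above (range (%s. G s s))" "(SUP s. G s s) = gam^2"
  and K_bounded: "kap >= 0" "esssup rho\<mu> (%m. ereal (K m m)) = ereal (kap^2)"
  and al: "0 < al" and L_pos: "L > 0"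
  and hoelder: "!!m1 m2. m1 \<in> P ==> m2 \<in> P ==> norm (KS m1 - KS m2) <= L * norm (m1 - m2) powr al"
  and eta0: "0 < eta0" "4 * kap^2 * eta0 < 1"
begin

lemma ph_continuous: "continuous_on UNIV ph" unfolding ph_eq by (rule ksec_continuous[OF rkhs_G mercer_G])

lemma ph_measurable [measurable]: "ph \<in> borel_measurable borel"
 by (rule borel_measurable_continuous_onI[OF ph_continuous])

lemma ph_norm_le: "norm (ph s) <= \<bar>gam\<bar>"
proof -
 have "(norm (ph s))^2 = G s s" unfolding ph_eq by (rule ksec_norm_square[OF rkhs_G]) simp
 also have "... <= gam^2" unfolding G_bounded(2)[symmetric] by (rule cSUP_upper[OF _ G_bounded(1)]) simp
 finally show ?thesis by (metis abs_norm_cancel abs_le_square_iff)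
qed

lemma mean_embedding_in_P: "x \<in> space (prob_algebra borel) ==> mean_embedding ph x \<in> P"
 by (simp add: P_eq)

lemma empirical_embedding_in_P: "N > 0 ==> empirical_embedding ph N s \<in> P"
 unfolding P_eq by (rule empirical_embedding_eq_mean[OF _ ph_measurable])

lemma P_norm_le: "m \<in> P ==> norm m <= \<bar>gam\<bar>"
proof -
 assume "m \<in> P"
 then obtain x where x: "prob_space x" "sets x = sets borel" and m: "m = (LINT s|x. ph s)"
  by (auto simp: P_eq space_prob_algebra mean_embedding_def)
 interpret prob_space x by (rule x)
 have "ph \<in> borel_measurable x" using ph_measurable measurable_cong_sets[OF x(2) refl] by blast
 then have "integrable x ph" by (intro integrable_const_bound[of _ "\<bar>gam\<bar>"]) (auto simp: ph_norm_le)
 have "norm m <= (LINT s|x. norm (ph s))" unfolding m by (rule integral_norm_bound)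
 also have "... <= (LINT s|x. \<bar>gam\<bar>)" using \<open>integrable x ph\<close> by (intro integral_mono) (auto simp: ph_norm_le)
 finally show ?thesis by (simp add: prob_space)
qed

lemma mean_embedding_measurable [measurable]: "mean_embedding ph \<in> prob_algebra borel \<rightarrow>\<^sub>M PM"
 unfolding PM_eq
proof (rule measurable_restrict_space2)
 show "mean_embedding ph \<in> space (prob_algebra borel) \<rightarrow> P" by (auto simp: mean_embedding_in_P)
 show "mean_embedding ph \<in> borel_measurable (prob_algebra borel)"
  unfolding mean_embedding_def prob_algebra_def
  by (intro measurable_restrict_space1 integral_measurable_subprob_algebra) simp
qed

lemma space_PM: "space PM = P" by (simp add: PM_eq space_restrict_space)

lemma evK_eq: "m \<in> P ==> evK u m = u .* KS m" unfolding KS_eq by (rule rkhs_ksec(2)[OF rkhs_K])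

lemma KS_norm_square: "m \<in> P ==> (norm (KS m))^2 = K m m" unfolding KS_eq by (rule ksec_norm_square[OF rkhs_K])

lemma KS_continuous: "continuous_on P KS"
 unfolding continuous_on_def
proof
 fix m assume m: "m \<in> P"
 have "((%m'. L * norm (m' - m) powr al) \<longlongrightarrow> L * norm (m - m) powr al) (at m within P)"
  using al by (intro tendsto_intros tendsto_powr') auto
 then have lim: "((%m'. L * norm (m' - m) powr al) \<longlongrightarrow> 0) (at m within P)" using al by simp
 have "((%m'. KS m' - KS m) \<longlongrightarrow> 0) (at m within P)"
 proof (rule Lim_null_comparison[OF _ lim])
  show "\<forall>\<^sub>F m' in at m within P. norm (KS m' - KS m) <= L * norm (m' - m) powr al"
   unfolding eventually_at_filter using hoelder[OF _ m] by (auto intro: always_eventually)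
 qed
 then show "(KS \<longlongrightarrow> KS m) (at m within P)" by (rule LIM_zero_cancel)
qed

lemma KS_measurable [measurable]: "KS \<in> PM \<rightarrow>\<^sub>M borel"
 unfolding PM_eq by (rule borel_measurable_continuous_on_restrict[OF KS_continuous])

text \<open>A bound on all of \<open>P\<close>, from Hoelder continuity and the boundedness of
  \<open>P\<close>. The bound \<open>kap\<close> holds almost everywhere only and says nothing about
  the empirical embeddings; \<open>KB\<close> in turn may violate the step size condition.\<close>

definition "KB = (SOME B. B > 0 \<and> (\<forall>m\<in>P. norm (KS m) <= B))"

lemma KB: "KB > 0" "m \<in> P ==> norm (KS m) <= KB"
proof -
 have "\<exists>B. B > 0 \<and> (\<forall>m\<in>P. norm (KS m) <= B)"
 proof (cases "P = {}")
  case False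
  then obtain m0 where m0: "m0 \<in> P" by auto
  let ?B = "norm (KS m0) + L * (2 * \<bar>gam\<bar>) powr al + 1"
  have "norm (KS m) <= ?B" if m: "m \<in> P" for m
  proof -
   have "norm (m - m0) <= 2 * \<bar>gam\<bar>"
    using norm_triangle_ineq4[of m m0] P_norm_le[OF m] P_norm_le[OF m0] by linarith
   then have "L * norm (m - m0) powr al <= L * (2 * \<bar>gam\<bar>) powr al"
    using L_pos al by (intro mult_left_mono powr_mono2) auto
   then show ?thesis using hoelder[OF m m0] norm_triangle_ineq2[of "KS m" "KS m0"] by linarith
  qed
  moreover have "?B > 0" using L_pos by (simp add: add_nonneg_pos)
  ultimately show ?thesis by blast
 qed (auto intro: exI[of _ 1])
 from someI_ex[OF this] show "KB > 0" "m \<in> P ==> norm (KS m) <= KB" by (auto simp: KB_def)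
qed

text \<open>The threshold \<open>kap'\<close> exceeds \<open>kap\<close> and saturates the step size condition.\<close>
definition "kap' = 1 / (2 * sqrt eta0)"

lemma kap': "kap' > 0" "kap < kap'" "4 * eta0 * kap'^2 <= 1"
proof -
 show "kap' > 0" using eta0 by (simp add: kap'_def)
 have sq: "kap'^2 = 1 / (4 * eta0)" using eta0 by (simp add: kap'_def power_divide power_mult_distrib)
 then show "4 * eta0 * kap'^2 <= 1" using eta0 by simp
 have "kap^2 < kap'^2" unfolding sq using eta0 by (simp add: field_simps)
 then show "kap < kap'" using \<open>kap' > 0\<close> by (intro power_less_imp_less_base[of kap 2]) auto
qed

sublocale prob_space rho by (rule prob_rho)

lemma fst_rho [measurable]: "fst \<in> rho \<rightarrow>\<^sub>M PM" and snd_rho [measurable]: "snd \<in> rho \<rightarrow>\<^sub>M YM"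
 unfolding measurable_cong_sets[OF sets_rho refl] by measurable

lemma YM_borel: "f \<in> borel \<rightarrow>\<^sub>M N' ==> f \<in> YM \<rightarrow>\<^sub>M N'"
 unfolding YM_eq by (rule measurable_restrict_space1)

lemma snd_borel [measurable]: "snd \<in> borel_measurable rho"
 using measurable_compose[OF snd_rho YM_borel[OF measurable_ident]] by simp

lemma space_rho: "space rho = P \<times> Y"
 using sets_eq_imp_space_eq[OF sets_rho] by (simp add: space_pair_measure space_PM YM_eq space_restrict_space)

lemma Y_abs_le: "y \<in> Y ==> \<bar>y\<bar> <= M" using Y_bounded by force

lemma prob_space_rho\<mu>: "prob_space rho\<mu>" unfolding rho\<mu>_eq by (rule prob_space_distr[OF fst_rho])

lemma sets_rho\<mu> [measurable_cong]: "sets rho\<mu> = sets PM" by (simp add: rho\<mu>_eq)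

lemma space_rho\<mu>: "space rho\<mu> = P" by (simp add: rho\<mu>_eq space_PM)

lemma KS_norm_AE: "AE m in rho\<mu>. norm (KS m) <= kap"
proof -
 have "AE m in rho\<mu>. ereal (K m m) <= esssup rho\<mu> (%m. ereal (K m m))" by (rule esssup_AE)
 then show ?thesis using AE_space
 proof eventually_elim
  case (elim m)
  then have "(norm (KS m))^2 <= kap^2" by (simp add: K_bounded(2) space_rho\<mu> KS_norm_square)
  then show ?case by (rule power2_le_imp_le) (rule K_bounded)
 qed
qed

text \<open>A version of the feature map bounded at every point, as \<open>regression_model\<close>
  demands; it agrees with the kernel section almost everywhere because
  \<open>kap < kap'\<close>.\<close>

definition "feat z = (if norm (KS (fst z)) <= kap' then KS (fst z) else 0)" for z :: "'g \<times> real"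

lemma feat_measurable [measurable]: "feat \<in> borel_measurable rho"
 unfolding feat_def by measurable

lemma KS_fst_norm_AE: "AE z in rho. norm (KS (fst z)) <= kap"
 by (rule AE_distrD[OF fst_rho KS_norm_AE[unfolded rho\<mu>_eq]])

lemma feat_eq_AE: "AE z in rho. feat z = KS (fst z)"
 using KS_fst_norm_AE by eventually_elim (use kap' in \<open>auto simp: feat_def\<close>)

abbreviation "rg \<equiv> regression_fun rho_cond"

lemma rho_cond [measurable]: "rho_cond \<in> PM \<rightarrow>\<^sub>M prob_algebra YM"
 using cond_rho by (simp add: conditional_law_def)

lemma rg_measurable [measurable]: "rg \<in> borel_measurable PM"
proof -
 have "(%p. \<integral>y. y \<partial>p) \<in> borel_measurable (prob_algebra YM)"
  unfolding prob_algebra_def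
  by (intro measurable_restrict_space1 integral_measurable_subprob_algebra YM_borel) simp
 from measurable_compose[OF rho_cond this] show ?thesis by (simp add: regression_fun_def[abs_def])
qed

lemma rho_cond_space:
 assumes "m \<in> P"
 shows "prob_space (rho_cond m)" "space (rho_cond m) = Y" "sets (rho_cond m) = sets YM"
proof -
 have *: "rho_cond m \<in> space (prob_algebra YM)" using measurable_space[OF rho_cond] assms by (simp add: space_PM)
 then show "prob_space (rho_cond m)" "sets (rho_cond m) = sets YM" by (auto simp: space_prob_algebra)
 then show "space (rho_cond m) = Y" using sets_eq_imp_space_eq[of "rho_cond m" YM] by (simp add: YM_eq space_restrict_space)
qed

lemma rho_cond_integrable:
 assumes "m \<in> P"
 shows "integrable (rho_cond m) (%y. y)"
proof -
 interpret p: prob_space "rho_cond m" by (rule rho_cond_space[OF assms])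
 have "(%y. y) \<in> borel_measurable (rho_cond m)"
  unfolding measurable_cong_sets[OF rho_cond_space(3)[OF assms] refl] by (rule YM_borel) simp
 then show ?thesis by (intro p.integrable_const_bound[of _ M]) (auto simp: rho_cond_space(2)[OF assms] Y_abs_le)
qed

lemma rg_bound: "m \<in> P ==> \<bar>rg m\<bar> <= M"
proof -
 assume m: "m \<in> P"
 interpret p: prob_space "rho_cond m" by (rule rho_cond_space[OF m])
 have "\<bar>rg m\<bar> <= (LINT y|rho_cond m. \<bar>y\<bar>)" unfolding regression_fun_def by (rule integral_abs_bound)
 also have "... <= (LINT y|rho_cond m. M)"
  using rho_cond_integrable[OF m] by (intro integral_mono) (auto simp: rho_cond_space(2)[OF m] Y_abs_le)
 finally show ?thesis by (simp add: p.prob_space)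
qed

text \<open>The disintegration is available for nonnegative integrands, so the bounded integrand is
  shifted by B M.\<close>

lemma regression_fun_integral:
 assumes g [measurable]: "g \<in> borel_measurable PM" and b: "!!m. m \<in> P ==> \<bar>g m\<bar> <= B"
 shows "(LINT z|rho. g (fst z) * snd z) = (LINT m|rho\<mu>. g m * rg m)"
proof -
 interpret \<mu>: prob_space rho\<mu> by (rule prob_space_rho\<mu>)
 have gy: "\<bar>g m * y\<bar> <= B * M" if "m \<in> P" "\<bar>y\<bar> <= M" for m y
  using mult_mono[OF b[OF that(1)] that(2)] b[OF that(1)] by (simp add: abs_mult)
 have gy0: "0 <= g m * y + B * M" if "m \<in> P" "\<bar>y\<bar> <= M" for m y using gy[OF that] by linarith
 have i1: "integrable rho (%z. g (fst z) * snd z)"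
  by (rule integrable_const_bound[of _ "B * M"]) (auto simp: space_rho gy Y_abs_le)
 have i2: "integrable rho\<mu> (%m. g m * rg m)"
  by (rule \<mu>.integrable_const_bound[of _ "B * M"]) (auto simp: space_rho\<mu> gy rg_bound)
 have "ennreal (LINT z|rho. g (fst z) * snd z + B * M) = (\<integral>\<^sup>+z. ennreal (g (fst z) * snd z + B * M) \<partial>rho)"
 proof (rule nn_integral_eq_integral[symmetric])
  show "AE z in rho. 0 <= g (fst z) * snd z + B * M"
  proof (rule AE_I2)
   fix z assume "z \<in> space rho"
   then show "0 <= g (fst z) * snd z + B * M" using gy0[of "fst z" "snd z"] by (auto simp: space_rho Y_abs_le)
  qed
 qed (use i1 in simp)
 also have "... = (\<integral>\<^sup>+m. \<integral>\<^sup>+y. ennreal (g m * y + B * M) \<partial>rho_cond m \<partial>distr rho PM fst)"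
 proof -
  have [measurable]: "(%y. y) \<in> borel_measurable YM" by (rule YM_borel) simp
  have "(%z. ennreal (g (fst z) * snd z + B * M)) \<in> borel_measurable (PM \<Otimes>\<^sub>M YM)"
   by (subst measurable_cong_sets[OF sets_rho[symmetric] refl]) measurable
  from conditional_law_nn_integral[OF cond_rho prob_rho sets_rho this] show ?thesis by simp
 qed
 also have "... = (\<integral>\<^sup>+m. ennreal (g m * rg m + B * M) \<partial>rho\<mu>)"
  unfolding rho\<mu>_eq[symmetric]
 proof (rule nn_integral_cong)
  fix m assume "m \<in> space rho\<mu>"
  then have m: "m \<in> P" by (simp add: space_rho\<mu>)
  interpret p: prob_space "rho_cond m" by (rule rho_cond_space[OF m])
  have "(\<integral>\<^sup>+y. ennreal (g m * y + B * M) \<partial>rho_cond m) = ennreal (LINT y|rho_cond m. g m * y + B * M)"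
  proof (rule nn_integral_eq_integral)
   show "AE y in rho_cond m. 0 <= g m * y + B * M"
   proof (rule AE_I2)
    fix y assume "y \<in> space (rho_cond m)"
    then show "0 <= g m * y + B * M" using gy0[OF m, of y] by (auto simp: rho_cond_space(2)[OF m] Y_abs_le)
   qed
  qed (use rho_cond_integrable[OF m] in simp)
  also have "(LINT y|rho_cond m. g m * y + B * M) = g m * rg m + B * M"
   using rho_cond_integrable[OF m] by (simp add: regression_fun_def p.prob_space)
  finally show "(\<integral>\<^sup>+y. ennreal (g m * y + B * M) \<partial>rho_cond m) = ennreal (g m * rg m + B * M)" .
 qed
 also have "... = ennreal (LINT m|rho\<mu>. g m * rg m + B * M)"
 proof (rule nn_integral_eq_integral)
  show "AE m in rho\<mu>. 0 <= g m * rg m + B * M"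
  proof (rule AE_I2)
   fix m assume "m \<in> space rho\<mu>"
   then show "0 <= g m * rg m + B * M" using gy0[of m "rg m"] by (auto simp: space_rho\<mu> rg_bound)
  qed
 qed (use i2 in simp)
 finally have e: "ennreal (LINT z|rho. g (fst z) * snd z + B * M) = ennreal (LINT m|rho\<mu>. g m * rg m + B * M)" .
 have n1: "0 <= (LINT z|rho. g (fst z) * snd z + B * M)"
 proof (rule integral_nonneg_AE, rule AE_I2)
  fix z assume "z \<in> space rho"
  then show "0 <= g (fst z) * snd z + B * M" using gy0[of "fst z" "snd z"] by (auto simp: space_rho Y_abs_le)
 qed
 have n2: "0 <= (LINT m|rho\<mu>. g m * rg m + B * M)"
 proof (rule integral_nonneg_AE, rule AE_I2)
  fix m assume "m \<in> space rho\<mu>"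
  then show "0 <= g m * rg m + B * M" using gy0[of m "rg m"] by (auto simp: space_rho\<mu> rg_bound)
 qed
 show ?thesis using e n1 n2 i1 i2 by (simp add: prob_space \<mu>.prob_space)
qed

end

section \<open>The inclusion into L2 and its adjoint\<close>

lemma integrable_mult_square_integrable:
 assumes "square_integrable M f" "square_integrable M g"
 shows "integrable M (%x. f x * g x :: real)"
proof (rule Bochner_Integration.integrable_bound)
 show "integrable M (%x. (f x)^2 + (g x)^2)" using assms by (simp add: square_integrable_def)
 show "(%x. f x * g x) \<in> borel_measurable M" using assms unfolding square_integrable_def by (intro borel_measurable_times) auto
 show "AE x in M. norm (f x * g x) <= norm ((f x)^2 + (g x)^2)"
 proof (rule AE_I2)
  fix x
  have "2 * \<bar>f x\<bar> * \<bar>g x\<bar> <= (f x)^2 + (g x)^2" using sum_squares_bound[of "\<bar>f x\<bar>" "\<bar>g x\<bar>"] by simp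
  moreover have "0 <= \<bar>f x\<bar> * \<bar>g x\<bar>" by simp
  ultimately have "\<bar>f x\<bar> * \<bar>g x\<bar> <= (f x)^2 + (g x)^2" by linarith
  then show "norm (f x * g x) <= norm ((f x)^2 + (g x)^2)" by (simp add: abs_mult)
 qed
qed

context distribution_regression
begin

lemma cls_inner: "square_integrable rho\<mu> f ==> square_integrable rho\<mu> g ==> cls f .* cls g = (LINT m|rho\<mu>. f m * g m)"
 using L2 unfolding L2_space_def by blast

lemma cls_surj: obtains f where "square_integrable rho\<mu> f" "cls f = u"
 using L2 unfolding L2_space_def by blast

lemma square_integrable_bounded:
 assumes "f \<in> borel_measurable PM" "!!m. m \<in> P ==> \<bar>f m\<bar> <= B"
 shows "square_integrable rho\<mu> f"
proof -
 interpret \<mu>: prob_space rho\<mu> by (rule prob_space_rho\<mu>)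
 have f [measurable]: "f \<in> borel_measurable rho\<mu>" using assms(1) by (simp cong: measurable_cong_sets)
 have "integrable rho\<mu> (%m. (f m)^2)"
 proof (rule \<mu>.integrable_const_bound[of _ "B^2"])
  show "AE m in rho\<mu>. norm ((f m)^2) <= B^2"
  proof (rule AE_I2)
   fix m assume "m \<in> space rho\<mu>"
   then have "\<bar>f m\<bar>\<^sup>2 <= B^2" using assms(2) by (intro power_mono) (auto simp: space_rho\<mu>)
   then show "norm ((f m)^2) <= B^2" by simp
  qed
 qed measurable
 then show ?thesis by (simp add: square_integrable_def)
qed

lemma evK_measurable [measurable]: "evK u \<in> borel_measurable PM"
proof -
 have "(%m. u .* KS m) \<in> borel_measurable PM" by measurable
 then show ?thesis by (rule subst[OF measurable_cong, rotated]) (simp add: space_PM evK_eq)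
qed

lemma evK_bound: "m \<in> P ==> \<bar>evK u m\<bar> <= norm u * KB"
 using Cauchy_Schwarz_ineq2[of u "KS m"] mult_left_mono[OF KB(2)[of m], of "norm u"] by (simp add: evK_eq)

lemma evK_square_integrable: "square_integrable rho\<mu> (evK u)"
 by (rule square_integrable_bounded[OF evK_measurable evK_bound])

lemma rg_square_integrable: "square_integrable rho\<mu> rg"
 by (rule square_integrable_bounded[OF rg_measurable rg_bound])

text \<open>Linearity of \<open>cls\<close> follows from the inner product formula: the defect d is
  itself a class, and d .* d = 0.\<close>

lemma cls_add_scaled:
 assumes f: "square_integrable rho\<mu> f" and g: "square_integrable rho\<mu> g" and h: "square_integrable rho\<mu> h"
  and eq: "!!m. m \<in> P ==> h m = f m + c * g m"
 shows "cls h = cls f + c *\<^sub>R cls g"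
proof -
 define d where "d = cls h - (cls f + c *\<^sub>R cls g)"
 obtain k where k: "square_integrable rho\<mu> k" "cls k = d" by (rule cls_surj)
 have "d .* d = d .* cls h - (d .* cls f + c * (d .* cls g))"
  by (subst (2) d_def) (simp add: inner_diff_right inner_add_right)
 also have "... = (LINT m|rho\<mu>. k m * h m) - ((LINT m|rho\<mu>. k m * f m) + c * (LINT m|rho\<mu>. k m * g m))"
  unfolding k(2)[symmetric] using f g h k(1) by (simp add: cls_inner)
 also have "(LINT m|rho\<mu>. k m * h m) = (LINT m|rho\<mu>. k m * f m + c * (k m * g m))"
  by (rule Bochner_Integration.integral_cong) (simp_all add: space_rho\<mu> eq algebra_simps)
 also have "... = (LINT m|rho\<mu>. k m * f m) + c * (LINT m|rho\<mu>. k m * g m)"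
  using integrable_mult_square_integrable[OF k(1) f] integrable_mult_square_integrable[OF k(1) g] by simp
 finally show ?thesis by (simp add: d_def)
qed

lemma S_linear: "linear S"
proof (rule linearI)
 have add: "S (u + c *\<^sub>R v) = S u + c *\<^sub>R S v" for u v c
  unfolding S_eq by (rule cls_add_scaled[OF evK_square_integrable evK_square_integrable evK_square_integrable])
   (simp add: evK_eq inner_add_left)
 show "S (u + v) = S u + S v" for u v using add[of u 1 v] by simp
 have "S 0 = 0" using add[of 0 1 0] by simp
 then show "S (c *\<^sub>R u) = c *\<^sub>R S u" for c u using add[of 0 c u] by simp
qed

text \<open>The Riesz vector is the Bochner integral of g against the kernel sections. As
  \<open>adjoint\<close> is defined by choice, exhibiting one adjoint proves the identity.\<close>

lemma S_adjoint: "S u .* v = u .* adjoint S v"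
proof -
 have "\<exists>w. \<forall>u. S u .* v = u .* w" for v
 proof -
  obtain g where g: "square_integrable rho\<mu> g" "cls g = v" by (rule cls_surj)
  interpret \<mu>: prob_space rho\<mu> by (rule prob_space_rho\<mu>)
  have gm [measurable]: "g \<in> borel_measurable rho\<mu>" using g(1) by (simp add: square_integrable_def)
  have KSm [measurable]: "KS \<in> borel_measurable rho\<mu>" using KS_measurable by (simp cong: measurable_cong_sets)
  have "square_integrable rho\<mu> (%_. 1)" by (simp add: square_integrable_def)
  from integrable_mult_square_integrable[OF g(1) this] have gi: "integrable rho\<mu> g" by simp
  have i: "integrable rho\<mu> (%m. g m *\<^sub>R KS m)"
  proof (rule Bochner_Integration.integrable_bound)
   show "integrable rho\<mu> (%m. KB * g m)" using gi by simp
   show "AE m in rho\<mu>. norm (g m *\<^sub>R KS m) <= norm (KB * g m)"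
   proof (rule AE_I2)
    fix m assume "m \<in> space rho\<mu>"
    then have "norm (KS m) <= KB" by (simp add: space_rho\<mu> KB)
    from mult_left_mono[OF this, of "\<bar>g m\<bar>"] show "norm (g m *\<^sub>R KS m) <= norm (KB * g m)"
     using KB(1) by (simp add: abs_mult mult.commute)
   qed
  qed measurable
  show ?thesis
  proof (intro exI allI)
   fix u
   have "S u .* v = (LINT m|rho\<mu>. evK u m * g m)"
    unfolding S_eq g(2)[symmetric] by (rule cls_inner[OF evK_square_integrable g(1)])
   also have "... = (LINT m|rho\<mu>. u .* (g m *\<^sub>R KS m))"
    by (rule Bochner_Integration.integral_cong) (simp_all add: space_rho\<mu> evK_eq)
   also have "... = u .* (LINT m|rho\<mu>. g m *\<^sub>R KS m)" by (rule integral_inner_right) (rule i)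
   finally show "S u .* v = u .* (LINT m|rho\<mu>. g m *\<^sub>R KS m)" .
  qed
 qed
 then have "\<exists>S'. \<forall>x y. S x .* y = x .* S' y" by metis
 from someI_ex[OF this] show ?thesis unfolding adjoint_def by blast
qed

lemma integral_rho\<mu>:
 fixes f :: "'g => real"
 shows "f \<in> borel_measurable PM ==> (LINT m|rho\<mu>. f m) = (LINT z|rho. f (fst z))"
 unfolding rho\<mu>_eq by (rule integral_distr[OF fst_rho])

lemma integral_feat:
 fixes F :: "'g \<times> real => 'h => real"
 assumes [measurable]: "(%(z, v). F z v) \<in> borel_measurable (rho \<Otimes>\<^sub>M borel)"
 shows "(LINT z|rho. F z (KS (fst z))) = (LINT z|rho. F z (feat z))"
proof (rule integral_cong_AE)
 show "AE z in rho. F z (KS (fst z)) = F z (feat z)" using feat_eq_AE by eventually_elim simp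
qed measurable

text \<open>The integral identities are first proved for the kernel sections and then transferred to
  \<open>feat\<close>, which equals them almost everywhere.\<close>

sublocale model: regression_model rho feat snd "%z. rg (fst z)" S "adjoint S" frho kap' M
proof
 show "norm (feat z) <= kap'" for z using kap' by (simp add: feat_def)
 show "\<bar>snd z\<bar> <= M" if "z \<in> space rho" for z using that by (auto simp: space_rho Y_abs_le)
 show "\<bar>rg (fst z)\<bar> <= M" if "z \<in> space rho" for z using that by (auto simp: space_rho rg_bound)
 have ev: "evK u (fst z) = u .* KS (fst z)" if "z \<in> space rho" for u z using that by (auto simp: space_rho evK_eq)
 have SS: "S u .* S v = (LINT z|rho. (KS (fst z) .* u) * (KS (fst z) .* v))" for u v
 proof -
  have "S u .* S v = (LINT m|rho\<mu>. evK u m * evK v m)"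
   unfolding S_eq by (rule cls_inner[OF evK_square_integrable evK_square_integrable])
  also have "... = (LINT z|rho. evK u (fst z) * evK v (fst z))" by (rule integral_rho\<mu>) measurable
  also have "... = (LINT z|rho. (KS (fst z) .* u) * (KS (fst z) .* v))"
   by (rule Bochner_Integration.integral_cong) (simp_all add: ev inner_commute)
  finally show ?thesis .
 qed
 show "S u .* S v = (LINT z|rho. (feat z .* u) * (feat z .* v))" for u v
  unfolding SS by (rule integral_feat) measurable
 have Sf: "S u .* frho = (LINT m|rho\<mu>. evK u m * rg m)" for u
  unfolding S_eq frho_eq by (rule cls_inner[OF evK_square_integrable rg_square_integrable])
 show "S u .* frho = (LINT z|rho. (feat z .* u) * snd z)" for u
 proof -
  have "S u .* frho = (LINT z|rho. evK u (fst z) * snd z)"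
   unfolding Sf by (rule regression_fun_integral[OF evK_measurable evK_bound, symmetric])
  also have "... = (LINT z|rho. (KS (fst z) .* u) * snd z)"
   by (rule Bochner_Integration.integral_cong) (simp_all add: ev inner_commute)
  also have "... = (LINT z|rho. (feat z .* u) * snd z)" by (rule integral_feat) measurable
  finally show ?thesis .
 qed
 show "(norm (S u - frho))^2 = (LINT z|rho. (feat z .* u - rg (fst z))^2)" for u
 proof -
  note i = integrable_mult_square_integrable[OF evK_square_integrable[of u] evK_square_integrable[of u]]
   integrable_mult_square_integrable[OF evK_square_integrable[of u] rg_square_integrable]
   integrable_mult_square_integrable[OF rg_square_integrable rg_square_integrable]
  have "(norm (S u - frho))^2 = S u .* S u - 2 * (S u .* frho) + frho .* frho"
   unfolding power2_norm_eq_inner by (simp add: inner_diff_left inner_diff_right inner_commute)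
  also have "... = (LINT m|rho\<mu>. evK u m * evK u m) - 2 * (LINT m|rho\<mu>. evK u m * rg m) + (LINT m|rho\<mu>. rg m * rg m)"
   unfolding Sf unfolding S_eq frho_eq by (simp add: cls_inner evK_square_integrable rg_square_integrable)
  also have "... = (LINT m|rho\<mu>. evK u m * evK u m - 2 * (evK u m * rg m) + rg m * rg m)"
   using i by simp
  also have "... = (LINT m|rho\<mu>. (evK u m - rg m)^2)"
   by (rule Bochner_Integration.integral_cong) (simp_all add: power2_eq_square algebra_simps)
  also have "... = (LINT z|rho. (evK u (fst z) - rg (fst z))^2)" by (rule integral_rho\<mu>) measurable
  also have "... = (LINT z|rho. (KS (fst z) .* u - rg (fst z))^2)"
   by (rule Bochner_Integration.integral_cong) (simp_all add: ev inner_commute)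
  also have "... = (LINT z|rho. (feat z .* u - rg (fst z))^2)"
   by (rule integral_feat[where F = "%z v. (v .* u - rg (fst z))^2"]) measurable
  finally show ?thesis .
 qed
qed (use kap' M_pos linear_add[OF S_linear] linear_scale[OF S_linear] S_adjoint in auto)

lemma model_L: "model.L = S \<circ> adjoint S"
 by (rule ext) (simp add: model.L_def)

end

section \<open>A priori bounds and measurability of the iterates\<close>

lemma sgd_cong:
 fixes app :: "'h::real_vector => 'm => real" and app' :: "'h => 'n => real"
 assumes "!!i h. i < b * T ==> app h (fst (z i)) = app' h (fst (z' i))"
  and "!!i. i < b * T ==> k (fst (z i)) = k' (fst (z' i))" and "!!i. i < b * T ==> snd (z i) = snd (z' i)" and "t <= T"
 shows "sgd eta b app k h0 z t = sgd eta b app' k' h0 z' t"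
 using assms(4)
proof (induction t)
 case (Suc t)
 have le: "i < b * T" if "i < b * (t + 1)" for i
  using that mult_le_mono2[OF Suc.prems, of b] by simp
 show ?case using Suc by (auto intro!: sum.cong simp: assms(1-3) le)
qed simp

lemma tail_average_cong: "(!!t. t <= T ==> h t = h' t) ==> tail_average h T = tail_average h' T"
 unfolding tail_average_def by (auto intro!: sum.cong arg_cong[where f = "(*\<^sub>R) _"])

lemma tail_average_norm_le:
 fixes h :: "nat => 'h::real_normed_vector"
 assumes "T > 0" and h: "!!t. t <= T ==> norm (h t) <= B"
 shows "norm (tail_average h T) <= 2 * B"
proof -
 have B: "B >= 0" using h[of 0] norm_ge_zero[of "h 0"] by linarith
 have "norm (\<Sum>t = T div 2 + 1..T. h t) <= (\<Sum>t = T div 2 + 1..T. B)"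
  by (rule sum_norm_le) (use h in auto)
 also have "... = real (T - T div 2) * B" by simp
 also have "... <= real T * B" using B by (intro mult_right_mono) auto
 finally have "2 / real T * norm (\<Sum>t = T div 2 + 1..T. h t) <= 2 / real T * (real T * B)" by (rule mult_left_mono) simp
 then show ?thesis using assms(1) by (simp add: tail_average_def)
qed

text \<open>The batch step is an average of maps h - \<eta> (h .* k) k plus a label term. The bound
  \<open>q\<close> on these maps is a parameter: 1 where the step size condition holds, and 1 +
  \<eta> KB^2 in general.\<close>

lemma sgd_norm_le:
 fixes app :: "'h::real_inner => 'm => real"
 assumes app: "!!i h. i < b * T ==> app h (fst (z i)) = h .* k (fst (z i))"
  and k: "!!i. i < b * T ==> norm (k (fst (z i))) <= B" and y: "!!i. i < b * T ==> \<bar>snd (z i)\<bar> <= M"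
  and q: "!!i h. i < b * T ==> norm (h - (eta * (h .* k (fst (z i)))) *\<^sub>R k (fst (z i))) <= q * norm h" "q >= 1"
  and b: "b > 0" and eta: "eta >= 0" and B: "B >= 0" and M: "M >= 0" and t: "t <= T"
 shows "norm (sgd eta b app k h0 z t) <= q ^ t * (norm h0 + real t * (eta * M * B))"
 using t
proof (induction t)
 case (Suc t)
 define h where "h = sgd eta b app k h0 z t"
 let ?k = "%i. k (fst (z i))"
 have le: "i < b * T" if "i < b * (t + 1)" for i
  using that mult_le_mono2[OF Suc.prems, of b] by simp
 have card: "card {b * t..<b * (t + 1)} = b" by simp
 have "sgd eta b app k h0 z (Suc t) = h - eta *\<^sub>R (1 / real b) *\<^sub>R (\<Sum>i = b * t..<b * (t + 1). (app h (fst (z i)) - snd (z i)) *\<^sub>R ?k i)"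
  by (simp add: h_def)
 also have "h = (1 / real b) *\<^sub>R (\<Sum>i = b * t..<b * (t + 1). h)"
  unfolding sum_constant_scaleR card using b by simp
 also have "(1 / real b) *\<^sub>R (\<Sum>i = b * t..<b * (t + 1). h) - eta *\<^sub>R (1 / real b) *\<^sub>R (\<Sum>i = b * t..<b * (t + 1). (app ((1 / real b) *\<^sub>R (\<Sum>i = b * t..<b * (t + 1). h)) (fst (z i)) - snd (z i)) *\<^sub>R ?k i)
  = (1 / real b) *\<^sub>R ((\<Sum>i = b * t..<b * (t + 1). h) - (\<Sum>i = b * t..<b * (t + 1). eta *\<^sub>R ((app h (fst (z i)) - snd (z i)) *\<^sub>R ?k i)))"
  unfolding scaleR_diff_right scaleR_sum_right[symmetric] sum_constant_scaleR card using b
  by (simp add: mult.commute)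
 finally have "norm (sgd eta b app k h0 z (Suc t)) = (1 / real b) * norm (\<Sum>i = b * t..<b * (t + 1). h - eta *\<^sub>R ((app h (fst (z i)) - snd (z i)) *\<^sub>R ?k i))"
  by (simp add: sum_subtractf del: sgd.simps)
 also have "... <= (1 / real b) * (\<Sum>i = b * t..<b * (t + 1). q * norm h + eta * M * B)"
 proof (intro mult_left_mono sum_norm_le)
  fix i assume "i \<in> {b * t..<b * (t + 1)}"
  then have i: "i < b * T" using le by simp
  have e: "h - eta *\<^sub>R ((app h (fst (z i)) - snd (z i)) *\<^sub>R ?k i) = (h - (eta * (h .* ?k i)) *\<^sub>R ?k i) + (eta * snd (z i)) *\<^sub>R ?k i"
   by (simp add: app[OF i] scaleR_diff_left scaleR_diff_right)
  have "norm ((eta * snd (z i)) *\<^sub>R ?k i) <= eta * M * B"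
   using k[OF i] y[OF i] eta B M by (simp add: abs_mult mult_mono)
  then show "norm (h - eta *\<^sub>R ((app h (fst (z i)) - snd (z i)) *\<^sub>R ?k i)) <= q * norm h + eta * M * B"
   unfolding e using norm_triangle_ineq[of "h - (eta * (h .* ?k i)) *\<^sub>R ?k i" "(eta * snd (z i)) *\<^sub>R ?k i"] q(1)[OF i, of h] by linarith
 qed simp
 also have "... = q * norm h + eta * M * B" using b by simp
 also have "... <= q * (q ^ t * (norm h0 + real t * (eta * M * B))) + q ^ Suc t * (eta * M * B)"
 proof (intro add_mono mult_left_mono)
  show "norm h <= q ^ t * (norm h0 + real t * (eta * M * B))" unfolding h_def using Suc by simp
  have "1 * (eta * M * B) <= q ^ Suc t * (eta * M * B)"
   using q(2) eta M B by (intro mult_right_mono one_le_power) auto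
  then show "eta * M * B <= q ^ Suc t * (eta * M * B)" by simp
 qed (use q(2) in simp)
 also have "... = q ^ Suc t * (norm h0 + real (Suc t) * (eta * M * B))" by (simp add: algebra_simps)
 finally show ?case .
qed simp

lemma sgd_measurable:
 fixes app :: "'h::{real_inner, second_countable_topology} => 'm => real"
 assumes app: "!!i h om. i < b * T ==> om \<in> space Om ==> app h (fst (z i om)) = h .* k (fst (z i om))"
  and k: "!!i. i < b * T ==> (%om. k (fst (z i om))) \<in> borel_measurable Om"
  and y: "!!i. i < b * T ==> (%om. snd (z i om)) \<in> borel_measurable Om" and t: "t <= T"
 shows "(%om. sgd eta b app k h0 (%i. z i om) t) \<in> borel_measurable Om"
 using t
proof (induction t)
 case (Suc t)
 have le: "i < b * T" if "i < b * (t + 1)" for i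
  using that mult_le_mono2[OF Suc.prems, of b] by simp
 let ?h = "%om. sgd eta b app k h0 (%i. z i om) t"
 have h [measurable]: "?h \<in> borel_measurable Om" using Suc by simp
 have "(%om. ?h om - eta *\<^sub>R (1 / real b) *\<^sub>R (\<Sum>i = b * t..<b * (t + 1). (?h om .* k (fst (z i om)) - snd (z i om)) *\<^sub>R k (fst (z i om)))) \<in> borel_measurable Om"
  by (intro borel_measurable_diff borel_measurable_scaleR borel_measurable_sum borel_measurable_inner
   borel_measurable_const h k y le) auto
 moreover have "sgd eta b app k h0 (%i. z i om) (Suc t) = ?h om - eta *\<^sub>R (1 / real b) *\<^sub>R
   (\<Sum>i = b * t..<b * (t + 1). (?h om .* k (fst (z i om)) - snd (z i om)) *\<^sub>R k (fst (z i om)))" if "om \<in> space Om" for om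
  using that le by (auto intro!: sum.cong simp: app)
 ultimately show ?case by (subst measurable_cong) auto
qed simp

lemma contraction_bound:
 fixes k :: "'h::real_inner"
 assumes "eta >= 0" "eta * (norm k)^2 <= 2"
 shows "norm (h - (eta * (h .* k)) *\<^sub>R k) <= 1 * norm h"
proof -
 have "(norm (h - (eta * (h .* k)) *\<^sub>R k))^2 = (norm h)^2 - eta * (h .* k)^2 * (2 - eta * (norm k)^2)"
  unfolding power2_norm_eq_inner
  by (simp add: inner_diff_left inner_diff_right inner_commute[of k h] power2_eq_square algebra_simps)
 also have "... <= (norm h)^2" using assms by simp
 finally show ?thesis unfolding mult_1 by (rule power2_le_imp_le) simp
qed

lemma growth_bound:
 fixes k :: "'h::real_inner"
 assumes "eta >= 0" "norm k <= B"
 shows "norm (h - (eta * (h .* k)) *\<^sub>R k) <= (1 + eta * B^2) * norm h"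
proof -
 have "\<bar>h .* k\<bar> * norm k <= (norm h * norm k) * norm k" by (intro mult_right_mono Cauchy_Schwarz_ineq2) simp
 also have "... = norm h * (norm k)^2" by (simp add: power2_eq_square)
 also have "... <= norm h * B^2" by (intro mult_left_mono power_mono assms) auto
 finally have "eta * (\<bar>h .* k\<bar> * norm k) <= eta * (norm h * B^2)" using assms(1) by (rule mult_left_mono)
 then have "norm ((eta * (h .* k)) *\<^sub>R k) <= eta * B^2 * norm h" using assms(1) by (simp add: abs_mult mult_ac)
 then show ?thesis using norm_triangle_ineq4[of h "(eta * (h .* k)) *\<^sub>R k"] by (simp add: algebra_simps)
qed

section \<open>The conditional risk\<close>

locale sampled_regression = distribution_regression G evG K evK cls ph P PM KS M Y YM rho rho\<mu> rho_cond Q S frho gam kap al L eta0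
 for G :: "'x::topological_space => 'x => real"
  and evG :: "'g::{real_inner, banach, second_countable_topology} => 'x => real"
  and K :: "'g => 'g => real"
  and evK :: "'h::{real_inner, banach, second_countable_topology} => 'g => real"
  and cls :: "('g => real) => 'l::{real_inner, banach, second_countable_topology}"
  and ph :: "'x => 'g" and P :: "'g set" and PM :: "'g measure"
  and KS :: "'g => 'h"
  and M :: real and Y :: "real set" and YM :: "real measure"
  and rho :: "('g \<times> real) measure" and rho\<mu> :: "'g measure"
  and rho_cond :: "'g => real measure"
  and Q :: "('x measure \<times> real) measure"
  and S :: "'h => 'l" and frho :: 'l
  and gam kap al L eta0 :: real +
 fixes Om :: "'w measure" and n N b T :: nat and x :: "nat => 'w => 'x measure" and y :: "nat => 'w => real"
  and xs :: "nat => nat => 'w => 'x" and J :: "nat => 'w => nat" and h0 :: 'h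
 assumes sample: "two_stage_sample Om Q n N x y xs" and indices: "uniform_indices Om Q n N x y xs (b * T) J"
  and n: "n > 0" and N: "N > 0" and b: "b > 0" and T: "T > 0"
begin

sublocale O: prob_space Om using sample by (simp add: two_stage_sample_def)

lemma Q_components:
 assumes "(%om. (u om, v om)) \<in> W \<rightarrow>\<^sub>M Q"
 shows "u \<in> W \<rightarrow>\<^sub>M prob_algebra borel" and "v \<in> W \<rightarrow>\<^sub>M YM"
proof -
 have "(%om. (u om, v om)) \<in> W \<rightarrow>\<^sub>M prob_algebra borel \<Otimes>\<^sub>M YM"
  using assms measurable_cong_sets[OF refl sets_Q] by blast
 from measurable_compose[OF this measurable_fst] measurable_compose[OF this measurable_snd]
 show "u \<in> W \<rightarrow>\<^sub>M prob_algebra borel" "v \<in> W \<rightarrow>\<^sub>M YM" by simp_all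
qed

lemma embed_measurable: "(%(x, y). (mean_embedding ph x, y)) \<in> Q \<rightarrow>\<^sub>M PM \<Otimes>\<^sub>M YM"
 unfolding measurable_cong_sets[OF sets_Q refl] by measurable

lemma xy_measurable: "j < n ==> (%om. (x j om, y j om)) \<in> Om \<rightarrow>\<^sub>M Q"
 using sample by (simp add: two_stage_sample_def O.indep_vars_def2)

lemmas x_measurable = Q_components(1)[OF xy_measurable]
lemmas y_measurable = Q_components(2)[OF xy_measurable]

lemma xs_measurable: "j < n ==> i < N ==> xs j i \<in> borel_measurable Om"
 using sample by (simp add: two_stage_sample_def)

lemma y_bound: "j < n ==> om \<in> space Om ==> \<bar>y j om\<bar> <= M"
 using measurable_space[OF y_measurable] by (auto simp: YM_eq space_restrict_space Y_abs_le)

text \<open>\<open>Gs\<close> is generated by both sampling stages and \<open>Fs\<close> by the data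
  D, which record mean embeddings instead of the measures \<open>x j\<close>; hence
  \<open>Fs\<close> is contained in \<open>Gs\<close>.\<close>

definition "stages om = (\<lambda>j\<in>{..<n}. (x j om, y j om), \<lambda>p\<in>{..<n} \<times> {..<N}. xs (fst p) (snd p) om)"
definition "Gs = vimage_algebra (space Om) stages ((iid n Q) \<Otimes>\<^sub>M (\<Pi>\<^sub>M p\<in>{..<n} \<times> {..<N}. borel))"
definition "data om = (\<lambda>j\<in>{..<n}. (mean_embedding ph (x j om), y j om))"
definition "Fs = vimage_algebra (space Om) data (iid n (PM \<Otimes>\<^sub>M YM))"

lemma stage1_measurable: "(%om. \<lambda>j\<in>{..<n}. (x j om, y j om)) \<in> Om \<rightarrow>\<^sub>M (iid n Q)"
 by (intro measurable_restrict xy_measurable) simp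

lemma stages_measurable: "stages \<in> Om \<rightarrow>\<^sub>M (iid n Q) \<Otimes>\<^sub>M (\<Pi>\<^sub>M p\<in>{..<n} \<times> {..<N}. borel)"
 unfolding stages_def[abs_def]
 by (intro measurable_Pair stage1_measurable measurable_restrict) (auto intro: xs_measurable)

lemma space_Gs: "space Gs = space Om" and space_Fs: "space Fs = space Om" by (simp_all add: Gs_def Fs_def)

lemma sets_Gs: "sets Gs \<subseteq> sets Om"
 unfolding Gs_def by (rule sets_image_in_sets[OF refl stages_measurable])

lemma stages_Gs: "stages \<in> Gs \<rightarrow>\<^sub>M (iid n Q) \<Otimes>\<^sub>M (\<Pi>\<^sub>M p\<in>{..<n} \<times> {..<N}. borel)"
 unfolding Gs_def using measurable_space[OF stages_measurable] by (intro measurable_vimage_algebra1) auto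

lemma xy_Gs: "j < n ==> (%om. (x j om, y j om)) \<in> Gs \<rightarrow>\<^sub>M Q"
proof -
 assume j: "j < n"
 have "(%om. fst (stages om) j) \<in> Gs \<rightarrow>\<^sub>M Q"
  using j by (intro measurable_compose[OF measurable_compose[OF stages_Gs measurable_fst] measurable_component_singleton]) auto
 then show ?thesis using j by (simp add: stages_def)
qed

lemma xs_Gs: "j < n ==> i < N ==> xs j i \<in> borel_measurable Gs"
proof -
 assume ji: "j < n" "i < N"
 have "(%om. snd (stages om) (j, i)) \<in> borel_measurable Gs"
  using ji by (intro measurable_compose[OF measurable_compose[OF stages_Gs measurable_snd] measurable_component_singleton]) auto
 then show ?thesis using ji by (simp add: stages_def)
qed

lemma Gs_Om: "f \<in> Gs \<rightarrow>\<^sub>M N' ==> f \<in> Om \<rightarrow>\<^sub>M N'"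
 using measurable_mono[of N' N' Gs Om] sets_Gs space_Gs by auto

lemma data_component_Gs: "j < n ==> (%om. (mean_embedding ph (x j om), y j om)) \<in> Gs \<rightarrow>\<^sub>M PM \<Otimes>\<^sub>M YM"
 using Q_components[OF xy_Gs] by (intro measurable_Pair measurable_compose[OF _ mean_embedding_measurable]) auto

lemma data_Gs: "data \<in> Gs \<rightarrow>\<^sub>M (iid n (PM \<Otimes>\<^sub>M YM))"
 unfolding data_def[abs_def] by (intro measurable_restrict data_component_Gs) simp

lemma sets_Fs: "sets Fs \<subseteq> sets Gs"
 unfolding Fs_def by (rule sets_image_in_sets[OF space_Gs data_Gs])

lemma data_component_law:
 assumes j: "j < n"
 shows "distr Om (PM \<Otimes>\<^sub>M YM) (%om. (mean_embedding ph (x j om), y j om)) = rho"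
proof -
 have "distr Om (PM \<Otimes>\<^sub>M YM) (%om. (mean_embedding ph (x j om), y j om))
  = distr (distr Om Q (%om. (x j om, y j om))) (PM \<Otimes>\<^sub>M YM) (%(x, y). (mean_embedding ph x, y))"
  by (subst distr_distr[OF embed_measurable xy_measurable[OF j]]) (simp add: o_def)
 also have "distr Om Q (%om. (x j om, y j om)) = Q" using sample j by (simp add: two_stage_sample_def)
 finally show ?thesis unfolding Q_rho .
qed

lemma data_law: "distr Om (iid n (PM \<Otimes>\<^sub>M YM)) data = (iid n rho)"
proof -
 have "O.indep_vars (%_. Q) (%j om. (x j om, y j om)) {..<n}" using sample by (simp add: two_stage_sample_def)
 from O.indep_vars_compose2[OF this, of "%_ (x, y). (mean_embedding ph x, y)" "%_. PM \<Otimes>\<^sub>M YM"] embed_measurable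
 have ind: "O.indep_vars (%_. PM \<Otimes>\<^sub>M YM) (%j om. (mean_embedding ph (x j om), y j om)) {..<n}" by simp
 have "distr Om (iid n (PM \<Otimes>\<^sub>M YM)) data
  = (\<Pi>\<^sub>M j\<in>{..<n}. distr Om (PM \<Otimes>\<^sub>M YM) (%om. (mean_embedding ph (x j om), y j om)))"
  unfolding data_def[abs_def]
  by (rule iffD1[OF O.indep_vars_iff_distr_eq_PiM' ind]) (use n Gs_Om[OF data_component_Gs] in auto)
 also have "... = (iid n rho)" by (rule PiM_cong) (simp_all add: data_component_law)
 finally show ?thesis .
qed

definition "mh j om = empirical_embedding ph N (%k. xs j k om)"

lemma mh_P: "mh j om \<in> P" unfolding mh_def by (rule empirical_embedding_in_P[OF N])

lemma mh_Gs: "j < n ==> mh j \<in> Gs \<rightarrow>\<^sub>M PM"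
 unfolding PM_eq
proof (rule measurable_restrict_space2)
 show "mh j \<in> space Gs \<rightarrow> P" by (simp add: mh_P)
 assume "j < n"
 then show "mh j \<in> borel_measurable Gs"
  unfolding mh_def[abs_def] empirical_embedding_def
  by (intro borel_measurable_scaleR borel_measurable_sum measurable_compose[OF xs_Gs ph_measurable]) auto
qed

lemma y_Gs: "j < n ==> y j \<in> borel_measurable Gs"
 using measurable_compose[OF Q_components(2)[OF xy_Gs] YM_borel[OF measurable_ident]] by simp

definition "err j om = norm (S (tail_average (sgd eta0 b evK KS h0 (%i. (mh (j i) om, y (j i) om))) T) - frho)"

lemma S_measurable: "S \<in> borel_measurable borel"
proof -
 have "bounded_linear S"
  by (rule bounded_linear_intro[where K = kap'])
   (simp_all only: linear_add[OF S_linear] linear_scale[OF S_linear] model.S_norm_le mult.commute[of _ kap'])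
 then show ?thesis by (intro borel_measurable_continuous_onI linear_continuous_on)
qed

lemma err_measurable:
 assumes j: "!!i. i < b * T ==> j i < n"
 shows "err j \<in> borel_measurable Gs"
proof -
 have "(%om. sgd eta0 b evK KS h0 (%i. (mh (j i) om, y (j i) om)) t) \<in> borel_measurable Gs" if "t \<in> {T div 2 + 1..T}" for t
  by (rule sgd_measurable[of b T Gs evK "%i om. (mh (j i) om, y (j i) om)" KS])
   (use j that in \<open>auto simp: evK_eq[OF mh_P] intro: y_Gs measurable_compose[OF mh_Gs KS_measurable]\<close>)
 then have "(%om. \<Sum>t = T div 2 + 1..T. sgd eta0 b evK KS h0 (%i. (mh (j i) om, y (j i) om)) t) \<in> borel_measurable Gs"
  by (rule borel_measurable_sum)
 then have "(%om. (2 / real T) *\<^sub>R (\<Sum>t = T div 2 + 1..T. sgd eta0 b evK KS h0 (%i. (mh (j i) om, y (j i) om)) t)) \<in> borel_measurable Gs"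
  by (intro borel_measurable_scaleR borel_measurable_const)
 from measurable_compose[OF borel_measurable_diff[OF measurable_compose[OF this S_measurable] borel_measurable_const] borel_measurable_norm]
 show ?thesis unfolding err_def[abs_def] tail_average_def .
qed

text \<open>A deterministic bound on the error: \<open>q\<close> bounds the growth per step,
  \<open>B\<close> the features, and the factor 2 comes from the tail average.\<close>

definition "U q B = 2 * kap' * (q ^ T * (norm h0 + real T * (eta0 * M * B))) + norm frho"

lemma err_le:
 assumes j: "!!i. i < b * T ==> j i < n" and om: "om \<in> space Om"
  and k: "!!i. i < n ==> norm (KS (mh i om)) <= B"
  and q: "!!i h. i < n ==> norm (h - (eta0 * (h .* KS (mh i om))) *\<^sub>R KS (mh i om)) <= q * norm h" "q >= 1"
 shows "err j om <= U q B"
proof -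
 have B: "B >= 0" using order_trans[OF norm_ge_zero k[OF n]] .
 let ?X = "q ^ T * (norm h0 + real T * (eta0 * M * B))"
 have "norm (sgd eta0 b evK KS h0 (%i. (mh (j i) om, y (j i) om)) t) <= ?X" if t: "t <= T" for t
 proof -
  have "norm (sgd eta0 b evK KS h0 (%i. (mh (j i) om, y (j i) om)) t) <= q ^ t * (norm h0 + real t * (eta0 * M * B))"
   by (rule sgd_norm_le[where T = T]) (use j om k q b eta0 B M_pos t in \<open>auto simp: evK_eq[OF mh_P] y_bound\<close>)
  also have "... <= ?X"
   using t q(2) eta0 M_pos B by (intro mult_mono power_increasing add_mono mult_right_mono add_nonneg_nonneg) auto
  finally show ?thesis .
 qed
 then have "norm (tail_average (sgd eta0 b evK KS h0 (%i. (mh (j i) om, y (j i) om))) T) <= 2 * ?X"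
  by (rule tail_average_norm_le[OF T])
 then have "kap' * norm (tail_average (sgd eta0 b evK KS h0 (%i. (mh (j i) om, y (j i) om))) T) <= kap' * (2 * ?X)"
  using kap' by (intro mult_left_mono) auto
 then have "norm (S (tail_average (sgd eta0 b evK KS h0 (%i. (mh (j i) om, y (j i) om))) T)) <= kap' * (2 * ?X)"
  by (rule order_trans[OF model.S_norm_le])
 then show ?thesis
  unfolding err_def U_def using norm_triangle_ineq4[of "S (tail_average (sgd eta0 b evK KS h0 (%i. (mh (j i) om, y (j i) om))) T)" frho] by simp
qed

lemma embedding_tail:
 assumes j: "j < n" and c: "\<bar>gam\<bar> <= c" "c > 0" and ep: "0 <= ep" "ep <= 4 * c"
 shows "O.prob {om \<in> space Om. norm (mh j om - mean_embedding ph (x j om)) >= ep} <= 2 * exp (- (real N * ep^2 / (16 * c^2)))"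
 unfolding mh_def empirical_embedding_def mean_embedding_def
proof (rule conditional_iid_tail[OF O.prob_space_axioms x_measurable[OF j] xs_measurable[OF j] _ ph_measurable _ c(2) ep N])
 show "norm (ph s) <= c" for s using ph_norm_le[of s] c(1) by linarith
 fix A :: "'x measure set" and B :: "nat => 'x set"
 assume A: "A \<in> sets (prob_algebra borel)" and B: "!!i. i < N ==> B i \<in> sets borel"
 \<comment> \<open>All points outside the j-th group are unrestricted; their factors equal 1, which
   isolates the conditional law of that group.\<close>
 define D where "D j' i = (if j' = j \<and> i < N then B i else UNIV)" for j' i
 define W where "W = {om\<in>space Om. x j om \<in> A}"
 have xp: "prob_space (x j' om)" "space (x j' om) = UNIV" if "j' < n" "om \<in> space Om" for j' om
  using measurable_space[OF x_measurable[OF that(1)] that(2)] sets_eq_imp_space_eq[of "x j' om" borel]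
  by (auto simp: space_prob_algebra)
 have Dm: "\<forall>j i. D j i \<in> sets borel" using B by (auto simp: D_def)
 let ?V = "vimage_algebra (space Om) (%om. \<lambda>j\<in>{..<n}. (x j om, y j om)) (iid n Q)"
 have "(%om. \<lambda>j\<in>{..<n}. (x j om, y j om)) \<in> ?V \<rightarrow>\<^sub>M (iid n Q)"
  using measurable_space[OF stage1_measurable] by (intro measurable_vimage_algebra1) auto
 from measurable_compose[OF this measurable_component_singleton[of j]] j
 have "(%om. (x j om, y j om)) \<in> ?V \<rightarrow>\<^sub>M Q" by simp
 from measurable_sets[OF Q_components(1)[OF this] A]
 have W: "W \<in> sets ?V" by (simp add: W_def vimage_def Int_def conj_commute)
 have "measure Om {om\<in>W. \<forall>j<n. \<forall>i<N. xs j i om \<in> D j i} =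
   (LINT om|Om. indicator W om * (\<Prod>j<n. \<Prod>i<N. measure (x j om) (D j i)))"
  using sample Dm W unfolding two_stage_sample_def by blast
 moreover have "{om\<in>W. \<forall>j<n. \<forall>i<N. xs j i om \<in> D j i} = {om\<in>space Om. x j om \<in> A \<and> (\<forall>i<N. xs j i om \<in> B i)}"
  using j by (auto simp: W_def D_def)
 moreover have "(LINT om|Om. indicator W om * (\<Prod>j<n. \<Prod>i<N. measure (x j om) (D j i)))
  = (LINT om|Om. indicator A (x j om) * (\<Prod>i<N. measure (x j om) (B i)))"
 proof (rule Bochner_Integration.integral_cong[OF refl])
  fix om assume om: "om \<in> space Om"
  have "(\<Prod>j'<n. \<Prod>i<N. measure (x j' om) (D j' i)) = (\<Prod>j'<n. if j' = j then \<Prod>i<N. measure (x j om) (B i) else 1)"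
  proof (rule prod.cong[OF refl])
   fix j' assume j': "j' \<in> {..<n}"
   have "measure (x j' om) UNIV = 1" using prob_space.prob_space[OF xp(1)] xp(2) j' om by (metis lessThan_iff)
   then show "(\<Prod>i<N. measure (x j' om) (D j' i)) = (if j' = j then \<Prod>i<N. measure (x j om) (B i) else 1)"
    by (auto simp: D_def intro!: prod.cong prod.neutral)
  qed
  also have "... = (\<Prod>i<N. measure (x j om) (B i))" using j by simp
  finally show "indicator W om * (\<Prod>j<n. \<Prod>i<N. measure (x j om) (D j i)) = indicator A (x j om) * (\<Prod>i<N. measure (x j om) (B i))"
   using om by (simp add: W_def indicator_def)
 qed
 ultimately show "measure Om {om\<in>space Om. x j om \<in> A \<and> (\<forall>i<N. xs j i om \<in> B i)}
   = (LINT om|Om. indicator A (x j om) * (\<Prod>i<N. measure (x j om) (B i)))" by simp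
qed

lemma KS_mean_embedding_AE: "AE om in Om. \<forall>j\<in>{..<n}. norm (KS (mean_embedding ph (x j om))) <= kap"
proof (subst AE_finite_all)
 show "\<forall>j\<in>{..<n}. AE om in Om. norm (KS (mean_embedding ph (x j om))) <= kap"
 proof
  fix j assume "j \<in> {..<n}"
  then have j: "j < n" by simp
  from AE_distrD[OF Gs_Om[OF data_component_Gs[OF j]] KS_fst_norm_AE[folded data_component_law[OF j]]]
  show "AE om in Om. norm (KS (mean_embedding ph (x j om))) <= kap" by simp
 qed
qed simp

text \<open>On the first bad event the empirical embeddings may leave the region where the steps are
 contractions; off it, but on the second one, the iterates still grow at most linearly.\<close>
definition "deviation ep j = {om \<in> space Om. norm (mh j om - mean_embedding ph (x j om)) >= ep}"
definition "bad ep = (\<Union>j<n. deviation ep j)"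

lemma deviation_sets: "j < n ==> deviation ep j \<in> sets Om"
proof -
 assume j: "j < n"
 have PMb: "(%m. m) \<in> PM \<rightarrow>\<^sub>M borel" unfolding PM_eq by (rule measurable_restrict_space1) simp
 have "mh j \<in> borel_measurable Om" "(%om. mean_embedding ph (x j om)) \<in> borel_measurable Om"
  using measurable_compose[OF Gs_Om[OF mh_Gs[OF j]] PMb]
   measurable_compose[OF measurable_compose[OF x_measurable[OF j] mean_embedding_measurable] PMb] by simp_all
 then show ?thesis unfolding deviation_def by measurable
qed

lemma bad_sets: "bad ep \<in> sets Om"
 unfolding bad_def by (rule sets.finite_UN) (auto intro: deviation_sets)

lemma bad_prob:
 assumes "\<bar>gam\<bar> <= c" "c > 0" "0 <= ep" "ep <= 4 * c"
 shows "O.prob (bad ep) <= real n * (2 * exp (- (real N * ep^2 / (16 * c^2))))"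
proof -
 have "O.prob (bad ep) <= (SUM j<n. O.prob (deviation ep j))"
  unfolding bad_def by (intro O.finite_measure_subadditive_finite) (auto intro: deviation_sets)
 also have "... <= (SUM j<n. 2 * exp (- (real N * ep^2 / (16 * c^2))))"
  unfolding deviation_def using assms by (intro sum_mono embedding_tail) auto
 finally show ?thesis by simp
qed

lemma KS_near:
 assumes "om \<in> space Om" "om \<notin> bad ep" "j < n" "L * ep powr al <= D"
 shows "norm (KS (mh j om) - KS (mean_embedding ph (x j om))) <= D"
proof -
 have "norm (mh j om - mean_embedding ph (x j om)) <= ep" using assms by (force simp: bad_def deviation_def)
 then have "L * norm (mh j om - mean_embedding ph (x j om)) powr al <= L * ep powr al"
  using L_pos al by (intro mult_left_mono powr_mono2) auto
 then show ?thesis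
  using hoelder[OF mh_P mean_embedding_in_P[OF measurable_space[OF x_measurable[OF assms(3)] assms(1)]], of j om] assms(4)
  by linarith
qed

text \<open>\<open>A\<close> is an event of the data on which the average over the indices is at
  most \<open>B1\<close> for all nearby features. The threshold 2 B1 leaves room for Markov's
  inequality: on the event \<open>W\<close> where it is exceeded, 2 B1 P(W) is at most B1 P(W) plus
  the contribution of the bad events, which \<open>small\<close> bounds by B1 e.\<close>

theorem conditional_error:
 assumes A: "A \<in> sets (iid n rho)" and B1: "B1 > 0" and
  good: "!!z k. z \<in> A ==> (\<forall>i<n. norm (k i - feat (z i)) <= d \<and> norm (k i) <= kap') ==>
   model.risk eta0 b T h0 n k (%i. snd (z i)) <= B1"
  and c: "\<bar>gam\<bar> <= c" "c > 0" and ep1: "0 <= ep1" "ep1 <= 4 * c" "L * ep1 powr al <= kap' - kap"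
  and ep2: "0 <= ep2" "ep2 <= 4 * c" "L * ep2 powr al <= d"
  and small: "U 1 kap' * (real n * (2 * exp (- (real N * ep2^2 / (16 * c^2)))))
   + U (1 + eta0 * KB^2) KB * (real n * (2 * exp (- (real N * ep1^2 / (16 * c^2))))) <= B1 * e"
 shows "O.prob {om \<in> space Om. real_cond_exp Om Fs (%om. err (%i. J i om) om) om <= 2 * B1}
  >= measure (iid n rho) A - e"
proof -
 let ?f = "%om. err (%i. J i om) om" and ?P = "iid n rho"
 let ?U1 = "U 1 kap'" and ?U2 = "U (1 + eta0 * KB^2) KB"
 interpret PP: prob_space ?P by (intro prob_space_PiM prob_rho)
 have U0: "0 <= U q B" if "q >= 1" "B >= 0" for q B
  using kap' eta0 M_pos that unfolding U_def by (intro add_nonneg_nonneg mult_nonneg_nonneg) auto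
 have q2: "1 <= 1 + eta0 * KB^2" using eta0 by simp
 have U1: "0 <= ?U1" and U2: "0 <= ?U2" using U0[of 1 kap'] U0[OF q2, of KB] kap' KB by auto
 have "0 <= ?U1 * (real n * (2 * exp (- (real N * ep2^2 / (16 * c^2))))) + ?U2 * (real n * (2 * exp (- (real N * ep1^2 / (16 * c^2)))))"
  using U1 U2 by (intro add_nonneg_nonneg mult_nonneg_nonneg) auto
 then have "0 <= B1 * e" using small by linarith
 then have e0: "0 <= e" using B1 by (simp add: zero_le_mult_iff)
 show ?thesis
 proof (cases "?f \<in> borel_measurable Om")
  \<comment> \<open>On the null set where an index is not below n, points and labels are not assumed
    measurable, so the error may fail to be measurable. The conditional expectation then falls back
    on default values and is at most 0.\<close>
  case False
  have "(%om. ennreal (?f om)) \<notin> borel_measurable Om"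
  proof
   assume "(%om. ennreal (?f om)) \<in> borel_measurable Om"
   from measurable_compose[OF this borel_measurable_enn2real[OF measurable_ident]]
   have "(%om. enn2real (ennreal (?f om))) \<in> borel_measurable Om" by simp
   then show False using False by (simp add: err_def)
  qed
  moreover have "ennreal (- ?f om) = 0" for om by (simp add: err_def ennreal_neg)
  ultimately have "real_cond_exp Om Fs ?f om = - enn2real (nn_cond_exp Om Fs (%_. 0) om)" for om
   by (simp add: real_cond_exp_def nn_cond_exp_def[of Om Fs "%om. ennreal (?f om)"])
  then have "real_cond_exp Om Fs ?f om <= 2 * B1" for om
   using B1 enn2real_nonneg[of "nn_cond_exp Om Fs (%_. 0) om"] by (simp add: order_trans[of _ 0])
  then have "{om \<in> space Om. real_cond_exp Om Fs ?f om <= 2 * B1} = space Om" by auto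
  then have "O.prob {om \<in> space Om. real_cond_exp Om Fs ?f om <= 2 * B1} = 1" by (simp only: O.prob_space)
  then show ?thesis using e0 PP.prob_le_1[of A] by linarith
 next
  case f: True
  have J: "O.indep_vars (%_. count_space UNIV) J {..<b * T}"
   "\<forall>i<b * T. distr Om (count_space UNIV) (J i) = measure_pmf (pmf_of_set {..<n})"
   "O.indep_set (sets Gs) (sets (vimage_algebra (space Om) (%om. \<lambda>i\<in>{..<b * T}. J i om) (\<Pi>\<^sub>M i\<in>{..<b * T}. count_space UNIV)))"
   using indices by (simp_all add: uniform_indices_def Gs_def stages_def[abs_def])
  have jlt: "j i < n" if "j \<in> {..<b * T} \<rightarrow>\<^sub>E {..<n}" "i < b * T" for j i using that by auto
  have errG: "err j \<in> borel_measurable Gs" if "j \<in> {..<b * T} \<rightarrow>\<^sub>E {..<n}" for j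
   using jlt[OF that] by (rule err_measurable)
  have err2: "err j om <= ?U2" if "!!i. i < b * T ==> j i < n" "om \<in> space Om" for j om
   using that q2 eta0 KB(2)[OF mh_P] by (intro err_le growth_bound) auto
  have errb: "\<bar>err j om\<bar> <= ?U2" if "j \<in> {..<b * T} \<rightarrow>\<^sub>E {..<n}" "om \<in> space Om" for j om
   using err2[OF jlt[OF that(1)] that(2)] by (simp add: err_def)
  have errc: "err j om = err j' om" if "\<forall>i<b * T. j i = j' i" for j j' om
  proof -
   have "tail_average (sgd eta0 b evK KS h0 (%i. (mh (j i) om, y (j i) om))) T
    = tail_average (sgd eta0 b evK KS h0 (%i. (mh (j' i) om, y (j' i) om))) T"
    by (rule tail_average_cong, rule sgd_cong[where T = T]) (use that in auto)
   then show ?thesis by (simp add: err_def)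
  qed
  note ri = random_index_integral[where F = err and B = "?U2", OF O.prob_space_axioms J(1,2) n J(3) space_Gs sets_Gs]
  have fi: "integrable Om ?f" by (rule ri(3)[where W = "space Gs"]) (fact errG errb errc f sets.top)+
  define IM where "IM om = index_mean n (b * T) (%j. err j om)" for om
  have IMi: "integrable Om IM" unfolding IM_def[abs_def] by (rule ri(4)[where W = "space Gs"]) (fact errG errb errc f sets.top)+
  define Z where "Z = real_cond_exp Om Fs ?f"
  have sub: "subalgebra Om Fs" using sets_Fs sets_Gs space_Fs by (auto simp: subalgebra_def)
  interpret F: finite_measure_subalgebra Om Fs by unfold_locales (rule sub)
  have Zm [measurable]: "Z \<in> borel_measurable Fs" unfolding Z_def by (rule borel_measurable_cond_exp)
  have PiM_sets: "sets ?P = sets (iid n (PM \<Otimes>\<^sub>M YM))" by (intro sets_PiM_cong) (simp_all add: sets_rho)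
  have A': "A \<in> sets (iid n (PM \<Otimes>\<^sub>M YM))" using A PiM_sets by simp
  define E where "E = data -` A \<inter> space Om"
  have E: "E \<in> sets Fs" unfolding E_def Fs_def by (rule in_vimage_algebra[OF A'])
  have PE: "O.prob E = measure ?P A"
   unfolding E_def data_law[symmetric] by (rule measure_distr[symmetric, OF Gs_Om[OF data_Gs] A'])
  define W where "W = E \<inter> {om\<in>space Fs. 2 * B1 < Z om}"
  have WF: "W \<in> sets Fs" unfolding W_def by (rule sets.Int[OF E]) measurable
  have WG: "W \<in> sets Gs" and WO: "W \<in> sets Om" using WF sets_Fs sets_Gs by auto
  have EO: "E \<in> sets Om" using E sets_Fs sets_Gs by auto
  \<comment> \<open>Exponential growth is allowed for on \<open>bad ep1\<close> and linear growth on
    \<open>bad ep2\<close>; on the rest of \<open>W\<close> the perturbed features satisfy the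
    hypothesis of \<open>good\<close>.\<close>
  have point: "AE om in Om. indicator W om * IM om <= B1 * indicator W om + (?U1 * indicator (bad ep2) om + ?U2 * indicator (bad ep1) om)"
   using KS_mean_embedding_AE AE_space
  proof eventually_elim
   case (elim om)
   let ?m = "%j. mean_embedding ph (x j om)"
   have near: "norm (KS (mh j om)) <= kap'" if "om \<notin> bad ep1" "j < n" for j
    using KS_near[OF elim(2) that ep1(3)] elim(1) that(2) norm_triangle_ineq2[of "KS (mh j om)" "KS (?m j)"] by force
   have IM2: "IM om <= ?U2"
   proof -
    have "IM om <= index_mean n (b * T) (%j. ?U2)" unfolding IM_def
     by (rule index_mean_mono_on) (use err2[OF _ elim(2)] in auto)
    then show ?thesis by (simp add: index_mean_const[OF n])
   qed
   have IM0: "0 <= IM om" unfolding IM_def by (rule index_mean_nonneg) (simp add: err_def)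
   consider "om \<notin> W" | "om \<in> bad ep1" | "om \<in> W" "om \<notin> bad ep1" "om \<in> bad ep2" | "om \<in> W" "om \<notin> bad ep1" "om \<notin> bad ep2" by blast
   then show ?case
   proof cases
    case 1
    then show ?thesis using B1 U1 U2 by simp
   next
    case 2
    have "indicator W om * IM om <= 1 * IM om" using IM0 by (intro mult_right_mono) (auto simp: indicator_def)
    moreover have "0 <= B1 * indicator W om" "0 <= ?U1 * indicator (bad ep2) om" using B1 U1 by auto
    ultimately show ?thesis using 2 IM2 by simp
   next
    case 3
    have "err j om <= ?U1" if "!!i. i < b * T ==> j i < n" for j
    proof (rule err_le[OF that elim(2) near[OF 3(2)]])
     show "norm (h - (eta0 * (h .* KS (mh i om))) *\<^sub>R KS (mh i om)) <= 1 * norm h" if "i < n" for i h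
     proof (rule contraction_bound)
      have "eta0 * (norm (KS (mh i om)))^2 <= eta0 * kap'^2" using eta0 near[OF 3(2) that] by (intro mult_left_mono power_mono) auto
      then show "eta0 * (norm (KS (mh i om)))^2 <= 2" using kap'(3) by linarith
     qed (use eta0 in simp)
    qed auto
    then have "IM om <= index_mean n (b * T) (%j. ?U1)" unfolding IM_def by (intro index_mean_mono_on) auto
    then have "IM om <= ?U1" by (simp add: index_mean_const[OF n])
    then show ?thesis using 3 B1 by simp
   next
    case 4
    let ?z = "data om" and ?k = "%j. KS (mh j om)"
    have zA: "?z \<in> A" using 4(1) by (auto simp: W_def E_def)
    have "feat (?z i) = KS (?m i)" if "i < n" for i
     using that elim(1) kap'(2) by (force simp: data_def feat_def)
    then have kk: "\<forall>i<n. norm (?k i - feat (?z i)) <= d \<and> norm (?k i) <= kap'" using near[OF 4(2)] KS_near[OF elim(2) 4(3) _ ep2(3)] by simp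
    have "IM om <= index_mean n (b * T) (%j. norm (S (tail_average (sgd eta0 b (.*) (%v. v) h0 (%i. (?k (j i), snd (?z (j i))))) T) - frho))"
     unfolding IM_def
    proof (rule index_mean_mono_on)
     fix j :: "nat => nat" assume j: "\<forall>i<b * T. j i < n"
     have "tail_average (sgd eta0 b evK KS h0 (%i. (mh (j i) om, y (j i) om))) T
      = tail_average (sgd eta0 b (.*) (%v. v) h0 (%i. (?k (j i), snd (?z (j i))))) T"
      by (rule tail_average_cong, rule sgd_cong[where T = T]) (use j in \<open>auto simp: evK_eq[OF mh_P] data_def\<close>)
     then show "err j om <= norm (S (tail_average (sgd eta0 b (.*) (%v. v) h0 (%i. (?k (j i), snd (?z (j i))))) T) - frho)"
      by (simp add: err_def)
    qed
    also have "... <= B1" by (rule good[OF zA kk, unfolded model.risk_def])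
    finally show ?thesis using 4 by simp
   qed
  qed
  have "2 * B1 * O.prob W = (LINT om|Om. indicator W om * (2 * B1))" using WO by simp
  also have "... <= (LINT om|Om. indicator W om * Z om)"
  proof (rule integral_mono)
   show "integrable Om (%om. indicator W om * (2 * B1))"
    using WO by (intro integrable_mult_left integrable_real_indicator) (simp_all add: O.emeasure_eq_measure)
   show "integrable Om (%om. indicator W om * Z om)"
    using integrable_mult_indicator[OF WO F.real_cond_exp_int(1)[OF fi]] by (simp add: Z_def)
   show "indicator W om * (2 * B1) <= indicator W om * Z om" for om by (auto simp: W_def indicator_def)
  qed
  also have "... = (LINT om|Om. indicator W om * ?f om)"
   using F.real_cond_exp_intA[OF fi WF] by (simp add: set_lebesgue_integral_def Z_def)
  \<comment> \<open>\<open>W\<close> depends on the data only, so the indices can be averaged out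
    under the integral.\<close>
  also have "... = (LINT om|Om. indicator W om * IM om)"
   unfolding IM_def by (rule ri(1)) (fact errG errb errc f WG)+
  also have "... <= (LINT om|Om. B1 * indicator W om + (?U1 * indicator (bad ep2) om + ?U2 * indicator (bad ep1) om))"
  proof (rule integral_mono_AE[OF _ _ point])
   show "integrable Om (%om. indicator W om * IM om)" using integrable_mult_indicator[OF WO IMi] by simp
   show "integrable Om (%om. B1 * indicator W om + (?U1 * indicator (bad ep2) om + ?U2 * indicator (bad ep1) om))"
    using WO bad_sets by (intro Bochner_Integration.integrable_add integrable_mult_right integrable_real_indicator) (simp_all add: O.emeasure_eq_measure)
  qed
  also have "... = B1 * O.prob W + (?U1 * O.prob (bad ep2) + ?U2 * O.prob (bad ep1))"
   using WO bad_sets[of ep1] bad_sets[of ep2] by (simp add: O.emeasure_eq_measure)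
  also have "?U1 * O.prob (bad ep2) + ?U2 * O.prob (bad ep1) <= B1 * e"
   using mult_left_mono[OF bad_prob[OF c ep2(1,2)] U1] mult_left_mono[OF bad_prob[OF c ep1(1,2)] U2] small by linarith
  finally have "B1 * O.prob W <= B1 * e" by linarith
  then have PW: "O.prob W <= e" using B1 by simp
  have "measure ?P A - e <= O.prob E - O.prob W" using PE PW by simp
  also have "... = O.prob (E - W)" by (rule O.finite_measure_Diff[symmetric, OF EO WO]) (auto simp: W_def)
  also have "... <= O.prob {om \<in> space Om. Z om <= 2 * B1}"
  proof (rule O.finite_measure_mono)
   show "E - W \<subseteq> {om \<in> space Om. Z om <= 2 * B1}" by (auto simp: W_def E_def space_Fs)
   have [measurable]: "Z \<in> borel_measurable Om" unfolding Z_def by (rule borel_measurable_cond_exp2)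
   show "{om \<in> space Om. Z om <= 2 * B1} \<in> sets Om" by measurable
  qed
  finally show ?thesis unfolding Z_def .
 qed
qed

end

text \<open>The first term stands for the probability of \<open>bad ep2\<close> times linear growth,
  where \<nu> > 0 makes the exponent a positive; the second for that of \<open>bad ep1\<close> times
  exponential growth exp (g u), which the Gaussian factor defeats.\<close>

lemma second_stage_negligible:
 fixes a k k' g be be' A1 A2 A3 :: real
 assumes a: "a > 0" and k: "k > 0" "k' > 0" and A3: "A3 > 0"
 shows "\<forall>\<^sub>F u in at_top. A1 * (u powr be * exp (- (k * u powr a))) + A2 * (u powr be * exp (g * u - k' * u^2)) <= A3 * u powr (- be')"
proof -
 have 1: "((%u::real. u powr (be + be') * exp (- (k * u powr a))) \<longlongrightarrow> 0) at_top"
  using a k by real_asymp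
 have 2: "((%u::real. u powr (be + be') * exp (g * u - k' * u^2)) \<longlongrightarrow> 0) at_top"
  using k by real_asymp
 have "((%u. A1 * (u powr (be + be') * exp (- (k * u powr a))) + A2 * (u powr (be + be') * exp (g * u - k' * u^2))) \<longlongrightarrow> A1 * 0 + A2 * 0) at_top"
  by (intro tendsto_add tendsto_mult_left 1 2)
 then have "\<forall>\<^sub>F u in at_top. A1 * (u powr (be + be') * exp (- (k * u powr a))) + A2 * (u powr (be + be') * exp (g * u - k' * u^2)) < A3"
  using A3 by (intro order_tendstoD(2)[of _ "A1 * 0 + A2 * 0"]) auto
 then show ?thesis using eventually_gt_at_top[of 0]
 proof eventually_elim
  case (elim u)
  have e: "u powr (be + be') * u powr (- be') = u powr be" by (simp add: powr_add[symmetric])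
  have "A1 * (u powr be * exp (- (k * u powr a))) + A2 * (u powr be * exp (g * u - k' * u^2))
   = (A1 * (u powr (be + be') * exp (- (k * u powr a))) + A2 * (u powr (be + be') * exp (g * u - k' * u^2))) * u powr (- be')"
   unfolding e[symmetric] by (simp add: algebra_simps)
  also have "... <= A3 * u powr (- be')" using elim by (intro mult_right_mono) auto
  finally show ?case .
 qed
qed

section \<open>The final rate\<close>

context distribution_regression
begin

definition cond_risk :: "'w measure => _" where
 "cond_risk Om n N b T h0 x y xs J =
  real_cond_exp Om
   (vimage_algebra (space Om) (%om. \<lambda>j\<in>{..<n}. (mean_embedding ph (x j om), y j om)) (iid n (PM \<Otimes>\<^sub>M YM)))
   (%om. norm (S (tail_average (sgd eta0 b evK KS h0
    (%i. (empirical_embedding ph N (%k. xs (J i om) k om), y (J i om) om))) T) - frho))"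

text \<open>Everything is expressed by v = (R^2 n / M^2)^(1/s) with s = 2r + \<nu>: T lies between v
  and 2 v, and n is a multiple of v^s. The admissible feature distance is of order 1 / v, so
  \<open>ep2\<close> is of order v^(-1/\<alpha>), and N >= v^((2+\<nu>)/\<alpha>) makes N ep2^2 at
  least of order v^(\<nu>/\<alpha>); its exponential beats every power of v.\<close>

theorem convergence_rate:
 fixes r R nx cnx :: real and hrho :: 'l and h0 :: 'h
 assumes al1: "al <= 1" and r: "0 < r" "r <= 1 / 2"
  and source: "frho = op_powr (S \<circ> adjoint S) r hrho" "norm hrho <= R" and R_pos: "R > 0"
  and nx: "0 < nx" "nx <= 1" "2 * r + nx > 1"
  and eff_dim: "!!l. l > 0 ==> effective_dim (S \<circ> adjoint S) l <= cnx * l powr (- nx)"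
 shows "\<exists>C. \<forall>dl. 0 < dl \<and> dl <= 1 -->
  (\<exists>n0. \<forall>n\<ge>n0. \<forall>N b T. \<forall>(Om :: 'w measure) x y xs J.
    T = nat \<lceil>(R^2 * real n / M^2) powr (1 / (2 * r + nx))\<rceil> \<and>
    (b = nat \<lceil>sqrt (real n)\<rceil> \<or> b = n) \<and>
    real N >= ln (real n) powr (2 / al) * (R^2 / M^2 * real n) powr ((2 + nx) / (al * (2 * r + nx))) \<and>
    two_stage_sample Om Q n N x y xs \<and>
    uniform_indices Om Q n N x y xs (b * T) J -->
    measure Om {om \<in> space Om.
     cond_risk Om n N b T h0 x y xs J om
     <= C * ln (6 / dl) * R * (M^2 / (R^2 * real n)) powr (r / (2 * r + nx))} >= 1 - dl)"
 (is "\<exists>C. \<forall>dl. _ --> (\<exists>n0. ?rate C dl n0)")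
proof -
 define s where "s = 2 * r + nx"
 have s: "s > 1" using nx by (simp add: s_def)
 \<comment> \<open>Calibrated so that \<lambda> >= 1 / (2 eta0 v) gives c1 \<lambda>^(-s) <=
   n.\<close>
 define c1 where "c1 = M^2 / (R^2 * (2 * eta0) powr s)"
 have c1: "c1 > 0" using M_pos R_pos eta0 by (simp add: c1_def)
 let ?ev = "%C dl l. \<forall>n b T. T > 0 \<and> l = 1 / (eta0 * real T) \<and>
  c1 * l powr (- s) <= real n \<and> sqrt (real n) <= real b -->
  (\<exists>A\<in>sets (iid n rho). measure (iid n rho) A >= 1 - 2 / 3 * dl \<and>
   (\<forall>z\<in>A. \<forall>k. model.near_features l n z k -->
    model.risk eta0 b T h0 n k (%i. snd (z i)) <= C * ln (6 / dl) * l powr r))"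
 have "\<exists>C. \<forall>dl. 0 < dl \<and> dl <= 1 --> (\<forall>\<^sub>F l in at_right 0. ?ev C dl l)"
  unfolding s_def
  by (rule model.sample_rate[OF r source(1)[folded model_L] source(2) R_pos nx eff_dim[folded model_L] c1 eta0(1) kap'(3)])
 then obtain C0 where C0: "\<forall>dl. 0 < dl \<and> dl <= 1 --> (\<forall>\<^sub>F l in at_right 0. ?ev C0 dl l)" by (rule exE)
 \<comment> \<open>\<open>conditional_error\<close> asks for a positive bound \<open>B1\<close>,
   while \<open>C0\<close> has no known sign.\<close>
 define C1 where "C1 = max C0 1"
 have C1: "C0 <= C1" "C1 > 0" by (simp_all add: C1_def)
 \<comment> \<open>The factor 2 comes from Markov's inequality; division by R offsets the factor R
   of the claim, as the dependence on R already sits in \<open>C1\<close>.\<close>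
 define C where "C = 2 * C1 * eta0 powr (- r) / R"
 \<comment> \<open>A common bound for the kernel sections that also keeps both deviation levels
   below 4 c.\<close>
 define c where "c = \<bar>gam\<bar> + 1 + (1 / (4 * kap' * L)) powr (1 / al) + ((kap' - kap) / L) powr (1 / al)"
 have c: "\<bar>gam\<bar> <= c" "c > 0" "(1 / (4 * kap' * L)) powr (1 / al) <= 4 * c" "((kap' - kap) / L) powr (1 / al) <= 4 * c"
 proof -
  have aux: "g <= g + 1 + x + z" "0 < g + 1 + x + z" "x <= 4 * (g + 1 + x + z)" "z <= 4 * (g + 1 + x + z)"
   if "0 <= g" "0 <= x" "0 <= z" for g x z :: real
   using that by (auto simp: algebra_simps)
  show "\<bar>gam\<bar> <= c" "c > 0" "(1 / (4 * kap' * L)) powr (1 / al) <= 4 * c" "((kap' - kap) / L) powr (1 / al) <= 4 * c"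
   unfolding c_def by (rule aux; simp)+
 qed
 define ep1 where "ep1 = ((kap' - kap) / L) powr (1 / al)"
 have ep1: "0 < ep1" "ep1 <= 4 * c" "L * ep1 powr al <= kap' - kap"
  using kap' L_pos al c(4) by (simp_all add: ep1_def powr_powr)
 define k1 where "k1 = ep1^2 / (16 * c^2)"
 define k2 where "k2 = (1 / (8 * eta0 * kap' * L)) powr (2 / al) / (16 * c^2)"
 have k: "k1 > 0" "k2 > 0" using ep1 c eta0 kap' L_pos by (simp_all add: k1_def k2_def)
 define q where "q = 1 + eta0 * KB^2"
 have q: "q >= 1" using eta0 by (simp add: q_def)
 define a1 where "a1 = 2 * kap' * (norm h0 + eta0 * M * kap') + norm frho"
 define a2 where "a2 = 2 * kap' * (norm h0 + eta0 * M * KB) + norm frho"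
 have a0: "a1 >= 0" "a2 >= 0" using kap' eta0 M_pos KB by (simp_all add: a1_def a2_def)
 let ?X = "M^2 / R^2"
 show ?thesis
 proof (intro exI[of _ C] allI impI, elim conjE)
  fix dl :: real assume dl: "0 < dl" "dl <= 1"
  note Lg = ln_6_div_ge_1[OF dl]
  from C0 dl have "\<forall>\<^sub>F l in at_right 0. ?ev C0 dl l" by simp
  then obtain l0 where l0: "l0 > 0" and small_l: "\<forall>l>0. l < l0 --> ?ev C0 dl l"
   unfolding eventually_at_right_field by (elim exE conjE)
  \<comment> \<open>Gives the lower bound k3 v^(-r) for \<open>B1 * (dl / 3)\<close>.\<close>
  define k3 where "k3 = C1 * ln (6 / dl) * (2 * eta0) powr (- r) * (dl / 3)"
  have k3: "k3 > 0" using C1 Lg dl eta0 by (simp add: k3_def)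
  define u where "u n = (R^2 * real n / M^2) powr (1 / s)" for n
  have u_top: "filterlim u at_top sequentially"
   unfolding u_def using R_pos M_pos s by real_asymp
  have "\<forall>\<^sub>F v in at_top. 2 * (2 * a1 * ?X) * (v powr (s + 1) * exp (- (k2 * v powr (nx / al))))
   + 2 * (2 * a2 * ?X) * (v powr (s + 1) * exp (2 * ln q * v - k1 * v^2)) <= k3 * v powr (- r)"
   using nx al k k3 by (intro second_stage_negligible) auto
  moreover have "\<forall>\<^sub>F v in at_top. max 1 (1 / (eta0 * min l0 1)) < v" by (rule eventually_gt_at_top)
  ultimately have "\<forall>\<^sub>F v in at_top. 2 * (2 * a1 * ?X) * (v powr (s + 1) * exp (- (k2 * v powr (nx / al))))
   + 2 * (2 * a2 * ?X) * (v powr (s + 1) * exp (2 * ln q * v - k1 * v^2)) <= k3 * v powr (- r) \<and> max 1 (1 / (eta0 * min l0 1)) < v"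
   by (rule eventually_conj)
  from eventually_compose_filterlim[OF this u_top] have "\<forall>\<^sub>F n in sequentially. 2 * (2 * a1 * ?X) * (u n powr (s + 1) * exp (- (k2 * u n powr (nx / al))))
   + 2 * (2 * a2 * ?X) * (u n powr (s + 1) * exp (2 * ln q * u n - k1 * (u n)^2)) <= k3 * u n powr (- r) \<and> max 1 (1 / (eta0 * min l0 1)) < u n" .
  moreover have "\<forall>\<^sub>F n in sequentially. n >= (3::nat)" by (rule eventually_ge_at_top)
  ultimately have "\<forall>\<^sub>F n in sequentially. (2 * (2 * a1 * ?X) * (u n powr (s + 1) * exp (- (k2 * u n powr (nx / al))))
   + 2 * (2 * a2 * ?X) * (u n powr (s + 1) * exp (2 * ln q * u n - k1 * (u n)^2)) <= k3 * u n powr (- r) \<and> max 1 (1 / (eta0 * min l0 1)) < u n) \<and> n >= 3"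
   by (rule eventually_conj)
  then obtain n0 where n0: "!!n. n >= n0 ==> (2 * (2 * a1 * ?X) * (u n powr (s + 1) * exp (- (k2 * u n powr (nx / al))))
   + 2 * (2 * a2 * ?X) * (u n powr (s + 1) * exp (2 * ln q * u n - k1 * (u n)^2)) <= k3 * u n powr (- r) \<and> max 1 (1 / (eta0 * min l0 1)) < u n) \<and> n >= 3"
   unfolding eventually_sequentially by (elim exE) (rule that, blast)
  show "\<exists>n0. ?rate C dl n0"
  proof (intro exI[of _ n0] allI impI, elim conjE)
   fix n N b T :: nat and Om :: "'w measure" and x y xs J
   assume nn: "n >= n0" and T: "T = nat \<lceil>(R^2 * real n / M^2) powr (1 / (2 * r + nx))\<rceil>"
    and b: "b = nat \<lceil>sqrt (real n)\<rceil> \<or> b = n"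
    and N: "real N >= ln (real n) powr (2 / al) * (R^2 / M^2 * real n) powr ((2 + nx) / (al * (2 * r + nx)))"
    and sample: "two_stage_sample Om Q n N x y xs" and indices: "uniform_indices Om Q n N x y xs (b * T) J"
   define v where "v = u n"
   have n3: "n >= 3" using n0[OF nn] by simp
   have v1: "1 < v" and vl: "1 / (eta0 * min l0 1) < v" using n0[OF nn] by (auto simp: v_def)
   have tail: "2 * (2 * a1 * ?X) * (v powr (s + 1) * exp (- (k2 * v powr (nx / al))))
    + 2 * (2 * a2 * ?X) * (v powr (s + 1) * exp (2 * ln q * v - k1 * v^2)) <= k3 * v powr (- r)"
    using n0[OF nn] by (simp add: v_def)
   have X0: "0 <= R^2 * real n / M^2" by simp
   have vs: "v powr s = R^2 * real n / M^2" using s by (simp add: v_def u_def powr_powr)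
   then have nv: "real n = ?X * v powr s" using R_pos M_pos by (simp add: field_simps)
   have Tv: "v <= real T" "real T <= 2 * v"
   proof -
    have "T = nat \<lceil>v\<rceil>" by (simp add: T v_def u_def s_def)
    then show "v <= real T" "real T <= 2 * v" using v1 by linarith+
   qed
   have T0: "T > 0" using Tv v1 by (cases T) auto
   define l where "l = 1 / (eta0 * real T)"
   have l_pos: "l > 0" using eta0 T0 by (simp add: l_def)
   have lT: "1 / l = eta0 * real T" by (simp add: l_def)
   have l_lt: "l < min l0 1"
   proof -
    have m0: "0 < min l0 1" using l0 by simp
    have "1 < v * (eta0 * min l0 1)" using vl eta0 m0 by (simp add: divide_less_eq)
    also have "... <= real T * (eta0 * min l0 1)" using Tv eta0 m0 by (intro mult_right_mono) auto
    finally have *: "1 < min l0 1 * (eta0 * real T)" by (simp only: mult_ac)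
    have eta_T: "0 < eta0 * real T" using eta0 T0 by simp
    show ?thesis unfolding l_def pos_divide_less_eq[OF eta_T] by (rule *)
   qed
   have l_up: "l powr r <= eta0 powr (- r) * v powr (- r)"
   proof -
    have "l powr r = (eta0 * real T) powr (- r)" using eta0 T0 by (simp add: l_def powr_minus_divide powr_divide)
    also have "... <= (eta0 * v) powr (- r)" using eta0 Tv v1 r by (intro powr_mono2') auto
    finally show ?thesis using eta0 v1 by (simp add: powr_mult)
   qed
   have l_low: "1 / (2 * eta0 * v) <= l"
    unfolding l_def using Tv v1 eta0 T0 by (intro divide_left_mono) (auto intro!: mult_pos_pos)
   have l_lowr: "(2 * eta0) powr (- r) * v powr (- r) <= l powr r"
   proof -
    have "(2 * eta0) powr (- r) * v powr (- r) = (1 / (2 * eta0 * v)) powr r"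
     using eta0 v1 by (simp add: powr_mult powr_minus_divide powr_divide)
    also have "... <= l powr r" using l_low eta0 v1 r by (intro powr_mono2) auto
    finally show ?thesis .
   qed
   have nb: "sqrt (real n) <= real b"
    using b
   proof
    assume "b = n"
    moreover have "sqrt (real n) <= real n" using n3 by (intro real_le_lsqrt) (auto simp: power2_eq_square)
    ultimately show ?thesis by simp
   qed linarith
   then have b0: "b > 0" using n3 by (cases b) auto
   have nl: "c1 * l powr (- s) <= real n"
   proof -
    have "l powr (- s) = (1 / l) powr s" using l_pos by (simp add: powr_minus_divide powr_divide)
    also have "... <= (2 * eta0 * v) powr s"
     unfolding lT using Tv eta0 s by (intro powr_mono2) auto
    also have "... = (2 * eta0) powr s * v powr s" using eta0 v1 by (simp add: powr_mult)
    finally have "c1 * l powr (- s) <= c1 * ((2 * eta0) powr s * v powr s)" using c1 by (intro mult_left_mono) auto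
    also have "... = real n" unfolding nv c1_def using eta0 by simp
    finally show ?thesis .
   qed
   have Nv: "v powr ((2 + nx) / al) <= real N"
   proof -
    \<comment> \<open>The logarithmic factor in N is at least 1 as soon as n >= 3.\<close>
    have "exp 1 <= real n" using exp_le n3 by linarith
    then have "ln (exp 1) <= ln (real n)" using n3 by (subst ln_le_cancel_iff) auto
    then have "1 <= ln (real n)" by simp
    then have "1 <= ln (real n) powr (2 / al)" using al by (intro ge_one_powr_ge_zero) auto
    have "(R^2 / M^2 * real n) powr ((2 + nx) / (al * (2 * r + nx))) = v powr ((2 + nx) / al)"
     unfolding v_def u_def powr_powr s_def[symmetric] by (simp add: mult_ac)
    then have "1 * v powr ((2 + nx) / al) <= ln (real n) powr (2 / al) * (R^2 / M^2 * real n) powr ((2 + nx) / (al * (2 * r + nx)))"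
     using \<open>1 <= ln (real n) powr (2 / al)\<close> by (simp only:) (intro mult_right_mono, auto)
    then show ?thesis using N by simp
   qed
   have N0: "N > 0" using Nv v1 by (cases N) auto
   interpret sr: sampled_regression G evG K evK cls ph P PM KS M Y YM rho rho\<mu> rho_cond Q S frho gam kap al L eta0 Om n N b T x y xs J h0
    by unfold_locales (use sample indices n3 N0 b0 T0 in auto)
   obtain A where A: "A \<in> sets (iid n rho)" "measure (iid n rho) A >= 1 - 2 / 3 * dl"
    "\<forall>z\<in>A. \<forall>k. model.near_features l n z k -->
     model.risk eta0 b T h0 n k (%i. snd (z i)) <= C0 * ln (6 / dl) * l powr r"
   proof -
    have "l < l0" using l_lt by simp
    from small_l[rule_format, OF l_pos this conjI[OF T0 conjI[OF l_def conjI[OF nl nb]]]]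
    show ?thesis by (elim bexE conjE) (rule that)
   qed
   define B1 where "B1 = C1 * ln (6 / dl) * l powr r"
   have B1: "B1 > 0" using C1 Lg l_pos by (simp add: B1_def)
   define d where "d = l / (4 * kap')"
   define ep2 where "ep2 = (d / L) powr (1 / al)"
   have d0: "d > 0" using l_pos kap' by (simp add: d_def)
   have ep2: "0 <= ep2" "L * ep2 powr al <= d" using d0 L_pos al by (simp_all add: ep2_def powr_powr)
   have ep2c: "ep2 <= 4 * c"
   proof -
    have "d / L <= 1 / (4 * kap' * L)" using l_lt kap' L_pos by (simp add: d_def divide_right_mono)
    then have "ep2 <= (1 / (4 * kap' * L)) powr (1 / al)" unfolding ep2_def using d0 L_pos al by (intro powr_mono2) auto
    then show ?thesis using c(3) by linarith
   qed
   have Nep2: "k2 * v powr (nx / al) <= real N * ep2^2 / (16 * c^2)"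
   proof -
    have "1 / (8 * eta0 * kap' * L) * v powr (- 1) <= d / L"
    proof -
     have "1 / (8 * eta0 * kap' * L) * v powr (- 1) = 1 / (2 * eta0 * v) / (4 * kap') / L" using v1 by (simp add: powr_minus_divide mult_ac)
     also have "... <= l / (4 * kap') / L" using kap' L_pos by (intro divide_right_mono l_low) auto
     finally show ?thesis by (simp add: d_def)
    qed
    then have "(1 / (8 * eta0 * kap' * L) * v powr (- 1)) powr (2 / al) <= (d / L) powr (2 / al)"
     using eta0 kap' L_pos al by (intro powr_mono2) auto
    also have "(d / L) powr (2 / al) = ep2^2" using d0 L_pos by (simp add: ep2_def powr_power)
    also have "(1 / (8 * eta0 * kap' * L) * v powr (- 1)) powr (2 / al) = (1 / (8 * eta0 * kap' * L)) powr (2 / al) * v powr (- (2 / al))"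
     using eta0 kap' L_pos by (subst powr_mult) (simp_all only: powr_powr, simp_all)
    finally have e: "(1 / (8 * eta0 * kap' * L)) powr (2 / al) * v powr (- (2 / al)) <= ep2^2" .
    have ex: "nx / al = (2 + nx) / al + - (2 / al)" by (simp add: add_divide_distrib)
    have "k2 * v powr (nx / al) = v powr ((2 + nx) / al) * ((1 / (8 * eta0 * kap' * L)) powr (2 / al) * v powr (- (2 / al))) / (16 * c^2)"
     unfolding k2_def ex powr_add by (simp only: times_divide_eq_left times_divide_eq_right mult_ac)
    also have "... <= real N * ep2^2 / (16 * c^2)"
     by (intro divide_right_mono mult_mono Nv e) auto
    finally show ?thesis .
   qed
   have Nep1: "k1 * v^2 <= real N * ep1^2 / (16 * c^2)"
   proof -
    \<comment> \<open>Here \<alpha> <= 1 enters: N >= v^2 makes the Gaussian factor beat the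
      exponential growth of the iterates.\<close>
    have "2 <= (2 + nx) / al" using nx al al1 by (simp add: pos_le_divide_eq)
    then have "v powr 2 <= v powr ((2 + nx) / al)" using v1 by (intro powr_mono) auto
    then have "v^2 <= real N" using Nv v1 by simp
    from mult_right_mono[OF this, of k1] k show ?thesis by (simp add: k1_def mult_ac)
   qed
   have T1: "1 <= real T" using T0 by simp
   have U1: "sr.U 1 kap' <= a1 * (2 * v)"
   proof -
    have "norm h0 + real T * (eta0 * M * kap') <= real T * norm h0 + real T * (eta0 * M * kap')"
     using mult_right_mono[OF T1, of "norm h0"] by simp
    then have "2 * kap' * (1 ^ T * (norm h0 + real T * (eta0 * M * kap'))) <= 2 * kap' * (real T * (norm h0 + eta0 * M * kap'))"
     using kap' by (intro mult_left_mono) (auto simp: distrib_left)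
    then have "sr.U 1 kap' <= real T * a1"
     unfolding sr.U_def a1_def using mult_right_mono[OF T1, of "norm frho"] by (simp add: algebra_simps)
    also have "... <= 2 * v * a1" using a0 Tv by (intro mult_right_mono) auto
    finally show ?thesis by (simp add: mult.commute)
   qed
   have qT: "q ^ T <= exp (2 * ln q * v)"
   proof -
    have "q ^ T = exp (real T * ln q)" using q by (simp add: exp_of_nat_mult)
    also have "... <= exp (2 * ln q * v)" using mult_right_mono[OF Tv(2), of "ln q"] q by (simp add: mult_ac)
    finally show ?thesis .
   qed
   have U2: "sr.U q KB <= a2 * (2 * v) * exp (2 * ln q * v)"
   proof -
    have qT1: "1 <= q ^ T" using q by (rule one_le_power)
    have KB0: "0 <= KB" using KB(1) by simp
    let ?y = "norm h0 + real T * (eta0 * M * KB)"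
    have y: "?y <= real T * (norm h0 + eta0 * M * KB)"
     using mult_right_mono[OF T1, of "norm h0"] by (simp add: distrib_left)
    have y0: "0 <= ?y" using eta0 M_pos KB0 by simp
    have "sr.U q KB <= q ^ T * (2 * kap' * ?y + norm frho)"
     unfolding sr.U_def using mult_right_mono[OF qT1, of "norm frho"] by (simp add: algebra_simps)
    also have "... <= q ^ T * (real T * a2)"
    proof (rule mult_left_mono)
     have "2 * kap' * ?y <= 2 * kap' * (real T * (norm h0 + eta0 * M * KB))" using kap' y by (intro mult_left_mono) auto
     then show "2 * kap' * ?y + norm frho <= real T * a2"
      unfolding a2_def using mult_right_mono[OF T1, of "norm frho"] by (simp add: algebra_simps)
    qed (use qT1 in simp)
    also have "... <= exp (2 * ln q * v) * (2 * v * a2)"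
     using a0 Tv by (intro mult_mono qT mult_right_mono) auto
    finally show ?thesis by (simp add: mult_ac)
   qed
   have vv: "v * v powr s = v powr (s + 1)" using v1 by (simp add: powr_add)
   have small: "sr.U 1 kap' * (real n * (2 * exp (- (real N * ep2^2 / (16 * c^2)))))
    + sr.U (1 + eta0 * KB^2) KB * (real n * (2 * exp (- (real N * ep1^2 / (16 * c^2))))) <= B1 * (dl / 3)"
   proof -
    have "sr.U 1 kap' * (real n * (2 * exp (- (real N * ep2^2 / (16 * c^2))))) <= a1 * (2 * v) * (real n * (2 * exp (- (k2 * v powr (nx / al)))))"
     using U1 Nep2 a0 v1 by (intro mult_mono mult_left_mono) auto
    also have "... = 2 * (2 * a1 * ?X) * (v powr (s + 1) * exp (- (k2 * v powr (nx / al))))"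
     unfolding nv vv[symmetric] by simp
    finally have 1: "sr.U 1 kap' * (real n * (2 * exp (- (real N * ep2^2 / (16 * c^2))))) <= 2 * (2 * a1 * ?X) * (v powr (s + 1) * exp (- (k2 * v powr (nx / al))))" .
    have "sr.U q KB * (real n * (2 * exp (- (real N * ep1^2 / (16 * c^2))))) <= a2 * (2 * v) * exp (2 * ln q * v) * (real n * (2 * exp (- (k1 * v^2))))"
     using U2 Nep1 a0 v1 by (intro mult_mono mult_left_mono) auto
    also have "... = 2 * (2 * a2 * ?X) * (v powr (s + 1) * (exp (2 * ln q * v) * exp (- (k1 * v^2))))"
     unfolding nv vv[symmetric] by simp
    also have "exp (2 * ln q * v) * exp (- (k1 * v^2)) = exp (2 * ln q * v - k1 * v^2)" by (simp add: exp_diff exp_minus divide_inverse)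
    finally have 2: "sr.U q KB * (real n * (2 * exp (- (real N * ep1^2 / (16 * c^2))))) <= 2 * (2 * a2 * ?X) * (v powr (s + 1) * exp (2 * ln q * v - k1 * v^2))" .
    have "k3 * v powr (- r) <= B1 * (dl / 3)"
    proof -
     have "C1 * ln (6 / dl) * (dl / 3) * ((2 * eta0) powr (- r) * v powr (- r)) <= C1 * ln (6 / dl) * (dl / 3) * l powr r"
      using C1 Lg dl by (intro mult_left_mono l_lowr) auto
     then show ?thesis by (simp add: k3_def B1_def mult_ac)
    qed
    then show ?thesis using 1 2 tail unfolding q_def[symmetric] by linarith
   qed
   have good: "model.risk eta0 b T h0 n k (%i. snd (z i)) <= B1"
    if "z \<in> A" "\<forall>i<n. norm (k i - feat (z i)) <= d \<and> norm (k i) <= kap'" for z k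
   proof -
    have "model.risk eta0 b T h0 n k (%i. snd (z i)) <= C0 * ln (6 / dl) * l powr r"
     by (rule A(3)[rule_format, OF that(1)]) (use that(2) in \<open>simp add: d_def model.near_features_def\<close>)
    also have "... <= B1" unfolding B1_def using C1 Lg by (intro mult_right_mono) auto
    finally show ?thesis .
   qed
   \<comment> \<open>The first stage costs 2/3 dl, the passage to the conditional risk dl /
     3.\<close>
   have "1 - dl <= measure (iid n rho) A - dl / 3" using A(2) by simp
   also have "... <= sr.O.prob {om \<in> space Om. real_cond_exp Om sr.Fs (%om. sr.err (%i. J i om) om) om <= 2 * B1}"
    by (rule sr.conditional_error[OF A(1) B1 good c(1,2) less_imp_le[OF ep1(1)] ep1(2,3) ep2(1) ep2c ep2(2) small])
   also have "... <= sr.O.prob {om \<in> space Om. real_cond_exp Om sr.Fs (%om. sr.err (%i. J i om) om) om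
    <= C * ln (6 / dl) * R * (M^2 / (R^2 * real n)) powr (r / (2 * r + nx))}"
   proof (rule sr.O.finite_measure_mono)
    have "(M^2 / (R^2 * real n)) powr (r / (2 * r + nx)) = v powr (- r)"
    proof -
     have "M^2 / (R^2 * real n) = 1 / v powr s" unfolding vs by simp
     also have "... = v powr (- s)" by (simp add: powr_minus_divide)
     finally show ?thesis using s by (simp add: powr_powr s_def[symmetric])
    qed
    then have "C * ln (6 / dl) * R * (M^2 / (R^2 * real n)) powr (r / (2 * r + nx)) = 2 * (C1 * ln (6 / dl) * (eta0 powr (- r) * v powr (- r)))"
     using R_pos by (simp add: C_def)
    moreover have "B1 <= C1 * ln (6 / dl) * (eta0 powr (- r) * v powr (- r))"
     unfolding B1_def using C1 Lg by (intro mult_left_mono l_up) auto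
    ultimately have "2 * B1 <= C * ln (6 / dl) * R * (M^2 / (R^2 * real n)) powr (r / (2 * r + nx))" by linarith
    then show "{om \<in> space Om. real_cond_exp Om sr.Fs (%om. sr.err (%i. J i om) om) om <= 2 * B1}
     \<subseteq> {om \<in> space Om. real_cond_exp Om sr.Fs (%om. sr.err (%i. J i om) om) om
      <= C * ln (6 / dl) * R * (M^2 / (R^2 * real n)) powr (r / (2 * r + nx))}" by auto
   qed (use borel_measurable_cond_exp2 in measurable)
   finally show "1 - dl <= measure Om {om \<in> space Om.
     cond_risk Om n N b T h0 x y xs J om
     <= C * ln (6 / dl) * R * (M^2 / (R^2 * real n)) powr (r / (2 * r + nx))}"
    unfolding cond_risk_def sr.Fs_def sr.data_def[abs_def] sr.err_def[abs_def] sr.mh_def .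
  qed
 qed
qed

end

theorem corollary3p6:
  fixes G :: "'x::topological_space \<Rightarrow> 'x \<Rightarrow> real"
    and evG :: "'g::{real_inner, banach, second_countable_topology} \<Rightarrow> 'x \<Rightarrow> real"
    and K :: "'g \<Rightarrow> 'g \<Rightarrow> real"
    and evK :: "'h::{real_inner, banach, second_countable_topology} \<Rightarrow> 'g \<Rightarrow> real"
    and cls :: "('g \<Rightarrow> real) \<Rightarrow> 'l::{real_inner, banach, second_countable_topology}"
    and \<phi> :: "'x \<Rightarrow> 'g" and P :: "'g set" and PM :: "'g measure"
    and KS :: "'g \<Rightarrow> 'h"
    and M :: real and Y :: "real set" and YM :: "real measure"
    and \<rho> :: "('g \<times> real) measure" and \<rho>\<mu> :: "'g measure"
    and \<rho>cond :: "'g \<Rightarrow> real measure"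
    and Q :: "('x measure \<times> real) measure"
    and S :: "'h \<Rightarrow> 'l" and LK :: "'l \<Rightarrow> 'l" and f\<rho> h\<rho> :: 'l
    and \<gamma> \<kappa> \<alpha> L r R \<nu> c\<nu> \<eta>0 :: real
    and h0 :: 'h
  (* the input space and the first kernel *)
  assumes compact_X: "compact (UNIV :: 'x set)"
    and mercer_G: "mercer_kernel G"
    and rkhs_G: "rkhs UNIV G evG"
    and \<phi>_eq: "\<phi> = ksec UNIV G evG"
    and P_eq: "P = mean_embedding \<phi> ` space (prob_algebra borel)"
    and PM_eq: "PM = restrict_space borel P"
  (* the second kernel *)
    and kernel_K: "psd_kernel P K"
    and rkhs_K: "rkhs P K evK"
    and KS_eq: "KS = ksec P K evK"
  (* the distribution of the data *)
    and M_pos: "M > 0" and Y_bounded: "Y \<subseteq> {-M..M}"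
    and YM_eq: "YM = restrict_space borel Y"
    and prob_\<rho>: "prob_space \<rho>" and sets_\<rho>: "sets \<rho> = sets (PM \<Otimes>\<^sub>M YM)"
    and \<rho>\<mu>_eq: "\<rho>\<mu> = distr \<rho> PM fst"
    and cond_\<rho>: "conditional_law PM YM \<rho> \<rho>cond"
    and prob_Q: "prob_space Q" and sets_Q: "sets Q = sets (prob_algebra borel \<Otimes>\<^sub>M YM)"
    and Q_\<rho>: "distr Q (PM \<Otimes>\<^sub>M YM) (\<lambda>(x, y). (mean_embedding \<phi> x, y)) = \<rho>"
  (* L2, the inclusion, the integral operator, the regression function *)
    and L2: "L2_space \<rho>\<mu> cls"
    and S_eq: "S = (\<lambda>h. cls (evK h))"
    and LK_eq: "LK = S \<circ> adjoint S"
    and f\<rho>_eq: "f\<rho> = cls (regression_fun \<rho>cond)"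
  (* boundedness, Hoelder continuity, source condition, effective dimension *)
    and G_bounded: "bdd_above (range (\<lambda>s. G s s))" "(SUP s. G s s) = \<gamma>\<^sup>2"
    and K_bounded: "\<kappa> \<ge> 0" "esssup \<rho>\<mu> (\<lambda>m. ereal (K m m)) = ereal (\<kappa>\<^sup>2)"
    and \<alpha>: "0 < \<alpha>" "\<alpha> \<le> 1" and L_pos: "L > 0"
    and hoelder: "\<And>m1 m2. m1 \<in> P \<Longrightarrow> m2 \<in> P \<Longrightarrow> norm (KS m1 - KS m2) \<le> L * norm (m1 - m2) powr \<alpha>"
    and r: "0 < r" "r \<le> 1 / 2"
    and source: "f\<rho> = op_powr LK r h\<rho>" "norm h\<rho> \<le> R" and R_pos: "R > 0"
    and \<nu>: "0 < \<nu>" "\<nu> \<le> 1" "2 * r + \<nu> > 1"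
    and eff_dim: "\<And>l. l > 0 \<Longrightarrow> effective_dim LK l \<le> c\<nu> * l powr (- \<nu>)"
  (* the step size; the bound is \<eta>0 < 1 / (4 * \<kappa>^2), meaningful also for \<kappa> = 0 *)
    and \<eta>0: "0 < \<eta>0" "4 * \<kappa>\<^sup>2 * \<eta>0 < 1"
  shows "\<exists>C. \<forall>\<delta>. 0 < \<delta> \<and> \<delta> \<le> 1 \<longrightarrow>
    (\<exists>n0. \<forall>n\<ge>n0. \<forall>N b T. \<forall>l::real. \<forall>(\<Omega> :: 'w measure) x y xs J.
       T = nat \<lceil>(R\<^sup>2 * real n / M\<^sup>2) powr (1 / (2 * r + \<nu>))\<rceil> \<and>
       (b = nat \<lceil>sqrt (real n)\<rceil> \<or> b = n) \<and>
       l = 1 / (\<eta>0 * real T) \<and>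
       real n \<ge> 32 * \<kappa>\<^sup>2 * ln (4 / \<delta>) / l * ln (exp 1 * effective_dim LK l * (1 + l / onorm LK)) \<and>
       real N \<ge> ln (real n) powr (2 / \<alpha>) * (R\<^sup>2 / M\<^sup>2 * real n) powr ((2 + \<nu>) / (\<alpha> * (2 * r + \<nu>))) \<and>
       two_stage_sample \<Omega> Q n N x y xs \<and>
       uniform_indices \<Omega> Q n N x y xs (b * T) J \<longrightarrow>
       measure \<Omega> {\<omega> \<in> space \<Omega>.
         real_cond_exp \<Omega>
           (vimage_algebra (space \<Omega>)
              (\<lambda>\<omega>. \<lambda>j\<in>{..<n}. (mean_embedding \<phi> (x j \<omega>), y j \<omega>))
              (\<Pi>\<^sub>M j\<in>{..<n}. PM \<Otimes>\<^sub>M YM))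
           (\<lambda>\<omega>. norm (S (tail_average
              (sgd \<eta>0 b evK KS h0
                 (\<lambda>i. (empirical_embedding \<phi> N (\<lambda>k. xs (J i \<omega>) k \<omega>), y (J i \<omega>) \<omega>))) T) - f\<rho>)) \<omega>
         \<le> C * ln (6 / \<delta>) * R * (M\<^sup>2 / (R\<^sup>2 * real n)) powr (r / (2 * r + \<nu>))} \<ge> 1 - \<delta>)"
proof -
  have "\<alpha> \<le> 1" by (rule \<alpha>)
  interpret distribution_regression G evG K evK cls \<phi> P PM KS M Y YM \<rho> \<rho>\<mu> \<rho>cond Q S f\<rho> \<gamma> \<kappa> \<alpha> L \<eta>0
    by (rule distribution_regression.intro) fact+
  show ?thesis
    using convergence_rate[where 'w = 'w, OF \<open>\<alpha> \<le> 1\<close> r source(1)[unfolded LK_eq] source(2) R_pos \<nu> eff_dim[unfolded LK_eq], of h0]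
    unfolding cond_risk_def by meson
qed

end
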